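(* Let $K=\mathbb{Q}(\sqrt{-1})$ with $\mathrm{Gal}(K/\mathbb{Q})=\langle c\rangle$. For each prime $p$ split in $K$, choose one place $v$ of $K$ above $p$ and let $S_K$ be the collection of these chosen places. Then: (I) Up to multiplication by characters from base change, a quadratic idele class character $\chi$ of $K$ with conductor $\mathfrak{f}$ satisfies the following conditions: (A) No places above an odd inert prime divide $\mathfrak{f}$; (B) At most one place $v$ above a ramified prime $\equiv3\bmod4$ divides $\mathfrak{f}$, and $\mathrm{ord}_v\mathfrak{f}=1$ (this is automatically satisfied, since no odd primes ramify in $\mathbb{Q}(\sqrt{-1})$); (C) If a place $v$ above a split prime $p$ divides $\mathfrak{f}$ to the power $m(v)$, then $v\in S_K$ and $m(v)=1$ for $p$ odd, and $m(v)=2$ or $3$ for $p=2$; (D') If a place $v$ above $2$ divides $\mathfrak{f}$ to the power $m(v)$, then $m(v)=2$ or $5$. Further, $\chi_v(\mu_4)=-1$ if $m(v)=2$, and $\chi_v(1+\pi_v^3)=1$ if $m(v)=5$. Here $\pi_v=\mu_4-1$. (II) Any quadratic idele class character $\chi$ of $K$ with nontrivial conductor $\mathfrak{f}$ satisfying (A)-(C) and (D') does not arise from base change. In other words, $\chi^c=\chi\cdot\delta$ for some quadratic idele class character $\delta$ of $K$. (III) No two distinct quadratic idele class characters of $K$ satisfying (A)-(C) and (D') differ by multiplication by an idele class character of $K$ from base change. (IV) Let $\mathfrak{f}=\prod_{v\ \text{finite}}v^{m(v)}$ be an integral ideal of $K$ with $m(v)$ satisfying (A)-(C) and (D'). Denote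 by $r(\mathfrak{f})$ the number of places $v$ occurring in $\mathfrak{f}$ such that $v$ is above a prime $p\equiv5\bmod8$. Then there is a quadratic idele class character $\chi$ of $K$ with conductor $\mathfrak{f}$ satisfying the conditions (A)-(C) and (D') if and only if $r(\mathfrak{f})$ is even if no $v\mid\mathfrak{f}$ is above $2$, and $r(\mathfrak{f})$ is odd if there is a prime $v\mid\mathfrak{f}$ above $2$ with $m(v)=2$.
   Context: $\mathbb{Z}_K$ is the ring of integers of $K$ and $\mu_4=\sqrt{-1}$ a primitive fourth root of unity. An idele class character $\chi$ of $K$ is a continuous homomorphism from the idele group $I_K$ to the unit circle, trivial on $K^\times$; $\chi_v$ is its restriction to $K_v^\times$. It is quadratic if it has order $2$. For a finite place $v$, $\mathcal{U}_v$ is the unit group of the ring of integers of $K_v$ and $\mathcal{M}_v$ the maximal ideal of that ring. The conductor of $\chi$ is $\mathfrak{f}=\prod v^{n(\chi_v)}$ over the finite places $v$ where $\chi_v|_{\mathcal{U}_v}\neq1$, with $n(\chi_v)$ the smallest positive integer such that $\chi_v$ is trivial on $1+\mathcal{M}_v^{n(\chi_v)}$; nontrivial conductor means $\mathfrak{f}\ne\mathbb{Z}_K$. Finite places are identified with prime ideals of $\mathbb{Z}_K$. The conjugate of $\chi$ is $\chi^c=\chi\circ c$, with $c$ acting on $I_K$. A character $\mu$ of $K$ is from base change if $\mu=\nu\circ N_{K/\mathbb{Q}}$ for some idele class character $\nu$ of $\mathbb{Q}$.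
   Formalization: In (IV) the ideal f is assumed different from Z_K: for f = Z_K the parity condition holds (r(f)=0, no v above 2), but K has no quadratic idele class character of trivial conductor, so the printed equivalence fails there. *)

theory Defs
  imports
    "HOL-Analysis.Analysis"
    "HOL-Computational_Algebra.Polynomial"
    "HOL-Computational_Algebra.Primes"
    "HOL-Algebra.QuotRing"
    "HOL-Algebra.Ideal_Product"
    "HOL-Algebra.Divisibility"
begin

(* Leaves the name to primality in type classes, which is the one used for rational primes. *)
no_notation Divisibility.prime (\<open>prime\<index>\<close>)
hide_const (open) Divisibility.prime

section \<open>Number rings and finite places\<close>

text \<open>
  The two base fields, the rationals and the Gaussian numbers, are realised as subfields of the
  complex numbers. Everything up to idele class characters is defined once, for a subfield
  \<open>F\<close> of the complex numbers, and used for these two fields only.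
\<close>

definition gauss_field :: "complex set" where
  "gauss_field = {a + b * \<i> | a b. a \<in> \<rat> \<and> b \<in> \<rat>}"

definition int_ring :: "complex set \<Rightarrow> complex ring" where
  "int_ring F = \<lparr>carrier = {x \<in> F. algebraic_int x}, mult = (*), one = 1, zero = 0, add = (+)\<rparr>"

definition finite_places :: "complex set \<Rightarrow> complex set set" where
  "finite_places F = {P. primeideal P (int_ring F) \<and> P \<noteq> {0}}"

abbreviation ideal_dvd :: "complex set \<Rightarrow> complex set \<Rightarrow> complex set \<Rightarrow> bool" where
  "ideal_dvd F I J \<equiv> I divides\<^bsub>ideals_set (int_ring F)\<^esub> J"

abbreviation ideal_pow :: "('a, 'b) ring_scheme \<Rightarrow> 'a set \<Rightarrow> nat \<Rightarrow> 'a set" where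
  "ideal_pow R I n \<equiv> I [^]\<^bsub>ideals_set R\<^esub> n"

definition ord_ideal :: "complex set \<Rightarrow> complex set \<Rightarrow> complex set \<Rightarrow> nat" where
  "ord_ideal F P I = (GREATEST n. ideal_dvd F (ideal_pow (int_ring F) P n) I)"

definition ord_elem :: "complex set \<Rightarrow> complex set \<Rightarrow> complex \<Rightarrow> int" where
  "ord_elem F P x = (THE k. \<exists>a\<in>carrier (int_ring F) - {0}. \<exists>b\<in>carrier (int_ring F) - {0}.
     x = a / b \<and>
     k = int (ord_ideal F P (PIdl\<^bsub>int_ring F\<^esub> a)) - int (ord_ideal F P (PIdl\<^bsub>int_ring F\<^esub> b)))"

section \<open>Places and completions\<close>

text \<open>
  The rationals and the Gaussian field each have exactly one infinite place, given by the modulus.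
  For a finite place the base 2 of the absolute value is an arbitrary normalisation; completion,
  topology and unit group do not depend on it.
\<close>

datatype place = Fin_place "complex set" | Inf_place

definition places :: "complex set \<Rightarrow> place set" where
  "places F = insert Inf_place (Fin_place ` finite_places F)"

fun absv :: "complex set \<Rightarrow> place \<Rightarrow> complex \<Rightarrow> real" where
  "absv F (Fin_place P) x = (if x = 0 then 0 else 2 powi (- ord_elem F P x))"
| "absv F Inf_place x = cmod x"

definition cauchy_ring :: "complex set \<Rightarrow> place \<Rightarrow> (nat \<Rightarrow> complex) ring" where
  "cauchy_ring F v =
     \<lparr>carrier = {s. range s \<subseteq> F \<and>
                   (\<forall>e>0. \<exists>N. \<forall>m\<ge>N. \<forall>n\<ge>N. absv F v (s m - s n) < e)},
      mult = (\<lambda>s t n. s n * t n), one = (\<lambda>_. 1), zero = (\<lambda>_. 0), add = (\<lambda>s t n. s n + t n)\<rparr>"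

definition null_seqs :: "complex set \<Rightarrow> place \<Rightarrow> (nat \<Rightarrow> complex) set" where
  "null_seqs F v = {s \<in> carrier (cauchy_ring F v). (\<lambda>n. absv F v (s n)) \<longlonglongrightarrow> 0}"

text \<open>An element of the completion is a coset of null sequences, i.e. a set of Cauchy sequences.\<close>

definition completion :: "complex set \<Rightarrow> place \<Rightarrow> (nat \<Rightarrow> complex) set ring" where
  "completion F v = cauchy_ring F v Quot null_seqs F v"

definition embed :: "complex set \<Rightarrow> place \<Rightarrow> complex \<Rightarrow> (nat \<Rightarrow> complex) set" where
  "embed F v a = null_seqs F v +>\<^bsub>cauchy_ring F v\<^esub> (\<lambda>_. a)"

definition completion_abs :: "complex set \<Rightarrow> place \<Rightarrow> (nat \<Rightarrow> complex) set \<Rightarrow> real" where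
  "completion_abs F v X = (THE r. \<forall>s\<in>X. (\<lambda>n. absv F v (s n)) \<longlonglongrightarrow> r)"

text \<open>
  The distance is set to 0 off the carrier because the locale \<open>Metric_space\<close> asks for
  nonnegativity and symmetry on the whole type.
\<close>

definition completion_dist ::
    "complex set \<Rightarrow> place \<Rightarrow> (nat \<Rightarrow> complex) set \<Rightarrow> (nat \<Rightarrow> complex) set \<Rightarrow> real" where
  "completion_dist F v X Y =
     (if X \<in> carrier (completion F v) \<and> Y \<in> carrier (completion F v)
      then completion_abs F v (X \<ominus>\<^bsub>completion F v\<^esub> Y) else 0)"

definition completion_topology :: "complex set \<Rightarrow> place \<Rightarrow> (nat \<Rightarrow> complex) set topology" where
  "completion_topology F v =
     Metric_space.mtopology (carrier (completion F v)) (completion_dist F v)"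

abbreviation completion_units :: "complex set \<Rightarrow> place \<Rightarrow> (nat \<Rightarrow> complex) set set" where
  "completion_units F v \<equiv> Units (completion F v)"

definition local_int_ring :: "complex set \<Rightarrow> complex set \<Rightarrow> (nat \<Rightarrow> complex) set ring" where
  "local_int_ring F P =
     (completion F (Fin_place P))
       \<lparr>carrier := {X \<in> carrier (completion F (Fin_place P)).
                     completion_abs F (Fin_place P) X \<le> 1}\<rparr>"

definition local_units :: "complex set \<Rightarrow> complex set \<Rightarrow> (nat \<Rightarrow> complex) set set" where
  "local_units F P = Units (local_int_ring F P)"

definition local_maxideal :: "complex set \<Rightarrow> complex set \<Rightarrow> (nat \<Rightarrow> complex) set set" where
  "local_maxideal F P = (THE M. maximalideal M (local_int_ring F P))"

text \<open>The set \<open>1 + M^n\<close>.\<close>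

definition higher_units ::
    "complex set \<Rightarrow> complex set \<Rightarrow> nat \<Rightarrow> (nat \<Rightarrow> complex) set set" where
  "higher_units F P n =
     (\<lambda>X. \<one>\<^bsub>local_int_ring F P\<^esub> \<oplus>\<^bsub>local_int_ring F P\<^esub> X) `
       ideal_pow (local_int_ring F P) (local_maxideal F P) n"

section \<open>Ideles\<close>

type_synonym idele = "place \<Rightarrow> (nat \<Rightarrow> complex) set"

definition idele_group :: "complex set \<Rightarrow> idele monoid" where
  "idele_group F =
     \<lparr>carrier = {x \<in> (\<Pi>\<^sub>E v\<in>places F. completion_units F v).
                   finite {P \<in> finite_places F. x (Fin_place P) \<notin> local_units F P}},
      mult = (\<lambda>x y. \<lambda>v\<in>places F. x v \<otimes>\<^bsub>completion F v\<^esub> y v),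
      one = (\<lambda>v\<in>places F. \<one>\<^bsub>completion F v\<^esub>)\<rparr>"

text \<open>The restricted product topology.\<close>

definition idele_topology :: "complex set \<Rightarrow> idele topology" where
  "idele_topology F = topology_generated_by
     {(\<Pi>\<^sub>E v\<in>places F. V v) | V.
        (\<forall>v\<in>places F. openin (subtopology (completion_topology F v) (completion_units F v)) (V v)) \<and>
        finite {P \<in> finite_places F. V (Fin_place P) \<noteq> local_units F P}}"

definition principal_idele :: "complex set \<Rightarrow> complex \<Rightarrow> idele" where
  "principal_idele F a = (\<lambda>v\<in>places F. embed F v a)"

definition local_idele :: "complex set \<Rightarrow> place \<Rightarrow> (nat \<Rightarrow> complex) set \<Rightarrow> idele" where
  "local_idele F v X = (\<lambda>w\<in>places F. if w = v then X else \<one>\<^bsub>completion F w\<^esub>)"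

section \<open>Idele class characters\<close>

text \<open>
  Characters are functions on the whole type \<open>idele\<close> whose values matter on the idele group only;
  equality of characters is therefore always spelled out on its carrier.
\<close>

definition circle_group :: "complex monoid" where
  "circle_group = \<lparr>carrier = sphere 0 1, mult = (*), one = 1\<rparr>"

definition idele_class_char :: "complex set \<Rightarrow> (idele \<Rightarrow> complex) \<Rightarrow> bool" where
  "idele_class_char F \<psi> \<longleftrightarrow>
     \<psi> \<in> hom (idele_group F) circle_group \<and>
     continuous_map (idele_topology F) (top_of_set (sphere 0 1)) \<psi> \<and>
     (\<forall>a\<in>F - {0}. \<psi> (principal_idele F a) = 1)"

definition char_eq :: "complex set \<Rightarrow> (idele \<Rightarrow> complex) \<Rightarrow> (idele \<Rightarrow> complex) \<Rightarrow> bool" where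
  "char_eq F \<psi> \<phi> \<longleftrightarrow> (\<forall>x\<in>carrier (idele_group F). \<psi> x = \<phi> x)"

definition char_mult :: "(idele \<Rightarrow> complex) \<Rightarrow> (idele \<Rightarrow> complex) \<Rightarrow> idele \<Rightarrow> complex" where
  "char_mult \<psi> \<phi> = (\<lambda>x. \<psi> x * \<phi> x)"

definition trivial_char :: "idele \<Rightarrow> complex" where
  "trivial_char = (\<lambda>_. 1)"

definition quadratic_char :: "complex set \<Rightarrow> (idele \<Rightarrow> complex) \<Rightarrow> bool" where
  "quadratic_char F \<psi> \<longleftrightarrow>
     idele_class_char F \<psi> \<and> \<not> char_eq F \<psi> trivial_char \<and>
     char_eq F (char_mult \<psi> \<psi>) trivial_char"

definition local_char ::
    "complex set \<Rightarrow> (idele \<Rightarrow> complex) \<Rightarrow> place \<Rightarrow> (nat \<Rightarrow> complex) set \<Rightarrow> complex" where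
  "local_char F \<psi> v X = \<psi> (local_idele F v X)"

definition conductor_exponent ::
    "complex set \<Rightarrow> (idele \<Rightarrow> complex) \<Rightarrow> complex set \<Rightarrow> nat" where
  "conductor_exponent F \<psi> P =
     (LEAST n. n > 0 \<and> (\<forall>X\<in>higher_units F P n. local_char F \<psi> (Fin_place P) X = 1))"

text \<open>By continuity the set of ramified places in the product is finite.\<close>

definition conductor :: "complex set \<Rightarrow> (idele \<Rightarrow> complex) \<Rightarrow> complex set" where
  "conductor F \<psi> =
     finprod (ideals_set (int_ring F))
       (\<lambda>P. ideal_pow (int_ring F) P (conductor_exponent F \<psi> P))
       {P \<in> finite_places F. \<exists>X\<in>local_units F P. local_char F \<psi> (Fin_place P) X \<noteq> 1}"

section \<open>Galois action, norm and base change\<close>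

text \<open>
  The generator \<open>c\<close> of the Galois group is complex conjugation. On ideles it maps the component
  at the conjugate of \<open>v\<close> to the component at \<open>v\<close>, by conjugating Cauchy sequences termwise.
\<close>

fun conj_place :: "place \<Rightarrow> place" where
  "conj_place (Fin_place P) = Fin_place (cnj ` P)"
| "conj_place Inf_place = Inf_place"

definition idele_conj :: "idele \<Rightarrow> idele" where
  "idele_conj x = (\<lambda>v\<in>places gauss_field. (\<lambda>s. cnj \<circ> s) ` x (conj_place v))"

definition char_conj :: "(idele \<Rightarrow> complex) \<Rightarrow> idele \<Rightarrow> complex" where
  "char_conj \<psi> = \<psi> \<circ> idele_conj"

fun place_below :: "place \<Rightarrow> place" where
  "place_below (Fin_place P) = Fin_place (P \<inter> \<rat>)"
| "place_below Inf_place = Inf_place"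

text \<open>
  The inclusion of the ideles of the rationals into those of the Gaussian field: a class of
  Cauchy sequences of rationals goes to the class over the Gaussian field that contains it.
\<close>

definition idele_incl :: "idele \<Rightarrow> idele" where
  "idele_incl y = (\<lambda>v\<in>places gauss_field.
     THE Z. Z \<in> carrier (completion gauss_field v) \<and> y (place_below v) \<subseteq> Z)"

text \<open>
  The idele norm of a Galois extension, as the product of the Galois conjugates; this is the image
  of a unique idele of the rationals.
\<close>

definition idele_norm :: "idele \<Rightarrow> idele" where
  "idele_norm x = (THE y. y \<in> carrier (idele_group \<rat>) \<and>
     idele_incl y = x \<otimes>\<^bsub>idele_group gauss_field\<^esub> idele_conj x)"

definition from_base_change :: "(idele \<Rightarrow> complex) \<Rightarrow> bool" where
  "from_base_change \<mu> \<longleftrightarrow>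
     idele_class_char gauss_field \<mu> \<and>
     (\<exists>\<nu>. idele_class_char \<rat> \<nu> \<and> char_eq gauss_field \<mu> (\<nu> \<circ> idele_norm))"

section \<open>Splitting of rational primes and the conditions on conductors\<close>

abbreviation ZK :: "complex ring" where
  "ZK \<equiv> int_ring gauss_field"

definition places_above :: "nat \<Rightarrow> complex set set" where
  "places_above p = {P \<in> finite_places gauss_field. of_nat p \<in> P}"

definition split_prime :: "nat \<Rightarrow> bool" where
  "split_prime p \<longleftrightarrow> prime p \<and> card (places_above p) = 2"

definition inert_prime :: "nat \<Rightarrow> bool" where
  "inert_prime p \<longleftrightarrow> prime p \<and> primeideal (PIdl\<^bsub>ZK\<^esub> (of_nat p)) ZK"

definition ramified_prime :: "nat \<Rightarrow> bool" where
  "ramified_prime p \<longleftrightarrow>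
     prime p \<and> (\<exists>P\<in>places_above p. ord_ideal gauss_field P (PIdl\<^bsub>ZK\<^esub> (of_nat p)) > 1)"

definition split_choice :: "complex set set \<Rightarrow> bool" where
  "split_choice S \<longleftrightarrow>
     S \<subseteq> (\<Union>p\<in>{p. split_prime p}. places_above p) \<and>
     (\<forall>p. split_prime p \<longrightarrow> (\<exists>!P. P \<in> S \<and> P \<in> places_above p))"

abbreviation divides_cond :: "complex set \<Rightarrow> complex set \<Rightarrow> bool" where
  "divides_cond P f \<equiv> ideal_dvd gauss_field P f"

abbreviation cond_mult :: "complex set \<Rightarrow> complex set \<Rightarrow> nat" where
  "cond_mult P f \<equiv> ord_ideal gauss_field P f"

definition condA :: "complex set \<Rightarrow> bool" where
  "condA f \<longleftrightarrow> (\<forall>p. odd p \<and> inert_prime p \<longrightarrow> (\<forall>P\<in>places_above p. \<not> divides_cond P f))"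

definition condB :: "complex set \<Rightarrow> bool" where
  "condB f \<longleftrightarrow>
     (let B = {P. divides_cond P f \<and>
                  (\<exists>p. ramified_prime p \<and> p mod 4 = 3 \<and> P \<in> places_above p)}
      in (\<forall>P\<in>B. \<forall>Q\<in>B. P = Q) \<and> (\<forall>P\<in>B. cond_mult P f = 1))"

definition condC :: "complex set set \<Rightarrow> complex set \<Rightarrow> bool" where
  "condC S f \<longleftrightarrow>
     (\<forall>p. split_prime p \<longrightarrow> (\<forall>P\<in>places_above p. divides_cond P f \<longrightarrow>
        P \<in> S \<and> (odd p \<longrightarrow> cond_mult P f = 1) \<and> (p = 2 \<longrightarrow> cond_mult P f \<in> {2, 3})))"

text \<open>
  The last condition has a part concerning the conductor only, and a part concerning the local
  character at the place above 2. In the latter, \<open>1 + \<pi>^3\<close> is a single element, with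
  \<open>\<pi> = u - 1\<close> for the chosen primitive fourth root of unity \<open>u\<close>.
\<close>

definition condD_ideal :: "complex set \<Rightarrow> bool" where
  "condD_ideal f \<longleftrightarrow>
     (\<forall>P\<in>places_above 2. divides_cond P f \<longrightarrow> cond_mult P f \<in> {2, 5})"

definition condD_char :: "complex \<Rightarrow> (idele \<Rightarrow> complex) \<Rightarrow> bool" where
  "condD_char u \<psi> \<longleftrightarrow>
     (\<forall>P\<in>places_above 2. divides_cond P (conductor gauss_field \<psi>) \<longrightarrow>
        (cond_mult P (conductor gauss_field \<psi>) = 2 \<longrightarrow>
           local_char gauss_field \<psi> (Fin_place P) (embed gauss_field (Fin_place P) u) = -1) \<and>
        (cond_mult P (conductor gauss_field \<psi>) = 5 \<longrightarrow>
           local_char gauss_field \<psi> (Fin_place P)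
             (embed gauss_field (Fin_place P) (1 + (u - 1) ^ 3)) = 1))"

definition ideal_conditions :: "complex set set \<Rightarrow> complex set \<Rightarrow> bool" where
  "ideal_conditions S f \<longleftrightarrow> condA f \<and> condB f \<and> condC S f \<and> condD_ideal f"

definition char_conditions :: "complex set set \<Rightarrow> complex \<Rightarrow> (idele \<Rightarrow> complex) \<Rightarrow> bool" where
  "char_conditions S u \<psi> \<longleftrightarrow>
     ideal_conditions S (conductor gauss_field \<psi>) \<and> condD_char u \<psi>"

definition r_count :: "complex set \<Rightarrow> nat" where
  "r_count f = card {P. divides_cond P f \<and>
     (\<exists>p. prime p \<and> p mod 8 = 5 \<and> P \<in> places_above p)}"

end

theory Submission
  imports Defs "HOL-Algebra.Subrings" "HOL-Algebra.Multiplicative_Group" "HOL-Number_Theory.Number_Theory"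
begin

text \<open>
  Both rings of integers are norm-Euclidean, hence principal, so every idele is a principal idele
  times an idele whose finite components are units. A quadratic character is therefore determined
  by its signs on the local units, and signs on finitely many of these groups come from a character
  iff their product is trivial on the global units. At an odd place the unit group has exactly one
  nontrivial sign character; at \<open>1 + i\<close> the signs factor through level 5 and are free on the
  generators \<open>u\<close>, \<open>w = 1 + (u - 1)^3\<close> and \<open>13\<close>, with conductor exponent 0, 2 or 5 once the sign of
  \<open>w\<close> is 1.

  The conditions say that the odd ramified places are chosen split ones and that the sign of \<open>w\<close> is 1.
  Base changes of characters of the rationals reach this normal form: norms from an inert place hit
  nonresidues, at a split place the base change ramifies at both places, and \<open>w\<close> has norm 13, on
  which a 2-adic sign character of the rationals can be prescribed. A character in normal form that
  is invariant under conjugation is unramified at all odd places, then at \<open>1 + i\<close> by the product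
  formula at \<open>u\<close>, hence trivial; this gives the statements on base change. The parity condition is
  the product formula at \<open>u\<close>, since \<open>u\<close> is a nonsquare modulo a split prime exactly when \<open>p = 5\<close>
  modulo 8.
\<close>

section \<open>Norm-Euclidean subfields of the complex numbers\<close>

text \<open>The element \<open>w\<close> links the two ground fields. Since
  \<open>w * cnj w = 13\<close>, and since 13 and -1 generate the units of the rationals modulo 8,
  the sign at \<open>w\<close> can be altered by base change. Since 13 is also the deepest generator
  at \<open>1 + i\<close>, the same identity shows that a conjugation-invariant character with sign
  1 at \<open>w\<close> has sign 1 at 13. The sign at -1 of the rational 2-adic component is spent
  on the product formula for the global unit -1, so only the sign at 13 is available, and
  \<open>w\<close> is the generator that it can correct. Exponents 3 and 4 do not occur at
  \<open>1 + i\<close> in normal form because level 2 belongs to \<open>-1 = u^2\<close>, which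
  always has sign 1, and level 3 to \<open>w\<close>. An obstacle is the real place of the
  rationals, where a character may be nontrivial. \<open>full\<close> singles out the characters
  without a contribution from infinity; over the Gaussian numbers every sign character has this
  property. Local questions are moved into the ground field: the sign of a local unit is that of any
  close element of the field, so most arguments concern \<open>vunit\<close> elements and the
  congruences \<open>cng\<close>.\<close>

abbreviation "fp \<equiv> Fin_place"

text \<open>What the integers in the rationals and the Gaussian integers in their field have in
  common. \<open>O_norm\<close> and \<open>O_cnj\<close> provide the norm \<open>x * cnj x\<close>,
  \<open>O_eucl\<close> the division with remainder for it, and \<open>O_fin\<close> the finiteness
  of the residue fields.\<close>

locale euclid_field =
  fixes F Oi :: "complex set"
  assumes F_add: "x \<in> F \<Longrightarrow> y \<in> F \<Longrightarrow> x + y \<in> F"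
    and F_mult: "x \<in> F \<Longrightarrow> y \<in> F \<Longrightarrow> x * y \<in> F"
    and F_inverse: "x \<in> F \<Longrightarrow> inverse x \<in> F"
    and F_cnj: "x \<in> F \<Longrightarrow> cnj x \<in> F"
    and O_sub: "Oi \<subseteq> F"
    and O_int: "of_int k \<in> Oi"
    and O_add: "x \<in> Oi \<Longrightarrow> y \<in> Oi \<Longrightarrow> x + y \<in> Oi"
    and O_mult: "x \<in> Oi \<Longrightarrow> y \<in> Oi \<Longrightarrow> x * y \<in> Oi"
    and O_cnj: "x \<in> Oi \<Longrightarrow> cnj x \<in> Oi"
    and O_frac: "x \<in> F \<Longrightarrow> \<exists>n::nat. n > 0 \<and> of_nat n * x \<in> Oi"
    and O_eucl: "x \<in> F \<Longrightarrow> \<exists>q\<in>Oi. cmod (x - q) < 1"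
    and O_norm: "x \<in> Oi \<Longrightarrow> \<exists>k::nat. (cmod x)^2 = real k"
    and O_alg: "x \<in> Oi \<Longrightarrow> algebraic_int x"
    and O_fin: "finite {x \<in> Oi. cmod x < r}"
begin

abbreviation "FP \<equiv> finite_places F"
abbreviation "av P \<equiv> absv F (fp P)"
abbreviation "emb P \<equiv> embed F (fp P)"
abbreviation "KU v \<equiv> completion_units F v"
abbreviation "LU P \<equiv> local_units F P"
abbreviation "cexpo \<equiv> conductor_exponent F"
abbreviation "cabs \<equiv> completion_abs F"
abbreviation "HU P n \<equiv> higher_units F P n"

lemma O_F: "x \<in> Oi \<Longrightarrow> x \<in> F" using O_sub by blast
lemma O_simps [simp]: "0 \<in> Oi" "1 \<in> Oi" "numeral w \<in> Oi" "of_nat n \<in> Oi" "-1 \<in> Oi" "- numeral w \<in> Oi"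
  using O_int[of 0] O_int[of 1] O_int[of "numeral w"] O_int[of "int n"] O_int[of "-1"]
    O_int[of "- numeral w"] by simp_all
lemma O_uminus: "x \<in> Oi \<Longrightarrow> - x \<in> Oi"
  using O_mult[of "-1" x] by simp
lemma O_diff: "x \<in> Oi \<Longrightarrow> y \<in> Oi \<Longrightarrow> x - y \<in> Oi"
  using O_add[of x "-y"] O_uminus by simp
lemma O_power: "x \<in> Oi \<Longrightarrow> x ^ n \<in> Oi"
  by (induction n) (auto intro: O_mult)
lemma F_simps [simp]: "0 \<in> F" "1 \<in> F" "numeral w \<in> F" "of_nat n \<in> F" "of_int k \<in> F" "-1 \<in> F"
  using O_F O_int by simp_all
lemma F_uminus: "x \<in> F \<Longrightarrow> - x \<in> F"
  using F_mult[of "-1" x] by simp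
lemma F_diff: "x \<in> F \<Longrightarrow> y \<in> F \<Longrightarrow> x - y \<in> F"
  using F_add[of x "-y"] F_uminus by simp
lemma F_divide: "x \<in> F \<Longrightarrow> y \<in> F \<Longrightarrow> x / y \<in> F"
  using F_mult[of x "inverse y"] F_inverse by (simp add: divide_inverse)
lemma F_power: "x \<in> F \<Longrightarrow> x ^ n \<in> F"
  by (induction n) (auto intro: F_mult)
lemma F_powi: "x \<in> F \<Longrightarrow> x powi n \<in> F"
  by (simp add: power_int_def F_power F_inverse)

lemmas O_closed = O_add O_mult O_uminus O_diff O_power O_cnj
lemmas F_closed = F_add F_mult F_uminus F_diff F_power F_cnj F_inverse F_divide F_powi

text \<open>The squared modulus. For Gaussian integers this is the norm, for rational integers the
  square of the absolute value. Both are multiplicative and take the value 1 exactly at the units,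
  so divisibility can be treated by induction on it.\<close>

definition nrm :: "complex \<Rightarrow> nat" where
  "nrm x = (THE k. (cmod x)^2 = real k)"

lemma nrm: "x \<in> Oi \<Longrightarrow> (cmod x)^2 = real (nrm x)"
  unfolding nrm_def using O_norm[of x] by auto

lemma nrm_mult: "x \<in> Oi \<Longrightarrow> y \<in> Oi \<Longrightarrow> nrm (x * y) = nrm x * nrm y"
  using nrm[of x] nrm[of y] nrm[of "x*y"] O_mult[of x y]
  by (metis norm_mult of_nat_eq_iff of_nat_mult power_mult_distrib)

lemma nrm_0: "x \<in> Oi \<Longrightarrow> nrm x = 0 \<longleftrightarrow> x = 0"
  using nrm[of x] by auto

lemma nrm_cnj: "x \<in> Oi \<Longrightarrow> of_nat (nrm x) = x * cnj x"
  using nrm[of x] by (metis complex_norm_square of_real_of_nat_eq)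

lemma nrm_1: assumes "x \<in> Oi" "nrm x = 1" shows "inverse x \<in> Oi" "x \<noteq> 0"
proof -
  have "x * cnj x = 1" using nrm_cnj[OF assms(1)] assms(2) by simp
  then show "x \<noteq> 0" by auto
  then have "inverse x = cnj x" using \<open>x * cnj x = 1\<close> by (metis inverse_unique)
  then show "inverse x \<in> Oi" using O_cnj assms by simp
qed

lemma nrm_one [simp]: "nrm 1 = 1" using nrm[of 1] by simp

lemma nrm_unit: assumes "x \<in> Oi" "y \<in> Oi" "x * y = 1" shows "nrm x = 1"
  using nrm_mult[OF assms(1,2)] assms(3) by simp

section \<open>Principal ideals, Bezout identities and reduced fractions\<close>

definition pid :: "complex \<Rightarrow> complex set" where
  "pid a = {c * a | c. c \<in> Oi}"

lemma pidI: "c \<in> Oi \<Longrightarrow> x = c * a \<Longrightarrow> x \<in> pid a" by (auto simp: pid_def)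
lemma pidE: assumes "x \<in> pid a" obtains c where "c \<in> Oi" "x = c * a" using assms by (auto simp: pid_def)
lemma pid_self: "a \<in> pid a" by (rule pidI[of 1]) auto

text \<open>A nonzero element of least \<open>nrm\<close> generates, because the remainder
  \<open>a * (y / a - q)\<close> has smaller modulus than \<open>a\<close>. Closure conditions stand
  in place of an ideal so that the set of combinations in a Bezout identity is covered too.\<close>

lemma principal:
  assumes sub: "I \<subseteq> Oi" and z: "0 \<in> I" and add: "\<And>x y. x \<in> I \<Longrightarrow> y \<in> I \<Longrightarrow> x + y \<in> I"
    and mul: "\<And>c x. c \<in> Oi \<Longrightarrow> x \<in> I \<Longrightarrow> c * x \<in> I"
  shows "\<exists>a\<in>I. I = pid a"
proof (cases "I = {0}")
  case True then show ?thesis by (auto simp: pid_def intro: exI[of _ 0])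
next
  case False
  then obtain x where x: "x \<in> I" "x \<noteq> 0" using z by blast
  obtain a where a: "a \<in> I - {0}" "\<And>y. y \<in> I - {0} \<Longrightarrow> nrm a \<le> nrm y"
    using ex_has_least_nat[of "\<lambda>x. x \<in> I - {0}" x nrm] x by auto
  have aO: "a \<in> Oi" using a sub by auto
  have "I = pid a"
  proof
    show "pid a \<subseteq> I" using a mul by (auto simp: pid_def)
    show "I \<subseteq> pid a"
    proof
      fix y assume y: "y \<in> I"
      then have yO: "y \<in> Oi" using sub by auto
      obtain q where q: "q \<in> Oi" "cmod (y / a - q) < 1"
        using O_eucl[of "y / a"] F_divide O_F yO aO by blast
      define r where "r = y - q * a"
      have rI: "r \<in> I" using add[OF y mul[OF _ a(1)[THEN DiffD1], of "-q"]] q O_uminus by (simp add: r_def)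
      have "r = a * (y / a - q)" using a by (simp add: r_def field_simps)
      then have "cmod r = cmod a * cmod (y / a - q)" by (simp only: norm_mult)
      then have "cmod r < cmod a" using q a by (simp add: mult_less_cancel_left2)
      then have "(cmod r)^2 < (cmod a)^2" by (intro power_strict_mono) auto
      then have "nrm r < nrm a" using nrm[OF aO] nrm[of r] rI sub by auto
      then have "r = 0" using a(2)[of r] rI by force
      then show "y \<in> pid a" using q by (auto simp: r_def pid_def)
    qed
  qed
  then show ?thesis using a by blast
qed

lemma bezout:
  assumes "a \<in> Oi" "b \<in> Oi"
  obtains g s t a' b' where "g \<in> Oi" "s \<in> Oi" "t \<in> Oi" "a' \<in> Oi" "b' \<in> Oi"
    "g = s * a + t * b" "a = a' * g" "b = b' * g"
proof -
  let ?I = "{s * a + t * b | s t. s \<in> Oi \<and> t \<in> Oi}"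
  have "\<exists>g\<in>?I. ?I = pid g"
  proof (rule principal)
    show "?I \<subseteq> Oi" using assms by (auto intro!: O_closed)
    show "0 \<in> ?I" by (auto intro!: exI[of _ 0])
    fix x y assume "x \<in> ?I" "y \<in> ?I"
    then obtain s t s' t' where "s\<in>Oi" "t\<in>Oi" "s'\<in>Oi" "t'\<in>Oi" "x = s*a+t*b" "y=s'*a+t'*b" by auto
    then show "x + y \<in> ?I" by (intro CollectI exI[of _ "s+s'"] exI[of _ "t+t'"]) (auto intro!: O_closed simp: algebra_simps)
  next
    fix c x assume "c \<in> Oi" "x \<in> ?I"
    then obtain s t where "s\<in>Oi" "t\<in>Oi" "x = s*a+t*b" by auto
    then show "c * x \<in> ?I" using \<open>c \<in> Oi\<close> by (intro CollectI exI[of _ "c * s"] exI[of _ "c*t"]) (auto intro!: O_closed simp: algebra_simps)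
  qed
  then obtain g where g: "g \<in> ?I" "?I = pid g" by blast
  have "a \<in> ?I" by (rule CollectI, rule exI[of _ 1], rule exI[of _ 0]) auto
  moreover have "b \<in> ?I" by (rule CollectI, rule exI[of _ 0], rule exI[of _ 1]) auto
  ultimately have "a \<in> pid g" "b \<in> pid g" using g by auto
  then obtain a' b' where "a' \<in> Oi" "b' \<in> Oi" "a = a' * g" "b = b' * g" by (auto simp: pid_def)
  moreover obtain s t where st: "s\<in>Oi" "t\<in>Oi" "g = s * a + t * b" using g(1) by auto
  moreover have "g \<in> Oi" using st assms by (auto intro!: O_closed)
  ultimately show thesis using that by blast
qed

text \<open>Numerator and denominator are divided by their common divisor. Coprimality is recorded
  as a Bezout identity, which is the form in which it is used later.\<close>

lemma frac_coprime:
  assumes "x \<in> F"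
  obtains a b s t where "a \<in> Oi" "b \<in> Oi" "s \<in> Oi" "t \<in> Oi" "b \<noteq> 0" "x = a / b" "s * a + t * b = 1"
proof -
  obtain n :: nat where n: "n > 0" "of_nat n * x \<in> Oi" using O_frac[OF assms] by blast
  obtain g s t a' b' where g: "g \<in> Oi" "s \<in> Oi" "t \<in> Oi" "a' \<in> Oi" "b' \<in> Oi"
    "g = s * (of_nat n * x) + t * of_nat n" "of_nat n * x = a' * g" "of_nat n = b' * g"
    by (rule bezout[OF n(2) O_simps(4)[of n]])
  have g0: "g \<noteq> 0" using g(8) n(1) by auto
  have "b' \<noteq> 0" using g(8) n(1) by auto
  moreover have "x = a' / b'"
  proof -
    have "x = (of_nat n * x) / of_nat n" using n by simp
    also have "\<dots> = a' / b'" unfolding g(7) unfolding g(8) using g0 by simp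
    finally show ?thesis .
  qed
  moreover have "s * a' + t * b' = 1"
  proof -
    have "g = s * (a' * g) + t * (b' * g)" using g(6) unfolding g(7)  unfolding g(8) by simp
    then have "g * (s * a' + t * b') = g * 1" by (simp add: algebra_simps)
    then show ?thesis using g0 mult_left_cancel by blast
  qed
  ultimately show thesis using that g by blast
qed

text \<open>Multiplying the identity for \<open>a ^ n\<close> by the one for \<open>a\<close> leaves
  every term but one divisible by \<open>b\<close>.\<close>

lemma bezout_power:
  assumes "s \<in> Oi" "t \<in> Oi" "a \<in> Oi" "b \<in> Oi" "s * a + t * b = 1"
  shows "\<exists>s'\<in>Oi. \<exists>t'\<in>Oi. s' * a ^ n + t' * b = 1"
proof (induction n)
  case 0
  then show ?case by (intro bexI[of _ 1] bexI[of _ 0]) auto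
next
  case (Suc n)
  then obtain s' t' where st: "s'\<in>Oi" "t'\<in>Oi" "s' * a ^ n + t' * b = 1" by blast
  have "(s' * a ^ n + t' * b) * (s * a + t * b) = 1" using st assms by simp
  then have "(s' * s) * a ^ Suc n + (s' * a^n * t + t' * s * a + t' * b * t) * b = 1"
    by (simp add: algebra_simps)
  then show ?case using st assms by (intro bexI[of _ "s' * s"] bexI[of _ "s' * a^n * t + t' * s * a + t' * b * t"])
     (auto intro!: O_closed)
qed

lemma O_sum: "(\<And>i. i \<in> A \<Longrightarrow> f i \<in> Oi) \<Longrightarrow> sum f A \<in> Oi"
  by (induction A rule: infinite_finite_induct) (auto intro: O_closed)

text \<open>Rational root argument: for \<open>x = a / b\<close> in lowest terms, clearing
  denominators in a monic equation makes \<open>b\<close> divide \<open>a ^ n\<close>, and as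
  \<open>b\<close> is coprime to \<open>a ^ n\<close> it is a unit. This identifies the carrier of
  \<open>int_ring F\<close> with \<open>Oi\<close>.\<close>

lemma integrally_closed:
  assumes x: "x \<in> F" "algebraic_int x"
  shows "x \<in> Oi"
proof -
  obtain a b s t where ab: "a \<in> Oi" "b \<in> Oi" "s \<in> Oi" "t \<in> Oi" "b \<noteq> 0" "x = a / b" "s * a + t * b = 1"
    using frac_coprime[OF x(1)] by blast
  from x(2) obtain p where p: "lead_coeff p = 1" "\<forall>i. Polynomial.coeff p i \<in> \<int>" "poly p x = 0"
    by (auto simp: algebraic_int.simps)
  have cO: "Polynomial.coeff p i \<in> Oi" for i using p(2) O_int by (metis Ints_cases)
  define n where "n = Polynomial.degree p"
  have n0: "n > 0" using p by (intro Nat.gr0I) (auto simp: n_def elim!: degree_eq_zeroE)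
  \<comment> \<open>The lower terms of \<open>poly p x * b ^ n\<close> with one factor
    \<open>b\<close> taken out, hence the exponent \<open>n - i - 1\<close>.\<close>
  define r where "r = (\<Sum>i<n. Polynomial.coeff p i * a ^ i * b ^ (n - i - 1))"
  have rO: "r \<in> Oi" unfolding r_def using ab cO by (auto intro!: O_sum O_closed)
  have [simp]: "Polynomial.coeff p n = 1" using p by (auto simp: n_def)
  have "0 = poly p x * b ^ n" using p by simp
  also have "\<dots> = (\<Sum>i\<le>n. Polynomial.coeff p i * x ^ i * b ^ n)"
    by (simp add: poly_altdef n_def sum_distrib_right)
  also have "\<dots> = (\<Sum>i\<le>n. Polynomial.coeff p i * (a ^ i * b ^ (n - i)))"
  proof (intro sum.cong refl)
    fix i assume "i \<in> {..n}"
    then have "b ^ n = b ^ i * b ^ (n - i)" by (simp flip: power_add)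
    then show "Polynomial.coeff p i * x ^ i * b ^ n = Polynomial.coeff p i * (a ^ i * b ^ (n - i))"
      using ab(5,6) by (simp add: power_divide)
  qed
  also have "{..n} = insert n {..<n}" using n0 by auto
  also have "(\<Sum>i\<in>\<dots>. Polynomial.coeff p i * (a ^ i * b ^ (n - i))) =
               a ^ n + (\<Sum>i<n. Polynomial.coeff p i * (a ^ i * b ^ (n - i)))"
    by (subst sum.insert) auto
  also have "(\<Sum>i<n. Polynomial.coeff p i * (a ^ i * b ^ (n - i))) = b * r"
    unfolding r_def sum_distrib_left
    by (intro sum.cong) (auto simp flip: power_Suc simp: Suc_diff_Suc mult_ac)
  finally have an: "a ^ n = - b * r" by (simp add: eq_neg_iff_add_eq_0)
  obtain s' t' where st: "s'\<in>Oi" "t'\<in>Oi" "s' * a ^ n + t' * b = 1"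
    using bezout_power[OF ab(3,4,1,2,7)] by blast
  then have "b * (t' - s' * r) = 1" using an by (simp add: algebra_simps)
  then have "inverse b = t' - s' * r" by (metis inverse_unique)
  then have "inverse b \<in> Oi" using st rO by (auto intro!: O_closed)
  then show ?thesis using ab O_mult by (simp add: divide_inverse)
qed

section \<open>The ring of integers and its ideals\<close>

abbreviation RR where "RR \<equiv> int_ring F"

lemma carr [simp]: "carrier RR = Oi"
  using integrally_closed O_alg O_F by (auto simp: int_ring_def)
lemma R_ops [simp]: "x \<otimes>\<^bsub>RR\<^esub> y = x * y" "x \<oplus>\<^bsub>RR\<^esub> y = x + y" "\<zero>\<^bsub>RR\<^esub> = 0" "\<one>\<^bsub>RR\<^esub> = 1"
  by (simp_all add: int_ring_def)

lemma R_cring: "cring RR"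
proof (rule cringI)
  show "abelian_group RR"
    by (rule abelian_groupI) (auto intro!: O_closed bexI[of _ "- _"] simp: algebra_simps)
  show "comm_monoid RR" by (rule comm_monoidI) (auto intro!: O_closed simp: algebra_simps)
qed (auto simp: algebra_simps)

lemma R_uminus: "x \<in> Oi \<Longrightarrow> \<ominus>\<^bsub>RR\<^esub> x = - x"
proof -
  interpret cring RR by (rule R_cring)
  assume "x \<in> Oi" then show ?thesis using minus_equality[of "-x" x] O_uminus by simp
qed

lemma ideal_iff:
  "ideal I RR \<longleftrightarrow> I \<subseteq> Oi \<and> 0 \<in> I \<and> (\<forall>x\<in>I. \<forall>y\<in>I. x + y \<in> I) \<and> (\<forall>c\<in>Oi. \<forall>x\<in>I. c * x \<in> I)"
proof
  interpret cring RR by (rule R_cring)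
  assume "ideal I RR"
  then interpret ideal I RR .
  show "I \<subseteq> Oi \<and> 0 \<in> I \<and> (\<forall>x\<in>I. \<forall>y\<in>I. x + y \<in> I) \<and> (\<forall>c\<in>Oi. \<forall>x\<in>I. c * x \<in> I)"
    using a_subset zero_closed a_closed I_l_closed by auto
next
  interpret cring RR by (rule R_cring)
  assume I: "I \<subseteq> Oi \<and> 0 \<in> I \<and> (\<forall>x\<in>I. \<forall>y\<in>I. x + y \<in> I) \<and> (\<forall>c\<in>Oi. \<forall>x\<in>I. c * x \<in> I)"
  show "ideal I RR"
  proof (rule idealI)
    show "ring RR" by (rule ring_axioms)
    show "subgroup I (add_monoid RR)"
    proof
      fix x assume "x \<in> I"
      then have "\<ominus>\<^bsub>RR\<^esub> x = (-1) * x" using R_uminus I by auto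
      moreover have "(-1) * x \<in> I" using I \<open>x \<in> I\<close> O_simps(5) by blast
      ultimately show "inv\<^bsub>add_monoid RR\<^esub> x \<in> I" unfolding a_inv_def by metis
    qed (use I in auto)
    have "x * c \<in> I" if "x \<in> I" "c \<in> Oi" for x c using I that by (metis mult.commute)
    then show "\<And>a x. a \<in> I \<Longrightarrow> x \<in> carrier RR \<Longrightarrow> x \<otimes>\<^bsub>RR\<^esub> a \<in> I"
      "\<And>a x. a \<in> I \<Longrightarrow> x \<in> carrier RR \<Longrightarrow> a \<otimes>\<^bsub>RR\<^esub> x \<in> I" using I by auto
  qed
qed

lemma idealD:
  assumes "ideal I RR"
  shows "I \<subseteq> Oi" "0 \<in> I" "x \<in> I \<Longrightarrow> y \<in> I \<Longrightarrow> x + y \<in> I" "c \<in> Oi \<Longrightarrow> x \<in> I \<Longrightarrow> c * x \<in> I"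
  using assms unfolding ideal_iff by auto

lemma ideal_principal: "ideal I RR \<Longrightarrow> \<exists>a\<in>Oi. I = pid a"
  using principal[of I] idealD[of I] by blast

lemma pid_ideal: "a \<in> Oi \<Longrightarrow> ideal (pid a) RR"
  unfolding ideal_iff
proof (intro conjI ballI)
  assume a: "a \<in> Oi"
  show "pid a \<subseteq> Oi" "0 \<in> pid a" using a by (auto simp: pid_def intro: O_closed exI[of _ 0])
  fix x assume x: "x \<in> pid a"
  { fix y assume "y \<in> pid a" then show "x + y \<in> pid a"
      using x O_add by (auto simp: pid_def simp flip: distrib_right) }
  { fix c assume "c \<in> Oi" then show "c * x \<in> pid a"
      using x O_mult by (auto simp: pid_def simp flip: mult.assoc) }
qed

lemma PIdl: "PIdl\<^bsub>RR\<^esub> a = pid a"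
  by (auto simp: cgenideal_def pid_def)

lemma pid_subset: "a \<in> Oi \<Longrightarrow> b \<in> Oi \<Longrightarrow> pid a \<subseteq> pid b \<longleftrightarrow> (\<exists>c\<in>Oi. a = c * b)"
proof -
  assume "a \<in> Oi" "b \<in> Oi"
  have "pid a \<subseteq> pid b \<longleftrightarrow> a \<in> pid b"
    using pid_self pid_ideal[OF \<open>b \<in> Oi\<close>] unfolding ideal_iff by (auto elim!: pidE)
  then show ?thesis by (auto simp: pid_def)
qed

lemma ideal_prod_pid: "a \<in> Oi \<Longrightarrow> b \<in> Oi \<Longrightarrow> ideal_prod RR (pid a) (pid b) = pid (a * b)"
proof
  assume ab: "a \<in> Oi" "b \<in> Oi"
  show "ideal_prod RR (pid a) (pid b) \<subseteq> pid (a * b)"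
  proof
    fix x assume "x \<in> ideal_prod RR (pid a) (pid b)"
    then show "x \<in> pid (a * b)"
    proof induction
      case (prod i j)
      then obtain c d where "c \<in> Oi" "d \<in> Oi" "i = c * a" "j = d * b" by (auto elim!: pidE)
      then show ?case by (intro pidI[of "c*d"]) (auto intro!: O_closed)
    next
      case (sum s1 s2)
      then show ?case using pid_ideal[of "a*b"] O_mult ab unfolding ideal_iff by auto
    qed
  qed
  show "pid (a * b) \<subseteq> ideal_prod RR (pid a) (pid b)"
  proof
    fix x assume "x \<in> pid (a * b)"
    then obtain c where c: "c \<in> Oi" "x = c * a * b" by (auto elim!: pidE)
    then have "(c * a) \<otimes>\<^bsub>RR\<^esub> b \<in> ideal_prod RR (pid a) (pid b)"
      by (intro ideal_prod.prod) (auto intro: pidI pid_self)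
    then show "x \<in> ideal_prod RR (pid a) (pid b)" using c by simp
  qed
qed

lemma ideals_set_simps [simp]: "carrier (ideals_set R) = {I. ideal I R}" 
  "mult (ideals_set R) = ideal_prod R" "one (ideals_set R) = carrier R"
  by (simp_all add: ideals_set_def)

lemma pid_1 [simp]: "pid 1 = Oi" by (auto simp: pid_def)
lemma pid_0 [simp]: "pid 0 = {0}" by (auto simp: pid_def intro: exI[of _ 0])

lemma ideal_pow_pid: "a \<in> Oi \<Longrightarrow> ideal_pow RR (pid a) n = pid (a ^ n)"
proof (induction n)
  case 0
  then show ?case by (simp add: nat_pow_def)
next
  case (Suc n)
  have "ideal_pow RR (pid a) (Suc n) = ideal_prod RR (ideal_pow RR (pid a) n) (pid a)"
    by (simp add: nat_pow_def)
  then show ?case using Suc by (simp add: ideal_prod_pid O_closed mult.commute)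
qed

lemma ideal_dvd_pid: "a \<in> Oi \<Longrightarrow> b \<in> Oi \<Longrightarrow> ideal_dvd F (pid a) (pid b) \<longleftrightarrow> (\<exists>c\<in>Oi. b = c * a)"
proof
  assume ab: "a \<in> Oi" "b \<in> Oi"
  { assume "ideal_dvd F (pid a) (pid b)"
    then obtain J where J: "ideal J RR" "pid b = ideal_prod RR (pid a) J"
      by (auto simp: factor_def)
    then obtain c where "c \<in> Oi" "J = pid c" using ideal_principal by blast
    then have "pid b = pid (a * c)" using J ideal_prod_pid ab by simp
    then have "b \<in> pid (a * c)" using pid_self[of b] by simp
    then obtain d where "d \<in> Oi" "b = d * (a * c)" by (auto elim: pidE)
    then show "\<exists>c\<in>Oi. b = c * a" using \<open>c \<in> Oi\<close> by (intro bexI[of _ "d*c"]) (auto intro: O_closed) }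
  { assume "\<exists>c\<in>Oi. b = c * a"
    then obtain c where c: "c \<in> Oi" "b = a * c" by (auto simp: mult.commute)
    then have "pid b = ideal_prod RR (pid a) (pid c)" using ideal_prod_pid ab by simp
    then show "ideal_dvd F (pid a) (pid b)" using pid_ideal[OF c(1)] by (auto simp: factor_def) }
qed

section \<open>Prime ideals and their generators\<close>

lemma placeD:
  assumes "P \<in> FP"
  shows "ideal P RR" "P \<subseteq> Oi" "1 \<notin> P" "\<And>a b. a \<in> Oi \<Longrightarrow> b \<in> Oi \<Longrightarrow> a * b \<in> P \<Longrightarrow> a \<in> P \<or> b \<in> P"
    "P \<noteq> {0}"
proof -
  interpret primeideal P RR using assms by (simp add: finite_places_def)
  show "ideal P RR" by (rule is_ideal)
  then show "P \<subseteq> Oi" by (rule idealD)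
  show "1 \<notin> P" using I_notcarr one_imp_carrier by auto
  show "P \<noteq> {0}" using assms by (simp add: finite_places_def)
  fix a b assume "a \<in> Oi" "b \<in> Oi" "a * b \<in> P" then show "a \<in> P \<or> b \<in> P" using I_prime by simp
qed

lemma placeI:
  assumes "ideal P RR" "1 \<notin> P" "\<And>a b. a \<in> Oi \<Longrightarrow> b \<in> Oi \<Longrightarrow> a * b \<in> P \<Longrightarrow> a \<in> P \<or> b \<in> P" "P \<noteq> {0}"
  shows "P \<in> FP"
proof -
  have "primeideal P RR"
    using assms R_cring by (intro primeidealI) auto
  then show ?thesis using assms by (simp add: finite_places_def)
qed

text \<open>A uniformiser at \<open>P\<close>. It is determined up to a unit only, which affects no
  valuation.\<close>

definition ppi :: "complex set \<Rightarrow> complex" where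
  "ppi P = (SOME a. a \<in> Oi \<and> P = pid a)"

lemma ppi: assumes "P \<in> FP"
  shows "ppi P \<in> Oi" "P = pid (ppi P)" "ppi P \<noteq> 0" "ppi P \<in> P" "nrm (ppi P) > 1" "ppi P \<in> F"
proof -
  have "ppi P \<in> Oi \<and> P = pid (ppi P)" unfolding ppi_def
    by (rule someI_ex) (use ideal_principal[OF placeD(1)[OF assms]] in blast)
  then show *: "ppi P \<in> Oi" "P = pid (ppi P)" by auto
  then show "ppi P \<in> F" using O_F by auto
  show "ppi P \<noteq> 0" using * placeD(5)[OF assms] by (metis pid_0)
  then have "nrm (ppi P) \<noteq> 0" using * nrm_0 by simp
  show "ppi P \<in> P" using * pid_self by metis
  have "nrm (ppi P) \<noteq> 1"
  proof
    assume "nrm (ppi P) = 1"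
    then have "inverse (ppi P) \<in> Oi" using nrm_1 * by blast
    then have "1 \<in> pid (ppi P)" using \<open>ppi P \<noteq> 0\<close> by (intro pidI) auto
    then show False using * placeD(3)[OF assms] by simp
  qed
  then show "nrm (ppi P) > 1" using \<open>nrm (ppi P) \<noteq> 0\<close> by linarith
qed

lemma place_mult: "P \<in> FP \<Longrightarrow> c \<in> Oi \<Longrightarrow> x \<in> P \<Longrightarrow> c * x \<in> P"
  using idealD(3,4)[OF placeD(1)] by blast
lemma place_add: "P \<in> FP \<Longrightarrow> y \<in> P \<Longrightarrow> x \<in> P \<Longrightarrow> x + y \<in> P"
  using idealD(3,4)[OF placeD(1)] by blast
lemma place_minus: "P \<in> FP \<Longrightarrow> x \<in> P \<Longrightarrow> - x \<in> P"
  using place_mult[of P "-1" x] by simp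
lemma place_diff: "P \<in> FP \<Longrightarrow> x \<in> P \<Longrightarrow> y \<in> P \<Longrightarrow> x - y \<in> P"
  using place_add[of P "-y" x] place_minus by simp
text \<open>Irreducible elements are prime by Bezout: with \<open>g\<close> the common divisor of
  \<open>a\<close> and \<open>d\<close>, either \<open>d\<close> is \<open>g\<close> up to a unit
  and divides \<open>a\<close>, or \<open>g\<close> is a unit and multiplying its Bezout identity by
  \<open>b\<close> shows that \<open>d\<close> divides \<open>b\<close>.\<close>

lemma irred_place:
  assumes d: "d \<in> Oi" "nrm d > 1" and irr: "\<And>x y. x \<in> Oi \<Longrightarrow> y \<in> Oi \<Longrightarrow> d = x * y \<Longrightarrow> nrm x = 1 \<or> nrm y = 1"
  shows "pid d \<in> FP"
proof (rule placeI)
  have d0: "d \<noteq> 0" using d nrm_0[of 0] by auto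
  show "ideal (pid d) RR" using pid_ideal d by blast
  show "pid d \<noteq> {0}" using d0 pid_self by blast
  show "1 \<notin> pid d"
  proof
    assume "1 \<in> pid d"
    then obtain c where "c \<in> Oi" "d * c = 1" by (metis pidE mult.commute)
    then show False using nrm_unit[of d c] d by auto
  qed
  fix a b assume ab: "a \<in> Oi" "b \<in> Oi" "a * b \<in> pid d"
  obtain g s t a' d' where g: "g \<in> Oi" "s \<in> Oi" "t \<in> Oi" "a' \<in> Oi" "d' \<in> Oi"
    "g = s * a + t * d" "a = a' * g" "d = d' * g" using bezout[OF ab(1) d(1)] by blast
  from irr[OF g(5,1,8)] show "a \<in> pid d \<or> b \<in> pid d"
  proof
    assume "nrm d' = 1"
    then have "inverse d' \<in> Oi" "d' \<noteq> 0" using nrm_1[OF g(5)] by auto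
    then have "g = inverse d' * d" using g(8) by simp
    then have "a = (a' * inverse d') * d" using g(7) by simp
    then show ?thesis using pidI O_mult[OF g(4) \<open>inverse d' \<in> Oi\<close>] by blast
  next
    assume "nrm g = 1"
    then have ig: "inverse g \<in> Oi" "g \<noteq> 0" using nrm_1[OF g(1)] by auto
    obtain c where c: "c \<in> Oi" "a * b = c * d" using ab by (auto elim: pidE)
    have "g * b = s * (a * b) + t * d * b" using g(6) by (simp add: algebra_simps)
    also have "\<dots> = (s * c + t * b) * d" using c by (simp add: algebra_simps)
    finally have "b = (inverse g * (s * c + t * b)) * d" using ig(2) by (simp add: field_simps)
    moreover have "inverse g * (s * c + t * b) \<in> Oi" using ig(1) g(2,3) c(1) ab(2) by (intro O_closed)
    ultimately show ?thesis using pidI by blast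
  qed
qed

text \<open>Induction on \<open>nrm\<close>: a nonzero nonunit that is not irreducible has a nonunit
  factor of smaller norm.\<close>

lemma nonunit_place:
  assumes a: "a \<in> Oi" "nrm a \<noteq> 1"
  obtains P where "P \<in> FP" "a \<in> P"
proof -
  have "\<exists>P\<in>FP. a \<in> P" if "a \<in> Oi" "nrm a \<noteq> 1" "a \<noteq> 0" for a
    using that
  proof (induction "nrm a" arbitrary: a rule: less_induct)
    case less
    show ?case
    proof (cases "\<forall>x y. x \<in> Oi \<longrightarrow> y \<in> Oi \<longrightarrow> a = x * y \<longrightarrow> nrm x = 1 \<or> nrm y = 1")
      case True
      moreover have "nrm a > 1" using less nrm_0[of a] by auto
      ultimately show ?thesis using irred_place[of a] less pid_self by blast
    next
      case False
      then obtain x y where xy: "x \<in> Oi" "y \<in> Oi" "a = x * y" "nrm x \<noteq> 1" "nrm y \<noteq> 1" by blast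
      then have "nrm a = nrm x * nrm y" "nrm x \<noteq> 0" "nrm y \<noteq> 0" "x \<noteq> 0" using nrm_mult nrm_0 less by auto
      then have "nrm x < nrm a" using xy by (cases "nrm y") auto
      then obtain P where "P\<in>FP" "x \<in> P" using less xy \<open>x \<noteq> 0\<close> by blast
      then show ?thesis using place_mult[of P y x] xy by (auto simp: mult.commute)
    qed
  qed
  moreover have "\<exists>P\<in>FP. 0 \<in> P"
  proof -
    \<comment> \<open>Zero lies in every prime ideal, so it remains to produce one prime ideal; the
      nonunit 2 lies in one.\<close>
    have "nrm 2 = 4" using nrm[of 2] by simp
    then obtain P where "P\<in>FP" using calculation[of 2] by auto
    then show ?thesis using idealD(2)[OF placeD(1)] by blast
  qed
  ultimately show thesis using that a by blast
qed

section \<open>Valuations\<close>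

lemma ppi_factor:
  assumes P: "P \<in> FP" and a: "a \<in> Oi" "a \<noteq> 0"
  shows "\<exists>n. \<exists>b\<in>Oi - P. a = ppi P ^ n * b"
  using a
proof (induction "nrm a" arbitrary: a rule: less_induct)
  case less
  show ?case
  proof (cases "a \<in> P")
    case False
    then show ?thesis using less by (intro exI[of _ 0]) auto
  next
    case True
    then obtain c where c: "c \<in> Oi" "a = c * ppi P" using ppi(2)[OF P] by (metis pidE)
    then have "nrm a = nrm c * nrm (ppi P)" "c \<noteq> 0" "nrm c \<noteq> 0" using nrm_mult nrm_0 less ppi[OF P] by auto
    then have "nrm c < nrm a" using ppi(5)[OF P] by auto
    then obtain n b where "b \<in> Oi - P" "c = ppi P ^ n * b" using less(1)[of c] c \<open>c \<noteq> 0\<close> by blast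
    then show ?thesis using c by (intro exI[of _ "Suc n"] bexI[of _ b]) (auto simp: mult_ac)
  qed
qed

text \<open>The normalised valuation at \<open>P\<close>, read off from a quotient of integers
  \<open>b\<close> and \<open>c\<close> prime to \<open>P\<close>. At 0 it carries no
  information.\<close>

definition val :: "complex set \<Rightarrow> complex \<Rightarrow> int" where
  "val P x = (THE k. \<exists>b\<in>Oi - P. \<exists>c\<in>Oi - P. x = ppi P powi k * b / c)"

lemma valI:
  assumes P: "P \<in> FP" and x: "b \<in> Oi - P" "c \<in> Oi - P" "x = ppi P powi k * b / c"
  shows "val P x = k"
  unfolding val_def
proof (rule the_equality)
  show "\<exists>b\<in>Oi - P. \<exists>c\<in>Oi - P. x = ppi P powi k * b / c" using x by blast
  have z: "0 \<in> P" by (rule idealD(2)[OF placeD(1)[OF P]])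
  \<comment> \<open>If \<open>k1 < k2\<close>, cross-multiplying leaves a positive power of the
    uniformiser on one side only, so \<open>b1 * c2\<close> falls into \<open>P\<close> although
    neither factor does.\<close>
  have key: "\<not> k1 < k2" if "b1 \<in> Oi - P" "c1 \<in> Oi - P" "b2 \<in> Oi - P" "c2 \<in> Oi - P"
     "ppi P powi k1 * b1 / c1 = ppi P powi k2 * b2 / c2" for b1 c1 b2 c2 k1 k2
  proof
    assume lt: "k1 < k2"
    have "c1 \<noteq> 0" "c2 \<noteq> 0" using that z by auto
    then have eq: "ppi P powi k1 * (b1 * c2) = ppi P powi k2 * (b2 * c1)"
      using that(5) by (simp add: divide_simps mult_ac)
    obtain n where n: "k2 = k1 + int (Suc n)" using lt zless_iff_Suc_zadd by auto
    have "ppi P powi k2 = ppi P powi k1 * ppi P ^ Suc n" unfolding n using ppi(3)[OF P]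
      by (subst power_int_add) (auto simp flip: power_int_of_nat)
    then have "ppi P powi k1 * (b1 * c2) = ppi P powi k1 * (ppi P ^ Suc n * b2 * c1)" using eq by (simp add: mult_ac)
    then have "b1 * c2 = ppi P ^ n * b2 * c1 * ppi P" using ppi(3)[OF P] by (auto simp: mult_ac)
    moreover have "ppi P ^ n * b2 * c1 * ppi P \<in> P"
      using that ppi[OF P] by (intro place_mult[OF P]) (auto intro: O_closed)
    ultimately show False using placeD(4)[OF P, of b1 c2] that by auto
  qed
  fix k' assume "\<exists>b\<in>Oi - P. \<exists>c\<in>Oi - P. x = ppi P powi k' * b / c"
  then show "k' = k" using key[of _ _ b c k' k] key[of b c _ _ k k'] x by (metis linorder_neqE)
qed

lemma val_ex:
  assumes P: "P \<in> FP" and x: "x \<in> F" "x \<noteq> 0"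
  shows "\<exists>b\<in>Oi - P. \<exists>c\<in>Oi - P. x = ppi P powi (val P x) * b / c"
proof -
  obtain a b where ab: "a \<in> Oi" "b \<in> Oi" "b \<noteq> 0" "x = a / b" using frac_coprime[OF x(1)] by metis
  then have "a \<noteq> 0" using x by auto
  obtain n a' where a': "a' \<in> Oi - P" "a = ppi P ^ n * a'" using ppi_factor[OF P ab(1) \<open>a \<noteq> 0\<close>] by blast
  obtain m b' where b': "b' \<in> Oi - P" "b = ppi P ^ m * b'" using ppi_factor[OF P ab(2,3)] by blast
  have eq: "x = ppi P powi (int n - int m) * a' / b'"
    unfolding ab(4) a'(2) b'(2) using ppi(3)[OF P] by (simp add: power_int_diff power_int_of_nat field_simps)
  then have "val P x = int n - int m" using valI[OF P a'(1) b'(1)] by blast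
  then show ?thesis using eq a' b' by metis
qed

lemma val_mult:
  assumes P: "P \<in> FP" and x: "x \<in> F" "x \<noteq> 0" and y: "y \<in> F" "y \<noteq> 0"
  shows "val P (x * y) = val P x + val P y"
proof -
  obtain b c where bc: "b \<in> Oi - P" "c \<in> Oi - P" "x = ppi P powi (val P x) * b / c" using val_ex[OF P x] by blast
  obtain b' c' where bc': "b' \<in> Oi - P" "c' \<in> Oi - P" "y = ppi P powi (val P y) * b' / c'" using val_ex[OF P y] by blast
  show ?thesis
  proof (rule valI[OF P, of "b * b'" "c * c'"])
    show "x * y = ppi P powi (val P x + val P y) * (b * b') / (c * c')"
      using ppi(3)[OF P] by (subst bc(3), subst bc'(3)) (simp add: power_int_add mult_ac)
  qed (use bc bc' placeD(4)[OF P] O_mult in blast)+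
qed

lemma val_O_factor:
  assumes P: "P \<in> FP" and "b \<in> Oi - P"
  shows "val P (ppi P ^ n * b) = int n"
  using valI[OF P assms(2), of 1 "ppi P ^ n * b" "int n"] placeD(3)[OF P] by (simp add: power_int_of_nat)

lemma val_O_ge:
  assumes P: "P \<in> FP" and a: "a \<in> Oi" "a \<noteq> 0"
  shows "val P a \<ge> int n \<longleftrightarrow> a \<in> pid (ppi P ^ n)"
proof -
  obtain m b where b: "b \<in> Oi - P" "a = ppi P ^ m * b" using ppi_factor[OF P a] by blast
  have v: "val P a = int m" using val_O_factor[OF P b(1)] b by simp
  show ?thesis
  proof
    assume "val P a \<ge> int n"
    then have "n \<le> m" using v by simp
    then have "ppi P ^ m = ppi P ^ (m - n) * ppi P ^ n" by (simp flip: power_add)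
    then have "a = (ppi P ^ (m - n) * b) * ppi P ^ n" using b by (simp add: mult_ac)
    then show "a \<in> pid (ppi P ^ n)" using b ppi(1)[OF P] by (auto intro!: pidI[of "ppi P ^ (m - n) * b"] O_closed)
  next
    assume "a \<in> pid (ppi P ^ n)"
    then obtain c where c: "c \<in> Oi" "a = c * ppi P ^ n" by (auto elim: pidE)
    then have "c \<noteq> 0" using a by auto
    then obtain k d where d: "d \<in> Oi - P" "c = ppi P ^ k * d" using ppi_factor[OF P c(1)] by blast
    then have "a = ppi P ^ (k + n) * d" using c by (simp add: power_add mult_ac)
    then have "val P a = int (k + n)" using val_O_factor[OF P d(1)] by simp
    then show "val P a \<ge> int n" by simp
  qed
qed

lemma val_O_nonneg:
  assumes P: "P \<in> FP" and a: "a \<in> Oi" "a \<noteq> 0"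
  shows "val P a \<ge> 0" "val P a \<ge> 1 \<longleftrightarrow> a \<in> P"
  using val_O_ge[OF P a, of 0] val_O_ge[OF P a, of 1] ppi(2)[OF P] a by auto

lemma val_1 [simp]: "P \<in> FP \<Longrightarrow> val P 1 = 0"
  using val_mult[of P 1 1] by simp
lemma val_inverse: "P \<in> FP \<Longrightarrow> x \<in> F \<Longrightarrow> x \<noteq> 0 \<Longrightarrow> val P (inverse x) = - val P x"
  using val_mult[of P x "inverse x"] F_inverse by simp
lemma val_minus: "P \<in> FP \<Longrightarrow> x \<in> F \<Longrightarrow> val P (- x) = val P x"
proof (cases "x = 0")
  case False
  assume P: "P \<in> FP" and x: "x \<in> F"
  have "val P (-1) = 0" using val_mult[OF P, of "-1" "-1"] P by simp
  then show ?thesis using val_mult[OF P, of "-1" x] x False by simp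
qed auto
lemma val_power: "P \<in> FP \<Longrightarrow> x \<in> F \<Longrightarrow> x \<noteq> 0 \<Longrightarrow> val P (x ^ n) = int n * val P x"
  by (induction n) (auto simp: val_mult F_power algebra_simps)

text \<open>Factoring out the summand of smaller valuation reduces the claim to \<open>1 + z\<close>
  with \<open>z\<close> integral at \<open>P\<close>; there \<open>1 + z = d / c\<close> with
  \<open>d\<close> integral and \<open>c\<close> prime to \<open>P\<close>.\<close>

lemma val_add:
  assumes P: "P \<in> FP" and x: "x \<in> F" "x \<noteq> 0" and y: "y \<in> F" "y \<noteq> 0" and xy: "x + y \<noteq> 0"
  shows "val P (x + y) \<ge> min (val P x) (val P y)"
proof -
  have key: "val P (x + y) \<ge> val P x" if x: "x \<in> F" "x \<noteq> 0" and y: "y \<in> F" "y \<noteq> 0" and xy: "x + y \<noteq> 0"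
    and le: "val P x \<le> val P y" for x y
  proof -
    define z where "z = y / x"
    have z: "z \<in> F" "z \<noteq> 0" "1 + z \<noteq> 0" using x y xy by (auto simp: z_def F_divide field_simps)
    have "x + y = x * (1 + z)" using x by (simp add: z_def field_simps)
    then have v: "val P (x + y) = val P x + val P (1 + z)" using val_mult[OF P x, of "1+z"] z by (simp add: F_add)
    have "val P z \<ge> 0" using val_mult[OF P x z(1,2)] x le by (simp add: z_def)
    then obtain n where n: "val P z = int n" using nonneg_int_cases by blast
    obtain b c where bc: "b \<in> Oi - P" "c \<in> Oi - P" "z = ppi P powi (val P z) * b / c" using val_ex[OF P z(1,2)] by blast
    have c0: "c \<noteq> 0" using bc(2) idealD(2)[OF placeD(1)[OF P]] by auto
    define d where "d = c + ppi P ^ n * b"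
    have d: "1 + z = d / c" using bc(3) c0 n by (simp add: d_def field_simps power_int_of_nat)
    have dO: "d \<in> Oi" using bc ppi(1)[OF P] by (auto simp: d_def intro!: O_closed)
    have d0: "d \<noteq> 0" using d z by auto
    have "val P (1 + z) = val P d + val P (inverse c)" unfolding d divide_inverse
      using c0 d0 dO bc by (intro val_mult[OF P]) (auto intro: O_F F_closed)
    moreover have "val P c = 0" using val_O_nonneg[OF P, of c] bc c0 by auto
    ultimately have "val P (1 + z) = val P d" using val_inverse[OF P, of c] c0 bc O_F by auto
    then show ?thesis using v val_O_nonneg[OF P dO d0] by simp
  qed
  show ?thesis using key[OF x y xy] key[OF y x] xy by (cases "val P x \<le> val P y") (auto simp: add.commute)
qed

text \<open>If the denominator of a reduced fraction had a prime divisor, nonnegative valuation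
  there would force the numerator into the same prime, against the Bezout identity.\<close>

lemma val_all_nonneg:
  assumes x: "x \<in> F" "x \<noteq> 0" and v: "\<And>P. P \<in> FP \<Longrightarrow> val P x \<ge> 0"
  shows "x \<in> Oi"
proof -
  obtain a b s t where ab: "a \<in> Oi" "b \<in> Oi" "s \<in> Oi" "t \<in> Oi" "b \<noteq> 0" "x = a / b" "s * a + t * b = 1"
    using frac_coprime[OF x(1)] by blast
  then have a0: "a \<noteq> 0" using x by auto
  have "nrm b = 1"
  proof (rule ccontr)
    assume "nrm b \<noteq> 1"
    then obtain P where P: "P \<in> FP" "b \<in> P" using nonunit_place ab by metis
    have "val P x = val P a + val P (inverse b)" unfolding ab divide_inverse
      using a0 ab by (intro val_mult[OF P(1)]) (auto intro: O_F F_closed)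
    then have "val P a \<ge> val P b" using val_inverse[OF P(1) O_F[OF ab(2)] ab(5)] v[OF P(1)] by simp
    moreover have "val P b \<ge> 1" using val_O_nonneg[OF P(1) ab(2,5)] P by simp
    ultimately have "a \<in> P" using val_O_nonneg[OF P(1) ab(1) a0] by simp
    then have "s * a + t * b \<in> P" using P ab by (intro place_add place_mult) auto
    then show False using ab placeD(3)[OF P(1)] by simp
  qed
  then show ?thesis using nrm_1 ab O_mult by (simp add: divide_inverse)
qed

text \<open>An element that is a unit at every finite place is a global unit. This is where global
  units enter the gluing of local signs.\<close>

lemma val_all_zero:
  assumes x: "x \<in> F" "x \<noteq> 0" and v: "\<And>P. P \<in> FP \<Longrightarrow> val P x = 0"
  shows "x \<in> Oi" "nrm x = 1"
proof -
  show xO: "x \<in> Oi" using val_all_nonneg[OF x] v by simp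
  have "inverse x \<in> Oi" using val_all_nonneg[of "inverse x"] v x F_inverse val_inverse by auto
  then show "nrm x = 1" using nrm_unit[OF xO] x by simp
qed

text \<open>Nonzero primes are maximal: if \<open>ppi P = c * ppi Q\<close> and \<open>ppi Q\<close>
  were outside \<open>P\<close>, then \<open>ppi P\<close> would divide \<open>c\<close>, and
  \<open>ppi Q\<close> would be a unit.\<close>

lemma places_unique:
  assumes P: "P \<in> FP" and Q: "Q \<in> FP" and "ppi P \<in> Q"
  shows "P = Q"
proof -
  obtain c where c: "c \<in> Oi" "ppi P = c * ppi Q" using ppi(2)[OF Q] assms(3) by (metis pidE)
  have "ppi Q \<notin> P \<Longrightarrow> False"
  proof -
    assume n: "ppi Q \<notin> P"
    have "c * ppi Q \<in> P" using c(2) ppi(4)[OF P] by simp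
    then have "c \<in> P" using placeD(4)[OF P c(1) ppi(1)[OF Q]] n by blast
    then obtain d where d: "d \<in> Oi" "c = d * ppi P" using ppi(2)[OF P] by (metis pidE)
    have "ppi P * (ppi Q * d) = (d * ppi P) * ppi Q" by (simp add: mult_ac)
    also have "\<dots> = ppi P" using c(2) d(2) by metis
    finally have "ppi P * (ppi Q * d) = ppi P * 1" by simp
    then have "ppi Q * d = 1" using ppi(3)[OF P] mult_left_cancel by metis
    then show False using nrm_unit[OF ppi(1)[OF Q] d(1)] ppi(5)[OF Q] by simp
  qed
  then have "ppi Q \<in> P" by blast
  then obtain d where d: "d \<in> Oi" "ppi Q = d * ppi P" using ppi(2)[OF P] by (metis pidE)
  have "pid (ppi P) \<subseteq> pid (ppi Q)" "pid (ppi Q) \<subseteq> pid (ppi P)"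
    using pid_subset ppi(1)[OF P] ppi(1)[OF Q] c d by blast+
  then show ?thesis using ppi(2)[OF P] ppi(2)[OF Q] by simp
qed

lemma val_ppi: "P \<in> FP \<Longrightarrow> Q \<in> FP \<Longrightarrow> val Q (ppi P) = (if P = Q then 1 else 0)"
proof -
  assume P: "P \<in> FP" and Q: "Q \<in> FP"
  have "val P (ppi P) = 1" using val_O_factor[OF P, of 1 1] placeD(3)[OF P] by simp
  moreover have "val Q (ppi P) = 0" if "P \<noteq> Q"
    using places_unique[OF P Q] that val_O_nonneg[OF Q ppi(1)[OF P] ppi(3)[OF P]] by auto
  ultimately show ?thesis by auto
qed

text \<open>Dividing by the generator of one prime lowers \<open>nrm\<close> and removes at most
  that prime from the set.\<close>

lemma finite_val_O:
  assumes "a \<in> Oi" "a \<noteq> 0"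
  shows "finite {P \<in> FP. a \<in> P}"
  using assms
proof (induction "nrm a" arbitrary: a rule: less_induct)
  case less
  show ?case
  proof (cases "\<exists>P\<in>FP. a \<in> P")
    case True
    then obtain P where P: "P\<in>FP" "a \<in> P" by blast
    then obtain c where c: "c \<in> Oi" "a = c * ppi P" using ppi(2)[OF P(1)] by (metis pidE)
    then have "nrm a = nrm c * nrm (ppi P)" "c \<noteq> 0" "nrm c \<noteq> 0" using nrm_mult nrm_0 less ppi[OF P(1)] by auto
    then have "nrm c < nrm a" using ppi(5)[OF P(1)] by auto
    then have "finite {P \<in> FP. c \<in> P}" using less(1) c \<open>c \<noteq> 0\<close> by blast
    moreover have "{P \<in> FP. a \<in> P} \<subseteq> insert P {P \<in> FP. c \<in> P}"
      using placeD(4) c ppi(1)[OF P(1)] places_unique[OF P(1)] by blast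
    ultimately show ?thesis by (meson finite_insert finite_subset)
  next
    case False
    then have "{P \<in> FP. a \<in> P} = {}" by blast
    then show ?thesis by (metis finite.emptyI)
  qed
qed

lemma finite_val:
  assumes "x \<in> F" "x \<noteq> 0"
  shows "finite {P \<in> FP. val P x \<noteq> 0}"
proof -
  obtain a b where ab: "a \<in> Oi" "b \<in> Oi" "b \<noteq> 0" "x = a / b" using frac_coprime[OF assms(1)] by metis
  then have a0: "a \<noteq> 0" using assms by auto
  have "val P x = 0" if P: "P \<in> FP" "a \<notin> P" "b \<notin> P" for P
  proof -
    have "val P x = val P a + val P (inverse b)" unfolding ab divide_inverse
      using a0 ab by (intro val_mult[OF P(1)]) (auto intro: O_F F_closed)
    moreover have "val P b = 0" "val P a = 0" using val_O_nonneg[OF P(1)] ab a0 P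
      by (metis int_one_le_iff_zero_less linorder_neqE_linordered_idom not_le)+
    ultimately show ?thesis using val_inverse[OF P(1) O_F[OF ab(2)] ab(3)] by simp
  qed
  then have "{P \<in> FP. val P x \<noteq> 0} \<subseteq> {P \<in> FP. a \<in> P} \<union> {P \<in> FP. b \<in> P}"
    by blast
  then show ?thesis using finite_val_O ab a0 by (meson finite_UnI finite_subset)
qed

section \<open>Orders of ideals and of elements as valuations\<close>

lemma ord_ideal_pid:
  assumes P: "P \<in> FP" and a: "a \<in> Oi" "a \<noteq> 0"
  shows "ord_ideal F P (pid a) = nat (val P a)"
proof -
  have "ideal_dvd F (ideal_pow RR P n) (pid a) \<longleftrightarrow> n \<le> nat (val P a)" for n
  proof -
    have "ideal_pow RR P n = pid (ppi P ^ n)" using ideal_pow_pid[OF ppi(1)[OF P], of n] ppi(2)[OF P] by simp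
    then have "ideal_dvd F (ideal_pow RR P n) (pid a) \<longleftrightarrow> a \<in> pid (ppi P ^ n)"
      using ideal_dvd_pid[of "ppi P ^ n" a] a ppi(1)[OF P] O_power by (auto simp: pid_def)
    then show ?thesis using val_O_ge[OF P a, of n] val_O_nonneg(1)[OF P a] by auto
  qed
  then show ?thesis unfolding ord_ideal_def by (simp add: Greatest_equality)
qed

lemma ideal_dvd_place:
  assumes P: "P \<in> FP" and a: "a \<in> Oi"
  shows "ideal_dvd F P (pid a) \<longleftrightarrow> a \<in> P"
  using ideal_dvd_pid[OF ppi(1)[OF P] a] ppi(2)[OF P] by (auto simp: pid_def)

lemma ord_elem_val:
  assumes P: "P \<in> FP" and x: "x \<in> F" "x \<noteq> 0"
  shows "ord_elem F P x = val P x"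
proof -
  have key: "int (ord_ideal F P (PIdl\<^bsub>RR\<^esub> a)) - int (ord_ideal F P (PIdl\<^bsub>RR\<^esub> b)) = val P x"
    if "a \<in> carrier RR - {0}" "b \<in> carrier RR - {0}" "x = a / b" for a b
  proof -
    have ab: "a \<in> Oi" "a \<noteq> 0" "b \<in> Oi" "b \<noteq> 0" using that by auto
    have "val P x = val P a + val P (inverse b)" unfolding that(3) divide_inverse
      using ab by (intro val_mult[OF P]) (auto intro: O_F F_closed)
    then show ?thesis unfolding PIdl using ord_ideal_pid[OF P] ab val_inverse[OF P O_F[OF ab(3)] ab(4)]
      val_O_nonneg(1)[OF P] by simp
  qed
  obtain a b where ab: "a \<in> Oi" "b \<in> Oi" "b \<noteq> 0" "x = a / b" using frac_coprime[OF x(1)] by metis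
  then have "a \<noteq> 0" using x by auto
  show ?thesis unfolding ord_elem_def
  proof (rule the_equality)
    show "\<exists>a\<in>carrier RR - {0}. \<exists>b\<in>carrier RR - {0}. x = a / b \<and>
     val P x = int (ord_ideal F P (PIdl\<^bsub>RR\<^esub> a)) - int (ord_ideal F P (PIdl\<^bsub>RR\<^esub> b))"
      using ab \<open>a \<noteq> 0\<close> key by (intro bexI[of _ a] bexI[of _ b]) auto
  qed (use key in auto)
qed

end

section \<open>Completions\<close>

context euclid_field
begin

context
  fixes v :: place
  assumes v: "v \<in> places F"
begin

section \<open>Absolute values on the field\<close>

lemma A_0 [simp]: "absv F v 0 = 0" by (cases v) auto

lemma A_pos: "x \<in> F \<Longrightarrow> x \<noteq> 0 \<Longrightarrow> absv F v x > 0" by (cases v) auto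

lemma A_nonneg: "absv F v x \<ge> 0" by (cases v) auto

lemma v_fin: "v = fp P \<Longrightarrow> P \<in> FP" using v by (auto simp: places_def)

lemma A_mult: "x \<in> F \<Longrightarrow> y \<in> F \<Longrightarrow> absv F v (x * y) = absv F v x * absv F v y"
proof (cases v)
  case (Fin_place P)
  assume "x \<in> F" "y \<in> F"
  then show ?thesis unfolding Fin_place using v_fin[OF Fin_place]
    by (cases "x = 0 \<or> y = 0") (auto simp: ord_elem_val F_mult val_mult power_int_add[symmetric] algebra_simps)
qed (auto simp: norm_mult)

lemma A_minus: "x \<in> F \<Longrightarrow> absv F v (- x) = absv F v x"
proof (cases v)
  case (Fin_place P)
  assume "x \<in> F"
  then show ?thesis unfolding Fin_place using v_fin[OF Fin_place]
    by (cases "x = 0") (auto simp: ord_elem_val F_uminus val_minus)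
qed auto

lemma A_ultra: 
  assumes "v = fp P" "x \<in> F" "y \<in> F"
  shows "absv F v (x + y) \<le> max (absv F v x) (absv F v y)"
proof (cases "x = 0 \<or> y = 0 \<or> x + y = 0")
  case True
  then show ?thesis using A_nonneg by (auto simp: le_max_iff_disj)
next
  case False
  note P = v_fin[OF assms(1)]
  have "min (val P x) (val P y) \<le> val P (x + y)" using val_add[OF P assms(2) _ assms(3)] False by auto
  then have "val P x \<le> val P (x + y) \<or> val P y \<le> val P (x + y)" by linarith
  then have "(2::real) powi (- val P (x + y)) \<le> 2 powi (- val P x) \<or> (2::real) powi (- val P (x + y)) \<le> 2 powi (- val P y)"
    by (auto intro!: power_int_increasing)
  then show ?thesis using False assms P F_add by (auto simp: ord_elem_val le_max_iff_disj)
qed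

lemma A_triangle: "x \<in> F \<Longrightarrow> y \<in> F \<Longrightarrow> absv F v (x + y) \<le> absv F v x + absv F v y"
proof (cases v)
  case (Fin_place P)
  assume "x \<in> F" "y \<in> F"
  then show ?thesis using A_ultra[OF Fin_place, of x y] A_nonneg[of x] A_nonneg[of y] by auto
qed (auto simp: norm_triangle_ineq)

lemma A_diff_comm: "x \<in> F \<Longrightarrow> y \<in> F \<Longrightarrow> absv F v (x - y) = absv F v (y - x)"
  using A_minus[of "x - y"] F_diff by simp

lemma A_1 [simp]: "absv F v 1 = 1"
  using A_mult[of 1 1] A_pos[of 1] by simp

lemma A_inverse: "x \<in> F \<Longrightarrow> absv F v (inverse x) = inverse (absv F v x)"
proof (cases "x = 0")
  case False
  assume x: "x \<in> F"
  have "absv F v x * absv F v (inverse x) = 1" using A_mult[OF x F_inverse[OF x]] False by simp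
  then show ?thesis by (metis inverse_unique)
qed simp

lemma A_rev: "x \<in> F \<Longrightarrow> y \<in> F \<Longrightarrow> \<bar>absv F v x - absv F v y\<bar> \<le> absv F v (x - y)"
  using A_triangle[of "x - y" y] A_triangle[of "y - x" x] A_diff_comm[of x y] F_diff by auto

section \<open>Cauchy sequences and null sequences\<close>

abbreviation "C \<equiv> cauchy_ring F v"
abbreviation "N \<equiv> null_seqs F v"
abbreviation "K \<equiv> completion F v"

lemma C_iff: "s \<in> carrier C \<longleftrightarrow> range s \<subseteq> F \<and> (\<forall>e>0. \<exists>N. \<forall>m\<ge>N. \<forall>n\<ge>N. absv F v (s m - s n) < e)"
  by (simp add: cauchy_ring_def)
lemma C_ops [simp]: "s \<otimes>\<^bsub>C\<^esub> t = (\<lambda>n. s n * t n)" "s \<oplus>\<^bsub>C\<^esub> t = (\<lambda>n. s n + t n)"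
  "\<one>\<^bsub>C\<^esub> = (\<lambda>_. 1)" "\<zero>\<^bsub>C\<^esub> = (\<lambda>_. 0)"
  by (simp_all add: cauchy_ring_def)
lemma C_F: "s \<in> carrier C \<Longrightarrow> s n \<in> F" by (auto simp: C_iff)
lemma C_D: "s \<in> carrier C \<Longrightarrow> e > 0 \<Longrightarrow> \<exists>N. \<forall>m\<ge>N. \<forall>n\<ge>N. absv F v (s m - s n) < e" by (auto simp: C_iff)
lemma C_I: "(\<And>n. s n \<in> F) \<Longrightarrow> (\<And>e. e > 0 \<Longrightarrow> \<exists>N. \<forall>m\<ge>N. \<forall>n\<ge>N. absv F v (s m - s n) < e) \<Longrightarrow> s \<in> carrier C"
  by (auto simp: C_iff)

lemma C_bounded: assumes s: "s \<in> carrier C" obtains B where "B > 0" "\<And>n. absv F v (s n) \<le> B"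
proof -
  obtain N where N: "\<And>m n. m \<ge> N \<Longrightarrow> n \<ge> N \<Longrightarrow> absv F v (s m - s n) < 1" using C_D[OF s, of 1] by auto
  define B where "B = 1 + absv F v (s N) + (\<Sum>i<N. absv F v (s i))"
  have "absv F v (s n) \<le> B" for n
  proof (cases "n < N")
    case True
    then have "absv F v (s n) \<le> (\<Sum>i<N. absv F v (s i))" by (intro member_le_sum) (auto simp: A_nonneg)
    then show ?thesis using A_nonneg[of "s N"] by (simp add: B_def)
  next
    case False
    then have "absv F v (s n) \<le> absv F v (s n - s N) + absv F v (s N)"
      using A_triangle[of "s n - s N" "s N"] C_F[OF s] F_diff by simp
    moreover have "absv F v (s n - s N) < 1" using N False by simp
    ultimately show ?thesis using sum_nonneg[of "{..<N}" "\<lambda>i. absv F v (s i)"] A_nonneg by (simp add: B_def)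
  qed
  moreover have "B > 0" using A_nonneg sum_nonneg[of "{..<N}" "\<lambda>i. absv F v (s i)"] by (simp add: B_def add_pos_nonneg)
  ultimately show thesis using that by blast
qed

lemma C_const: "a \<in> F \<Longrightarrow> (\<lambda>_. a) \<in> carrier C"
  by (rule C_I) auto

lemma C_add: assumes "s \<in> carrier C" "t \<in> carrier C" shows "(\<lambda>n. s n + t n) \<in> carrier C"
proof (rule C_I)
  show "s n + t n \<in> F" for n using C_F assms F_add by auto
  fix e :: real assume e: "e > 0"
  obtain N1 where N1: "\<And>m n. m \<ge> N1 \<Longrightarrow> n \<ge> N1 \<Longrightarrow> absv F v (s m - s n) < e/2" using C_D[OF assms(1), of "e/2"] e by auto
  obtain N2 where N2: "\<And>m n. m \<ge> N2 \<Longrightarrow> n \<ge> N2 \<Longrightarrow> absv F v (t m - t n) < e/2" using C_D[OF assms(2), of "e/2"] e by auto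
  have "absv F v (s m + t m - (s n + t n)) < e" if "m \<ge> max N1 N2" "n \<ge> max N1 N2" for m n
  proof -
    have "absv F v (s m + t m - (s n + t n)) = absv F v ((s m - s n) + (t m - t n))" by (simp add: algebra_simps)
    also have "\<dots> \<le> absv F v (s m - s n) + absv F v (t m - t n)"
      by (rule A_triangle) (use C_F assms F_diff in auto)
    also have "\<dots> < e" using N1[of m n] N2[of m n] that by simp
    finally show ?thesis .
  qed
  then show "\<exists>N. \<forall>m\<ge>N. \<forall>n\<ge>N. absv F v (s m + t m - (s n + t n)) < e" by blast
qed

lemma C_mult: assumes "s \<in> carrier C" "t \<in> carrier C" shows "(\<lambda>n. s n * t n) \<in> carrier C"
proof (rule C_I)
  show "s n * t n \<in> F" for n using C_F assms F_mult by auto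
  fix e :: real assume e: "e > 0"
  obtain B1 where B1: "B1 > 0" "\<And>n. absv F v (s n) \<le> B1" using C_bounded[OF assms(1)] by blast
  obtain B2 where B2: "B2 > 0" "\<And>n. absv F v (t n) \<le> B2" using C_bounded[OF assms(2)] by blast
  obtain N1 where N1: "\<And>m n. m \<ge> N1 \<Longrightarrow> n \<ge> N1 \<Longrightarrow> absv F v (s m - s n) < e/2/B2" using C_D[OF assms(1), of "e/2/B2"] e B2 by auto
  obtain N2 where N2: "\<And>m n. m \<ge> N2 \<Longrightarrow> n \<ge> N2 \<Longrightarrow> absv F v (t m - t n) < e/2/B1" using C_D[OF assms(2), of "e/2/B1"] e B1 by auto
  have "absv F v (s m * t m - (s n * t n)) < e" if "m \<ge> max N1 N2" "n \<ge> max N1 N2" for m n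
  proof -
    have "absv F v (s m * t m - (s n * t n)) = absv F v (s m * (t m - t n) + (s m - s n) * t n)" by (simp add: algebra_simps)
    also have "\<dots> \<le> absv F v (s m * (t m - t n)) + absv F v ((s m - s n) * t n)"
      by (rule A_triangle) (use C_F assms F_diff F_mult in auto)
    also have "\<dots> = absv F v (s m) * absv F v (t m - t n) + absv F v (s m - s n) * absv F v (t n)"
      using C_F assms F_diff by (simp add: A_mult)
    also have "\<dots> \<le> B1 * absv F v (t m - t n) + absv F v (s m - s n) * B2"
      by (intro add_mono mult_right_mono mult_left_mono) (auto simp: B1 B2 A_nonneg)
    also have "\<dots> < B1 * (e/2/B1) + (e/2/B2) * B2" using N1[of m n] N2[of m n] that B1 B2
      by (intro add_strict_mono mult_strict_left_mono mult_strict_right_mono) auto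
    also have "\<dots> = e" using B1 B2 by simp
    finally show ?thesis .
  qed
  then show "\<exists>N. \<forall>m\<ge>N. \<forall>n\<ge>N. absv F v (s m * t m - (s n * t n)) < e" by blast
qed

lemma C_uminus: assumes "s \<in> carrier C" shows "(\<lambda>n. - s n) \<in> carrier C"
  using C_mult[OF C_const[of "-1"] assms] by simp

lemma C_diff: assumes "s \<in> carrier C" "t \<in> carrier C" shows "(\<lambda>n. s n - t n) \<in> carrier C"
  using C_add[OF assms(1) C_uminus[OF assms(2)]] by simp

lemmas C_closed = C_add C_mult C_uminus C_diff C_const

lemma C_cring: "cring C"
proof (rule cringI)
  show "abelian_group C"
  proof (rule abelian_groupI)
    fix x assume "x \<in> carrier C"
    then show "\<exists>y\<in>carrier C. y \<oplus>\<^bsub>C\<^esub> x = \<zero>\<^bsub>C\<^esub>" by (intro bexI[of _ "\<lambda>n. - x n"]) (auto intro: C_closed)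
  qed (auto intro!: C_closed simp: algebra_simps)
  show "comm_monoid C" by (rule comm_monoidI) (auto intro!: C_closed simp: algebra_simps)
qed (auto simp: algebra_simps)

lemma N_iff: "s \<in> N \<longleftrightarrow> s \<in> carrier C \<and> (\<lambda>n. absv F v (s n)) \<longlonglongrightarrow> 0"
  by (simp add: null_seqs_def)

lemma N_add: assumes "s \<in> N" "t \<in> N" shows "(\<lambda>n. s n + t n) \<in> N"
  unfolding N_iff
proof
  have st: "s \<in> carrier C" "t \<in> carrier C" using assms by (auto simp: N_iff)
  then show "(\<lambda>n. s n + t n) \<in> carrier C" by (rule C_add)
  show "(\<lambda>n. absv F v (s n + t n)) \<longlonglongrightarrow> 0"
  proof (rule tendsto_sandwich[of "\<lambda>_. 0"])
    show "(\<lambda>n. absv F v (s n) + absv F v (t n)) \<longlonglongrightarrow> 0"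
      using assms tendsto_add[of "\<lambda>n. absv F v (s n)" 0 _ "\<lambda>n. absv F v (t n)" 0] by (simp add: N_iff)
  qed (auto simp: A_nonneg intro!: always_eventually A_triangle C_F st)
qed

lemma N_mult: assumes s: "s \<in> carrier C" and t: "t \<in> N" shows "(\<lambda>n. s n * t n) \<in> N"
  unfolding N_iff
proof
  have st: "t \<in> carrier C" using t by (auto simp: N_iff)
  then show "(\<lambda>n. s n * t n) \<in> carrier C" using C_mult s by blast
  obtain B where B: "B > 0" "\<And>n. absv F v (s n) \<le> B" using C_bounded[OF s] by blast
  show "(\<lambda>n. absv F v (s n * t n)) \<longlonglongrightarrow> 0"
  proof (rule tendsto_sandwich[of "\<lambda>_. 0"])
    show "(\<lambda>n. B * absv F v (t n)) \<longlonglongrightarrow> 0"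
      using t tendsto_mult_left[of "\<lambda>n. absv F v (t n)" 0 _ B] by (simp add: N_iff)
    show "\<forall>\<^sub>F n in sequentially. absv F v (s n * t n) \<le> B * absv F v (t n)"
      using B C_F s st by (intro always_eventually allI) (simp add: A_mult A_nonneg mult_right_mono)
  qed (auto simp: A_nonneg)
qed

lemma N_zero: "(\<lambda>_. 0) \<in> N" by (simp add: N_iff C_const)
lemma N_sub: "N \<subseteq> carrier C" by (auto simp: N_iff)
lemma N_uminus: "s \<in> N \<Longrightarrow> (\<lambda>n. - s n) \<in> N" using N_mult[OF C_const[of "-1"]] by simp

lemma C_a_inv: "s \<in> carrier C \<Longrightarrow> \<ominus>\<^bsub>C\<^esub> s = (\<lambda>n. - s n)"
proof -
  assume s: "s \<in> carrier C"
  interpret cring C by (rule C_cring)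
  show ?thesis using minus_equality[of "\<lambda>n. - s n" s] s by (auto intro: C_closed)
qed

lemma N_ideal: "ideal N C"
proof (rule idealI)
  interpret cring C by (rule C_cring)
  show "ring C" by (rule ring_axioms)
  show "subgroup N (add_monoid C)"
  proof
    fix x assume "x \<in> N"
    then have "\<ominus>\<^bsub>C\<^esub> x \<in> N" using C_a_inv N_sub N_uminus by auto
    then show "inv\<^bsub>add_monoid C\<^esub> x \<in> N" by (simp add: a_inv_def)
  qed (use N_sub N_zero N_add in auto)
  fix a x assume "a \<in> N" "x \<in> carrier C"
  then show "x \<otimes>\<^bsub>C\<^esub> a \<in> N" "a \<otimes>\<^bsub>C\<^esub> x \<in> N" using N_mult[of x a] by (auto simp: mult.commute)
qed

section \<open>Elements of the completion as classes of Cauchy sequences\<close>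

definition cl :: "(nat \<Rightarrow> complex) \<Rightarrow> (nat \<Rightarrow> complex) set" where
  "cl s = N +>\<^bsub>C\<^esub> s"

lemma embed_cl: "embed F v a = cl (\<lambda>_. a)" by (simp add: embed_def cl_def)

lemma cl_set: "s \<in> carrier C \<Longrightarrow> cl s = {t \<in> carrier C. (\<lambda>n. t n - s n) \<in> N}"
proof -
  assume s: "s \<in> carrier C"
  have "cl s = {\<lambda>n. h n + s n | h. h \<in> N}" by (auto simp: cl_def a_r_coset_def')
  also have "\<dots> = {t \<in> carrier C. (\<lambda>n. t n - s n) \<in> N}"
  proof safe
    fix h assume "h \<in> N" then show "(\<lambda>n. h n + s n) \<in> carrier C" "(\<lambda>n. h n + s n - s n) \<in> N" 
      using N_sub s C_add by auto
  next
    fix t assume t: "(\<lambda>n. t n - s n) \<in> N"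
    show "\<exists>h. t = (\<lambda>n. h n + s n) \<and> h \<in> N" by (intro exI[of _ "\<lambda>n. t n - s n"]) (use t in auto)
  qed
  finally show ?thesis .
qed

lemma cl_self: "s \<in> carrier C \<Longrightarrow> s \<in> cl s" using N_zero by (simp add: cl_set)

lemma K_ops: "\<one>\<^bsub>K\<^esub> = cl (\<lambda>_. 1)" "\<zero>\<^bsub>K\<^esub> = N" "carrier K = cl ` carrier C"
  by (auto simp: completion_def FactRing_simps cl_def a_r_coset_def)

lemma K_cring: "cring K"
  unfolding completion_def by (rule ideal.quotient_is_cring[OF N_ideal C_cring])

lemma cl_mult: "s \<in> carrier C \<Longrightarrow> t \<in> carrier C \<Longrightarrow> cl s \<otimes>\<^bsub>K\<^esub> cl t = cl (\<lambda>n. s n * t n)"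
  using ideal.rcoset_mult_add[OF N_ideal, of s t] by (simp add: completion_def FactRing_def cl_def)

lemma cl_add: "s \<in> carrier C \<Longrightarrow> t \<in> carrier C \<Longrightarrow> cl s \<oplus>\<^bsub>K\<^esub> cl t = cl (\<lambda>n. s n + t n)"
proof -
  assume "s \<in> carrier C" "t \<in> carrier C"
  interpret ideal N C by (rule N_ideal)
  show ?thesis using a_rcos_sum[of s t] \<open>s \<in> carrier C\<close> \<open>t \<in> carrier C\<close> by (simp add: completion_def FactRing_def cl_def)
qed

lemma cl_eq: "s \<in> carrier C \<Longrightarrow> t \<in> carrier C \<Longrightarrow> cl s = cl t \<longleftrightarrow> (\<lambda>n. s n - t n) \<in> N"
proof
  assume st: "s \<in> carrier C" "t \<in> carrier C"
  { assume "cl s = cl t" then have "s \<in> cl t" using cl_self st by auto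
    then show "(\<lambda>n. s n - t n) \<in> N" using cl_set st by auto }
  assume *: "(\<lambda>n. s n - t n) \<in> N"
  show "cl s = cl t" unfolding cl_set[OF st(1)] cl_set[OF st(2)]
  proof safe
    fix r assume "(\<lambda>n. r n - s n) \<in> N" then show "(\<lambda>n. r n - t n) \<in> N" using N_add[OF _ *] by fastforce
  next
    fix r assume "(\<lambda>n. r n - t n) \<in> N" then show "(\<lambda>n. r n - s n) \<in> N" using N_add[OF _ N_uminus[OF *]] by fastforce
  qed
qed

lemma cl_zero: "cl (\<lambda>_. 0) = \<zero>\<^bsub>K\<^esub>"
  using cl_set[OF C_const[of 0]] N_sub by (auto simp: K_ops)

lemma cl_N: "s \<in> carrier C \<Longrightarrow> cl s = \<zero>\<^bsub>K\<^esub> \<longleftrightarrow> s \<in> N"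
  using cl_eq[of s "\<lambda>_. 0"] C_const[of 0] by (simp add: cl_zero)

lemma cl_carrier: "s \<in> carrier C \<Longrightarrow> cl s \<in> carrier K" by (auto simp: K_ops)

lemma K_cases: assumes "X \<in> carrier K" obtains s where "s \<in> carrier C" "X = cl s" "s \<in> X"
  using assms cl_self by (auto simp: K_ops)

lemma mem_cl: assumes "X \<in> carrier K" "s \<in> X" shows "s \<in> carrier C" "X = cl s"
proof -
  obtain t where t: "t \<in> carrier C" "X = cl t" using K_cases assms by blast
  then show "s \<in> carrier C" using assms cl_set by auto
  then show "X = cl s" using t assms cl_set[OF t(1)] cl_eq[of s t] by auto
qed

lemma cl_minus: "s \<in> carrier C \<Longrightarrow> t \<in> carrier C \<Longrightarrow> cl s \<ominus>\<^bsub>K\<^esub> cl t = cl (\<lambda>n. s n - t n)"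
proof -
  assume st: "s \<in> carrier C" "t \<in> carrier C"
  interpret cring K by (rule K_cring)
  have "cl (\<lambda>n. - t n) \<oplus>\<^bsub>K\<^esub> cl t = \<zero>\<^bsub>K\<^esub>" using st by (simp add: cl_add C_closed cl_zero)
  then have "\<ominus>\<^bsub>K\<^esub> cl t = cl (\<lambda>n. - t n)" using st by (intro minus_equality) (auto intro: cl_carrier C_closed)
  then show ?thesis using st by (simp add: a_minus_def cl_add C_closed)
qed

text \<open>The absolute values of a Cauchy sequence converge by the reverse triangle inequality,
  and adding a null sequence does not move the limit. So the definite description in
  \<open>completion_abs\<close> does denote a number.\<close>

lemma cabs_lim: assumes s: "s \<in> carrier C" shows "(\<lambda>n. absv F v (s n)) \<longlonglongrightarrow> cabs v (cl s)"
proof -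
  have "Cauchy (\<lambda>n. absv F v (s n))"
  proof (rule metric_CauchyI)
    fix e :: real assume "e > 0"
    then obtain N where N: "\<And>m n. m \<ge> N \<Longrightarrow> n \<ge> N \<Longrightarrow> absv F v (s m - s n) < e" using C_D[OF s] by blast
    have "dist (absv F v (s m)) (absv F v (s n)) < e" if "m \<ge> N" "n \<ge> N" for m n
      using N[OF that] A_rev[OF C_F[OF s] C_F[OF s], of m n] by (simp add: dist_real_def)
    then show "\<exists>M. \<forall>m\<ge>M. \<forall>n\<ge>M. dist (absv F v (s m)) (absv F v (s n)) < e" by blast
  qed
  then obtain L where L: "(\<lambda>n. absv F v (s n)) \<longlonglongrightarrow> L" using real_Cauchy_convergent convergent_def by blast
  have all: "(\<lambda>n. absv F v (t n)) \<longlonglongrightarrow> L" if "t \<in> cl s" for t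
  proof -
    have t: "t \<in> carrier C" "(\<lambda>n. t n - s n) \<in> N" using that cl_set[OF s] by auto
    have "(\<lambda>n. absv F v (t n) - absv F v (s n)) \<longlonglongrightarrow> 0"
    proof (rule Lim_null_comparison)
      show "(\<lambda>n. absv F v (t n - s n)) \<longlonglongrightarrow> 0" using t by (simp add: N_iff)
    qed (auto intro!: always_eventually A_rev C_F t s)
    then have "(\<lambda>n. (absv F v (t n) - absv F v (s n)) + absv F v (s n)) \<longlonglongrightarrow> 0 + L" using L by (intro tendsto_add)
    then show ?thesis by simp
  qed
  have "cabs v (cl s) = L" unfolding completion_abs_def
  proof (rule the_equality)
    show "\<forall>t\<in>cl s. (\<lambda>n. absv F v (t n)) \<longlonglongrightarrow> L" using all by blast
    fix r assume "\<forall>t\<in>cl s. (\<lambda>n. absv F v (t n)) \<longlonglongrightarrow> r"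
    then show "r = L" using cl_self[OF s] L LIMSEQ_unique by blast
  qed
  then show ?thesis using L by simp
qed

lemma cabs_eqI: "s \<in> carrier C \<Longrightarrow> (\<lambda>n. absv F v (s n)) \<longlonglongrightarrow> r \<Longrightarrow> cabs v (cl s) = r"
  using cabs_lim LIMSEQ_unique by blast

lemma cabs_nonneg: "X \<in> carrier K \<Longrightarrow> cabs v X \<ge> 0"
  by (erule K_cases) (auto intro!: LIMSEQ_le_const[OF cabs_lim] A_nonneg)

lemma cabs_0_iff: "X \<in> carrier K \<Longrightarrow> cabs v X = 0 \<longleftrightarrow> X = \<zero>\<^bsub>K\<^esub>"
proof (erule K_cases)
  fix s assume s: "s \<in> carrier C" "X = cl s"
  show ?thesis using s cl_N[OF s(1)] cabs_lim[OF s(1)] cabs_eqI[OF s(1), of 0] by (auto simp: N_iff)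
qed

lemma cabs_embed: "a \<in> F \<Longrightarrow> cabs v (embed F v a) = absv F v a"
  unfolding embed_cl by (intro cabs_eqI C_const) auto

lemma cabs_mult: assumes "X \<in> carrier K" "Y \<in> carrier K"
  shows "cabs v (X \<otimes>\<^bsub>K\<^esub> Y) = cabs v X * cabs v Y"
proof -
  obtain s t where st: "s \<in> carrier C" "X = cl s" "t \<in> carrier C" "Y = cl t" using assms K_cases by metis
  have "(\<lambda>n. absv F v (s n * t n)) \<longlonglongrightarrow> cabs v X * cabs v Y"
    using tendsto_mult[OF cabs_lim[OF st(1)] cabs_lim[OF st(3)]] st C_F by (simp add: A_mult)
  then show ?thesis using st by (simp add: cl_mult cabs_eqI C_closed)
qed

lemma cabs_add: assumes "X \<in> carrier K" "Y \<in> carrier K"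
  shows "cabs v (X \<oplus>\<^bsub>K\<^esub> Y) \<le> cabs v X + cabs v Y"
proof -
  obtain s t where st: "s \<in> carrier C" "X = cl s" "t \<in> carrier C" "Y = cl t" using assms K_cases by metis
  have "cabs v (cl (\<lambda>n. s n + t n)) \<le> cabs v X + cabs v Y"
    by (rule LIMSEQ_le[OF cabs_lim[OF C_add[OF st(1,3)]]]) 
      (use tendsto_add[OF cabs_lim[OF st(1)] cabs_lim[OF st(3)]] st A_triangle C_F in auto)
  then show ?thesis using st by (simp add: cl_add)
qed

lemma cabs_ultra: assumes "v = fp P" "X \<in> carrier K" "Y \<in> carrier K"
  shows "cabs v (X \<oplus>\<^bsub>K\<^esub> Y) \<le> max (cabs v X) (cabs v Y)"
proof -
  obtain s t where st: "s \<in> carrier C" "X = cl s" "t \<in> carrier C" "Y = cl t" using assms K_cases by metis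
  have "cabs v (cl (\<lambda>n. s n + t n)) \<le> max (cabs v X) (cabs v Y)"
    by (rule LIMSEQ_le[OF cabs_lim[OF C_add[OF st(1,3)]]]) 
      (use tendsto_max[OF cabs_lim[OF st(1)] cabs_lim[OF st(3)]] st A_ultra[OF assms(1)] C_F in auto)
  then show ?thesis using st by (simp add: cl_add)
qed

lemma cabs_uminus: "X \<in> carrier K \<Longrightarrow> cabs v (\<ominus>\<^bsub>K\<^esub> X) = cabs v X"
proof (erule K_cases)
  fix s assume s: "s \<in> carrier C" "X = cl s"
  interpret cring K by (rule K_cring)
  have "\<ominus>\<^bsub>K\<^esub> X = \<zero>\<^bsub>K\<^esub> \<ominus>\<^bsub>K\<^esub> X" using s by (simp add: a_minus_def cl_carrier)
  also have "\<dots> = cl (\<lambda>n. - s n)" using s cl_minus[of "\<lambda>_. 0" s] by (simp add: cl_zero C_const)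
  finally have e: "\<ominus>\<^bsub>K\<^esub> X = cl (\<lambda>n. - s n)" .
  have "(\<lambda>n. absv F v (- s n)) \<longlonglongrightarrow> cabs v X" using cabs_lim[OF s(1)] s C_F by (simp add: A_minus)
  then show ?thesis using e s cabs_eqI C_uminus by simp
qed

lemma cabs_diff_comm: "X \<in> carrier K \<Longrightarrow> Y \<in> carrier K \<Longrightarrow>
  cabs v (X \<ominus>\<^bsub>K\<^esub> Y) = cabs v (Y \<ominus>\<^bsub>K\<^esub> X)"
proof -
  interpret cring K by (rule K_cring)
  assume XY: "X \<in> carrier K" "Y \<in> carrier K"
  have "\<ominus>\<^bsub>K\<^esub> (X \<ominus>\<^bsub>K\<^esub> Y) = Y \<ominus>\<^bsub>K\<^esub> X" using XY by (simp add: a_minus_def minus_add a_comm)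
  then show ?thesis using cabs_uminus[of "X \<ominus>\<^bsub>K\<^esub> Y"] XY by simp
qed

section \<open>Metric, topology and units of the completion\<close>

lemma K_metric: "Metric_space (carrier K) (completion_dist F v)"
proof
  interpret cring K by (rule K_cring)
  show "0 \<le> completion_dist F v x y" for x y by (auto simp: completion_dist_def intro!: cabs_nonneg)
  show "completion_dist F v x y = completion_dist F v y x" for x y by (auto simp: completion_dist_def intro!: cabs_diff_comm)
  show "completion_dist F v x y = 0 \<longleftrightarrow> x = y" if "x \<in> carrier K" "y \<in> carrier K" for x y
    using that cabs_0_iff[of "x \<ominus>\<^bsub>K\<^esub> y"] by (simp add: completion_dist_def)
  show "completion_dist F v x z \<le> completion_dist F v x y + completion_dist F v y z"
    if "x \<in> carrier K" "y \<in> carrier K" "z \<in> carrier K" for x y z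
  proof -
    have "x \<ominus>\<^bsub>K\<^esub> z = (x \<ominus>\<^bsub>K\<^esub> y) \<oplus>\<^bsub>K\<^esub> (y \<ominus>\<^bsub>K\<^esub> z)" using that by (simp add: a_minus_def a_assoc r_neg1)
    then show ?thesis using cabs_add[of "x \<ominus>\<^bsub>K\<^esub> y" "y \<ominus>\<^bsub>K\<^esub> z"] that by (simp add: completion_dist_def)
  qed
qed

lemma topspace_K [simp]: "topspace (completion_topology F v) = carrier K"
  unfolding completion_topology_def using Metric_space.topspace_mtopology[OF K_metric] .

lemma openin_K: "openin (completion_topology F v) V \<longleftrightarrow>
  V \<subseteq> carrier K \<and> (\<forall>X\<in>V. \<exists>e>0. \<forall>Y\<in>carrier K. cabs v (Y \<ominus>\<^bsub>K\<^esub> X) < e \<longrightarrow> Y \<in> V)"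
proof -
  have "X \<in> V \<Longrightarrow> V \<subseteq> carrier K \<Longrightarrow> Metric_space.mball (carrier K) (completion_dist F v) X e \<subseteq> V \<longleftrightarrow>
    (\<forall>Y\<in>carrier K. cabs v (Y \<ominus>\<^bsub>K\<^esub> X) < e \<longrightarrow> Y \<in> V)" for X e
    unfolding Metric_space.mball_def[OF K_metric] using cabs_diff_comm
    by (auto simp: completion_dist_def subset_iff)
  then show ?thesis unfolding completion_topology_def Metric_space.openin_mtopology[OF K_metric]
    by (metis (no_types, lifting))
qed

text \<open>A Cauchy sequence that is not null eventually stays above half the limit of its absolute
  values, so its termwise inverse is again Cauchy.\<close>

lemma cl_inverse: assumes s: "s \<in> carrier C" "s \<notin> N"
  shows "(\<lambda>n. inverse (s n)) \<in> carrier C" "cl s \<otimes>\<^bsub>K\<^esub> cl (\<lambda>n. inverse (s n)) = \<one>\<^bsub>K\<^esub>"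
proof -
  define L where "L = cabs v (cl s)"
  have L0: "L > 0" using cabs_nonneg[OF cl_carrier[OF s(1)]] cabs_0_iff[OF cl_carrier[OF s(1)]] cl_N[OF s(1)] s(2)
    by (auto simp: L_def)
  have "\<forall>\<^sub>F n in sequentially. absv F v (s n) > L/2"
    using order_tendstoD(1)[OF cabs_lim[OF s(1)], of "L/2"] L0 by (simp add: L_def)
  then obtain N0 where N0: "\<And>n. n \<ge> N0 \<Longrightarrow> absv F v (s n) > L/2" by (auto simp: eventually_sequentially)
  have nz: "s n \<noteq> 0" if "n \<ge> N0" for n using N0[OF that] L0 by auto
  show inv: "(\<lambda>n. inverse (s n)) \<in> carrier C"
  proof (rule C_I)
    \<comment> \<open>Finitely many terms may be 0; there \<open>inverse 0 = 0\<close> keeps the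
      sequence inside \<open>F\<close>.\<close>
    show "inverse (s n) \<in> F" for n using C_F s F_inverse by auto
    fix e :: real assume e: "e > 0"
    then obtain N1 where N1: "\<And>m n. m \<ge> N1 \<Longrightarrow> n \<ge> N1 \<Longrightarrow> absv F v (s m - s n) < e * (L/2 * (L/2))"
      using C_D[OF s(1), of "e * (L/2 * (L/2))"] L0 by auto
    have "absv F v (inverse (s m) - inverse (s n)) < e" if mn: "m \<ge> max N0 N1" "n \<ge> max N0 N1" for m n
    proof -
      have FF: "s m \<in> F" "s n \<in> F" "inverse (s m) \<in> F" "inverse (s n) \<in> F" using C_F s F_inverse by auto
      have z: "s m \<noteq> 0" "s n \<noteq> 0" using nz mn by auto
      have "inverse (s m) - inverse (s n) = (s n - s m) * (inverse (s m) * inverse (s n))"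
        using z by (simp add: field_simps)
      then have "absv F v (inverse (s m) - inverse (s n)) = absv F v (s n - s m) * (inverse (absv F v (s m)) * inverse (absv F v (s n)))"
        using FF by (simp add: A_mult F_mult F_diff A_inverse)
      also have "\<dots> = absv F v (s n - s m) / (absv F v (s m) * absv F v (s n))" by (simp add: divide_inverse)
      also have "\<dots> < e"
      proof -
        have "L/2 * (L/2) < absv F v (s m) * absv F v (s n)" using N0[of m] N0[of n] mn L0
          by (intro mult_strict_mono) auto
        then have "e * (L/2 * (L/2)) < e * (absv F v (s m) * absv F v (s n))" using e by simp
        then have "absv F v (s n - s m) < e * (absv F v (s m) * absv F v (s n))" using N1[of n m] mn by simp
        then show ?thesis using A_pos FF z by (subst pos_divide_less_eq) auto
      qed
      finally show ?thesis .
    qed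
    then show "\<exists>N. \<forall>m\<ge>N. \<forall>n\<ge>N. absv F v (inverse (s m) - inverse (s n)) < e" by blast
  qed
  have c: "(\<lambda>n. s n * inverse (s n)) \<in> carrier C" "(\<lambda>_. 1) \<in> carrier C"
    using C_mult s inv C_const by auto
  have "\<forall>\<^sub>F n in sequentially. absv F v (s n * inverse (s n) - 1) = 0"
    unfolding eventually_sequentially by (rule exI[of _ N0]) (use nz in auto)
  then have "(\<lambda>n. s n * inverse (s n) - 1) \<in> N" unfolding N_iff
    by (intro conjI C_diff[OF c] tendsto_eventually)
  then have "cl (\<lambda>n. s n * inverse (s n)) = cl (\<lambda>_. 1)" using cl_eq[OF c] by blast
  then show "cl s \<otimes>\<^bsub>K\<^esub> cl (\<lambda>n. inverse (s n)) = \<one>\<^bsub>K\<^esub>" using cl_mult[OF s(1) inv] by (simp add: K_ops)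
qed

lemma one_zero: "\<one>\<^bsub>K\<^esub> \<noteq> \<zero>\<^bsub>K\<^esub>"
proof -
  have "(\<lambda>_. 1) \<notin> N" by (simp add: N_iff LIMSEQ_const_iff)
  then show ?thesis using cl_N[OF C_const[of 1]] by (simp add: K_ops)
qed

lemma K_units: "KU v = carrier K - {\<zero>\<^bsub>K\<^esub>}"
proof
  interpret cring K by (rule K_cring)
  show "KU v \<subseteq> carrier K - {\<zero>\<^bsub>K\<^esub>}"
    using one_zero by (auto simp: Units_def)
  show "carrier K - {\<zero>\<^bsub>K\<^esub>} \<subseteq> KU v"
  proof
    fix X assume X: "X \<in> carrier K - {\<zero>\<^bsub>K\<^esub>}"
    then obtain s where s: "s \<in> carrier C" "X = cl s" using K_cases by blast
    then have "s \<notin> N" using cl_N X by auto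
    define Y where "Y = cl (\<lambda>n. inverse (s n))"
    have Y: "Y \<in> carrier K" "X \<otimes>\<^bsub>K\<^esub> Y = \<one>\<^bsub>K\<^esub>"
      using cl_inverse[OF s(1) \<open>s \<notin> N\<close>] cl_carrier s(2) by (simp_all add: Y_def)
    then have "Y \<otimes>\<^bsub>K\<^esub> X = \<one>\<^bsub>K\<^esub>" using m_comm X by auto
    then show "X \<in> KU v" using X Y unfolding Units_def by blast
  qed
qed

lemma units_cases: assumes "X \<in> KU v" obtains s where "s \<in> carrier C" "X = cl s" "s \<in> X" "s \<notin> N"
proof -
  have X: "X \<in> carrier K" "X \<noteq> \<zero>\<^bsub>K\<^esub>" using assms by (auto simp: K_units)
  obtain s where "s \<in> carrier C" "X = cl s" "s \<in> X" using K_cases[OF X(1)] by blast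
  then show thesis using that[of s] X(2) cl_N[of s] by simp
qed

lemma cl_units: "s \<in> carrier C \<Longrightarrow> s \<notin> N \<Longrightarrow> cl s \<in> KU v"
  unfolding K_units using cl_carrier cl_N by auto

lemma embed_carrier: "a \<in> F \<Longrightarrow> embed F v a \<in> carrier K"
  unfolding embed_cl by (intro cl_carrier C_const)

lemma embed_units: "a \<in> F \<Longrightarrow> a \<noteq> 0 \<Longrightarrow> embed F v a \<in> KU v"
  unfolding embed_cl by (intro cl_units C_const) (auto simp: N_iff LIMSEQ_const_iff dest: A_pos)

lemma embed_mult: "a \<in> F \<Longrightarrow> b \<in> F \<Longrightarrow> embed F v a \<otimes>\<^bsub>K\<^esub> embed F v b = embed F v (a * b)"
  unfolding embed_cl by (simp add: cl_mult C_const)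

lemma embed_one: "embed F v 1 = \<one>\<^bsub>K\<^esub>"
  by (simp add: embed_cl K_ops)

lemma open_units: "openin (subtopology (completion_topology F v) (KU v)) (KU v)"
proof -
  have "KU v \<subseteq> topspace (completion_topology F v)" unfolding topspace_K by (auto simp: Units_def)
  then show ?thesis unfolding openin_subtopology
    by (intro exI[of _ "topspace (completion_topology F v)"]) (metis inf.absorb2 openin_topspace)
qed

text \<open>The unit group is open, since an element closer to \<open>X\<close> than
  \<open>cabs v X\<close> cannot vanish. The subspace topology can therefore be tested by balls
  inside the units.\<close>

lemma openin_units: "openin (subtopology (completion_topology F v) (KU v)) V \<longleftrightarrow>
  V \<subseteq> KU v \<and>
  (\<forall>X\<in>V. \<exists>e>0. \<forall>Y\<in>KU v. cabs v (Y \<ominus>\<^bsub>K\<^esub> X) < e \<longrightarrow> Y \<in> V)"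
proof -
  interpret cring K by (rule K_cring)
  have "openin (completion_topology F v) (KU v)" unfolding openin_K
  proof (intro conjI ballI)
    fix X assume X: "X \<in> KU v"
    then have X': "X \<in> carrier K" "X \<noteq> \<zero>\<^bsub>K\<^esub>" using K_units by auto
    show "\<exists>e>0. \<forall>Y\<in>carrier K. cabs v (Y \<ominus>\<^bsub>K\<^esub> X) < e \<longrightarrow> Y \<in> KU v"
    proof (intro exI[of _ "cabs v X"] conjI ballI impI)
      show "0 < cabs v X" using X' cabs_nonneg cabs_0_iff by force
      fix Y assume "Y \<in> carrier K" "cabs v (Y \<ominus>\<^bsub>K\<^esub> X) < cabs v X"
      then have "Y \<noteq> \<zero>\<^bsub>K\<^esub>" using X' cabs_uminus by (auto simp: a_minus_def)
      then show "Y \<in> KU v" using \<open>Y \<in> carrier K\<close> K_units by auto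
    qed
  qed auto
  then have U: "openin (completion_topology F v) (KU v)" .
  have "openin (subtopology (completion_topology F v) (KU v)) V \<longleftrightarrow>
     V \<subseteq> KU v \<and> openin (completion_topology F v) V"
    using openin_open_subtopology[OF U] by blast
  moreover have "openin (completion_topology F v) V" if V: "V \<subseteq> KU v"
    "\<forall>X\<in>V. \<exists>e>0. \<forall>Y\<in>KU v. cabs v (Y \<ominus>\<^bsub>K\<^esub> X) < e \<longrightarrow> Y \<in> V"
    unfolding openin_K
  proof (intro conjI ballI)
    show "V \<subseteq> carrier K" using V K_units by auto
    fix X assume X: "X \<in> V"
    then obtain e1 where e1: "e1 > 0" "\<And>Y. Y\<in>KU v \<Longrightarrow> cabs v (Y \<ominus>\<^bsub>K\<^esub> X) < e1 \<Longrightarrow> Y \<in> V"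
      using V by blast
    obtain e2 where e2: "e2 > 0" "\<And>Y. Y\<in>carrier K \<Longrightarrow> cabs v (Y \<ominus>\<^bsub>K\<^esub> X) < e2 \<Longrightarrow> Y \<in> KU v"
      using U[unfolded openin_K, THEN conjunct2, THEN bspec, OF subsetD[OF V(1) X]] by auto
    show "\<exists>e>0. \<forall>Y\<in>carrier K. cabs v (Y \<ominus>\<^bsub>K\<^esub> X) < e \<longrightarrow> Y \<in> V"
    proof (intro exI[of _ "min e1 e2"] conjI ballI impI)
      show "0 < min e1 e2" using e1(1) e2(1) by simp
      fix Y assume "Y \<in> carrier K" "cabs v (Y \<ominus>\<^bsub>K\<^esub> X) < min e1 e2"
      then show "Y \<in> V" using e1(2)[of Y] e2(2)[of Y] by simp
    qed
  qed
  moreover have "\<forall>X\<in>V. \<exists>e>0. \<forall>Y\<in>KU v. cabs v (Y \<ominus>\<^bsub>K\<^esub> X) < e \<longrightarrow> Y \<in> V"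
    if o: "openin (completion_topology F v) V"
  proof
    fix X assume XV: "X \<in> V"
    obtain e where "e > 0" "\<And>Y. Y\<in>carrier K \<Longrightarrow> cabs v (Y \<ominus>\<^bsub>K\<^esub> X) < e \<Longrightarrow> Y \<in> V"
      using o[unfolded openin_K, THEN conjunct2, THEN bspec, OF XV] by blast
    then show "\<exists>e>0. \<forall>Y\<in>KU v. cabs v (Y \<ominus>\<^bsub>K\<^esub> X) < e \<longrightarrow> Y \<in> V"
      using K_units by (intro exI[of _ e]) auto
  qed
  ultimately show ?thesis by blast
qed

end

end

section \<open>Local rings and approximation\<close>

declare absv.simps [simp del]

context euclid_field
begin

text \<open>Congruence modulo the \<open>n\<close>-th power of \<open>P\<close>, extended from the
  integers to the whole field; \<open>n = 0\<close> asks for a difference that is integral at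
  \<open>P\<close>.\<close>

definition cng :: "complex set \<Rightarrow> nat \<Rightarrow> complex \<Rightarrow> complex \<Rightarrow> bool" where
  "cng P n x y \<longleftrightarrow> av P (x - y) \<le> 1 / 2 ^ n"

definition vunit :: "complex set \<Rightarrow> complex \<Rightarrow> bool" where
  "vunit P x \<longleftrightarrow> x \<in> F \<and> av P x = 1"

text \<open>The same congruence between an element of the completion and one of the field. It moves
  questions on local units into \<open>F\<close>.\<close>

definition apx :: "complex set \<Rightarrow> nat \<Rightarrow> (nat \<Rightarrow> complex) set \<Rightarrow> complex \<Rightarrow> bool" where
  "apx P n X a \<longleftrightarrow> cabs (fp P)
     (X \<ominus>\<^bsub>completion F (fp P)\<^esub> emb P a) \<le> 1 / 2 ^ n"

lemma places_fin [simp]: "fp P \<in> places F \<longleftrightarrow> P \<in> FP"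
  by (auto simp: places_def)
lemma places_inf [simp]: "Inf_place \<in> places F"
  by (auto simp: places_def)

context
  fixes P
  assumes P: "P \<in> FP"
begin

lemma vP: "fp P \<in> places F" using P by simp

abbreviation "AP \<equiv> av P"
abbreviation "KP \<equiv> completion F (fp P)"
abbreviation "aK \<equiv> cabs (fp P)"

lemmas aA_0 [simp] = A_0[OF vP]
lemmas aA_1 [simp] = A_1[OF vP]
lemmas aA_nonneg = A_nonneg[OF vP]
lemmas aA_mult = A_mult[OF vP]
lemmas aA_ultra = A_ultra[OF vP refl]

section \<open>Congruences and units of the field at a finite place\<close>

lemma AP_val: "x \<in> F \<Longrightarrow> x \<noteq> 0 \<Longrightarrow> AP x = 2 powi (- val P x)"
  using P by (simp add: ord_elem_val absv.simps)

lemma pow_powi: "(1::real) / 2 ^ n = 2 powi (- int n)" by (simp add: power_int_minus divide_inverse power_int_of_nat)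

lemma AP_le: "x \<in> F \<Longrightarrow> x \<noteq> 0 \<Longrightarrow> AP x \<le> 1 / 2 ^ n \<longleftrightarrow> int n \<le> val P x"
  using power_int_increasing[of "- val P x" "- int n" "2::real"] power_int_strict_increasing[of "- int n" "- val P x" "2::real"]
  unfolding pow_powi by (auto simp: AP_val not_less[symmetric])

text \<open>The nonzero values are powers of 2, so lying strictly below the next larger value
  already gives the bound. This turns inequalities between limits into inequalities that hold
  eventually.\<close>

lemma AP_discrete: "x \<in> F \<Longrightarrow> AP x < 2 * (1 / 2 ^ n) \<Longrightarrow> AP x \<le> 1 / 2 ^ n"
proof (cases "x = 0")
  case False
  assume x: "x \<in> F" "AP x < 2 * (1 / 2 ^ n)"
  have "2 * (1 / 2 ^ n) = (2::real) powi (1 - int n)" by (simp add: power_int_diff power_int_of_nat)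
  then have "(2::real) powi (- val P x) < 2 powi (1 - int n)" using x False by (simp add: AP_val)
  then have "- val P x < 1 - int n" using power_int_increasing[of "1 - int n" "- val P x" "2::real"] by force
  then show ?thesis using AP_le[OF x(1) False] by simp
qed auto

lemma AP_discrete1: "x \<in> F \<Longrightarrow> AP x < 1 \<Longrightarrow> AP x \<le> 1 / 2"
  using AP_discrete[of x 1] by simp

lemma AP_O: "x \<in> Oi \<Longrightarrow> AP x \<le> 1 / 2 ^ n \<longleftrightarrow> x \<in> pid (ppi P ^ n)"
proof (cases "x = 0")
  case True then show ?thesis by (auto intro: pidI[of 0])
next
  case False
  assume "x \<in> Oi" then show ?thesis using AP_le[of x n] val_O_ge[OF P, of x n] False O_F by blast
qed

lemma AP_O_le1: "x \<in> Oi \<Longrightarrow> AP x \<le> 1" using AP_O[of x 0] by simp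
lemma AP_O_P: "x \<in> Oi \<Longrightarrow> AP x \<le> 1/2 \<longleftrightarrow> x \<in> P" using AP_O[of x 1] ppi(2)[OF P] by simp
lemma AP_O_1: "x \<in> Oi \<Longrightarrow> AP x = 1 \<longleftrightarrow> x \<notin> P"
  using AP_O_P[of x] AP_O_le1[of x] AP_discrete1[OF O_F, of x] by linarith
lemma AP_ppi: "AP (ppi P) = 1 / 2" using AP_val[OF ppi(6)[OF P] ppi(3)[OF P]] val_ppi[OF P P] by simp
lemma AP_power: "x \<in> F \<Longrightarrow> AP (x ^ n) = AP x ^ n" by (induction n) (auto simp: aA_mult F_power)

lemma cng_O1: "x \<in> Oi \<Longrightarrow> y \<in> Oi \<Longrightarrow> cng P 1 x y \<longleftrightarrow> x - y \<in> P"
  using AP_O_P O_diff by (simp add: cng_def)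

lemma cng_refl [simp]: "cng P n x x" by (simp add: cng_def)
lemma cng_sym: "x \<in> F \<Longrightarrow> y \<in> F \<Longrightarrow> cng P n x y \<Longrightarrow> cng P n y x"
  using A_diff_comm[OF vP] by (simp add: cng_def)
lemma cng_trans: "x \<in> F \<Longrightarrow> y \<in> F \<Longrightarrow> z \<in> F \<Longrightarrow> cng P n x y \<Longrightarrow> cng P n y z \<Longrightarrow> cng P n x z"
  using aA_ultra[of "x - y" "y - z"] F_diff by (fastforce simp: cng_def)
lemma cng_mono: "cng P n x y \<Longrightarrow> m \<le> n \<Longrightarrow> cng P m x y"
  unfolding cng_def by (rule order_trans) (auto simp: frac_le)

lemma cng_mult:
  assumes "x \<in> F" "y \<in> F" "z \<in> F" "w \<in> F" "AP x \<le> 1" "AP w \<le> 1" "cng P n x y" "cng P n z w"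
  shows "cng P n (x * z) (y * w)"
proof -
  \<comment> \<open>This splitting is the reason why integrality is asked of \<open>x\<close> and
    \<open>w\<close>.\<close>
  have "x * z - y * w = x * (z - w) + (x - y) * w" by (simp add: algebra_simps)
  then have "AP (x * z - y * w) \<le> max (AP (x * (z - w))) (AP ((x - y) * w))"
    using aA_ultra assms by (metis F_diff F_mult)
  also have "\<dots> \<le> 1 / 2 ^ n"
  proof (rule max.boundedI)
    have "AP x * AP (z - w) \<le> 1 * (1/2^n)" using assms by (intro mult_mono) (auto simp: cng_def aA_nonneg)
    then show "AP (x * (z - w)) \<le> 1 / 2 ^ n" using assms F_diff by (simp add: aA_mult)
    have "AP (x - y) * AP w \<le> (1/2^n) * 1" using assms by (intro mult_mono) (auto simp: cng_def aA_nonneg)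
    then show "AP ((x - y) * w) \<le> 1 / 2 ^ n" using assms F_diff by (simp add: aA_mult)
  qed
  finally show ?thesis by (simp add: cng_def)
qed

lemma vunit_F: "vunit P x \<Longrightarrow> x \<in> F" by (simp add: vunit_def)
lemma vunit_nz: "vunit P x \<Longrightarrow> x \<noteq> 0" by (auto simp: vunit_def)
lemma vunit_mult: "vunit P x \<Longrightarrow> vunit P y \<Longrightarrow> vunit P (x * y)"
  by (simp add: vunit_def aA_mult F_mult)
lemma vunit_1 [simp]: "vunit P 1" by (simp add: vunit_def)
lemma vunit_power: "vunit P x \<Longrightarrow> vunit P (x ^ n)"
  by (induction n) (auto intro: vunit_mult)
lemma vunit_inverse: "vunit P x \<Longrightarrow> vunit P (inverse x)"
  by (simp add: vunit_def A_inverse[OF vP] F_inverse)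
lemma vunit_O: "x \<in> Oi \<Longrightarrow> vunit P x \<longleftrightarrow> x \<notin> P"
  using AP_O_1 O_F by (simp add: vunit_def)
lemma vunit_val: "x \<in> F \<Longrightarrow> x \<noteq> 0 \<Longrightarrow> vunit P x \<longleftrightarrow> val P x = 0"
  using power_int_strict_increasing[of "- val P x" 0 "2::real"] power_int_strict_increasing[of 0 "- val P x" "2::real"]
  by (cases "val P x" "0::int" rule: linorder_cases) (auto simp: vunit_def AP_val)
lemma vunit_minus1: "vunit P (-1)"
  using A_minus[OF vP, of 1] by (simp add: vunit_def)

text \<open>For positive \<open>n\<close> the difference is smaller than 1, and in an ultrametric a
  smaller summand does not change the absolute value.\<close>

lemma vunit_cng: "vunit P x \<Longrightarrow> y \<in> F \<Longrightarrow> cng P n x y \<Longrightarrow> n > 0 \<Longrightarrow> vunit P y"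
proof -
  assume a: "vunit P x" "y \<in> F" "cng P n x y" "n > 0"
  have "1 / 2 ^ n < (1::real)" using a by simp
  then have l: "AP (x - y) < 1" by (rule le_less_trans[OF a(3)[unfolded cng_def]])
  have "AP x \<le> max (AP (x - y)) (AP y)" using aA_ultra[of "x - y" y] F_diff a vunit_F by simp
  then have 1: "AP y \<ge> 1" using l a by (auto simp: vunit_def)
  have "AP y \<le> max (AP (y - x)) (AP x)" using aA_ultra[of "y - x" x] F_diff a vunit_F by simp
  then have "AP y \<le> 1" using l a A_diff_comm[OF vP vunit_F[OF a(1)] a(2)] by (auto simp: vunit_def)
  then show ?thesis using 1 a by (simp add: vunit_def)
qed

lemma cng_vmult: "vunit P x \<Longrightarrow> vunit P y \<Longrightarrow> vunit P z \<Longrightarrow> vunit P w \<Longrightarrow> cng P n x y \<Longrightarrow> cng P n z w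
   \<Longrightarrow> cng P n (x * z) (y * w)"
  by (rule cng_mult) (auto simp: vunit_def)

lemma cng_power: "vunit P x \<Longrightarrow> vunit P y \<Longrightarrow> cng P n x y \<Longrightarrow> cng P n (x ^ k) (y ^ k)"
  by (induction k) (auto intro!: cng_vmult vunit_power)

lemma cng_div: "vunit P x \<Longrightarrow> y \<in> F \<Longrightarrow> cng P n y x \<longleftrightarrow> cng P n (y * inverse x) 1"
proof -
  assume a: "vunit P x" "y \<in> F"
  have "y * inverse x - 1 = (y - x) * inverse x" using vunit_nz[OF a(1)] by (simp add: field_simps)
  then have "AP (y * inverse x - 1) = AP (y - x)"
    using aA_mult[of "y - x" "inverse x"] vunit_inverse[OF a(1)] a F_diff by (simp add: vunit_def)
  then show ?thesis by (simp add: cng_def)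
qed

text \<open>A limit of at most \<open>1 / 2 ^ n\<close> lies below twice that bound, hence so do
  almost all terms, and discreteness improves this back to \<open>1 / 2 ^ n\<close>. The congruence
  can thus be read off from any representative.\<close>

lemma apx_seq: assumes "X \<in> carrier KP" "s \<in> X" "a \<in> F"
  shows "apx P n X a \<longleftrightarrow> (\<forall>\<^sub>F m in sequentially. AP (s m - a) \<le> 1 / 2 ^ n)"
proof -
  have s: "s \<in> carrier (cauchy_ring F (fp P))" "X = cl (fp P) s" using mem_cl[OF vP assms(1,2)] by auto
  have c: "(\<lambda>n. s n - a) \<in> carrier (cauchy_ring F (fp P))" by (rule C_diff[OF vP s(1) C_const[OF vP assms(3)]])
  have "X \<ominus>\<^bsub>KP\<^esub> emb P a = cl (fp P) (\<lambda>n. s n - a)"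
    unfolding s(2) embed_cl[OF vP] by (rule cl_minus[OF vP s(1) C_const[OF vP assms(3)]])
  then have e: "apx P n X a \<longleftrightarrow> aK (cl (fp P) (\<lambda>n. s n - a)) \<le> 1 / 2 ^ n" by (simp add: apx_def)
  note lim = cabs_lim[OF vP c]
  show ?thesis
  proof
    assume "apx P n X a"
    then have "aK (cl (fp P) (\<lambda>n. s n - a)) \<le> 1/2^n" using e by simp
    moreover have "1/2^n < 2 * (1/2^n::real)" by (simp add: divide_strict_right_mono)
    ultimately have "aK (cl (fp P) (\<lambda>n. s n - a)) < 2 * (1/2^n)" by (rule le_less_trans)
    then have "\<forall>\<^sub>F m in sequentially. AP (s m - a) < 2 * (1/2^n)" using order_tendstoD(2)[OF lim] by blast
    then show "\<forall>\<^sub>F m in sequentially. AP (s m - a) \<le> 1 / 2 ^ n"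
      by (rule eventually_mono) (use AP_discrete F_diff C_F[OF vP s(1)] assms in blast)
  next
    assume "\<forall>\<^sub>F m in sequentially. AP (s m - a) \<le> 1 / 2 ^ n"
    then show "apx P n X a" unfolding e by (rule tendsto_upperbound[OF lim]) simp
  qed
qed

lemma apx_ex: assumes "X \<in> carrier KP" shows "\<exists>a\<in>F. apx P n X a"
proof -
  obtain s where s: "s \<in> carrier (cauchy_ring F (fp P))" "X = cl (fp P) s" "s \<in> X" using K_cases[OF vP assms] by blast
  obtain N where N: "\<And>m k. m \<ge> N \<Longrightarrow> k \<ge> N \<Longrightarrow> AP (s m - s k) < 1/2^n" using C_D[OF vP s(1), of "1/2^n"] by auto
  have "apx P n X (s N)" unfolding apx_seq[OF assms s(3) C_F[OF vP s(1)]] eventually_sequentially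
    by (rule exI[of _ N]) (use N less_imp_le in auto)
  then show ?thesis using C_F[OF vP s(1)] by blast
qed

lemma apx_cng: assumes "X \<in> carrier KP" "a \<in> F" "b \<in> F" "apx P n X a"
  shows "apx P n X b \<longleftrightarrow> cng P n a b"
proof -
  obtain s where s: "s \<in> carrier (cauchy_ring F (fp P))" "X = cl (fp P) s" "s \<in> X" using K_cases[OF vP assms(1)] by blast
  note sF = C_F[OF vP s(1)]
  have a: "\<forall>\<^sub>F m in sequentially. cng P n (s m) a" using assms apx_seq[OF assms(1) s(3) assms(2)] by (simp add: cng_def)
  have b: "apx P n X b \<longleftrightarrow> (\<forall>\<^sub>F m in sequentially. cng P n (s m) b)" using apx_seq[OF assms(1) s(3) assms(3)] by (simp add: cng_def)
  show ?thesis unfolding b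
  proof
    assume "\<forall>\<^sub>F m in sequentially. cng P n (s m) b"
    with a have "\<forall>\<^sub>F m in sequentially. cng P n a b"
      by eventually_elim (use cng_trans cng_sym sF assms in blast)
    then show "cng P n a b" by simp
  next
    assume ab: "cng P n a b"
    show "\<forall>\<^sub>F m in sequentially. cng P n (s m) b" using a
      by eventually_elim (use ab cng_trans sF assms in blast)
  qed
qed

lemma apx_embed: "a \<in> F \<Longrightarrow> b \<in> F \<Longrightarrow> apx P n (emb P a) b \<longleftrightarrow> cng P n a b"
proof (rule apx_cng)
  assume a: "a \<in> F"
  then show "emb P a \<in> carrier KP" using embed_carrier[OF vP] by blast
  then have "a \<in> F \<Longrightarrow> apx P n (emb P a) a"
    by (subst apx_seq[where s="\<lambda>_. a"]) (auto simp: embed_cl[OF vP] intro: cl_self[OF vP] C_const[OF vP])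
  then show "apx P n (emb P a) a" using a by blast
qed

lemma apx_mult: assumes "X \<in> carrier KP" "Y \<in> carrier KP" "a \<in> F" "b \<in> F" "apx P n X a" "apx P n Y b" "AP a \<le> 1" "AP b \<le> 1"
  shows "apx P n (X \<otimes>\<^bsub>KP\<^esub> Y) (a * b)"
proof -
  obtain s where s: "s \<in> carrier (cauchy_ring F (fp P))" "X = cl (fp P) s" "s \<in> X" using K_cases[OF vP assms(1)] by blast
  obtain t where t: "t \<in> carrier (cauchy_ring F (fp P))" "Y = cl (fp P) t" "t \<in> Y" using K_cases[OF vP assms(2)] by blast
  note sF = C_F[OF vP s(1)] C_F[OF vP t(1)]
  have e: "X \<otimes>\<^bsub>KP\<^esub> Y = cl (fp P) (\<lambda>n. s n * t n)" using cl_mult[OF vP s(1) t(1)] s t by simp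
  have c: "(\<lambda>n. s n * t n) \<in> carrier (cauchy_ring F (fp P))" using C_mult[OF vP s(1) t(1)] .
  have "\<forall>\<^sub>F m in sequentially. cng P n (s m) a" "\<forall>\<^sub>F m in sequentially. cng P n (t m) b"
    using assms apx_seq[OF assms(1) s(3) assms(3)] apx_seq[OF assms(2) t(3) assms(4)] by (auto simp: cng_def)
  then have "\<forall>\<^sub>F m in sequentially. cng P n (s m * t m) (a * b)"
  proof eventually_elim
    case (elim m)
    have "AP (s m) \<le> max (AP (s m - a)) (AP a)" using aA_ultra[of "s m - a" a] sF assms F_diff by simp
    moreover have "1 / 2 ^ n \<le> (1::real)" by simp
    ultimately have "AP (s m) \<le> 1" using elim assms unfolding cng_def by linarith
    then show ?case using elim assms sF by (intro cng_mult)
  qed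
  then show ?thesis unfolding e using apx_seq[OF cl_carrier[OF vP c] cl_self[OF vP c], of "a*b"] F_mult assms
    by (simp add: cng_def)
qed

lemma apx_1: "X \<in> carrier KP \<Longrightarrow> apx P n X 1 \<longleftrightarrow> aK (X \<ominus>\<^bsub>KP\<^esub> \<one>\<^bsub>KP\<^esub>) \<le> 1 / 2 ^ n"
  by (simp add: apx_def embed_one[OF vP])

lemma apx_mono: "apx P n X a \<Longrightarrow> m \<le> n \<Longrightarrow> apx P m X a"
  unfolding apx_def by (rule order_trans) (auto simp: frac_le)

lemma aK_lt1: "X \<in> carrier KP \<Longrightarrow> aK X < 1 \<Longrightarrow> aK X \<le> 1 / 2"
proof -
  assume X: "X \<in> carrier KP" "aK X < 1"
  obtain s where s: "s \<in> carrier (cauchy_ring F (fp P))" "X = cl (fp P) s" "s \<in> X" using K_cases[OF vP X(1)] by blast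
  have "\<forall>\<^sub>F m in sequentially. AP (s m) < 1" using order_tendstoD(2)[OF cabs_lim[OF vP s(1)]] s X by blast
  then have "\<forall>\<^sub>F m in sequentially. AP (s m) \<le> 1/2"
    by (rule eventually_mono) (use AP_discrete1 C_F[OF vP s(1)] in blast)
  then show ?thesis unfolding s(2) by (rule tendsto_upperbound[OF cabs_lim[OF vP s(1)]]) simp
qed

lemma cabs_one: "aK \<one>\<^bsub>KP\<^esub> = 1" using cabs_embed[OF vP, of 1] by (simp add: embed_one[OF vP])

section \<open>The local ring of integers and the filtration of its units\<close>

abbreviation "OK \<equiv> local_int_ring F P"

lemma OK_simps: "carrier OK = {X \<in> carrier KP. aK X \<le> 1}" "mult OK = mult KP" "add OK = add KP" "one OK = one KP" "zero OK = zero KP"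
  by (simp_all add: local_int_ring_def)

lemma OK_cring: "cring OK"
proof -
  interpret cring KP by (rule K_cring[OF vP])
  have "subcring {X \<in> carrier KP. aK X \<le> 1} KP"
  proof (rule subcringI)
    show "subring {X \<in> carrier KP. aK X \<le> 1} KP"
    proof (rule subringI)
      fix h1 h2 assume h: "h1 \<in> {X \<in> carrier KP. aK X \<le> 1}" "h2 \<in> {X \<in> carrier KP. aK X \<le> 1}"
      show "h1 \<otimes>\<^bsub>KP\<^esub> h2 \<in> {X \<in> carrier KP. aK X \<le> 1}"
        using h cabs_mult[OF vP, of h1 h2] cabs_nonneg[OF vP] by (auto intro: mult_le_one)
      show "h1 \<oplus>\<^bsub>KP\<^esub> h2 \<in> {X \<in> carrier KP. aK X \<le> 1}"
        using h cabs_ultra[OF vP refl, of h1 h2] by auto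
    qed (auto simp: cabs_uminus[OF vP] cabs_one)
    fix h1 h2 assume "h1 \<in> {X \<in> carrier KP. aK X \<le> 1}" "h2 \<in> {X \<in> carrier KP. aK X \<le> 1}"
    then show "h1 \<otimes>\<^bsub>KP\<^esub> h2 = h2 \<otimes>\<^bsub>KP\<^esub> h1" using m_comm by auto
  qed
  then show ?thesis unfolding local_int_ring_def using subcring_iff[of "{X \<in> carrier KP. aK X \<le> 1}"] by auto
qed

text \<open>\<open>aK X * aK Y = 1\<close> with both factors at most 1 forces both to be 1.
  Conversely, the inverse of \<open>X\<close> in the completion has absolute value 1 as
  well.\<close>

lemma local_units: "LU P = {X \<in> carrier KP. aK X = 1}"
proof
  interpret cring KP by (rule K_cring[OF vP])
  show "LU P \<subseteq> {X \<in> carrier KP. aK X = 1}"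
  proof
    fix X assume "X \<in> LU P"
    then obtain Y where XY: "X \<in> carrier KP" "aK X \<le> 1" "Y \<in> carrier KP" "aK Y \<le> 1" "X \<otimes>\<^bsub>KP\<^esub> Y = \<one>\<^bsub>KP\<^esub>"
      unfolding local_units_def Units_def OK_simps by blast
    then have "aK X * aK Y = 1" using cabs_mult[OF vP XY(1,3)] cabs_one by simp
    then have "aK X = 1" using XY cabs_nonneg[OF vP XY(1)] cabs_nonneg[OF vP XY(3)]
      by (smt (verit) mult_left_le mult_less_cancel_left2)
    then show "X \<in> {X \<in> carrier KP. aK X = 1}" using XY by blast
  qed
  show "{X \<in> carrier KP. aK X = 1} \<subseteq> LU P"
  proof
    fix X assume X: "X \<in> {X \<in> carrier KP. aK X = 1}"
    then have "X \<in> Units KP" using K_units[OF vP] cabs_0_iff[OF vP, of X] by auto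
    then obtain Y where Y: "Y \<in> carrier KP" "X \<otimes>\<^bsub>KP\<^esub> Y = \<one>\<^bsub>KP\<^esub>" "Y \<otimes>\<^bsub>KP\<^esub> X = \<one>\<^bsub>KP\<^esub>" unfolding Units_def by blast
    then have "aK X * aK Y = 1" using cabs_mult[OF vP, of X Y] X cabs_one by simp
    then show "X \<in> LU P" using X Y unfolding local_units_def Units_def OK_simps by auto
  qed
qed

lemma local_units_sub: "LU P \<subseteq> KU (fp P)"
proof -
  interpret cring KP by (rule K_cring[OF vP])
  have "aK \<zero>\<^bsub>KP\<^esub> = 0" using cabs_0_iff[OF vP zero_closed] by simp
  then show ?thesis unfolding local_units K_units[OF vP] by auto
qed

text \<open>An element of absolute value 1 is a unit of the local ring, so an ideal not contained in
  \<open>?M\<close> is everything, and \<open>?M\<close> is the only maximal ideal. By discreteness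
  the open unit disc is the closed disc of radius 1/2.\<close>

lemma local_maxideal: "local_maxideal F P = {X \<in> carrier KP. aK X \<le> 1 / 2}"
proof -
  interpret K: cring KP by (rule K_cring[OF vP])
  interpret cring OK by (rule OK_cring)
  let ?M = "{X \<in> carrier KP. aK X \<le> 1 / 2}"
  have idl: "ideal ?M OK"
  proof (rule idealI)
    show "ring OK" by (rule ring_axioms)
    show "subgroup ?M (add_monoid OK)"
    proof
      show "?M \<subseteq> carrier (add_monoid OK)" by (auto simp: OK_simps)
      fix x y assume xy: "x \<in> ?M" "y \<in> ?M"
      then show "x \<otimes>\<^bsub>add_monoid OK\<^esub> y \<in> ?M" using cabs_ultra[OF vP refl, of x y] by (auto simp: OK_simps)
    next
      show "\<one>\<^bsub>add_monoid OK\<^esub> \<in> ?M" using cabs_0_iff[OF vP K.zero_closed] by (simp add: OK_simps)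
      fix x assume x: "x \<in> ?M"
      have "\<ominus>\<^bsub>OK\<^esub> x = \<ominus>\<^bsub>KP\<^esub> x"
        using x cabs_uminus[OF vP, of x] by (intro minus_equality) (auto simp: OK_simps K.l_neg)
      then show "inv\<^bsub>add_monoid OK\<^esub> x \<in> ?M" using x cabs_uminus[OF vP, of x] K.a_inv_closed unfolding a_inv_def by auto
    qed
    fix a x assume a: "a \<in> ?M" "x \<in> carrier OK"
    then have "aK x * aK a \<le> 1 * (1/2)" using cabs_nonneg[OF vP] by (intro mult_mono) (auto simp: OK_simps)
    then show "x \<otimes>\<^bsub>OK\<^esub> a \<in> ?M" "a \<otimes>\<^bsub>OK\<^esub> x \<in> ?M" using a cabs_mult[OF vP] by (auto simp: OK_simps mult.commute)
  qed
  have unit: "J = carrier OK" if J: "ideal J OK" "X \<in> J" "X \<notin> ?M" for J X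
  proof -
    interpret J: ideal J OK by (rule J(1))
    have "X \<in> carrier OK" using J by (simp add: J.Icarr)
    then have "X \<in> LU P" using J(3) aK_lt1[of X] by (force simp: local_units OK_simps)
    then obtain Y where "Y \<in> carrier OK" "Y \<otimes>\<^bsub>OK\<^esub> X = \<one>\<^bsub>OK\<^esub>" by (auto simp: local_units_def Units_def)
    then have "\<one>\<^bsub>OK\<^esub> \<in> J" using J.I_l_closed[OF J(2)] by metis
    then show ?thesis by (rule J.one_imp_carrier)
  qed
  have one: "\<one>\<^bsub>OK\<^esub> \<notin> ?M" by (simp add: OK_simps cabs_one)
  have mx: "maximalideal ?M OK"
  proof (rule maximalidealI[OF idl])
    show "carrier OK \<noteq> ?M" using one one_closed by auto
    fix J assume "ideal J OK" "?M \<subseteq> J" "J \<subseteq> carrier OK"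
    then show "J = ?M \<or> J = carrier OK" using unit by blast
  qed
  show ?thesis unfolding local_maxideal_def
  proof (rule the_equality[where a="?M" and P="\<lambda>M. maximalideal M OK", OF mx])
    fix M assume M: "maximalideal M OK"
    then interpret M: maximalideal M OK .
    have "M \<subseteq> ?M" using unit[OF M.is_ideal] M.I_notcarr by blast
    moreover have "?M \<subseteq> carrier OK" by (auto simp: OK_simps)
    ultimately show "M = ?M" using M.I_maximal[OF idl] one one_closed by blast
  qed
qed

text \<open>The image of \<open>ppi P\<close> has absolute value 1/2, so dividing by it moves an
  element of depth \<open>Suc n\<close> to depth \<open>n\<close>.\<close>

lemma maxideal_pow: "ideal_pow OK (local_maxideal F P) n = {X \<in> carrier KP. aK X \<le> 1 / 2 ^ n}"
proof (induction n)
  case 0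
  then show ?case by (simp add: nat_pow_def ideals_set_def OK_simps)
next
  interpret K: cring KP by (rule K_cring[OF vP])
  case (Suc n)
  have "ideal_pow OK (local_maxideal F P) (Suc n) = ideal_prod OK (ideal_pow OK (local_maxideal F P) n) (local_maxideal F P)"
    by (simp add: nat_pow_def ideals_set_def)
  also have "\<dots> = ideal_prod OK {X \<in> carrier KP. aK X \<le> 1 / 2 ^ n} {X \<in> carrier KP. aK X \<le> 1 / 2}"
    by (simp only: Suc) (simp only: local_maxideal)
  also have "\<dots> = {X \<in> carrier KP. aK X \<le> 1 / 2 ^ Suc n}"
  proof safe
    fix X assume "X \<in> ideal_prod OK {X \<in> carrier KP. aK X \<le> 1 / 2 ^ n} {X \<in> carrier KP. aK X \<le> 1 / 2}"
    then have "X \<in> carrier KP \<and> aK X \<le> 1 / 2 ^ Suc n"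
    proof induction
      case (prod i j)
      then have "aK i * aK j \<le> (1/2^n) * (1/2)" using cabs_nonneg[OF vP] by (intro mult_mono) auto
      then show ?case using prod cabs_mult[OF vP, of i j] by (simp add: OK_simps)
    next
      case (sum s1 s2)
      then show ?case using cabs_ultra[OF vP refl, of s1 s2] by (auto simp: OK_simps)
    qed
    then show "X \<in> carrier KP" "aK X \<le> 1 / 2 ^ Suc n" by auto
  next
    fix X assume X: "X \<in> carrier KP" "aK X \<le> 1 / 2 ^ Suc n"
    let ?p = "emb P (ppi P)" and ?q = "emb P (inverse (ppi P))"
    have pq: "?p \<in> carrier KP" "?q \<in> carrier KP" using embed_carrier[OF vP] ppi(6)[OF P] F_inverse by auto
    have "?q \<otimes>\<^bsub>KP\<^esub> ?p = \<one>\<^bsub>KP\<^esub>" using embed_mult[OF vP, of "inverse (ppi P)" "ppi P"] ppi(6,3)[OF P] F_inverse embed_one[OF vP] by simp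
    then have e: "X = (X \<otimes>\<^bsub>KP\<^esub> ?q) \<otimes>\<^bsub>KP\<^esub> ?p" using X pq by (simp add: K.m_assoc)
    have "aK ?p = 1/2" using cabs_embed[OF vP] AP_ppi ppi(6)[OF P] by simp
    moreover have "aK ?q = inverse (1/2)" unfolding AP_ppi[symmetric]
      using cabs_embed[OF vP] ppi(6)[OF P] F_inverse A_inverse[OF vP] by simp
    then have "aK ?q = 2" by simp
    ultimately
    have "X \<otimes>\<^bsub>KP\<^esub> ?q \<in> {X \<in> carrier KP. aK X \<le> 1 / 2 ^ n}" "?p \<in> {X \<in> carrier KP. aK X \<le> 1 / 2}"
      using X pq cabs_mult[OF vP X(1) pq(2)] by auto
    then have "(X \<otimes>\<^bsub>KP\<^esub> ?q) \<otimes>\<^bsub>OK\<^esub> ?p \<in> ideal_prod OK {X \<in> carrier KP. aK X \<le> 1 / 2 ^ n} {X \<in> carrier KP. aK X \<le> 1 / 2}"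
      by (rule ideal_prod.prod)
    then show "X \<in> ideal_prod OK {X \<in> carrier KP. aK X \<le> 1 / 2 ^ n} {X \<in> carrier KP. aK X \<le> 1 / 2}"
      using e by (simp add: OK_simps)
  qed
  finally show ?case .
qed

lemma higher_units: "HU P n = {X \<in> carrier KP. apx P n X 1}"
proof -
  interpret K: cring KP by (rule K_cring[OF vP])
  have "HU P n = (\<lambda>X. \<one>\<^bsub>KP\<^esub> \<oplus>\<^bsub>KP\<^esub> X) ` {X \<in> carrier KP. aK X \<le> 1 / 2 ^ n}"
    unfolding higher_units_def maxideal_pow by (simp add: OK_simps)
  also have "\<dots> = {X \<in> carrier KP. apx P n X 1}"
  proof safe
    fix X assume X: "X \<in> carrier KP" "aK X \<le> 1/2^n"
    have "\<one>\<^bsub>KP\<^esub> \<oplus>\<^bsub>KP\<^esub> X \<ominus>\<^bsub>KP\<^esub> \<one>\<^bsub>KP\<^esub> = X" using X K.ring_simprules by (metis K.one_closed K.minus_eq K.r_neg1 K.add.m_comm K.a_inv_closed K.add.m_assoc)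
    then show "apx P n (\<one>\<^bsub>KP\<^esub> \<oplus>\<^bsub>KP\<^esub> X) 1" using X by (simp add: apx_1)
  next
    fix X assume X: "X \<in> carrier KP" "apx P n X 1"
    have "X = \<one>\<^bsub>KP\<^esub> \<oplus>\<^bsub>KP\<^esub> (X \<ominus>\<^bsub>KP\<^esub> \<one>\<^bsub>KP\<^esub>)" using X by (metis K.one_closed K.minus_eq K.r_neg2 K.add.m_comm K.a_inv_closed K.add.m_lcomm)
    then show "X \<in> (\<lambda>X. \<one>\<^bsub>KP\<^esub> \<oplus>\<^bsub>KP\<^esub> X) ` {X \<in> carrier KP. aK X \<le> 1 / 2 ^ n}"
      using X apx_1[OF X(1)] by (intro image_eqI) auto
  qed auto
  finally show ?thesis .
qed

lemma lu_apx: assumes "X \<in> carrier KP" "a \<in> F" "apx P n X a" "n > 0"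
  shows "X \<in> LU P \<longleftrightarrow> vunit P a"
proof -
  obtain s where s: "s \<in> carrier (cauchy_ring F (fp P))" "X = cl (fp P) s" "s \<in> X" using K_cases[OF vP assms(1)] by blast
  note sF = C_F[OF vP s(1)]
  have ev: "\<forall>\<^sub>F m in sequentially. cng P n (s m) a" using assms apx_seq[OF assms(1) s(3) assms(2)] by (simp add: cng_def)
  note lim = cabs_lim[OF vP s(1)]
  show ?thesis
  proof
    assume a: "vunit P a"
    from ev have "\<forall>\<^sub>F m in sequentially. AP (s m) = 1"
    proof eventually_elim
      case (elim m)
      show ?case using vunit_cng[OF a sF cng_sym[OF sF assms(2) elim] assms(4)] by (simp add: vunit_def)
    qed
    then have "aK X = 1" using cabs_eqI[OF vP s(1) tendsto_eventually] s by simp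
    then show "X \<in> LU P" using assms local_units by auto
  next
    assume "X \<in> LU P"
    then have X: "aK X = 1" using local_units by auto
    have "\<forall>\<^sub>F m in sequentially. AP (s m) > 1/2" "\<forall>\<^sub>F m in sequentially. AP (s m) < 2"
      using order_tendstoD(1)[OF lim, of "1/2"] order_tendstoD(2)[OF lim, of 2] X s by auto
    with ev have "\<forall>\<^sub>F m in sequentially. vunit P a"
    proof eventually_elim
      case (elim m)
      have "AP (s m) \<le> 1" using elim(3) AP_discrete[OF sF, of m 0] by simp
      moreover have "AP (s m) \<ge> 1" using elim(2) AP_discrete1[OF sF, of m] by linarith
      ultimately have "vunit P (s m)" using sF by (simp add: vunit_def)
      then show ?case using vunit_cng elim assms by blast
    qed
    then show "vunit P a" by simp
  qed
qed

lemma lu_apx_ex: assumes "X \<in> LU P" "n > 0" obtains a where "vunit P a" "apx P n X a"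
  using apx_ex[of X n] lu_apx assms local_units by blast

lemma lu_mult: "X \<in> LU P \<Longrightarrow> Y \<in> LU P \<Longrightarrow> X \<otimes>\<^bsub>KP\<^esub> Y \<in> LU P"
proof -
  interpret K: cring KP by (rule K_cring[OF vP])
  assume "X \<in> LU P" "Y \<in> LU P"
  then show ?thesis using cabs_mult[OF vP] by (auto simp: local_units)
qed

lemma lu_one: "\<one>\<^bsub>KP\<^esub> \<in> LU P"
proof -
  interpret K: cring KP by (rule K_cring[OF vP])
  show ?thesis using cabs_one by (auto simp: local_units)
qed

lemma lu_embed: "a \<in> F \<Longrightarrow> emb P a \<in> LU P \<longleftrightarrow> vunit P a"
  using embed_carrier[OF vP] cabs_embed[OF vP] by (auto simp: local_units vunit_def)

lemma hu_lu: "n > 0 \<Longrightarrow> HU P n \<subseteq> LU P"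
  using lu_apx[of _ 1 n] by (auto simp: higher_units)

lemma hu_embed: "a \<in> F \<Longrightarrow> emb P a \<in> HU P n \<longleftrightarrow> cng P n a 1"
  using apx_embed[of a 1 n] embed_carrier[OF vP] by (auto simp: higher_units)

lemma lu_decompose: assumes "X \<in> LU P" "n > 0"
  obtains a Y where "vunit P a" "Y \<in> HU P n" "X = emb P a \<otimes>\<^bsub>KP\<^esub> Y" "apx P n X a"
proof -
  interpret K: cring KP by (rule K_cring[OF vP])
  obtain a where a: "vunit P a" "apx P n X a" using lu_apx_ex assms by blast
  have XK: "X \<in> carrier KP" using assms local_units by auto
  let ?b = "emb P (inverse a)"
  have ia: "vunit P (inverse a)" "inverse a \<in> F" "a \<in> F" "a \<noteq> 0" using vunit_inverse vunit_F vunit_nz a by auto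
  have b: "?b \<in> carrier KP" using embed_carrier[OF vP] ia by blast
  have "apx P n (X \<otimes>\<^bsub>KP\<^esub> ?b) (a * inverse a)"
    using XK b ia a by (intro apx_mult) (auto simp: apx_embed vunit_def)
  then have "X \<otimes>\<^bsub>KP\<^esub> ?b \<in> HU P n" using ia XK b by (auto simp: higher_units)
  moreover have "X = emb P a \<otimes>\<^bsub>KP\<^esub> (X \<otimes>\<^bsub>KP\<^esub> ?b)"
  proof -
    have "emb P a \<otimes>\<^bsub>KP\<^esub> ?b = \<one>\<^bsub>KP\<^esub>" using embed_mult[OF vP, of a "inverse a"] ia embed_one[OF vP] by simp
    then show ?thesis using XK b embed_carrier[OF vP ia(3)] by (metis K.m_comm K.m_assoc K.r_one)
  qed
  ultimately show thesis using that a by blast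
qed

text \<open>One radius serves all points of \<open>H\<close>: 1 for the units and
  \<open>1 / 2 ^ n\<close> for the higher units. Multiplication by \<open>X\<close> scales it, which
  explains the radius \<open>e / aK Xi\<close> for the coset.\<close>

lemma open_coset:
  assumes X: "X \<in> KU (fp P)" and H: "H = LU P \<or> (\<exists>n>0. H = HU P n)"
  shows "openin (subtopology (completion_topology F (fp P)) (KU (fp P)))
    {X \<otimes>\<^bsub>KP\<^esub> Z | Z. Z \<in> H}"
proof -
  interpret K: cring KP by (rule K_cring[OF vP])
  have HU: "H \<subseteq> LU P" using H hu_lu by blast
  obtain e where e: "e > 0" "\<And>Z W. Z \<in> H \<Longrightarrow> W \<in> carrier KP \<Longrightarrow> aK (W \<ominus>\<^bsub>KP\<^esub> Z) < e \<Longrightarrow> W \<in> H"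
  proof -
    have split: "W \<ominus>\<^bsub>KP\<^esub> V = (W \<ominus>\<^bsub>KP\<^esub> Z) \<oplus>\<^bsub>KP\<^esub> (Z \<ominus>\<^bsub>KP\<^esub> V)" if "W \<in> carrier KP" "Z \<in> carrier KP" "V \<in> carrier KP" for W Z V
      using that by (simp add: K.minus_eq K.a_assoc K.r_neg1)
    have W2: "W = (W \<ominus>\<^bsub>KP\<^esub> Z) \<oplus>\<^bsub>KP\<^esub> Z" if "W \<in> carrier KP" "Z \<in> carrier KP" for W Z
      using that by (simp add: K.minus_eq K.a_assoc K.l_neg)
    from H show thesis
    proof
      assume HL: "H = LU P"
      have "W \<in> H" if "Z \<in> H" "W \<in> carrier KP" "aK (W \<ominus>\<^bsub>KP\<^esub> Z) < 1" for Z W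
      proof -
        have Z: "Z \<in> carrier KP" "aK Z = 1" using that HL local_units by auto
        have "aK W \<le> max (aK (W \<ominus>\<^bsub>KP\<^esub> Z)) (aK Z)" using cabs_ultra[OF vP refl, of "W \<ominus>\<^bsub>KP\<^esub> Z" Z] W2[of W Z] that Z by simp
        moreover have "aK Z \<le> max (aK (Z \<ominus>\<^bsub>KP\<^esub> W)) (aK W)" using cabs_ultra[OF vP refl, of "Z \<ominus>\<^bsub>KP\<^esub> W" W] W2[of Z W] that Z by simp
        ultimately have "aK W = 1" using that(3) Z cabs_diff_comm[OF vP Z(1) that(2)] by auto
        then show ?thesis using that HL local_units by auto
      qed
      then show thesis using that[of 1] by simp
    next
      assume "\<exists>n>0. H = HU P n"
      then obtain n where n: "H = HU P n" by blast
      have "W \<in> H" if "Z \<in> H" "W \<in> carrier KP" "aK (W \<ominus>\<^bsub>KP\<^esub> Z) < 1/2^n" for Z W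
      proof -
        have Z: "Z \<in> carrier KP" "aK (Z \<ominus>\<^bsub>KP\<^esub> \<one>\<^bsub>KP\<^esub>) \<le> 1/2^n" using that n higher_units apx_1 by auto
        have "aK (W \<ominus>\<^bsub>KP\<^esub> \<one>\<^bsub>KP\<^esub>) \<le> 1/2^n"
          using cabs_ultra[OF vP refl, of "W \<ominus>\<^bsub>KP\<^esub> Z" "Z \<ominus>\<^bsub>KP\<^esub> \<one>\<^bsub>KP\<^esub>"] split[of W Z "\<one>\<^bsub>KP\<^esub>"] that Z by simp
        then show ?thesis using that n higher_units apx_1 by auto
      qed
      then show thesis using that[of "1/2^n"] by simp
    qed
  qed
  have XK: "X \<in> carrier KP" using X K_units[OF vP] by auto
  obtain Xi where Xi: "Xi \<in> carrier KP" "X \<otimes>\<^bsub>KP\<^esub> Xi = \<one>\<^bsub>KP\<^esub>" using X unfolding Units_def by blast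
  have Xi0: "aK X * aK Xi = 1" using cabs_mult[OF vP XK Xi(1)] Xi(2) cabs_one by simp
  then have Xip: "aK Xi > 0" using cabs_nonneg[OF vP Xi(1)] by (cases "aK Xi = 0") auto
  have HK: "Z \<in> H \<Longrightarrow> Z \<in> carrier KP" for Z using HU local_units by auto
  show ?thesis unfolding openin_units[OF vP]
  proof (intro conjI ballI)
    show "{X \<otimes>\<^bsub>KP\<^esub> Z |Z. Z \<in> H} \<subseteq> KU (fp P)"
      using X HU local_units_sub K.Units_m_closed by blast
    fix Y assume "Y \<in> {X \<otimes>\<^bsub>KP\<^esub> Z |Z. Z \<in> H}"
    then obtain Z where Z: "Z \<in> H" "Y = X \<otimes>\<^bsub>KP\<^esub> Z" by blast
    show "\<exists>e>0. \<forall>Y'\<in>KU (fp P). aK (Y' \<ominus>\<^bsub>KP\<^esub> Y) < e \<longrightarrow> Y' \<in> {X \<otimes>\<^bsub>KP\<^esub> Z |Z. Z \<in> H}"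
    proof (intro exI[of _ "e / aK Xi"] conjI ballI impI)
      show "0 < e / aK Xi" using e Xip by simp
      fix Y' assume Y': "Y' \<in> KU (fp P)" "aK (Y' \<ominus>\<^bsub>KP\<^esub> Y) < e / aK Xi"
      have YK: "Y' \<in> carrier KP" using Y' K_units[OF vP] by auto
      have ZK: "Z \<in> carrier KP" using HK Z by blast
      have XiY: "Xi \<otimes>\<^bsub>KP\<^esub> Y = Z"
      proof -
        have "Xi \<otimes>\<^bsub>KP\<^esub> (X \<otimes>\<^bsub>KP\<^esub> Z) = (X \<otimes>\<^bsub>KP\<^esub> Xi) \<otimes>\<^bsub>KP\<^esub> Z" using Xi XK ZK by (metis K.m_assoc K.m_comm)
        then show ?thesis using Xi Z ZK by simp
      qed
      have "aK (Xi \<otimes>\<^bsub>KP\<^esub> Y' \<ominus>\<^bsub>KP\<^esub> Z) = aK (Xi \<otimes>\<^bsub>KP\<^esub> (Y' \<ominus>\<^bsub>KP\<^esub> Y))"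
        unfolding XiY[symmetric] using Xi YK Z ZK XK by (simp add: K.minus_eq K.r_distr K.r_minus)
      also have "\<dots> = aK Xi * aK (Y' \<ominus>\<^bsub>KP\<^esub> Y)" using Xi YK Z ZK XK by (simp add: cabs_mult[OF vP])
      also have "\<dots> < e" using Y'(2) Xip by (simp add: pos_less_divide_eq mult.commute)
      finally have "Xi \<otimes>\<^bsub>KP\<^esub> Y' \<in> H" using e(2)[OF Z(1)] Xi YK by simp
      moreover have "Y' = X \<otimes>\<^bsub>KP\<^esub> (Xi \<otimes>\<^bsub>KP\<^esub> Y')" using Xi YK XK by (simp add: K.m_assoc[symmetric])
      ultimately show "Y' \<in> {X \<otimes>\<^bsub>KP\<^esub> Z |Z. Z \<in> H}" by blast
    qed
  qed
qed

lemma open_nbhd: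
  assumes "openin (subtopology (completion_topology F (fp P)) (KU (fp P))) V"
    "\<one>\<^bsub>KP\<^esub> \<in> V"
  obtains n where "n > 0" "HU P n \<subseteq> V"
proof -
  obtain e where e: "e > 0" "\<And>Y. Y\<in>KU (fp P) \<Longrightarrow> aK (Y \<ominus>\<^bsub>KP\<^esub> \<one>\<^bsub>KP\<^esub>) < e \<Longrightarrow> Y \<in> V"
    using assms unfolding openin_units[OF vP] by blast
  obtain n where n: "(1/2::real) ^ n < e" using real_arch_pow_inv[of e "1/2"] e by auto
  have "HU P (Suc n) \<subseteq> V"
  proof
    fix Y assume Y: "Y \<in> HU P (Suc n)"
    then have "Y \<in> KU (fp P)" using hu_lu[of "Suc n"] local_units_sub by blast
    moreover have "aK (Y \<ominus>\<^bsub>KP\<^esub> \<one>\<^bsub>KP\<^esub>) \<le> 1/2^Suc n" using Y higher_units apx_1 by auto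
    moreover have "1/2^Suc n \<le> (1/2::real)^n" by (simp add: power_divide divide_simps)
    ultimately show "Y \<in> V" using e n by (meson le_less_trans order_trans)
  qed
  then show thesis using that[of "Suc n"] by simp
qed

end

end

section \<open>Ideles and their characters\<close>

context euclid_field
begin

abbreviation "IG \<equiv> idele_group F"
abbreviation "KK v \<equiv> completion F v"

lemma IG_mult: "v \<in> places F \<Longrightarrow> (x \<otimes>\<^bsub>IG\<^esub> y) v = x v \<otimes>\<^bsub>KK v\<^esub> y v"
  by (simp add: idele_group_def)
lemma IG_one: "v \<in> places F \<Longrightarrow> \<one>\<^bsub>IG\<^esub> v = \<one>\<^bsub>KK v\<^esub>"
  by (simp add: idele_group_def)

lemma IG_I: assumes "\<And>v. v \<in> places F \<Longrightarrow> x v \<in> KU v" "\<And>v. v \<notin> places F \<Longrightarrow> x v = undefined"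
  "finite B" "\<And>P. P \<in> FP \<Longrightarrow> P \<notin> B \<Longrightarrow> x (fp P) \<in> LU P"
  shows "x \<in> carrier IG"
proof -
  have "{P \<in> FP. x (fp P) \<notin> LU P} \<subseteq> B" using assms by blast
  then have "finite {P \<in> FP. x (fp P) \<notin> LU P}" using assms finite_subset by blast
  then show ?thesis using assms by (simp add: idele_group_def PiE_iff extensional_def)
qed

lemma IG_D: assumes "x \<in> carrier IG"
  shows "v \<in> places F \<Longrightarrow> x v \<in> KU v" "v \<notin> places F \<Longrightarrow> x v = undefined"
    "finite {P \<in> FP. x (fp P) \<notin> LU P}"
  using assms by (auto simp: idele_group_def PiE_iff extensional_def)

lemma K_comm_monoid: "v \<in> places F \<Longrightarrow> comm_monoid (KK v)"
  using K_cring cring.axioms(2) by blast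

lemma units_mult: "v \<in> places F \<Longrightarrow> X \<in> KU v \<Longrightarrow> Y \<in> KU v \<Longrightarrow> X \<otimes>\<^bsub>KK v\<^esub> Y \<in> KU v"
  by (rule monoid.Units_m_closed[OF comm_monoid.axioms(1)[OF K_comm_monoid]])
lemma units_one: "v \<in> places F \<Longrightarrow> \<one>\<^bsub>KK v\<^esub> \<in> KU v"
  by (rule monoid.Units_one_closed[OF comm_monoid.axioms(1)[OF K_comm_monoid]])
lemma units_carrier: "v \<in> places F \<Longrightarrow> X \<in> KU v \<Longrightarrow> X \<in> carrier (KK v)"
  by (auto simp: Units_def)
lemma units_inv: assumes "v \<in> places F" "X \<in> KU v"
  obtains Y where "Y \<in> KU v" "X \<otimes>\<^bsub>KK v\<^esub> Y = \<one>\<^bsub>KK v\<^esub>" "Y \<otimes>\<^bsub>KK v\<^esub> X = \<one>\<^bsub>KK v\<^esub>"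
  using assms by (auto simp: Units_def)

lemma IG_ext: "x \<in> carrier IG \<Longrightarrow> y \<in> carrier IG \<Longrightarrow> (\<And>v. v \<in> places F \<Longrightarrow> x v = y v) \<Longrightarrow> x = y"
  using IG_D(2) by (metis ext)

lemma IG_mult_closed: assumes x: "x \<in> carrier IG" and y: "y \<in> carrier IG" shows "x \<otimes>\<^bsub>IG\<^esub> y \<in> carrier IG"
proof (rule IG_I[of _ "{P \<in> FP. x (fp P) \<notin> LU P} \<union> {P \<in> FP. y (fp P) \<notin> LU P}"])
  show "(x \<otimes>\<^bsub>IG\<^esub> y) v \<in> KU v" if "v \<in> places F" for v
    using that IG_D(1)[OF x] IG_D(1)[OF y] units_mult by (simp add: IG_mult)
  show "(x \<otimes>\<^bsub>IG\<^esub> y) v = undefined" if "v \<notin> places F" for v using that by (simp add: idele_group_def)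
  show "(x \<otimes>\<^bsub>IG\<^esub> y) (fp P) \<in> LU P" if "P \<in> FP"
    "P \<notin> {P \<in> FP. x (fp P) \<notin> LU P} \<union> {P \<in> FP. y (fp P) \<notin> LU P}" for P
    using that by (auto simp: IG_mult intro: lu_mult)
qed (use IG_D(3)[OF x] IG_D(3)[OF y] in auto)

lemma IG_one_closed: "\<one>\<^bsub>IG\<^esub> \<in> carrier IG"
  by (rule IG_I[of _ "{}"]) (auto simp: idele_group_def units_one lu_one)

lemma IG_comm_monoid: "comm_monoid IG"
proof (rule comm_monoidI)
  fix x y z assume x: "x \<in> carrier IG" and y: "y \<in> carrier IG" and z: "z \<in> carrier IG"
  { fix v assume v: "v \<in> places F"
    interpret comm_monoid "KK v" by (rule K_comm_monoid[OF v])
    have c: "x v \<in> carrier (KK v)" "y v \<in> carrier (KK v)" "z v \<in> carrier (KK v)"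
      using IG_D(1) x y z v units_carrier by auto
    then have "x v \<otimes>\<^bsub>KK v\<^esub> y v \<otimes>\<^bsub>KK v\<^esub> z v = x v \<otimes>\<^bsub>KK v\<^esub> (y v \<otimes>\<^bsub>KK v\<^esub> z v)"
       "x v \<otimes>\<^bsub>KK v\<^esub> y v = y v \<otimes>\<^bsub>KK v\<^esub> x v" "\<one>\<^bsub>KK v\<^esub> \<otimes>\<^bsub>KK v\<^esub> x v = x v"
      by (simp_all add: m_assoc, simp add: m_comm) }
  note c = this
  show "x \<otimes>\<^bsub>IG\<^esub> y \<otimes>\<^bsub>IG\<^esub> z = x \<otimes>\<^bsub>IG\<^esub> (y \<otimes>\<^bsub>IG\<^esub> z)"
    by (rule IG_ext) (auto simp: IG_mult c(1) x y z intro!: IG_mult_closed)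
  show "x \<otimes>\<^bsub>IG\<^esub> y = y \<otimes>\<^bsub>IG\<^esub> x"
    by (rule IG_ext) (auto simp: IG_mult c(2) x y z intro!: IG_mult_closed)
  show "\<one>\<^bsub>IG\<^esub> \<otimes>\<^bsub>IG\<^esub> x = x"
    by (rule IG_ext) (auto simp: IG_mult IG_one c(3) x y z intro!: IG_mult_closed IG_one_closed)
qed (auto intro: IG_mult_closed IG_one_closed)

lemma principal_closed: assumes "a \<in> F" "a \<noteq> 0" shows "principal_idele F a \<in> carrier IG"
proof (rule IG_I[of _ "{P \<in> FP. val P a \<noteq> 0}"])
  show "principal_idele F a v \<in> KU v" if "v \<in> places F" for v
    using that embed_units[OF that assms] by (simp add: principal_idele_def)
  show "principal_idele F a (fp P) \<in> LU P" if "P \<in> FP" "P \<notin> {P \<in> FP. val P a \<noteq> 0}" for P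
    using that assms lu_embed[of P a] vunit_val[of P a] by (simp add: principal_idele_def)
qed (use finite_val assms in \<open>auto simp: principal_idele_def\<close>)

lemma principal_one: "principal_idele F 1 = \<one>\<^bsub>IG\<^esub>"
  by (auto simp: principal_idele_def idele_group_def embed_one intro!: restrict_ext)

abbreviation "lid P \<equiv> local_idele F (fp P)"

lemma local_idele_closed: assumes "v \<in> places F" "X \<in> KU v" shows "local_idele F v X \<in> carrier IG"
proof (rule IG_I[of _ "{P. v = fp P}"])
  show "finite {P. v = fp P}" by (cases v) auto
qed (use assms units_one lu_one in \<open>auto simp: local_idele_def\<close>)

lemma local_idele_mult: assumes v: "v \<in> places F" and X: "X \<in> KU v" "Y \<in> KU v"
  shows "local_idele F v (X \<otimes>\<^bsub>KK v\<^esub> Y) = local_idele F v X \<otimes>\<^bsub>IG\<^esub> local_idele F v Y"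
proof (rule IG_ext)
  fix w assume w: "w \<in> places F"
  interpret comm_monoid "KK w" by (rule K_comm_monoid[OF w])
  show "local_idele F v (X \<otimes>\<^bsub>KK v\<^esub> Y) w = (local_idele F v X \<otimes>\<^bsub>IG\<^esub> local_idele F v Y) w"
    using w by (simp add: IG_mult local_idele_def)
qed (auto intro!: local_idele_closed IG_mult_closed v X units_mult)

lemma local_idele_one: "v \<in> places F \<Longrightarrow> local_idele F v \<one>\<^bsub>KK v\<^esub> = \<one>\<^bsub>IG\<^esub>"
  by (auto simp: local_idele_def idele_group_def fun_eq_iff restrict_def)

text \<open>For positive \<open>n\<close> a subgroup, given by congruences at the places in
  \<open>T\<close> and by units at the other finite places. The archimedean component is
  unrestricted, so a character trivial on a box ignores infinity.\<close>

definition box :: "complex set set \<Rightarrow> nat \<Rightarrow> idele set" where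
  "box T n = {x \<in> carrier IG. \<forall>P\<in>FP.
     x (fp P) \<in> (if P \<in> T then HU P n else LU P)}"

lemma hu_mono: "P \<in> FP \<Longrightarrow> m \<le> n \<Longrightarrow> HU P n \<subseteq> HU P m"
  using apx_mono[of P n _ 1 m] by (auto simp: higher_units)

lemma box_mono: "T \<subseteq> T' \<Longrightarrow> m \<le> n \<Longrightarrow> m > 0 \<Longrightarrow> box T' n \<subseteq> box T m"
  using hu_mono hu_lu[of _ n] unfolding box_def by (fastforce split: if_splits)

section \<open>Sign characters and their continuity\<close>

definition sign_hom :: "(idele \<Rightarrow> complex) \<Rightarrow> bool" where
  "sign_hom \<psi> \<longleftrightarrow> (\<forall>x\<in>carrier IG. \<psi> x = 1 \<or> \<psi> x = -1) \<and>
     (\<forall>x\<in>carrier IG. \<forall>y\<in>carrier IG. \<psi> (x \<otimes>\<^bsub>IG\<^esub> y) = \<psi> x * \<psi> y)"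

text \<open>Unlike \<open>quadratic_char\<close> this admits the trivial character, so that products
  need no case distinction.\<close>

definition qchar :: "(idele \<Rightarrow> complex) \<Rightarrow> bool" where
  "qchar \<psi> \<longleftrightarrow> idele_class_char F \<psi> \<and> sign_hom \<psi>"

text \<open>The open set consists of all units at infinity and of \<open>x\<close> times the
  prescribed subgroup elsewhere. At almost all places \<open>x\<close> is a unit, so that factor is
  the local unit group, as the restricted product demands.\<close>

lemma box_open:
  assumes x: "x \<in> carrier IG" and T: "finite T" and n: "n > 0"
  shows "\<exists>B. openin (idele_topology F) B \<and> x \<in> B \<and> (\<forall>z\<in>B. \<exists>h\<in>box T n. z = x \<otimes>\<^bsub>IG\<^esub> h)"
proof -
  define H where "H P = (if P \<in> T then HU P n else LU P)" for P
  define V where "V v = (case v of Inf_place \<Rightarrow> KU v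
      | fp P \<Rightarrow> {x v \<otimes>\<^bsub>KK v\<^esub> Z | Z. Z \<in> H P})" for v
  define B where "B = (\<Pi>\<^sub>E v\<in>places F. V v)"
  have Vo: "openin (subtopology (completion_topology F v) (KU v)) (V v)" if "v \<in> places F" for v
  proof (cases v)
    case (Fin_place P)
    then have P: "P \<in> FP" using that by simp
    have "openin (subtopology (completion_topology F (fp P)) (KU (fp P)))
        {x (fp P) \<otimes>\<^bsub>KP P\<^esub> Z | Z. Z \<in> H P}"
      using IG_D(1)[OF x] P n by (intro open_coset) (auto simp: H_def)
    then show ?thesis by (simp add: V_def Fin_place)
  qed (use open_units that in \<open>auto simp: V_def\<close>)
  have HU: "H P \<subseteq> LU P" if "P \<in> FP" for P using that hu_lu n by (simp add: H_def)
  have one: "\<one>\<^bsub>KP P\<^esub> \<in> H P" if P: "P \<in> FP" for P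
  proof -
    have "emb P 1 \<in> H P" using P lu_embed[OF P, of 1] hu_embed[OF P, of 1 n] by (simp add: H_def)
    then show ?thesis using embed_one[of "fp P"] P by simp
  qed
  have Vlu: "V (fp P) = LU P" if P: "P \<in> FP" and xP: "x (fp P) \<in> LU P" "P \<notin> T" for P
  proof -
    interpret comm_monoid "KP P" using K_comm_monoid P by simp
    obtain Y where Y: "Y \<in> LU P" "x (fp P) \<otimes>\<^bsub>KP P\<^esub> Y = \<one>\<^bsub>KP P\<^esub>"
    proof -
      obtain Y where Y: "Y \<in> carrier (local_int_ring F P)" "x (fp P) \<otimes>\<^bsub>KP P\<^esub> Y = \<one>\<^bsub>KP P\<^esub>"
         "Y \<otimes>\<^bsub>KP P\<^esub> x (fp P) = \<one>\<^bsub>KP P\<^esub>" "x (fp P) \<in> carrier (local_int_ring F P)"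
        using xP(1) unfolding local_units_def Units_def by (auto simp: OK_simps[OF P])
      then have "Y \<in> LU P" unfolding local_units_def Units_def by (auto simp: OK_simps[OF P])
      then show thesis using that Y by blast
    qed
    show ?thesis
    proof
      show "V (fp P) \<subseteq> LU P" using lu_mult[OF P] xP by (auto simp: V_def H_def)
      show "LU P \<subseteq> V (fp P)"
      proof
        fix Z assume Z: "Z \<in> LU P"
        have c: "x (fp P) \<in> carrier (KP P)" "Y \<in> carrier (KP P)" "Z \<in> carrier (KP P)"
          using xP Y Z local_units[OF P] by auto
        have "Z = x (fp P) \<otimes>\<^bsub>KP P\<^esub> (Y \<otimes>\<^bsub>KP P\<^esub> Z)" using c Y by (simp flip: m_assoc)
        then show "Z \<in> V (fp P)" using lu_mult[OF P Y(1) Z] xP by (auto simp: V_def H_def)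
      qed
    qed
  qed
  have "{P \<in> FP. V (fp P) \<noteq> LU P} \<subseteq> T \<union> {P \<in> FP. x (fp P) \<notin> LU P}"
    using Vlu by blast
  then have "finite {P \<in> FP. V (fp P) \<noteq> LU P}" using T IG_D(3)[OF x] by (meson finite_UnI finite_subset)
  then have "openin (idele_topology F) B"
    unfolding idele_topology_def B_def using Vo by (intro topology_generated_by_Basis) auto
  moreover have "x \<in> B"
  proof -
    have "x v \<in> V v" if v: "v \<in> places F" for v
    proof (cases v)
      case (Fin_place P)
      then have P: "P \<in> FP" using v by simp
      interpret comm_monoid "KK v" using K_comm_monoid v by simp
      have "x v = x v \<otimes>\<^bsub>KK v\<^esub> \<one>\<^bsub>KK v\<^esub>" using units_carrier[OF v] IG_D(1)[OF x v] by simp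
      then show ?thesis using one[OF P] Fin_place by (auto simp: V_def)
    qed (use IG_D(1)[OF x v] in \<open>auto simp: V_def\<close>)
    then show ?thesis using IG_D(2)[OF x] by (auto simp: B_def PiE_iff extensional_def)
  qed
  moreover have "\<exists>h\<in>box T n. z = x \<otimes>\<^bsub>IG\<^esub> h" if z: "z \<in> B" for z
  proof -
    have "\<exists>h. h \<in> KU v \<and> z v = x v \<otimes>\<^bsub>KK v\<^esub> h \<and> (\<forall>P. v = fp P \<longrightarrow> h \<in> H P)" if v: "v \<in> places F" for v
    proof (cases v)
      case (Fin_place P)
      then have P: "P \<in> FP" using v by simp
      have "z v \<in> V v" using z v by (auto simp: B_def)
      then obtain h where "h \<in> H P" "z v = x v \<otimes>\<^bsub>KK v\<^esub> h" by (auto simp: V_def Fin_place)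
      then show ?thesis using HU[OF P] local_units_sub[OF P] Fin_place by auto
    next
      case Inf_place
      have "z v \<in> V v" using z v by (auto simp: B_def)
      then have zv: "z v \<in> KU v" by (simp add: V_def Inf_place)
      interpret comm_monoid "KK v" using K_comm_monoid v by simp
      obtain Y where Y: "Y \<in> KU v" "x v \<otimes>\<^bsub>KK v\<^esub> Y = \<one>\<^bsub>KK v\<^esub>"
        by (rule units_inv[OF v IG_D(1)[OF x v]])
      have c: "x v \<in> carrier (KK v)" "Y \<in> carrier (KK v)" "z v \<in> carrier (KK v)"
        using units_carrier[OF v] zv IG_D(1)[OF x v] Y(1) by blast+
      have zY: "z v = x v \<otimes>\<^bsub>KK v\<^esub> (Y \<otimes>\<^bsub>KK v\<^esub> z v)"
        unfolding m_assoc[OF c, symmetric] Y(2) using c(3) by simp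
      show ?thesis
        by (rule exI[of _ "Y \<otimes>\<^bsub>KK v\<^esub> z v"], intro conjI)
          (rule units_mult[OF v Y(1) zv], rule zY, simp add: Inf_place)
    qed
    then obtain h where h0: "\<And>v. v \<in> places F \<Longrightarrow> h v \<in> KU v \<and> z v = x v \<otimes>\<^bsub>KK v\<^esub> h v \<and> (\<forall>P. v = fp P \<longrightarrow> h v \<in> H P)"
      by metis
    have h: "v \<in> places F \<Longrightarrow> h v \<in> KU v" "v \<in> places F \<Longrightarrow> z v = x v \<otimes>\<^bsub>KK v\<^esub> h v"
      "P \<in> FP \<Longrightarrow> h (fp P) \<in> H P" for v P using h0[of v] h0[of "fp P"] by simp_all
    have hl: "P \<in> FP \<Longrightarrow> h (fp P) \<in> LU P" for P using h(3) HU by blast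
    define h' where "h' = restrict h (places F)"
    have h'c: "h' \<in> carrier IG"
      by (rule IG_I[of _ "{}"]) (use h(1) hl in \<open>auto simp: h'_def\<close>)
    then have "h' \<in> box T n" using h(3) by (auto simp: box_def h'_def H_def split: if_splits)
    moreover have "z = x \<otimes>\<^bsub>IG\<^esub> h'"
    proof
      fix v show "z v = (x \<otimes>\<^bsub>IG\<^esub> h') v"
      proof (cases "v \<in> places F")
        case False then show ?thesis using IG_D(2)[OF IG_mult_closed[OF x h'c]] z by (auto simp: B_def PiE_iff extensional_def)
      qed (use h(2) in \<open>simp add: IG_mult h'_def\<close>)
    qed
    ultimately show ?thesis by blast
  qed
  ultimately show ?thesis by blast
qed

lemma topspace_idele: "topspace (idele_topology F) = carrier IG"
proof
  show "carrier IG \<subseteq> topspace (idele_topology F)"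
  proof
    fix x assume "x \<in> carrier IG"
    then obtain B where "openin (idele_topology F) B" "x \<in> B" using box_open[of x "{}" 1] by auto
    then show "x \<in> topspace (idele_topology F)" using openin_subset by blast
  qed
  show "topspace (idele_topology F) \<subseteq> carrier IG"
    unfolding idele_topology_def topology_generated_by_topspace
  proof safe
    fix x V assume V: "\<forall>v\<in>places F. openin (subtopology (completion_topology F v) (KU v)) (V v)"
      "finite {P \<in> FP. V (fp P) \<noteq> LU P}" "x \<in> (\<Pi>\<^sub>E v\<in>places F. V v)"
    have "V v \<subseteq> KU v" if "v \<in> places F" for v
      using V(1) that openin_subset by fastforce
    then show "x \<in> carrier IG" using V by (intro IG_I[of _ "{P \<in> FP. V (fp P) \<noteq> LU P}"]) (auto simp: PiE_iff extensional_def)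
  qed
qed

text \<open>The homomorphism is constant on cosets of the box, and these contain open neighbourhoods
  by \<open>box_open\<close>.\<close>

lemma sign_hom_continuous:
  assumes s: "sign_hom \<psi>" and b: "finite T" "n > 0" "\<And>x. x \<in> box T n \<Longrightarrow> \<psi> x = 1"
  shows "continuous_map (idele_topology F) (top_of_set (sphere 0 1)) \<psi>"
  unfolding continuous_map_def topspace_idele
proof (intro conjI allI impI)
  have ns: "\<psi> x \<in> sphere 0 1" if "x \<in> carrier IG" for x using s that unfolding sign_hom_def by fastforce
  then show "\<psi> \<in> carrier IG \<rightarrow> topspace (top_of_set (sphere 0 1))" by auto
  fix U :: "complex set" assume "openin (top_of_set (sphere 0 1)) U"
  show "openin (idele_topology F) {x \<in> carrier IG. \<psi> x \<in> U}"
  proof (subst openin_subopen, intro ballI)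
    fix x assume x: "x \<in> {x \<in> carrier IG. \<psi> x \<in> U}"
    obtain B where B: "openin (idele_topology F) B" "x \<in> B" "\<And>z. z \<in> B \<Longrightarrow> \<exists>h\<in>box T n. z = x \<otimes>\<^bsub>IG\<^esub> h"
      using box_open[of x T n] x b by blast
    have "z \<in> {x \<in> carrier IG. \<psi> x \<in> U}" if z: "z \<in> B" for z
    proof -
      obtain h where h: "h \<in> box T n" "z = x \<otimes>\<^bsub>IG\<^esub> h" using B(3)[OF z] by blast
      then have hc: "h \<in> carrier IG" by (simp add: box_def)
      then have "\<psi> z = \<psi> x * \<psi> h" using s x h unfolding sign_hom_def by blast
      then show ?thesis using b(3)[OF h(1)] h(2) IG_mult_closed hc x by auto
    qed
    then show "\<exists>T. openin (idele_topology F) T \<and> x \<in> T \<and> T \<subseteq> {x \<in> carrier IG. \<psi> x \<in> U}" using B by blast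
  qed
qed

lemma qcharI:
  assumes s: "sign_hom \<psi>" and b: "finite T" "n > 0" "\<And>x. x \<in> box T n \<Longrightarrow> \<psi> x = 1"
    and p: "\<And>a. a \<in> F \<Longrightarrow> a \<noteq> 0 \<Longrightarrow> \<psi> (principal_idele F a) = 1"
  shows "qchar \<psi>"
proof -
  have "\<psi> \<in> hom IG circle_group"
  proof (rule homI)
    fix x assume "x \<in> carrier IG" then show "\<psi> x \<in> carrier circle_group"
      using s unfolding sign_hom_def circle_group_def by fastforce
  next
    fix x y assume "x \<in> carrier IG" "y \<in> carrier IG" then show "\<psi> (x \<otimes>\<^bsub>IG\<^esub> y) = \<psi> x \<otimes>\<^bsub>circle_group\<^esub> \<psi> y"
      using s unfolding sign_hom_def circle_group_def by simp
  qed
  then show ?thesis unfolding qchar_def idele_class_char_def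
    using sign_hom_continuous[OF s b] s p by auto
qed

lemma qchar_mult: "qchar \<psi> \<Longrightarrow> x \<in> carrier IG \<Longrightarrow> y \<in> carrier IG \<Longrightarrow> \<psi> (x \<otimes>\<^bsub>IG\<^esub> y) = \<psi> x * \<psi> y"
  unfolding qchar_def sign_hom_def by blast
lemma qchar_sign: "qchar \<psi> \<Longrightarrow> x \<in> carrier IG \<Longrightarrow> \<psi> x = 1 \<or> \<psi> x = -1"
  unfolding qchar_def sign_hom_def by blast
lemma qchar_sq: "qchar \<psi> \<Longrightarrow> x \<in> carrier IG \<Longrightarrow> \<psi> x * \<psi> x = 1"
  using qchar_sign[of \<psi> x] by auto
lemma qchar_principal: "qchar \<psi> \<Longrightarrow> a \<in> F \<Longrightarrow> a \<noteq> 0 \<Longrightarrow> \<psi> (principal_idele F a) = 1"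
  unfolding qchar_def idele_class_char_def by blast
lemma qchar_one: "qchar \<psi> \<Longrightarrow> \<psi> \<one>\<^bsub>IG\<^esub> = 1"
  using qchar_principal[of \<psi> 1] principal_one by simp

lemma quadratic_qchar: "quadratic_char F \<psi> \<longleftrightarrow> qchar \<psi> \<and> \<not> char_eq F \<psi> trivial_char"
proof -
  have "sign_hom \<psi>" if i: "idele_class_char F \<psi>" and q: "char_eq F (char_mult \<psi> \<psi>) trivial_char"
    unfolding sign_hom_def
  proof (intro conjI ballI)
    fix x assume "x \<in> carrier IG"
    then have "\<psi> x * \<psi> x = 1" using q by (simp add: char_eq_def char_mult_def trivial_char_def)
    then show "\<psi> x = 1 \<or> \<psi> x = - 1" by (simp add: square_eq_1_iff)
  next
    fix x y assume "x \<in> carrier IG" "y \<in> carrier IG"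
    then show "\<psi> (x \<otimes>\<^bsub>IG\<^esub> y) = \<psi> x * \<psi> y" using i unfolding idele_class_char_def hom_def circle_group_def by auto
  qed
  moreover have "char_eq F (char_mult \<psi> \<psi>) trivial_char" if "qchar \<psi>"
    using qchar_sq[OF that] by (simp add: char_eq_def char_mult_def trivial_char_def)
  ultimately show ?thesis unfolding quadratic_char_def by (auto simp: qchar_def)
qed

definition open_family :: "(place \<Rightarrow> (nat \<Rightarrow> complex) set set) \<Rightarrow> bool" where
  "open_family V \<longleftrightarrow>
     (\<forall>v\<in>places F. openin (subtopology (completion_topology F v) (KU v)) (V v)) \<and>
     finite {P \<in> FP. V (fp P) \<noteq> LU P}"

text \<open>The generating boxes are closed under binary intersections, so they form a basis. The
  induction over the generated topology makes this explicit.\<close>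

lemma open_box:
  assumes "openin (idele_topology F) U" "x \<in> U"
  shows "\<exists>V. open_family V \<and> x \<in> (\<Pi>\<^sub>E v\<in>places F. V v) \<and> (\<Pi>\<^sub>E v\<in>places F. V v) \<subseteq> U"
proof -
  let ?S = "{(\<Pi>\<^sub>E v\<in>places F. V v) | V. open_family V}"
  have "generate_topology_on ?S U"
    using assms(1) unfolding idele_topology_def openin_topology_generated_by_iff open_family_def .
  then show ?thesis using assms(2)
  proof (induction arbitrary: x)
    case Empty then show ?case by simp
  next
    case (Int a b)
    obtain V where V: "open_family V" "x \<in> (\<Pi>\<^sub>E v\<in>places F. V v)" "(\<Pi>\<^sub>E v\<in>places F. V v) \<subseteq> a"
      using Int.IH(1)[of x] Int.prems by auto
    obtain W where W: "open_family W" "x \<in> (\<Pi>\<^sub>E v\<in>places F. W v)" "(\<Pi>\<^sub>E v\<in>places F. W v) \<subseteq> b"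
      using Int.IH(2)[of x] Int.prems by auto
    have e: "(\<Pi>\<^sub>E v\<in>places F. V v \<inter> W v) = (\<Pi>\<^sub>E v\<in>places F. V v) \<inter> (\<Pi>\<^sub>E v\<in>places F. W v)" by (auto simp: PiE_iff)
    have "{P \<in> FP. V (fp P) \<inter> W (fp P) \<noteq> LU P} \<subseteq>
       {P \<in> FP. V (fp P) \<noteq> LU P} \<union> {P \<in> FP. W (fp P) \<noteq> LU P}" by auto
    then have "finite {P \<in> FP. V (fp P) \<inter> W (fp P) \<noteq> LU P}"
      using V(1) W(1) unfolding open_family_def by (meson finite_UnI finite_subset)
    then have "open_family (\<lambda>v. V v \<inter> W v)" using V(1) W(1) unfolding open_family_def by auto
    then show ?case using V(2,3) W(2,3) e by (intro exI[of _ "\<lambda>v. V v \<inter> W v"]) auto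
  next
    case (UN K)
    then obtain k where k: "k \<in> K" "x \<in> k" by blast
    obtain V where V: "open_family V" "x \<in> (\<Pi>\<^sub>E v\<in>places F. V v)" "(\<Pi>\<^sub>E v\<in>places F. V v) \<subseteq> k"
      using UN.IH[OF k] by auto
    then show ?case using k(1) by (intro exI[of _ V]) auto
  next
    case (Basis s)
    then obtain V where "open_family V" "s = (\<Pi>\<^sub>E v\<in>places F. V v)" by blast
    then show ?case using Basis.prems by auto
  qed
qed

text \<open>A neighbourhood of 1 is mapped into the right half plane, where 1 is the only sign. At
  the finite places the neighbourhood contains the conditions of a box; at infinity it is only known
  to contain 1, hence the component there is fixed.\<close>

lemma qchar_box:
  assumes q: "qchar \<psi>"
  shows "\<exists>T n. finite T \<and> T \<subseteq> FP \<and> n > 0 \<and>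
    (\<forall>x\<in>box T n. x Inf_place = \<one>\<^bsub>KK Inf_place\<^esub> \<longrightarrow> \<psi> x = 1)"
proof -
  have c: "continuous_map (idele_topology F) (top_of_set (sphere 0 1)) \<psi>" using q unfolding qchar_def idele_class_char_def by blast
  have "openin (top_of_set (sphere 0 1)) (sphere 0 1 \<inter> {z. 0 < Re z})"
    by (intro openin_open_Int open_halfspace_Re_gt)
  then have o: "openin (idele_topology F) {x \<in> carrier IG. \<psi> x \<in> sphere 0 1 \<inter> {z. 0 < Re z}}" (is "openin _ ?U")
    using c unfolding continuous_map_def topspace_idele by blast
  have "\<one>\<^bsub>IG\<^esub> \<in> ?U" using qchar_one[OF q] IG_one_closed by simp
  from open_box[OF o this] obtain V where
    ofam: "open_family V" and V3: "\<one>\<^bsub>IG\<^esub> \<in> (\<Pi>\<^sub>E v\<in>places F. V v)" "(\<Pi>\<^sub>E v\<in>places F. V v) \<subseteq> ?U" by auto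
  have V: "\<And>v. v\<in>places F \<Longrightarrow> openin (subtopology (completion_topology F v) (KU v)) (V v)"
      "finite {P \<in> FP. V (fp P) \<noteq> LU P}"
      "\<one>\<^bsub>IG\<^esub> \<in> (\<Pi>\<^sub>E v\<in>places F. V v)" "(\<Pi>\<^sub>E v\<in>places F. V v) \<subseteq> ?U" using ofam V3 unfolding open_family_def by auto
  define T where "T = {P \<in> FP. V (fp P) \<noteq> LU P}"
  have oneV: "\<one>\<^bsub>KK v\<^esub> \<in> V v" if "v \<in> places F" for v using V(3) that by (auto simp: PiE_iff IG_one)
  have "\<exists>n>0. HU P n \<subseteq> V (fp P)" if "P \<in> T" for P
  proof -
    have P: "P \<in> FP" using that by (simp add: T_def)
    obtain n where "n > 0" "HU P n \<subseteq> V (fp P)"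
      by (rule open_nbhd[OF P V(1)[OF vP[OF P]] oneV[OF vP[OF P]]])
    then show ?thesis by blast
  qed
  then obtain m where m: "\<And>P. P \<in> T \<Longrightarrow> m P > 0 \<and> HU P (m P) \<subseteq> V (fp P)" by metis
  \<comment> \<open>A single level for the box, at least as deep as each of the levels
    \<open>m P\<close>.\<close>
  define n where "n = Suc (\<Sum>P\<in>T. m P)"
  have fT: "finite T" using V(2) by (simp add: T_def)
  have le: "m P \<le> n" if "P \<in> T" for P using member_le_sum[of P T m] that fT by (simp add: n_def)
  have "\<psi> x = 1" if x: "x \<in> box T n" "x Inf_place = \<one>\<^bsub>KK Inf_place\<^esub>" for x
  proof -
    have xc: "x \<in> carrier IG" using x by (simp add: box_def)
    have "x v \<in> V v" if v: "v \<in> places F" for v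
    proof (cases v)
      case (Fin_place P)
      then have P: "P \<in> FP" using v by simp
      show ?thesis
      proof (cases "P \<in> T")
        case True
        then have "x v \<in> HU P n" using x P Fin_place by (auto simp: box_def)
        then show ?thesis using hu_mono[OF P le[OF True]] m[OF True] Fin_place by blast
      next
        case False
        then have "x v \<in> LU P" using x P Fin_place by (auto simp: box_def)
        then show ?thesis using False P Fin_place by (auto simp: T_def)
      qed
    qed (use x oneV[OF v] in auto)
    then have "x \<in> (\<Pi>\<^sub>E v\<in>places F. V v)" using IG_D(2)[OF xc] by (auto simp: PiE_iff extensional_def)
    then have "0 < Re (\<psi> x)" using V(4) by blast
    then show ?thesis using qchar_sign[OF q xc] by auto
  qed
  moreover have "T \<subseteq> FP" "n > 0" by (auto simp: T_def n_def)
  ultimately show ?thesis using fT by blast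
qed

section \<open>Splitting off local components; class number one\<close>

definition repl :: "complex set set \<Rightarrow> idele \<Rightarrow> idele" where
  "repl T x = (\<lambda>v\<in>places F. if v \<in> Fin_place ` T then \<one>\<^bsub>KK v\<^esub> else x v)"

lemma repl_closed: assumes x: "x \<in> carrier IG" shows "repl T x \<in> carrier IG"
  by (rule IG_I[of _ "{P \<in> FP. x (fp P) \<notin> LU P}"])
    (use IG_D[OF x] units_one lu_one in \<open>auto simp: repl_def\<close>)

text \<open>Isolates finitely many components, in such a way that the remaining idele can be placed
  in a box.\<close>

lemma qchar_split:
  assumes q: "qchar \<psi>" and x: "x \<in> carrier IG" and T: "finite T" "T \<subseteq> FP"
  shows "\<psi> x = (\<Prod>P\<in>T. local_char F \<psi> (fp P) (x (fp P))) * \<psi> (repl T x)"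
  using T x
proof (induction T arbitrary: x rule: finite_induct)
  case empty
  have "repl {} x = x" using IG_D(2)[OF empty(2)] by (auto simp: repl_def restrict_def fun_eq_iff)
  then show ?case by simp
next
  case (insert P T)
  have P: "P \<in> FP" using insert by simp
  let ?l = "lid P (x (fp P))"
  have lc: "?l \<in> carrier IG" using local_idele_closed P IG_D(1)[OF insert(5)] by simp
  have rc: "repl {P} x \<in> carrier IG" by (rule repl_closed[OF insert(5)])
  have "x = ?l \<otimes>\<^bsub>IG\<^esub> repl {P} x"
  proof (rule IG_ext[OF insert(5) IG_mult_closed[OF lc rc]])
    fix v assume v: "v \<in> places F"
    interpret comm_monoid "KK v" by (rule K_comm_monoid[OF v])
    have "x v \<in> carrier (KK v)" using units_carrier[OF v] IG_D(1)[OF insert(5) v] by blast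
    then have "x v \<otimes>\<^bsub>KK v\<^esub> \<one>\<^bsub>KK v\<^esub> = x v" "\<one>\<^bsub>KK v\<^esub> \<otimes>\<^bsub>KK v\<^esub> x v = x v" by simp_all
    then show "x v = (?l \<otimes>\<^bsub>IG\<^esub> repl {P} x) v" using v
      by (cases "v = fp P") (auto simp: IG_mult local_idele_def repl_def)
  qed
  then have "\<psi> x = \<psi> ?l * \<psi> (repl {P} x)" using qchar_mult[OF q lc rc] by simp
  also have "\<psi> (repl {P} x) = (\<Prod>Q\<in>T. local_char F \<psi> (fp Q) (repl {P} x (fp Q))) * \<psi> (repl T (repl {P} x))"
    using insert.IH[OF _ rc] insert(4) by simp
  also have "(\<Prod>Q\<in>T. local_char F \<psi> (fp Q) (repl {P} x (fp Q))) = (\<Prod>Q\<in>T. local_char F \<psi> (fp Q) (x (fp Q)))"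
    by (rule prod.cong) (use insert in \<open>auto simp: repl_def\<close>)
  also have "repl T (repl {P} x) = repl (insert P T) x" by (auto simp: repl_def fun_eq_iff restrict_def)
  finally show ?case using insert by (simp add: local_char_def)
qed

lemma val_prod:
  assumes P: "P \<in> FP" and B: "finite B" "\<And>Q. Q \<in> B \<Longrightarrow> g Q \<in> F \<and> g Q \<noteq> 0"
  shows "prod g B \<in> F \<and> prod g B \<noteq> 0 \<and> val P (prod g B) = (\<Sum>Q\<in>B. val P (g Q))"
  using B
proof (induction B rule: finite_induct)
  case (insert x B)
  then have g: "g x \<in> F" "g x \<noteq> 0" "prod g B \<in> F" "prod g B \<noteq> 0" "val P (prod g B) = (\<Sum>Q\<in>B. val P (g Q))" by auto
  then show ?case using insert val_mult[OF P g(1,2,3,4)] F_mult by simp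
qed (simp add: P)

lemma val_powi: "P \<in> FP \<Longrightarrow> x \<in> F \<Longrightarrow> x \<noteq> 0 \<Longrightarrow> val P (x powi k) = k * val P x"
  by (auto simp: power_int_def val_power val_inverse F_inverse)

text \<open>By the ultrametric inequality the absolute values along a Cauchy sequence with nonzero
  limit become constant, so completion adds no new values.\<close>

lemma units_abs: assumes P: "P \<in> FP" and X: "X \<in> KU (fp P)"
  shows "\<exists>b\<in>F - {0}. cabs (fp P) X = av P b"
proof -
  note vP = vP[OF P]
  obtain s where s: "s \<in> carrier (cauchy_ring F (fp P))" "X = cl (fp P) s" using units_cases[OF vP X] by blast
  note sF = C_F[OF vP s(1)]
  define L where "L = cabs (fp P) X"
  have X': "X \<in> carrier (KP P)" "X \<noteq> \<zero>\<^bsub>KP P\<^esub>" using X K_units[OF vP] by auto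
  have L0: "L > 0" using cabs_nonneg[OF vP X'(1)] cabs_0_iff[OF vP X'(1)] X'(2) by (simp add: L_def)
  note lim = cabs_lim[OF vP s(1)]
  have "\<forall>\<^sub>F n in sequentially. av P (s n) > L/2" using order_tendstoD(1)[OF lim, of "L/2"] L0 s by (simp add: L_def)
  then obtain N1 where N1: "\<And>n. n \<ge> N1 \<Longrightarrow> av P (s n) > L/2" by (auto simp: eventually_sequentially)
  obtain N2 where N2: "\<And>m n. m \<ge> N2 \<Longrightarrow> n \<ge> N2 \<Longrightarrow> av P (s m - s n) < L/2" using C_D[OF vP s(1), of "L/2"] L0 by auto
  define N where "N = max N1 N2"
  have "av P (s n) = av P (s N)" if "n \<ge> N" for n
  proof -
    have "av P (s n) \<le> max (av P (s n - s N)) (av P (s N))"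
      using A_ultra[OF vP refl, of "s n - s N" "s N"] sF F_diff by simp
    moreover have "av P (s N) \<le> max (av P (s N - s n)) (av P (s n))"
      using A_ultra[OF vP refl, of "s N - s n" "s n"] sF F_diff by simp
    ultimately show ?thesis using N1[of n] N1[of N] N2[of n N] N2[of N n] that by (auto simp: N_def max_def split: if_splits)
  qed
  then have "\<forall>\<^sub>F n in sequentially. av P (s n) = av P (s N)"
    by (rule eventually_sequentiallyI[of N])
  then have e: "L = av P (s N)" using cabs_eqI[OF vP s(1) tendsto_eventually] s by (simp add: L_def)
  then have "s N \<noteq> 0" using L0 by (auto simp: A_0[OF vP])
  then show ?thesis using e sF[of N] L_def by (intro bexI[of _ "s N"]) auto
qed

text \<open>\<open>a\<close> is the product of the generators of the finitely many primes at which
  \<open>x\<close> is not a unit, to the powers that cancel the valuations of \<open>x\<close>. Each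
  generator is a unit at all other finite places.\<close>

lemma idele_decompose:
  assumes x: "x \<in> carrier IG"
  shows "\<exists>a\<in>F - {0}. \<forall>P\<in>FP. emb P a \<otimes>\<^bsub>KP P\<^esub> x (fp P) \<in> LU P"
proof -
  have "\<exists>b. b \<in> F \<and> b \<noteq> 0 \<and> cabs (fp P) (x (fp P)) = av P b" if P: "P \<in> FP" for P
    using units_abs[OF P] IG_D(1)[OF x, of "fp P"] P by auto
  then obtain b where b: "\<And>P. P \<in> FP \<Longrightarrow> b P \<in> F \<and> b P \<noteq> 0 \<and> cabs (fp P) (x (fp P)) = av P (b P)"
    by metis
  define B where "B = {P \<in> FP. x (fp P) \<notin> LU P}"
  have fB: "finite B" "B \<subseteq> FP" using IG_D(3)[OF x] by (auto simp: B_def)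
  define a where "a = (\<Prod>P\<in>B. ppi P powi (- val P (b P)))"
  have g: "ppi Q powi (- val Q (b Q)) \<in> F \<and> ppi Q powi (- val Q (b Q)) \<noteq> 0" if "Q \<in> B" for Q
    using ppi[of Q] that fB(2) F_powi by auto
  have aF: "a \<in> F \<and> a \<noteq> 0"
  proof (cases "B = {}")
    case False
    then obtain P where "P \<in> FP" using fB by blast
    then show ?thesis using val_prod[OF _ fB(1) g] by (auto simp: a_def)
  qed (simp add: a_def)
  have "emb P a \<otimes>\<^bsub>KP P\<^esub> x (fp P) \<in> LU P" if P: "P \<in> FP" for P
  proof -
    note vP = vP[OF P]
    interpret cring "KP P" by (rule K_cring[OF vP])
    have xP: "x (fp P) \<in> carrier (KP P)" using units_carrier[OF vP] IG_D(1)[OF x vP] by blast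
    have "val P a = (\<Sum>Q\<in>B. val P (ppi Q powi (- val Q (b Q))))" using val_prod[OF P fB(1) g] by (simp add: a_def)
    also have "\<dots> = (\<Sum>Q\<in>B. if Q = P then - val P (b P) else 0)"
    proof (rule sum.cong)
      fix Q assume "Q \<in> B"
      then have Q: "Q \<in> FP" using fB by blast
      show "val P (ppi Q powi (- val Q (b Q))) = (if Q = P then - val P (b P) else 0)"
        using val_powi[OF P ppi(6)[OF Q] ppi(3)[OF Q]] val_ppi[OF Q P] by auto
    qed simp
    also have "\<dots> = (if P \<in> B then - val P (b P) else 0)" using fB(1) by simp
    also have "\<dots> = - val P (b P)"
    proof (cases "P \<in> B")
      case False
      then have "x (fp P) \<in> LU P" using P by (simp add: B_def)
      then have "vunit P (b P)" using local_units[OF P] b[OF P] by (auto simp: vunit_def)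
      then show ?thesis using vunit_val[OF P, of "b P"] b[OF P] by auto
    qed simp
    finally have va: "val P a = - val P (b P)" .
    have aF: "a \<in> F" "a \<noteq> 0" using aF by auto
    have "cabs (fp P) (emb P a \<otimes>\<^bsub>KP P\<^esub> x (fp P)) = av P a * av P (b P)"
      using cabs_mult[OF vP embed_carrier[OF vP aF(1)] xP] cabs_embed[OF vP aF(1)] b[OF P] by simp
    also have "\<dots> = 1" using AP_val[OF P aF] AP_val[OF P, of "b P"] b[OF P] va by (simp flip: power_int_add)
    finally show ?thesis using local_units[OF P] embed_carrier[OF vP aF(1)] xP by simp
  qed
  then show ?thesis using aF by blast
qed

text \<open>After multiplication by a principal idele all finite components are units. Those in
  \<open>T\<close> are covered by the hypothesis on local characters, and what remains lies in the
  box.\<close>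

lemma qchar_trivial:
  assumes q: "qchar \<psi>" and b: "finite T" "T \<subseteq> FP" "n > 0" "\<And>x. x \<in> box T n \<Longrightarrow> \<psi> x = 1"
    and l: "\<And>P X. P \<in> T \<Longrightarrow> X \<in> LU P \<Longrightarrow> local_char F \<psi> (fp P) X = 1"
    and x: "x \<in> carrier IG"
  shows "\<psi> x = 1"
proof -
  obtain a where a: "a \<in> F" "a \<noteq> 0" "\<And>P. P\<in>FP \<Longrightarrow> emb P a \<otimes>\<^bsub>KP P\<^esub> x (fp P) \<in> LU P"
    using idele_decompose[OF x] by blast
  note pc = principal_closed[OF a(1,2)]
  define y where "y = principal_idele F a \<otimes>\<^bsub>IG\<^esub> x"
  have yc: "y \<in> carrier IG" using IG_mult_closed pc x by (simp add: y_def)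
  have yl: "y (fp P) \<in> LU P" if "P \<in> FP" for P
    using a(3)[OF that] that by (simp add: y_def IG_mult principal_idele_def)
  have "repl T y \<in> box T n"
    using repl_closed[OF yc] yl b(2) hu_embed[of _ 1 n] embed_one unfolding box_def repl_def by auto
  then have "\<psi> (repl T y) = 1" by (rule b(4))
  then have "\<psi> y = 1" using qchar_split[OF q yc b(1,2)] l yl b(2) by (simp add: subset_iff)
  then show ?thesis using qchar_mult[OF q pc x] qchar_principal[OF q a(1,2)] by (simp add: y_def)
qed

section \<open>Gluing local signs\<close>

definition local_sgn :: "complex set \<Rightarrow> nat \<Rightarrow> ((nat \<Rightarrow> complex) set \<Rightarrow> complex) \<Rightarrow> bool" where
  "local_sgn P n L \<longleftrightarrow> (\<forall>X\<in>LU P. L X = 1 \<or> L X = -1) \<and>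
     (\<forall>X\<in>LU P. \<forall>Y\<in>LU P. L (X \<otimes>\<^bsub>KP P\<^esub> Y) = L X * L Y) \<and> (\<forall>X\<in>HU P n. L X = 1)"

lemma local_sgnD: assumes "local_sgn P n L"
  shows "X \<in> LU P \<Longrightarrow> L X = 1 \<or> L X = -1" "X \<in> LU P \<Longrightarrow> Y \<in> LU P \<Longrightarrow> L (X \<otimes>\<^bsub>KP P\<^esub> Y) = L X * L Y"
    "X \<in> HU P n \<Longrightarrow> L X = 1"
  using assms unfolding local_sgn_def by blast+

lemma local_sgn_mono: "local_sgn P m L \<Longrightarrow> P \<in> FP \<Longrightarrow> m \<le> n \<Longrightarrow> local_sgn P n L"
  using hu_mono unfolding local_sgn_def by blast

lemma local_sgn_embed: assumes P: "P \<in> FP" and L: "local_sgn P n L"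
  shows "L (emb P 1) = 1" "vunit P a \<Longrightarrow> L (emb P a) = 1 \<or> L (emb P a) = -1"
    "vunit P a \<Longrightarrow> vunit P b \<Longrightarrow> L (emb P (a * b)) = L (emb P a) * L (emb P b)"
    "vunit P a \<Longrightarrow> L (emb P (a ^ k)) = L (emb P a) ^ k"
    "vunit P a \<Longrightarrow> vunit P b \<Longrightarrow> cng P n a b \<Longrightarrow> L (emb P a) = L (emb P b)"
proof -
  have lu: "emb P x \<in> LU P" if "vunit P x" for x using lu_embed[OF P vunit_F[OF P that]] that by blast
  have hu: "L (emb P x) = 1" if "x \<in> F" "cng P n x 1" for x using local_sgnD(3)[OF L] hu_embed[OF P that(1)] that(2) by blast
  show one: "L (emb P 1) = 1" using hu[of 1] cng_refl[OF P] by simp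
  show "vunit P a \<Longrightarrow> L (emb P a) = 1 \<or> L (emb P a) = -1" by (rule local_sgnD(1)[OF L lu])
  have mu: "L (emb P (x * y)) = L (emb P x) * L (emb P y)" if "vunit P x" "vunit P y" for x y
    using local_sgnD(2)[OF L lu[OF that(1)] lu[OF that(2)]] embed_mult[OF vP[OF P] vunit_F[OF P that(1)] vunit_F[OF P that(2)]] by simp
  then show "vunit P a \<Longrightarrow> vunit P b \<Longrightarrow> L (emb P (a * b)) = L (emb P a) * L (emb P b)" .
  show "L (emb P (a ^ k)) = L (emb P a) ^ k" if a: "vunit P a"
    by (induction k) (simp_all add: one mu[OF a vunit_power[OF P a]])
  assume a: "vunit P a" and b: "vunit P b" and c: "cng P n a b"
  have i: "vunit P (a * inverse b)" by (intro vunit_mult[OF P] a vunit_inverse[OF P] b)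
  have "L (emb P (a * inverse b)) = 1" using hu[OF vunit_F[OF P i]] c cng_div[OF P b vunit_F[OF P a]] by blast
  moreover have "a * inverse b * b = a" using vunit_nz[OF P b] by simp
  ultimately show "L (emb P a) = L (emb P b)" using mu[OF i b] by (simp only: mult_1)
qed

text \<open>Since the class number is one, the only obstruction to gluing local sign characters comes from
  the global units.\<close>

lemma qchar_exists:
  assumes T: "finite T" "T \<subseteq> FP" and n: "n > 0"
    and sg: "\<And>P X. P \<in> T \<Longrightarrow> X \<in> LU P \<Longrightarrow> L P X = 1 \<or> L P X = (-1::complex)"
    and mu: "\<And>P X Y. P \<in> T \<Longrightarrow> X \<in> LU P \<Longrightarrow> Y \<in> LU P \<Longrightarrow> L P (X \<otimes>\<^bsub>KP P\<^esub> Y) = L P X * L P Y"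
    and hu: "\<And>P X. P \<in> T \<Longrightarrow> X \<in> HU P n \<Longrightarrow> L P X = 1"
    and un: "\<And>e. e \<in> Oi \<Longrightarrow> nrm e = 1 \<Longrightarrow> (\<Prod>P\<in>T. L P (emb P e)) = 1"
  obtains \<psi> where "qchar \<psi>" "\<And>x. x \<in> box T n \<Longrightarrow> \<psi> x = 1"
    "\<And>x. x \<in> carrier IG \<Longrightarrow> (\<And>P. P \<in> FP \<Longrightarrow> x (fp P) \<in> LU P) \<Longrightarrow> \<psi> x = (\<Prod>P\<in>T. L P (x (fp P)))"
proof -
  let ?s = "\<lambda>P a x. emb P a \<otimes>\<^bsub>KP P\<^esub> x (fp P)"
  define ok where "ok x a \<longleftrightarrow> a \<in> F \<and> a \<noteq> 0 \<and> (\<forall>P\<in>FP. ?s P a x \<in> LU P)" for x a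
  \<comment> \<open>Multiply \<open>x\<close> by a principal idele so that all finite components
    become units, then take the product of the local signs. That the choice of the principal idele
    does not matter is \<open>wd\<close>.\<close>
  define \<psi> where "\<psi> x = (\<Prod>P\<in>T. L P (emb P (SOME a. ok x a) \<otimes>\<^bsub>KP P\<^esub> x (fp P)))" for x
  have okD: "?s P a x \<in> LU P"
    if "ok x a" "P \<in> FP" for x a P using that by (simp add: ok_def)
  have ex: "\<exists>a. ok x a" if "x \<in> carrier IG" for x using idele_decompose[OF that] unfolding ok_def by blast
  have ok: "ok x (SOME a. ok x a)" if "x \<in> carrier IG" for x using ex[OF that] by (rule someI_ex)
  have xK: "x (fp P) \<in> carrier (KP P)" if "x \<in> carrier IG" "P \<in> FP" for x P
    using units_carrier IG_D(1)[OF that(1)] that(2) by simp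
  have wd: "\<psi> x = (\<Prod>P\<in>T. L P (?s P a x))" if x: "x \<in> carrier IG" and a: "ok x a" for x a
  proof -
    define b where "b = (SOME a. ok x a)"
    have b: "ok x b" using ok[OF x] by (simp add: b_def)
    define e where "e = b / a"
    have ab: "a \<in> F" "a \<noteq> 0" "b \<in> F" "b \<noteq> 0" using a b by (auto simp: ok_def)
    then have e: "e \<in> F" "e \<noteq> 0" "b = e * a" by (auto simp: e_def F_divide)
    have mult: "?s P b x =
       emb P e \<otimes>\<^bsub>KP P\<^esub> (?s P a x)" if P: "P \<in> FP" for P
    proof -
      note vP = vP[OF P]
      interpret cring "KP P" by (rule K_cring[OF vP])
      show ?thesis using embed_mult[OF vP e(1) ab(1)] e(3) embed_carrier[OF vP] ab e xK[OF x P] by (simp flip: m_assoc)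
    qed
    \<comment> \<open>Two admissible choices differ by an element that is a unit at every finite
      place, hence by a global unit, whose signs multiply to 1 by \<open>un\<close>.\<close>
    have eu: "vunit P e" if P: "P \<in> FP" for P
    proof -
      note vP = vP[OF P]
      let ?Y = "?s P a x"
      have Y: "?Y \<in> LU P" "emb P e \<otimes>\<^bsub>KP P\<^esub> ?Y \<in> LU P"
        using a b mult[OF P] P by (auto simp: ok_def)
      then have "av P e * 1 = 1" using cabs_mult[OF vP embed_carrier[OF vP e(1)], of ?Y] cabs_embed[OF vP e(1)] local_units[OF P] by simp
      then show ?thesis using e by (simp add: vunit_def)
    qed
    then have "e \<in> Oi" "nrm e = 1" using val_all_zero[OF e(1,2)] vunit_val e by auto
    then have 1: "(\<Prod>P\<in>T. L P (emb P e)) = 1" by (rule un)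
    have "\<psi> x = (\<Prod>P\<in>T. L P (emb P e) * L P (?s P a x))"
      unfolding \<psi>_def b_def[symmetric]
    proof (rule prod.cong)
      fix P assume PT: "P \<in> T"
      then have P: "P \<in> FP" using T by blast
      show "L P (?s P b x) = L P (emb P e) * L P (?s P a x)"
        unfolding mult[OF P] using a P lu_embed[OF P e(1)] eu[OF P] by (intro mu[OF PT]) (auto simp: ok_def)
    qed simp
    then show ?thesis using 1 by (simp add: prod.distrib)
  qed
  have okmult: "ok (x \<otimes>\<^bsub>IG\<^esub> y) (a * b) \<and> (\<forall>P\<in>FP. ?s P (a * b) (x \<otimes>\<^bsub>IG\<^esub> y) =
     (?s P a x) \<otimes>\<^bsub>KP P\<^esub> (?s P b y))"
    if x: "x \<in> carrier IG" and y: "y \<in> carrier IG" and a: "ok x a" and b: "ok y b" for x y a b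
  proof -
    have ab: "a \<in> F" "a \<noteq> 0" "b \<in> F" "b \<noteq> 0" using a b by (auto simp: ok_def)
    have e: "?s P (a * b) (x \<otimes>\<^bsub>IG\<^esub> y) =
     (?s P a x) \<otimes>\<^bsub>KP P\<^esub> (?s P b y)"
      if P: "P \<in> FP" for P
    proof -
      note vP = vP[OF P]
      interpret cring "KP P" by (rule K_cring[OF vP])
      show ?thesis using embed_mult[OF vP ab(1,3)] embed_carrier[OF vP] ab xK[OF x P] xK[OF y P]
        by (simp add: IG_mult[OF vP] m_ac flip: embed_mult[OF vP ab(1,3)])
    qed
    then show ?thesis using a b ab lu_mult F_mult by (auto simp: ok_def)
  qed
  have s: "sign_hom \<psi>" unfolding sign_hom_def
  proof (intro conjI ballI)
    fix x assume x: "x \<in> carrier IG"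
    have pm: "prod f A = 1 \<or> prod f A = -1" if "finite A" "\<And>i. i \<in> A \<Longrightarrow> f i = 1 \<or> f i = (-1::complex)" for f and A :: "complex set set"
      using that
    proof (induction A rule: finite_induct)
      case (insert i A)
      from insert have "f i = 1 \<or> f i = -1" "prod f A = 1 \<or> prod f A = -1" by auto
      then show ?case unfolding prod.insert[OF insert(1,2)] by (elim disjE) simp_all
    qed simp
    show "\<psi> x = 1 \<or> \<psi> x = - 1" unfolding \<psi>_def
      by (rule pm[OF T(1)], rule sg, assumption, rule okD[OF ok[OF x]]) (use T in blast)
  next
    fix x y assume x: "x \<in> carrier IG" and y: "y \<in> carrier IG"
    obtain a b where a: "ok x a" and b: "ok y b" using ex x y by blast
    have "\<psi> (x \<otimes>\<^bsub>IG\<^esub> y) = (\<Prod>P\<in>T. L P (?s P a x) * L P (?s P b y))"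
      unfolding wd[OF IG_mult_closed[OF x y] okmult[OF x y a b, THEN conjunct1]]
    proof (rule prod.cong)
      fix P assume PT: "P \<in> T"
      then have P: "P \<in> FP" using T by blast
      show "L P (?s P (a * b) (x \<otimes>\<^bsub>IG\<^esub> y)) =
        L P (?s P a x) * L P (?s P b y)"
        using okmult[OF x y a b] P mu[OF PT] a b by (auto simp: ok_def)
    qed simp
    then show "\<psi> (x \<otimes>\<^bsub>IG\<^esub> y) = \<psi> x * \<psi> y" by (simp add: wd[OF x a] wd[OF y b] prod.distrib)
  qed
  have unitcase: "\<psi> x = (\<Prod>P\<in>T. L P (x (fp P)))" if x: "x \<in> carrier IG" "\<And>P. P \<in> FP \<Longrightarrow> x (fp P) \<in> LU P" for x
  proof -
    have e: "?s P 1 x = x (fp P)" if P: "P \<in> FP" for P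
    proof -
      interpret cring "KP P" by (rule K_cring[OF vP[OF P]])
      show ?thesis using embed_one[OF vP[OF P]] xK[OF x(1) P] by simp
    qed
    then have "ok x 1" using x by (simp add: ok_def)
    then show ?thesis using wd[OF x(1)] e T by (simp add: subset_iff)
  qed
  have bx: "\<psi> x = 1" if x: "x \<in> box T n" for x
  proof -
    have "x (fp P) \<in> LU P" if "P \<in> FP" for P
      using x that hu_lu[OF that n] by (auto simp: box_def split: if_splits)
    moreover have "x (fp P) \<in> HU P n" if "P \<in> T" for P
    proof -
      have "P \<in> FP" using T(2) that by blast
      then have "x (fp P) \<in> (if P \<in> T then HU P n else LU P)" using x unfolding box_def by blast
      then show ?thesis using that by simp
    qed
    ultimately show ?thesis using unitcase[of x] x hu by (auto simp: box_def intro!: prod.neutral)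
  qed
  have pr: "\<psi> (principal_idele F a) = 1" if a: "a \<in> F" "a \<noteq> 0" for a
  proof -
    have e: "emb P (inverse a) \<otimes>\<^bsub>KP P\<^esub> principal_idele F a (fp P) = \<one>\<^bsub>KP P\<^esub>" if P: "P \<in> FP" for P
      using embed_mult[OF vP[OF P] F_inverse[OF a(1)] a(1)] embed_one[OF vP[OF P]] P a by (simp add: principal_idele_def)
    then have "ok (principal_idele F a) (inverse a)" using a F_inverse lu_one by (simp add: ok_def)
    then have "\<psi> (principal_idele F a) = (\<Prod>P\<in>T. L P \<one>\<^bsub>KP P\<^esub>)" using wd[OF principal_closed[OF a]] e T by (simp add: subset_iff)
    also have "\<dots> = 1"
    proof (rule prod.neutral, rule ballI)
      fix P assume PT: "P \<in> T"
      then have P: "P \<in> FP" using T by blast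
      then show "L P \<one>\<^bsub>KP P\<^esub> = 1" using hu[OF PT] hu_embed[OF P, of 1 n] embed_one[OF vP[OF P]] by simp
    qed
    finally show ?thesis .
  qed
  show thesis using that[of \<psi>] qcharI[OF s T(1) n bx pr] bx unitcase by blast
qed

end

section \<open>Local components and conductors\<close>

context euclid_field
begin

definition lam :: "(idele \<Rightarrow> complex) \<Rightarrow> complex set \<Rightarrow> complex \<Rightarrow> complex" where
  "lam \<psi> P a = local_char F \<psi> (fp P) (emb P a)"

text \<open>Triviality on the \<open>k\<close>-th higher units, tested on elements of the field
  only; for positive \<open>k\<close> this suffices by \<open>hu_triv_iff\<close>.\<close>

definition ltriv :: "(idele \<Rightarrow> complex) \<Rightarrow> complex set \<Rightarrow> nat \<Rightarrow> bool" where
  "ltriv \<psi> P k \<longleftrightarrow> (\<forall>a. vunit P a \<longrightarrow> cng P k a 1 \<longrightarrow> lam \<psi> P a = 1)"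

definition Ram :: "(idele \<Rightarrow> complex) \<Rightarrow> complex set set" where
  "Ram \<psi> = {P \<in> FP. \<exists>a. vunit P a \<and> lam \<psi> P a \<noteq> 1}"

text \<open>Trivial on a box, with no condition at infinity. Over the rationals this excludes
  characters with a sign at the real place; over the Gaussian numbers it holds for every
  \<open>qchar\<close> by \<open>gauss_full\<close>.\<close>

definition full :: "(idele \<Rightarrow> complex) \<Rightarrow> bool" where
  "full \<psi> \<longleftrightarrow> (\<exists>T n. finite T \<and> T \<subseteq> FP \<and> n > 0 \<and> (\<forall>x\<in>box T n. \<psi> x = 1))"

lemma ltriv_mono: "ltriv \<psi> P k \<Longrightarrow> P \<in> FP \<Longrightarrow> k \<le> m \<Longrightarrow> ltriv \<psi> P m"
  using cng_mono unfolding ltriv_def by blast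

context
  fixes \<psi> assumes q: "qchar \<psi>"
begin

context
  fixes P assumes P: "P \<in> FP"
begin

abbreviation "lc \<equiv> local_char F \<psi> (fp P)"

lemma lc_mult: "X \<in> KU (fp P) \<Longrightarrow> Y \<in> KU (fp P) \<Longrightarrow>
  lc (X \<otimes>\<^bsub>KP P\<^esub> Y) = lc X * lc Y"
  unfolding local_char_def local_idele_mult[OF vP[OF P]]
  by (rule qchar_mult[OF q]) (auto intro: local_idele_closed vP[OF P])

lemma lc_sign: "X \<in> KU (fp P) \<Longrightarrow> lc X = 1 \<or> lc X = -1"
  unfolding local_char_def by (rule qchar_sign[OF q local_idele_closed[OF vP[OF P]]])

lemma vunit_units: "vunit P a \<Longrightarrow> emb P a \<in> KU (fp P)"
  using embed_units[OF vP[OF P]] vunit_F[OF P] vunit_nz[OF P] by blast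

lemma lam_mult: "vunit P a \<Longrightarrow> vunit P b \<Longrightarrow> lam \<psi> P (a * b) = lam \<psi> P a * lam \<psi> P b"
  using lc_mult[OF vunit_units vunit_units] embed_mult[OF vP[OF P]] vunit_F[OF P] by (simp add: lam_def)
lemma lam_sign: "vunit P a \<Longrightarrow> lam \<psi> P a = 1 \<or> lam \<psi> P a = -1"
  unfolding lam_def by (rule lc_sign[OF vunit_units])
lemma lam_1: "lam \<psi> P 1 = 1"
  unfolding lam_def local_char_def embed_one[OF vP[OF P]] local_idele_one[OF vP[OF P]] by (rule qchar_one[OF q])
lemma lam_sq: "vunit P a \<Longrightarrow> lam \<psi> P a * lam \<psi> P a = 1"
  using lam_sign[of a] by auto
lemma lam_power: "vunit P a \<Longrightarrow> lam \<psi> P (a ^ n) = lam \<psi> P a ^ n"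
  by (induction n) (auto simp: lam_1 lam_mult vunit_power[OF P])
lemma lam_inverse: "vunit P a \<Longrightarrow> lam \<psi> P (inverse a) = lam \<psi> P a"
proof -
  assume a: "vunit P a"
  have "lam \<psi> P a * lam \<psi> P (inverse a) = 1"
    using lam_mult[OF a vunit_inverse[OF P a]] lam_1 vunit_nz[OF P a] by simp
  then show ?thesis using lam_sign[OF a] lam_sign[OF vunit_inverse[OF P a]] by (elim disjE) simp_all
qed

lemma lam_cng: assumes "ltriv \<psi> P n" "vunit P a" "vunit P b" "cng P n a b" shows "lam \<psi> P a = lam \<psi> P b"
proof -
  have ib: "vunit P (inverse b)" using vunit_inverse[OF P] assms by blast
  have "cng P n (a * inverse b) 1" using cng_div[OF P assms(3) vunit_F[OF P assms(2)]] assms(4) by blast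
  then have "lam \<psi> P (a * inverse b) = 1" using assms(1) vunit_mult[OF P assms(2) ib] unfolding ltriv_def by blast
  then show ?thesis using lam_mult[OF assms(2) ib] lam_inverse[OF assms(3)] lam_sign[OF assms(2)] lam_sign[OF assms(3)] by auto
qed

text \<open>An idele supported at \<open>P\<close> whose component is close to 1 lies in the box of
  \<open>qchar_box\<close> and is 1 at infinity.\<close>

lemma lc_level: "\<exists>n>0. \<forall>X\<in>HU P n. lc X = 1"
proof -
  obtain T n where "finite T" "T \<subseteq> FP" and T: "n > 0" "\<And>x. x \<in> box T n \<Longrightarrow> x Inf_place = \<one>\<^bsub>KK Inf_place\<^esub> \<Longrightarrow> \<psi> x = 1"
    using qchar_box[OF q] by blast
  have "lc X = 1" if X: "X \<in> HU P n" for X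
  proof -
    have Xl: "X \<in> LU P" using X hu_lu[OF P T(1)] by blast
    have one: "\<one>\<^bsub>KP Q\<^esub> \<in> HU Q n" if "Q \<in> FP" for Q
      using that hu_embed[OF that, of 1 n] embed_one[OF vP[OF that]] by simp
    have "lid P X \<in> box T n"
      using local_idele_closed[OF vP[OF P]] Xl local_units_sub[OF P] X lu_one one
      by (auto simp: box_def local_idele_def)
    then show ?thesis unfolding local_char_def by (rule T(2)) (simp add: local_idele_def)
  qed
  then show ?thesis using T(1) by blast
qed

text \<open>Some deep level is trivial by continuity, and an element of the \<open>k\<close>-th
  higher units differs from one of the field by a factor at that level.\<close>

lemma hu_triv_iff: assumes k: "k > 0" shows "(\<forall>X\<in>HU P k. lc X = 1) \<longleftrightarrow> ltriv \<psi> P k"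
proof
  assume "\<forall>X\<in>HU P k. lc X = 1"
  then show "ltriv \<psi> P k" using hu_embed[OF P] vunit_F[OF P] by (auto simp: ltriv_def lam_def)
next
  assume l: "ltriv \<psi> P k"
  obtain n where n: "n > 0" "\<And>X. X\<in>HU P n \<Longrightarrow> lc X = 1" using lc_level by blast
  define m where "m = max n k"
  show "\<forall>X\<in>HU P k. lc X = 1"
  proof
    fix X assume X: "X \<in> HU P k"
    then have Xl: "X \<in> LU P" using hu_lu[OF P k] by blast
    have m0: "m > 0" using n by (simp add: m_def)
    obtain a Y where a: "vunit P a" "Y \<in> HU P m" "X = emb P a \<otimes>\<^bsub>KP P\<^esub> Y" "apx P m X a"
      by (rule lu_decompose[OF P Xl m0])
    have XK: "X \<in> carrier (KP P)" "apx P k X 1" using X higher_units[OF P] by auto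
    have "apx P k X a" using a(4) apx_mono[OF P] m_def by simp
    then have "cng P k a 1" using apx_cng[OF P XK(1) vunit_F[OF P a(1)], of 1 k] XK(2) by simp
    then have "lam \<psi> P a = 1" using l a(1) unfolding ltriv_def by blast
    moreover have "lc Y = 1" using n(2) hu_mono[OF P, of n m] a(2) m_def by auto
    moreover have "Y \<in> KU (fp P)" using a(2) hu_lu[OF P m0] local_units_sub[OF P] by blast
    ultimately show "lc X = 1" using lc_mult[OF vunit_units[OF a(1)]] a(3) by (simp add: lam_def)
  qed
qed

lemma lu_triv_iff: "(\<forall>X\<in>LU P. lc X = 1) \<longleftrightarrow> (\<forall>a. vunit P a \<longrightarrow> lam \<psi> P a = 1)"
proof
  assume "\<forall>X\<in>LU P. lc X = 1"
  then show "\<forall>a. vunit P a \<longrightarrow> lam \<psi> P a = 1" using lu_embed[OF P] vunit_F[OF P] by (auto simp: lam_def)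
next
  assume l: "\<forall>a. vunit P a \<longrightarrow> lam \<psi> P a = 1"
  then have "ltriv \<psi> P 1" by (simp add: ltriv_def)
  then have h: "lc X = 1" if "X \<in> HU P 1" for X using hu_triv_iff[of 1] that by simp
  show "\<forall>X\<in>LU P. lc X = 1"
  proof
    fix X assume Xl: "X \<in> LU P"
    obtain a Y where a: "vunit P a" "Y \<in> HU P 1" "X = emb P a \<otimes>\<^bsub>KP P\<^esub> Y" "apx P 1 X a"
      by (rule lu_decompose[OF P Xl zero_less_one])
    have "Y \<in> KU (fp P)" using a(2) hu_lu[OF P, of 1] local_units_sub[OF P] by auto
    then show "lc X = 1" using lc_mult[OF vunit_units[OF a(1)]] a(3) h[OF a(2)] l a(1) by (simp add: lam_def)
  qed
qed

lemma ltriv_ex: "\<exists>n>0. ltriv \<psi> P n"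
  using lc_level hu_triv_iff by blast

lemma cexp: "cexpo \<psi> P = (LEAST n. n > 0 \<and> ltriv \<psi> P n)"
  unfolding conductor_exponent_def using hu_triv_iff by (metis (no_types, lifting))

lemma cexp_pos: "cexpo \<psi> P > 0" "ltriv \<psi> P (cexpo \<psi> P)"
  using LeastI_ex[OF ltriv_ex[unfolded]] unfolding cexp by auto

lemma cexpI: "n > 0 \<Longrightarrow> ltriv \<psi> P n \<Longrightarrow> (n = 1 \<or> \<not> ltriv \<psi> P (n - 1)) \<Longrightarrow> cexpo \<psi> P = n"
  unfolding cexp
proof (rule Least_equality)
  fix y assume n: "n > 0" "ltriv \<psi> P n" "n = 1 \<or> \<not> ltriv \<psi> P (n - 1)" and y: "0 < y \<and> ltriv \<psi> P y"
  show "n \<le> y"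
  proof (rule ccontr)
    assume "\<not> n \<le> y"
    then have "y \<le> n - 1" "n \<noteq> 1" using y by auto
    then show False using ltriv_mono[OF _ P, of \<psi> y "n - 1"] n y by blast
  qed
qed auto

lemma Ram_iff: "P \<in> Ram \<psi> \<longleftrightarrow> (\<exists>X\<in>LU P. lc X \<noteq> 1)"
  using lu_triv_iff P unfolding Ram_def by blast

end

text \<open>At a place outside the finite set of a box all local units lie in the box.\<close>

lemma finite_Ram: "finite (Ram \<psi>)"
proof -
  obtain T n where T: "finite T" and "T \<subseteq> FP" and T': "n > 0" "\<And>x. x \<in> box T n \<Longrightarrow> x Inf_place = \<one>\<^bsub>KK Inf_place\<^esub> \<Longrightarrow> \<psi> x = 1"
    using qchar_box[OF q] by blast
  have "Ram \<psi> \<subseteq> T"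
  proof (rule ccontr)
    assume "\<not> Ram \<psi> \<subseteq> T"
    then obtain P where P: "P \<in> Ram \<psi>" "P \<notin> T" by blast
    then have Pf: "P \<in> FP" by (simp add: Ram_def)
    then obtain X where X: "X \<in> LU P" "local_char F \<psi> (fp P) X \<noteq> 1" using Ram_iff P by blast
    have one: "\<one>\<^bsub>KP Q\<^esub> \<in> HU Q n" if "Q \<in> FP" for Q
      using that hu_embed[OF that, of 1 n] embed_one[OF vP[OF that]] by simp
    have "lid P X \<in> box T n"
      using local_idele_closed[OF vP[OF Pf]] X(1) local_units_sub[OF Pf] lu_one one P(2)
      by (auto simp: box_def local_idele_def)
    then have "\<psi> (lid P X) = 1" by (rule T'(2)) (simp add: local_idele_def)
    then show False using X(2) by (simp add: local_char_def)
  qed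
  then show ?thesis using T finite_subset by blast
qed

lemma Ram_places: "Ram \<psi> \<subseteq> FP" by (auto simp: Ram_def)

section \<open>The conductor as a principal ideal\<close>

definition cgen :: complex where
  "cgen = (\<Prod>P\<in>Ram \<psi>. ppi P ^ cexpo \<psi> P)"

lemma conductor_cgen: "conductor F \<psi> = pid cgen" "cgen \<in> Oi" "cgen \<noteq> 0"
proof -
  interpret cring RR by (rule R_cring)
  interpret I: comm_monoid "ideals_set RR" by (rule ideals_set_is_comm_monoid)
  let ?f = "\<lambda>P. ideal_pow RR P (cexpo \<psi> P)"
  let ?g = "\<lambda>P. ppi P ^ cexpo \<psi> P"
  have f: "?f P = pid (?g P)" if "P \<in> FP" for P
    using ideal_pow_pid[OF ppi(1)[OF that]] ppi(2)[OF that] by simp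
  have *: "finprod (ideals_set RR) ?f S = pid (prod ?g S) \<and> prod ?g S \<in> Oi \<and> prod ?g S \<noteq> 0" if "finite S" "S \<subseteq> FP" for S
    using that
  proof (induction S rule: finite_induct)
    case empty then show ?case by simp
  next
    case (insert P S)
    have P: "P \<in> FP" using insert by simp
    have gO: "?g P \<in> Oi" "?g P \<noteq> 0" using ppi[OF P] O_power by auto
    have "?f \<in> S \<rightarrow> carrier (ideals_set RR)" using f pid_ideal ppi(1) O_power insert(4) by (auto simp: subset_iff)
    moreover have "?f P \<in> carrier (ideals_set RR)" using f[OF P] pid_ideal gO by simp
    ultimately have "finprod (ideals_set RR) ?f (insert P S) = ideal_prod RR (?f P) (finprod (ideals_set RR) ?f S)"
      using insert by (subst I.finprod_insert) auto
    then show ?case using insert f[OF P] gO ideal_prod_pid O_mult by simp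
  qed
  have "{P \<in> FP. \<exists>X\<in>LU P. lc P X \<noteq> 1} = Ram \<psi>"
    using Ram_iff Ram_places by blast
  then show "conductor F \<psi> = pid cgen" "cgen \<in> Oi" "cgen \<noteq> 0"
    using *[OF finite_Ram Ram_places] by (auto simp: conductor_def cgen_def)
qed

lemma val_cgen: assumes Q: "Q \<in> FP"
  shows "val Q cgen = (if Q \<in> Ram \<psi> then int (cexpo \<psi> Q) else 0)"
proof -
  have "val Q cgen = (\<Sum>P\<in>Ram \<psi>. val Q (ppi P ^ cexpo \<psi> P))"
  proof -
    have g: "ppi P ^ cexpo \<psi> P \<in> F \<and> ppi P ^ cexpo \<psi> P \<noteq> 0" if "P \<in> Ram \<psi>" for P
      using ppi(3,6)[of P] Ram_places that F_power by auto
    show ?thesis using val_prod[OF Q finite_Ram g] by (simp add: cgen_def)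
  qed
  also have "\<dots> = (\<Sum>P\<in>Ram \<psi>. if P = Q then int (cexpo \<psi> Q) else 0)"
  proof (rule sum.cong)
    fix P assume "P \<in> Ram \<psi>"
    then have P: "P \<in> FP" using Ram_places by blast
    show "val Q (ppi P ^ cexpo \<psi> P) = (if P = Q then int (cexpo \<psi> Q) else 0)"
      using val_power[OF Q ppi(6)[OF P] ppi(3)[OF P]] val_ppi[OF P Q] by auto
  qed simp
  finally show ?thesis using finite_Ram by simp
qed

lemma cond_dvd: assumes Q: "Q \<in> FP" shows "ideal_dvd F Q (conductor F \<psi>) \<longleftrightarrow> Q \<in> Ram \<psi>"
proof -
  have "cgen \<in> Q \<longleftrightarrow> val Q cgen \<ge> 1" using val_O_nonneg(2)[OF Q conductor_cgen(2,3)] by blast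
  then show ?thesis unfolding conductor_cgen(1) ideal_dvd_place[OF Q conductor_cgen(2)]
    using val_cgen[OF Q] cexp_pos(1)[OF Q] by auto
qed

lemma cond_ord: assumes Q: "Q \<in> Ram \<psi>" shows "ord_ideal F Q (conductor F \<psi>) = cexpo \<psi> Q"
proof -
  have Qf: "Q \<in> FP" using Q Ram_places by blast
  show ?thesis unfolding conductor_cgen(1) ord_ideal_pid[OF Qf conductor_cgen(2,3)] val_cgen[OF Qf] using Q by simp
qed

end

lemma pid_eq: assumes a: "a \<in> Oi" "a \<noteq> 0" and b: "b \<in> Oi" "b \<noteq> 0" and v: "\<And>P. P \<in> FP \<Longrightarrow> val P a = val P b"
  shows "pid a = pid b"
proof -
  have *: "pid a \<subseteq> pid b" if a: "a \<in> Oi" "a \<noteq> 0" and b: "b \<in> Oi" "b \<noteq> 0" and v: "\<And>P. P \<in> FP \<Longrightarrow> val P a = val P b" for a b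
  proof -
    have F: "a / b \<in> F" "a / b \<noteq> 0" "inverse b \<in> F" using a b by (simp_all add: F_divide F_inverse O_F)
    have "val P (a / b) = 0" if P: "P \<in> FP" for P
      using val_mult[OF P O_F[OF a(1)] a(2) F(3)] val_inverse[OF P O_F[OF b(1)] b(2)] v[OF P] b by (simp add: divide_inverse)
    then have "a / b \<in> Oi" using val_all_nonneg[OF F(1,2)] by simp
    then show ?thesis using pid_subset[OF a(1) b(1)] b by (metis nonzero_eq_divide_eq)
  qed
  show ?thesis using *[OF a b v] *[OF b a] v by auto
qed

section \<open>Products of sign characters\<close>

lemma sign_hom_mult: assumes "sign_hom \<psi>" "sign_hom \<phi>" shows "sign_hom (char_mult \<psi> \<phi>)"
  unfolding sign_hom_def char_mult_def
proof (intro conjI ballI)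
  fix x assume "x \<in> carrier IG"
  then have "\<psi> x = 1 \<or> \<psi> x = -1" "\<phi> x = 1 \<or> \<phi> x = -1" using assms unfolding sign_hom_def by auto
  then show "\<psi> x * \<phi> x = 1 \<or> \<psi> x * \<phi> x = - 1" by (elim disjE) simp_all
next
  fix x y assume "x \<in> carrier IG" "y \<in> carrier IG"
  then show "\<psi> (x \<otimes>\<^bsub>IG\<^esub> y) * \<phi> (x \<otimes>\<^bsub>IG\<^esub> y) = \<psi> x * \<phi> x * (\<psi> y * \<phi> y)" using assms unfolding sign_hom_def by simp
qed

lemma qchar_char_mult: assumes "qchar \<psi>" "qchar \<phi>" "full \<psi>" "full \<phi>" shows "qchar (char_mult \<psi> \<phi>)" "full (char_mult \<psi> \<phi>)"
proof -
  obtain T n where T: "finite T" "T \<subseteq> FP" "n > 0" "\<forall>x\<in>box T n. \<psi> x = 1" using assms(3) unfolding full_def by blast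
  obtain T' n' where T': "finite T'" "T' \<subseteq> FP" "n' > 0" "\<forall>x\<in>box T' n'. \<phi> x = 1" using assms(4) unfolding full_def by blast
  have s: "box (T \<union> T') (max n n') \<subseteq> box T n" "box (T \<union> T') (max n n') \<subseteq> box T' n'" by (rule box_mono; use T T' in simp)+
  have b: "char_mult \<psi> \<phi> x = 1" if "x \<in> box (T \<union> T') (max n n')" for x
    using that s T(4) T'(4) by (auto simp: char_mult_def subset_iff)
  show "full (char_mult \<psi> \<phi>)" unfolding full_def
    by (rule exI[of _ "T \<union> T'"], rule exI[of _ "max n n'"]) (use T T' b in auto)
  show "qchar (char_mult \<psi> \<phi>)"
  proof (rule qcharI[of _ "T \<union> T'" "max n n'"])
    show "sign_hom (char_mult \<psi> \<phi>)" using assms sign_hom_mult unfolding qchar_def by blast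
    show "char_mult \<psi> \<phi> (principal_idele F a) = 1" if "a \<in> F" "a \<noteq> 0" for a
      using qchar_principal[OF assms(1) that] qchar_principal[OF assms(2) that] by (simp add: char_mult_def)
  qed (use T T' b in auto)
qed

lemma lam_char_mult: "lam (char_mult \<psi> \<phi>) P a = lam \<psi> P a * lam \<phi> P a"
  by (simp add: lam_def local_char_def char_mult_def)

text \<open>With class number one and no contribution from infinity, a character is determined by
  its values on the units at ramified places.\<close>

lemma qchar_unram_trivial:
  assumes q: "qchar \<psi>" "full \<psi>" and l: "Ram \<psi> = {}" and x: "x \<in> carrier IG"
  shows "\<psi> x = 1"
proof -
  obtain T n where T: "finite T" "T \<subseteq> FP" "n > 0" "\<And>x. x\<in>box T n \<Longrightarrow> \<psi> x = 1" using q(2) unfolding full_def by blast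
  show ?thesis
  proof (rule qchar_trivial[OF q(1) T(1-4) _ x])
    fix P X assume "P \<in> T" "X \<in> LU P"
    then show "lc \<psi> P X = 1" using Ram_iff[OF q(1), of P] l T(2) by blast
  qed
qed

section \<open>Sign characters of local unit groups\<close>

text \<open>Prescribed signs on generators of the units modulo level \<open>n\<close> extend to a
  sign character as soon as they respect the relations. \<open>gen\<close> expresses generation by
  making \<open>a\<close> times a monomial congruent to 1: values are signs, so an element and its
  inverse have the same value and no inverse has to be formed. Where fewer than three generators are
  wanted, 1 with sign 1 takes the free positions.\<close>

lemma local_sign:
  assumes P: "P \<in> FP" and n: "n > 0" and g: "vunit P g1" "vunit P g2" "vunit P g3"
    and s: "s1 = 1 \<or> s1 = (-1::complex)" "s2 = 1 \<or> s2 = (-1::complex)" "s3 = 1 \<or> s3 = (-1::complex)"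
    and gen: "\<And>a. vunit P a \<Longrightarrow> \<exists>i j k. cng P n (a * (g1 ^ i * g2 ^ j * g3 ^ k)) 1"
    and rel: "\<And>i j k. cng P n (g1 ^ i * g2 ^ j * g3 ^ k) 1 \<Longrightarrow> s1 ^ i * s2 ^ j * s3 ^ k = 1"
  shows "\<exists>L. local_sgn P n L \<and> L (emb P g1) = s1 \<and> L (emb P g2) = s2 \<and> L (emb P g3) = s3"
proof -
  define m where "m i j k = g1 ^ i * g2 ^ j * g3 ^ k" for i j k :: nat
  define t where "t i j k = s1 ^ i * s2 ^ j * s3 ^ k" for i j k :: nat
  have mu: "vunit P (m i j k)" for i j k unfolding m_def by (intro vunit_mult[OF P] vunit_power[OF P] g)
  have madd: "m i j k * m i' j' k' = m (i + i') (j + j') (k + k')" for i j k i' j' k' by (simp add: m_def power_add)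
  have tadd: "t i j k * t i' j' k' = t (i + i') (j + j') (k + k')" for i j k i' j' k' by (simp add: t_def power_add)
  have sp: "x ^ i = 1 \<or> x ^ i = -1" if "x = 1 \<or> x = (-1::complex)" for x i using that by (cases "even i") auto
  have tsq: "t i j k * t i j k = 1" for i j k
  proof -
    have "s1 ^ i * s1 ^ i = 1" "s2 ^ j * s2 ^ j = 1" "s3 ^ k * s3 ^ k = 1" using sp[OF s(1), of i] sp[OF s(2), of j] sp[OF s(3), of k] by auto
    then have "(s1 ^ i * s1 ^ i) * (s2 ^ j * s2 ^ j) * (s3 ^ k * s3 ^ k) = 1" by simp
    then show ?thesis unfolding t_def by (simp only: mult_ac)
  qed
  have tsign: "t i j k = 1 \<or> t i j k = -1" for i j k using tsq[of i j k] by (simp add: square_eq_1_iff)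
  have rel': "cng P n (m i j k) 1 \<Longrightarrow> t i j k = 1" for i j k using rel unfolding m_def t_def by blast
  have uniq: "t i j k = t i' j' k'" if a: "vunit P a" "cng P n (a * m i j k) 1" "cng P n (a * m i' j' k') 1" for a i j k i' j' k'
  proof -
    have ia: "vunit P (inverse a)" "a \<noteq> 0" using vunit_inverse[OF P a(1)] vunit_nz[OF P a(1)] by auto
    obtain x y z where x: "cng P n (inverse a * m x y z) 1" using gen[OF ia(1)] unfolding m_def by blast
    \<comment> \<open>Both monomials for \<open>a\<close> are compared with one for
      \<open>inverse a\<close>: multiplying the two congruences yields a relation between the
      generators.\<close>
    have *: "t i j k * t x y z = 1" if "cng P n (a * m i j k) 1" for i j k
    proof -
      have "cng P n ((a * m i j k) * (inverse a * m x y z)) (1 * 1)"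
        by (rule cng_vmult[OF P _ _ _ _ that x]) (auto intro!: vunit_mult[OF P] mu a(1) ia vunit_1[OF P])
      moreover have "(a * m i j k) * (inverse a * m x y z) = m (i + x) (j + y) (k + z)" using ia(2) by (simp add: madd[symmetric])
      ultimately show ?thesis unfolding tadd using rel' by simp
    qed
    show ?thesis using *[OF a(2)] *[OF a(3)] tsign[of i j k] tsign[of i' j' k'] tsign[of x y z] by auto
  qed
  define \<Lambda> where "\<Lambda> a = (THE r. \<exists>i j k. cng P n (a * m i j k) 1 \<and> r = t i j k)" for a
  have \<Lambda>: "\<Lambda> a = t i j k" if "vunit P a" "cng P n (a * m i j k) 1" for a i j k
    unfolding \<Lambda>_def by (rule the_equality) (use that uniq in blast)+
  have gen': "\<exists>i j k. cng P n (a * m i j k) 1" if "vunit P a" for a using gen[OF that] unfolding m_def .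
  have \<Lambda>c: "\<Lambda> a = \<Lambda> b" if a: "vunit P a" "vunit P b" "cng P n a b" for a b
  proof -
    obtain i j k where 1: "cng P n (b * m i j k) 1" using gen'[OF a(2)] by blast
    have "cng P n (a * m i j k) (b * m i j k)" using cng_vmult[OF P a(1,2) mu mu a(3)] cng_refl[OF P] by blast
    then have "cng P n (a * m i j k) 1" using cng_trans[OF P _ _ _ _ 1] vunit_F[OF P] vunit_mult[OF P] a mu by simp
    then show ?thesis using \<Lambda>[OF a(1)] \<Lambda>[OF a(2) 1] by simp
  qed
  have \<Lambda>m: "\<Lambda> (a * b) = \<Lambda> a * \<Lambda> b" if a: "vunit P a" and b: "vunit P b" for a b
  proof -
    obtain i j k where 1: "cng P n (a * m i j k) 1" using gen'[OF a] by blast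
    obtain x y z where 2: "cng P n (b * m x y z) 1" using gen'[OF b] by blast
    have "cng P n ((a * m i j k) * (b * m x y z)) (1 * 1)"
      by (rule cng_vmult[OF P _ _ _ _ 1 2]) (auto intro!: vunit_mult[OF P] mu a b vunit_1[OF P])
    then have "cng P n (a * b * m (i + x) (j + y) (k + z)) 1" unfolding madd[symmetric] by (simp add: mult_ac)
    then show ?thesis using \<Lambda>[OF vunit_mult[OF P a b]] \<Lambda>[OF a 1] \<Lambda>[OF b 2] tadd by metis
  qed
  have \<Lambda>1: "\<Lambda> 1 = 1" using \<Lambda>[of 1 0 0 0] vunit_1[OF P] cng_refl[OF P] by (simp add: m_def t_def)
  have \<Lambda>s: "\<Lambda> a = 1 \<or> \<Lambda> a = -1" if a: "vunit P a" for a
    using gen'[OF a] \<Lambda>[OF a] tsign by metis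
  have \<Lambda>g: "\<Lambda> (m i j k) = t i j k" for i j k
  proof -
    obtain x y z where 1: "cng P n (m i j k * m x y z) 1" using gen'[OF mu] by blast
    then have "\<Lambda> (m i j k) = t x y z" using \<Lambda>[OF mu] by blast
    moreover have "t i j k * t x y z = 1" using 1 unfolding madd tadd by (rule rel')
    ultimately show ?thesis using tsign[of i j k] tsign[of x y z] by auto
  qed
  \<comment> \<open>A local unit gets the sign of any element of the field that approximates it to
    level \<open>n\<close>. Such elements are congruent, so the choice does not matter.\<close>
  define L where "L X = \<Lambda> (SOME a. a \<in> F \<and> apx P n X a)" for X
  have LX: "L X = \<Lambda> a" if X: "X \<in> LU P" and a: "a \<in> F" "apx P n X a" for X a
  proof -
    have XK: "X \<in> carrier (KP P)" using X local_units[OF P] by auto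
    let ?b = "SOME a. a \<in> F \<and> apx P n X a"
    have b: "?b \<in> F \<and> apx P n X ?b" by (rule someI[of _ a]) (use a in blast)
    then have "cng P n ?b a" using apx_cng[OF P XK _ a(1), of ?b n] a(2) by blast
    moreover have "vunit P ?b" "vunit P a" using lu_apx[OF P XK _ _ n] b a X by blast+
    ultimately show ?thesis unfolding L_def using \<Lambda>c by blast
  qed
  have Lap: "\<exists>a. vunit P a \<and> apx P n X a" if X: "X \<in> LU P" for X
    by (rule lu_apx_ex[OF P X n]) blast
  have Le: "L (emb P a) = \<Lambda> a" if "vunit P a" for a
    by (rule LX) (use that lu_embed[OF P] vunit_F[OF P] apx_embed[OF P] cng_refl[OF P] in auto)
  show ?thesis
  proof (intro exI[of _ L] conjI)
    have s: "L X = 1 \<or> L X = -1" and m: "L (X \<otimes>\<^bsub>KP P\<^esub> Y) = L X * L Y" if X: "X \<in> LU P" and Y: "Y \<in> LU P" for X Y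
    proof -
      obtain a where a: "vunit P a" "apx P n X a" using X Lap by blast
      then have LXa: "L X = \<Lambda> a" using LX[OF X vunit_F[OF P]] by blast
      then show "L X = 1 \<or> L X = -1" using \<Lambda>s a by simp
      obtain b where b: "vunit P b" "apx P n Y b" using Y Lap by blast
      then have LYb: "L Y = \<Lambda> b" using LX[OF Y vunit_F[OF P]] by blast
      have "apx P n (X \<otimes>\<^bsub>KP P\<^esub> Y) (a * b)"
        using X Y a b local_units[OF P] by (intro apx_mult[OF P]) (auto simp: vunit_def)
      then have "L (X \<otimes>\<^bsub>KP P\<^esub> Y) = \<Lambda> (a * b)"
        using LX[OF lu_mult[OF P X Y] vunit_F[OF P vunit_mult[OF P a(1) b(1)]]] by blast
      then show "L (X \<otimes>\<^bsub>KP P\<^esub> Y) = L X * L Y" using LXa LYb \<Lambda>m a b by simp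
    qed
    have "L X = 1" if X: "X \<in> HU P n" for X
    proof -
      have "X \<in> LU P" "apx P n X 1" using X hu_lu[OF P n] higher_units[OF P] by auto
      then show ?thesis using LX[of X 1] \<Lambda>1 by simp
    qed
    then show "local_sgn P n L" unfolding local_sgn_def using s m by blast
    show "L (emb P g1) = s1" "L (emb P g2) = s2" "L (emb P g3) = s3"
      using Le g \<Lambda>g[of 1 0 0] \<Lambda>g[of 0 1 0] \<Lambda>g[of 0 0 1] by (simp_all add: m_def t_def)
  qed
qed

subsection \<open>Odd places\<close>

text \<open>The least positive natural number in \<open>P\<close> is prime, by division with
  remainder. There is one because \<open>P\<close> contains the norm of its generator.\<close>

lemma prime_below: assumes P: "P \<in> FP" shows "\<exists>p::nat. prime p \<and> of_nat p \<in> P"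
proof -
  have "of_nat (nrm (ppi P)) = cnj (ppi P) * ppi P" using nrm_cnj[OF ppi(1)[OF P]] by (simp add: mult.commute)
  then have "of_nat (nrm (ppi P)) \<in> P" using place_mult[OF P O_cnj[OF ppi(1)[OF P]] ppi(4)[OF P]] by simp
  then have ex: "\<exists>n>0. of_nat n \<in> P" using ppi(5)[OF P] by (intro exI[of _ "nrm (ppi P)"]) auto
  define p where "p = (LEAST n. n > 0 \<and> of_nat n \<in> P)"
  have p: "p > 0" "of_nat p \<in> P" using LeastI_ex[OF ex] by (auto simp: p_def)
  have least: "n \<ge> p" if "n > 0" "of_nat n \<in> P" for n unfolding p_def by (rule Least_le) (use that in blast)
  have "p \<noteq> 1" using p placeD(3)[OF P] by auto
  have "prime p"
  proof (rule prime_natI)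
    show "p \<ge> 2" using p \<open>p \<noteq> 1\<close> by linarith
    fix a b assume ab: "p dvd a * b"
    then obtain k where k: "a * b = p * k" by blast
    have e: "of_nat a * of_nat b = (of_nat k * of_nat p :: complex)" using k by (metis mult.commute of_nat_mult)
    have "of_nat a * of_nat b \<in> P" unfolding e by (rule place_mult[OF P O_simps(4) p(2)])
    then have *: "of_nat a \<in> P \<or> of_nat b \<in> P" using placeD(4)[OF P, of "of_nat a" "of_nat b"] by simp
    have "p dvd a" if "of_nat a \<in> P" for a
    proof (rule ccontr)
      assume "\<not> p dvd a"
      then have "a mod p > 0" by (simp add: mod_greater_zero_iff_not_dvd)
      have "(of_nat a :: complex) = of_nat (a div p) * of_nat p + of_nat (a mod p)" by (metis div_mult_mod_eq of_nat_add of_nat_mult)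
      then have "of_nat (a mod p) = (of_nat a :: complex) - of_nat (a div p) * of_nat p" by simp
      also have "\<dots> \<in> P" using place_diff[OF P that place_mult[OF P _ p(2)]] by simp
      finally have "a mod p \<ge> p" using least \<open>a mod p > 0\<close> by blast
      then show False using mod_less_divisor[OF p(1), of a] by linarith
    qed
    then show "p dvd a \<or> p dvd b" using * by blast
  qed
  then show ?thesis using p by blast
qed

text \<open>Let \<open>p\<close> be the residue characteristic. Raising to the \<open>p\<close>-th
  power deepens the level by at least one, and as \<open>p\<close> is odd it does not change a sign.
  So triviality descends from a deep level, where continuity gives it, to level 1.\<close>

lemma ltriv_odd:
  assumes q: "qchar \<psi>" and P: "P \<in> FP" and odd: "2 \<notin> P"
  shows "ltriv \<psi> P 1"
proof -
  obtain p where p: "prime p" "of_nat p \<in> P" using prime_below[OF P] by blast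
  have "p \<noteq> 2" using p odd by auto
  then have op: "odd p" using p(1) primes_dvd_imp_eq two_is_prime_nat by blast
  have step: "ltriv \<psi> P n" if n: "n \<ge> 1" and l: "ltriv \<psi> P (Suc n)" for n
    unfolding ltriv_def
  proof (intro allI impI)
    fix a assume a: "vunit P a" "cng P n a 1"
    have aF: "a \<in> F" by (rule vunit_F[OF P a(1)])
    have "cng P (Suc n) (a ^ p) 1"
    proof -
      \<comment> \<open>\<open>a ^ p - 1 = (a - 1) * S\<close>, and as \<open>a\<close> is 1 modulo
        \<open>P\<close>, the sum \<open>S\<close> is congruent to \<open>p\<close>, hence to
        0.\<close>
      define S where "S = (\<Sum>i<p. a ^ i)"
      have SF: "S \<in> F" unfolding S_def by (induction p) (auto intro!: F_add F_power aF)
      have "av P ((\<Sum>i<k. a ^ i) - of_nat k) \<le> 1/2" for k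
      proof (induction k)
        case (Suc k)
        have F: "(\<Sum>i<k. a ^ i) - of_nat k \<in> F" "a ^ k - 1 \<in> F"
        proof -
          have "(\<Sum>i<k. a ^ i) \<in> F" by (induction k) (auto intro!: F_add F_power aF)
          then show "(\<Sum>i<k. a ^ i) - of_nat k \<in> F" using F_diff by simp
        qed (auto intro!: F_diff F_power aF)
        have "cng P n (a ^ k) (1 ^ k)" by (rule cng_power[OF P a(1) vunit_1[OF P] a(2)])
        then have "cng P 1 (a ^ k) 1" using cng_mono[OF P _ n] by simp
        then have "av P (a ^ k - 1) \<le> 1/2" by (simp add: cng_def)
        moreover have e: "(\<Sum>i<Suc k. a ^ i) - of_nat (Suc k) = ((\<Sum>i<k. a ^ i) - of_nat k) + (a ^ k - 1)" by simp
        ultimately show ?case unfolding e by (intro order_trans[OF aA_ultra[OF P F] max.boundedI] Suc)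
      qed (simp add: aA_0[OF P])
      then have "av P (S - of_nat p) \<le> 1/2" by (simp add: S_def)
      moreover have "av P (of_nat p) \<le> 1/2" using AP_O_P[OF P, of "of_nat p"] p(2) by simp
      ultimately have S: "av P S \<le> 1/2" using aA_ultra[OF P, of "S - of_nat p" "of_nat p"] SF F_diff by simp
      have "a ^ p - 1 = (a - 1) * S" unfolding S_def by (rule power_diff_1_eq)
      then have "av P (a ^ p - 1) = av P (a - 1) * av P S"
        using aA_mult[OF P _ SF, of "a - 1"] aF F_diff by simp
      also have "\<dots> \<le> (1/2^n) * (1/2)" using a(2) S by (intro mult_mono) (auto simp: cng_def aA_nonneg[OF P])
      finally show ?thesis by (simp add: cng_def)
    qed
    then have "lam \<psi> P (a ^ p) = 1" using l vunit_power[OF P a(1)] unfolding ltriv_def by blast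
    then have "lam \<psi> P a ^ p = 1" using lam_power[OF q P a(1)] by simp
    then show "lam \<psi> P a = 1" using lam_sign[OF q P a(1)] op by auto
  qed
  obtain n where n: "n > 0" "ltriv \<psi> P n" using ltriv_ex[OF q P] by blast
  show ?thesis using n(1,2)
  proof (induction n rule: nat_induct_non_zero)
    case (Suc n) then show ?case using step[of n] by simp
  qed simp
qed

text \<open>The multiplicative group of the finite residue field is cyclic. Its order is even: if
  \<open>g ^ m\<close> is 1 with \<open>m\<close> odd, write -1 as a power of \<open>g\<close> and
  raise it to the power \<open>m\<close>; then 2 would lie in \<open>P\<close>. Evenness makes the
  sign \<open>(-1) ^ k\<close> of \<open>g ^ k\<close> well defined.\<close>

lemma odd_generator:
  assumes P: "P \<in> FP" and odd: "2 \<notin> P"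
  obtains g where "g \<in> Oi" "g \<notin> P" "\<And>a. vunit P a \<Longrightarrow> \<exists>k. cng P 1 a (g ^ k)"
    "\<And>m. cng P 1 (g ^ m) 1 \<Longrightarrow> even m"
proof -
  \<comment> \<open>Bezout for \<open>c\<close> and the generator of \<open>P\<close>: the common
    divisor \<open>x\<close> divides \<open>c\<close>, so it is outside \<open>P\<close>, and as it
    also divides the generator it is a unit.\<close>
  have inv: "\<exists>d\<in>Oi. c * d - 1 \<in> P" if c: "c \<in> Oi" "c \<notin> P" for c
  proof -
    obtain x s t a b where b: "x \<in> Oi" "s \<in> Oi" "t \<in> Oi" "a \<in> Oi" "b \<in> Oi" "x = s * c + t * ppi P" "c = a * x" "ppi P = b * x"
      by (rule bezout[OF c(1) ppi(1)[OF P]])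
    have "x \<notin> P" by (metis b(4,7) c(2) place_mult[OF P])
    then have "b \<in> P" using placeD(4)[OF P b(5,1)] ppi(4)[OF P] b(8) by metis
    then obtain e where e: "e \<in> Oi" "b = e * ppi P" using ppi(2)[OF P] by (metis pidE)
    have "ppi P * (e * x) = (e * ppi P) * x" by (simp only: mult_ac)
    also have "\<dots> = ppi P * 1" unfolding e(2)[symmetric] b(8)[symmetric] by simp
    finally have "e * x = 1" using ppi(3)[OF P] mult_left_cancel by blast
    then have "e * (s * c + t * ppi P) = 1" unfolding b(6)[symmetric] .
    then have "c * (e * s) - 1 = (- (e * t)) * ppi P" by (simp add: algebra_simps)
    moreover have "(- (e * t)) * ppi P \<in> P" by (intro place_mult[OF P] O_uminus O_mult e b ppi(4)[OF P])
    ultimately show ?thesis using O_mult[OF e(1) b(2)] by metis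
  qed
  have mx: "maximalideal P RR"
  proof (rule maximalidealI)
    show "ideal P RR" by (rule placeD(1)[OF P])
    show "carrier RR \<noteq> P" using placeD(3)[OF P] O_simps(2) by (metis carr)
    fix J assume J: "ideal J RR" "P \<subseteq> J" "J \<subseteq> carrier RR"
    show "J = P \<or> J = carrier RR"
    proof (rule disjCI)
      assume "J \<noteq> carrier RR"
      then have 1: "1 \<notin> J" using ideal.one_imp_carrier[OF J(1)] by auto
      have "c \<in> P" if c: "c \<in> J" for c
      proof (rule ccontr)
        assume "c \<notin> P"
        then obtain d where d: "d \<in> Oi" "c * d - 1 \<in> P" using inv c idealD(1)[OF J(1)] by blast
        have "d * c + (-1) * (c * d - 1) \<in> J" using idealD(3,4)[OF J(1)] c d J(2) O_simps(5) by blast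
        then show False using 1 by (simp add: mult.commute)
      qed
      then show "J = P" using J(2) by blast
    qed
  qed
  interpret M: maximalideal P RR by (rule mx)
  interpret Q: field "RR Quot P" by (rule M.quotient_is_field[OF R_cring])
  have hom: "ring_hom_ring RR (RR Quot P) ((+>\<^bsub>RR\<^esub>) P)" by (rule M.rcos_ring_hom_ring)
  define h where "h x = P +>\<^bsub>RR\<^esub> x" for x
  have hset: "h x = {y + x | y. y \<in> P}" for x by (auto simp: h_def a_r_coset_def')
  have heq: "h x = h y \<Longrightarrow> x - y \<in> P" if "x \<in> Oi" "y \<in> Oi" for x y
  proof -
    assume e: "h x = h y"
    have "0 \<in> P" by (rule idealD(2)[OF placeD(1)[OF P]])
    then have "x \<in> h x" unfolding hset by (auto intro: exI[of _ 0])
    then show "x - y \<in> P" using e unfolding hset by auto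
  qed
  have carrQ: "carrier (RR Quot P) = h ` Oi" by (auto simp: FactRing_def A_RCOSETS_def' h_def)
  have fin: "finite (carrier (RR Quot P))"
  proof -
    \<comment> \<open>Division with remainder represents every class by an integer of smaller
      modulus than the generator, and there are finitely many of these.\<close>
    have "h ` Oi \<subseteq> h ` {x \<in> Oi. cmod x < cmod (ppi P)}"
    proof
      fix X assume "X \<in> h ` Oi"
      then obtain x where x: "x \<in> Oi" "X = h x" by blast
      obtain c where c: "c \<in> Oi" "cmod (x / ppi P - c) < 1" using O_eucl[of "x / ppi P"] F_divide O_F x(1) ppi(1)[OF P] by blast
      define r where "r = x - c * ppi P"
      have rO: "r \<in> Oi" using x c ppi(1)[OF P] by (auto simp: r_def intro!: O_closed)
      have "r = ppi P * (x / ppi P - c)" using ppi(3)[OF P] by (simp add: r_def field_simps)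
      then have "cmod r = cmod (ppi P) * cmod (x / ppi P - c)" by (simp only: norm_mult)
      then have "cmod r < cmod (ppi P)" using c(2) ppi(3)[OF P] by (simp add: mult_less_cancel_left2)
      moreover have "h r = h x"
      proof -
        have d: "c * ppi P \<in> P" using place_mult[OF P c(1) ppi(4)[OF P]] .
        show ?thesis unfolding hset
        proof safe
          fix y assume "y \<in> P" then show "\<exists>ya. y + r = ya + x \<and> ya \<in> P"
            using place_diff[OF P _ d] by (intro exI[of _ "y - c * ppi P"]) (auto simp: r_def)
        next
          fix y assume "y \<in> P" then show "\<exists>ya. y + x = ya + r \<and> ya \<in> P"
            using place_add[OF P d] by (intro exI[of _ "y + c * ppi P"]) (auto simp: r_def)
        qed
      qed
      ultimately show "X \<in> h ` {x \<in> Oi. cmod x < cmod (ppi P)}" using x rO by (metis (mono_tags, lifting) image_eqI mem_Collect_eq)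
    qed
    then show ?thesis unfolding carrQ using finite_imageI[OF O_fin] finite_subset by blast
  qed
  obtain G where G: "G \<in> carrier (mult_of (RR Quot P))" "carrier (mult_of (RR Quot P)) = {G [^]\<^bsub>RR Quot P\<^esub> i | i::nat. i \<in> UNIV}"
    using Q.finite_field_mult_group_has_gen[OF fin] unfolding nat_pow_mult_of by blast
  have z: "h 0 = \<zero>\<^bsub>RR Quot P\<^esub>"
    by (simp add: FactRing_def hset)
  have GQ: "G \<in> carrier (RR Quot P)" "G \<noteq> \<zero>\<^bsub>RR Quot P\<^esub>" using G(1) by (auto simp: carrier_mult_of)
  then obtain g where g: "g \<in> Oi" "G = h g" unfolding carrQ by blast
  have hz: "x \<in> P \<Longrightarrow> h x = h 0" for x
    unfolding hset
  proof safe
    assume x: "x \<in> P"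
    fix y assume y: "y \<in> P"
    show "\<exists>ya. y + x = ya + 0 \<and> ya \<in> P" using place_add[OF P x y] by (intro exI[of _ "y + x"]) auto
    show "\<exists>ya. y + 0 = ya + x \<and> ya \<in> P" using place_diff[OF P y x] by (intro exI[of _ "y - x"]) auto
  qed
  have gP: "g \<notin> P" using hz[of g] g z GQ(2) by auto
  have Rpow: "x [^]\<^bsub>RR\<^esub> (n::nat) = x ^ n" for x n by (induction n) (auto simp: nat_pow_def)
  have hpow: "h (g ^ k) = G [^]\<^bsub>RR Quot P\<^esub> k" for k :: nat
    using ring_hom_ring.hom_nat_pow[OF hom, of g k] g by (simp add: h_def Rpow)
  have genO: "\<exists>k. b - g ^ k \<in> P" if b: "b \<in> Oi" "b \<notin> P" for b
  proof -
    have "h b \<noteq> h 0" using heq[OF b(1), of 0] b(2) by auto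
    then have "h b \<in> carrier (mult_of (RR Quot P))" using b z carrQ by (auto simp: carrier_mult_of)
    then obtain k :: nat where "h b = G [^]\<^bsub>RR Quot P\<^esub> k" unfolding G(2) by blast
    then have "h b = h (g ^ k)" using hpow by simp
    then show ?thesis using heq[OF b(1) O_power[OF g(1)]] by blast
  qed
  have gen: "\<exists>k. cng P 1 a (g ^ k)" if a: "vunit P a" for a
  proof -
    have aF: "a \<in> F" "a \<noteq> 0" using vunit_F[OF P a] vunit_nz[OF P a] by auto
    have "val P a = 0" using a vunit_val[OF P aF] by blast
    then obtain b c where bc: "b \<in> Oi - P" "c \<in> Oi - P" "a = b / c" using val_ex[OF P aF] by auto
    obtain d where d: "d \<in> Oi" "c * d - 1 \<in> P" using inv bc by blast
    have c0: "c \<noteq> 0" using bc a vunit_nz[OF P a] by auto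
    have "d \<notin> P" 
    proof
      assume "d \<in> P"
      then have "c * d \<in> P" using place_mult[OF P] bc by blast
      then have "c * d - (c * d - 1) \<in> P" using place_diff[OF P] d by blast
      then show False using placeD(3)[OF P] by simp
    qed
    then have bd: "b * d \<in> Oi" "b * d \<notin> P" using bc d O_mult placeD(4)[OF P] by auto
    obtain k where k: "b * d - g ^ k \<in> P" using genO[OF bd] by blast
    have "cng P 1 (b * d) a"
    proof -
      have vu: "vunit P b" "vunit P c" "vunit P d" using vunit_O[OF P] bc d \<open>d \<notin> P\<close> by auto
      have "cng P 1 (c * d) 1" using cng_O1[OF P, of "c * d" 1] d bc O_mult by auto
      then have "cng P 1 ((c * d) * a) (1 * a)"
        using cng_vmult[OF P vunit_mult[OF P vu(2,3)] vunit_1[OF P] a a _ cng_refl[OF P]] by blast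
      moreover have "(c * d) * a = b * d" using bc(3) c0 by simp
      ultimately show ?thesis by simp
    qed
    moreover have "cng P 1 (b * d) (g ^ k)" using cng_O1[OF P bd(1) O_power[OF g(1)]] k by blast
    ultimately show ?thesis using cng_trans[OF P aF(1) O_F[OF bd(1)] F_power[OF O_F[OF g(1)]] cng_sym[OF P O_F[OF bd(1)] aF(1)]] by blast
  qed
  have "even m" if m: "cng P 1 (g ^ m) 1" for m
  proof (rule ccontr)
    assume om: "odd m"
    have vg: "vunit P g" using vunit_O[OF P g(1)] gP by blast
    obtain k where k: "cng P 1 (-1) (g ^ k)" using gen[OF vunit_minus1[OF P]] by blast
    have "cng P 1 ((-1) ^ m) ((g ^ k) ^ m)" by (rule cng_power[OF P vunit_minus1[OF P] vunit_power[OF P vg] k])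
    moreover have "cng P 1 ((g ^ m) ^ k) (1 ^ k)" by (rule cng_power[OF P vunit_power[OF P vg] vunit_1[OF P] m])
    moreover have "(g ^ k) ^ m = (g ^ m) ^ k" by (simp flip: power_mult add: mult.commute)
    ultimately have "cng P 1 (-1) 1" using om cng_trans[OF P _ F_power[OF F_power[OF O_F[OF g(1)]]], of "-1" 1] by simp
    then have "(-1) - 1 \<in> P" using cng_O1[OF P, of "-1" 1] by simp
    then show False using odd place_minus[OF P, of "-2"] by simp
  qed
  then show thesis using that[OF g(1) gP gen] by blast
qed

text \<open>A cyclic group has a single nontrivial sign character, -1 on a generator. Hence the
  product of two characters ramified at the same odd place is unramified there.\<close>

lemma odd_unique:
  assumes q: "qchar \<psi>" "qchar \<phi>" and P: "P \<in> FP" and odd: "2 \<notin> P"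
    and n: "P \<in> Ram \<psi>" "P \<in> Ram \<phi>" and a: "vunit P a"
  shows "lam \<psi> P a = lam \<phi> P a"
proof -
  obtain g where g: "g \<in> Oi" "g \<notin> P" "\<And>a. vunit P a \<Longrightarrow> \<exists>k. cng P 1 a (g ^ k)" by (rule odd_generator[OF P odd]) blast
  have vg: "vunit P g" using vunit_O[OF P g(1)] g(2) by blast
  have *: "lam \<psi> P a = lam \<psi> P g ^ k" if q: "qchar \<psi>" and a: "vunit P a" and k: "cng P 1 a (g ^ k)" for \<psi> a k
    using lam_cng[OF q P ltriv_odd[OF q P odd] a vunit_power[OF P vg] k] lam_power[OF q P vg] by simp
  have **: "lam \<psi> P g = -1" if q: "qchar \<psi>" and r: "P \<in> Ram \<psi>" for \<psi>
  proof (rule ccontr)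
    assume "lam \<psi> P g \<noteq> -1"
    then have "lam \<psi> P g = 1" using lam_sign[OF q P vg] by blast
    then have "lam \<psi> P a = 1" if "vunit P a" for a using *[OF q that] g(3)[OF that] by auto
    then show False using r by (auto simp: Ram_def)
  qed
  obtain k where k: "cng P 1 a (g ^ k)" using g(3)[OF a] by blast
  show ?thesis using *[OF q(1) a k] *[OF q(2) a k] **[OF q(1) n(1)] **[OF q(2) n(2)] by simp
qed

subsection \<open>Places with residue field of two elements\<close>

text \<open>With two elements in the residue field, the units of level \<open>k\<close> modulo those
  of the next level form a group of order two, generated by \<open>g\<close>. So either
  \<open>a\<close> is already deeper or \<open>a * g\<close> is.\<close>

lemma level_step:
  assumes P: "P \<in> FP" and res: "\<And>x. vunit P x \<Longrightarrow> cng P 1 x 1" and two: "2 \<in> P"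
    and a: "vunit P a" "cng P k a 1" and g: "vunit P g" "av P (g - 1) = 1 / 2 ^ k" and k: "k > 0"
  shows "cng P (Suc k) a 1 \<or> cng P (Suc k) (a * g) 1"
proof (cases "av P (a - 1) < 1 / 2 ^ k")
  case True
  then have "av P (a - 1) < 2 * (1 / 2 ^ Suc k)" by simp
  then show ?thesis using AP_discrete[OF P, of "a - 1" "Suc k"] vunit_F[OF P a(1)] F_diff by (simp add: cng_def)
next
  case False
  then have e: "av P (a - 1) = 1 / 2 ^ k" using a(2) by (simp add: cng_def)
  have F: "a \<in> F" "g \<in> F" using vunit_F[OF P] a g by auto
  have g1: "g - 1 \<noteq> 0" using g(2) aA_0[OF P] by auto
  \<comment> \<open>\<open>a - 1\<close> and \<open>g - 1\<close> have the same absolute value, so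
    their quotient is a unit and thus 1 modulo \<open>P\<close>. As 2 lies in \<open>P\<close>, also
    \<open>t + 1\<close> vanishes modulo \<open>P\<close>, which makes
    \<open>(a - 1) + (g - 1)\<close> deeper.\<close>
  define t where "t = (a - 1) / (g - 1)"
  have tF: "t \<in> F" using F F_diff F_divide by (simp add: t_def)
  have at: "a - 1 = t * (g - 1)" using g1 by (simp add: t_def)
  have "av P t * (1 / 2 ^ k) = 1 / 2 ^ k"
    using aA_mult[OF P tF, of "g - 1"] F F_diff e g(2) at by simp
  then have "vunit P t" using tF by (simp add: vunit_def)
  then have t1: "av P (t - 1) \<le> 1/2" using res by (simp add: cng_def)
  have A2: "av P 2 \<le> 1/2" using AP_O_P[OF P, of 2] two by simp
  have e1: "t + 1 = (t - 1) + 2" by simp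
  have "av P (t + 1) \<le> 1/2"
    unfolding e1 by (rule order_trans[OF aA_ultra[OF P] max.boundedI[OF t1 A2]]) (simp_all add: tF F_diff)
  then have "av P (t + 1) * av P (g - 1) \<le> (1/2) * (1/2^k)" using g(2) by (intro mult_mono) auto
  then have 1: "av P ((t + 1) * (g - 1)) \<le> 1 / 2 ^ Suc k" using aA_mult[OF P, of "t + 1" "g - 1"] tF F F_add F_diff by simp
  \<comment> \<open>The cross term has level \<open>2 * k\<close>, which exceeds \<open>k\<close>
    because \<open>k > 0\<close>.\<close>
  have "av P ((a - 1) * (g - 1)) = (1/2^k) * (1/2^k)" using aA_mult[OF P, of "a - 1" "g - 1"] F F_diff e g(2) by simp
  also have "\<dots> \<le> (1/2) * (1/2^k)"
  proof (intro mult_right_mono)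
    have "(2::real) ^ 1 \<le> 2 ^ k" using k by (intro power_increasing) auto
    then show "1 / 2 ^ k \<le> 1 / (2::real)" by (intro divide_left_mono) auto
  qed simp
  finally have 2: "av P ((a - 1) * (g - 1)) \<le> 1 / 2 ^ Suc k" by simp
  have "a * g - 1 = (a - 1) * (g - 1) + (a - 1) + (g - 1)" by (simp add: algebra_simps)
  also have "\<dots> = (a - 1) * (g - 1) + (t + 1) * (g - 1)" using at by (simp add: algebra_simps)
  finally have "av P (a * g - 1) \<le> 1 / 2 ^ Suc k"
    using aA_ultra[OF P, of "(a - 1) * (g - 1)" "(t + 1) * (g - 1)"] 1 2 tF F F_add F_diff F_mult by simp
  then show ?thesis by (simp add: cng_def)
qed

text \<open>A factor deeper than level \<open>k\<close> cannot hide that \<open>g\<close> has exact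
  level \<open>k\<close>. This separates generators of different levels in a relation.\<close>

lemma level_exact:
  assumes P: "P \<in> FP" and g: "vunit P g" "av P (g - 1) = 1 / 2 ^ k"
    and h: "vunit P h" "cng P (Suc k) h 1" and m: "m > k"
  shows "\<not> cng P m (g * h) 1"
proof
  assume "cng P m (g * h) 1"
  then have c: "cng P (Suc k) (g * h) 1" using cng_mono[OF P] m by simp
  have "cng P (Suc k) (g * h) (g * 1)" using cng_vmult[OF P g(1) g(1) h(1) vunit_1[OF P] cng_refl[OF P] h(2)] .
  then have "cng P (Suc k) g 1" using c cng_trans[OF P, of "g" "g * h" 1] cng_sym[OF P, of "g * h" g] vunit_F[OF P] g h vunit_mult[OF P] by simp
  then have "1 / 2 ^ k \<le> 1 / (2::real) ^ Suc k" using g by (simp add: cng_def)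
  then show False by (simp add: field_simps)
qed

end

section \<open>The rationals and the Gaussian numbers\<close>

lemma Rats_fracE:
  assumes "x \<in> (\<rat> :: complex set)" obtains a b :: int where "b > 0" "x = of_int a / of_int b"
  by (rule Rats_cases'[OF assms]) (rule that, assumption+)

interpretation rat: euclid_field "\<rat>" "\<int>"
proof
  show "x + y \<in> \<rat>" "x * y \<in> \<rat>" if "x \<in> \<rat>" "y \<in> \<rat>" for x y :: complex using that by auto
  show "inverse x \<in> \<rat>" if "x \<in> \<rat>" for x :: complex using that by auto
  show "cnj x \<in> \<rat>" if "x \<in> \<rat>" for x :: complex using that by (auto elim!: Rats_fracE)
  show "(\<int> :: complex set) \<subseteq> \<rat>" by (rule Ints_subset_Rats)
  show "of_int k \<in> (\<int> :: complex set)" for k by simp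
  show "x + y \<in> \<int>" "x * y \<in> \<int>" if "x \<in> \<int>" "y \<in> \<int>" for x y :: complex using that by auto
  show "cnj x \<in> \<int>" if "x \<in> \<int>" for x :: complex using that by (auto elim!: Ints_cases)
  show "\<exists>n::nat. 0 < n \<and> of_nat n * x \<in> \<int>" if xm: "x \<in> \<rat>" for x :: complex
  proof -
    obtain a b where ab: "b > 0" "x = of_int a / of_int b" using xm by (rule Rats_fracE)
    have "of_nat (nat b) = (of_int b :: complex)" using ab(1) by (metis of_int_of_nat_eq int_nat_eq less_imp_le)
    then have "of_nat (nat b) * x = of_int a" using ab by simp
    then show ?thesis using ab(1) by (intro exI[of _ "nat b"]) auto
  qed
  show "\<exists>q\<in>\<int>. cmod (x - q) < 1" if xm: "x \<in> \<rat>" for x :: complex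
  proof -
    obtain a b where ab: "b > 0" "x = of_int a / of_int b" using xm by (rule Rats_fracE)
    define r :: real where "r = of_int a / of_int b"
    have x: "x = complex_of_real r" using ab by (simp add: r_def)
    have "x - of_int (round r) = complex_of_real (r - of_int (round r))" by (simp add: x)
    then have "cmod (x - of_int (round r)) = \<bar>r - of_int (round r)\<bar>" by (metis norm_of_real)
    also have "\<dots> < 1" using of_int_round_abs_le[of r] by linarith
    finally show ?thesis by (intro bexI[of _ "of_int (round r)"]) auto
  qed
  show "\<exists>k::nat. (cmod x)\<^sup>2 = real k" if xm: "x \<in> \<int>" for x :: complex
  proof -
    obtain k where "x = of_int k" using xm by (auto elim: Ints_cases)
    then show ?thesis by (intro exI[of _ "nat (k^2)"]) simp
  qed
  show "algebraic_int x" if "x \<in> \<int>" for x :: complex using that by (rule int_imp_algebraic_int)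
  show "finite {x \<in> \<int>. cmod x < r}" for r
  proof (rule finite_subset)
    show "{x \<in> \<int>. cmod x < r} \<subseteq> of_int ` {-\<lceil>r\<rceil>..\<lceil>r\<rceil>}"
    proof
      fix x :: complex assume "x \<in> {x \<in> \<int>. cmod x < r}"
      then obtain k where k: "x = of_int k" "\<bar>real_of_int k\<bar> < r" by (auto elim!: Ints_cases)
      then have "\<bar>k\<bar> \<le> \<lceil>r\<rceil>" by linarith
      then have "k \<in> {-\<lceil>r\<rceil>..\<lceil>r\<rceil>}" by auto
      then show "x \<in> of_int ` {-\<lceil>r\<rceil>..\<lceil>r\<rceil>}" unfolding k(1) by (rule imageI)
    qed
  qed simp
qed

section \<open>The Gaussian numbers\<close>

abbreviation "QI \<equiv> gauss_field"

definition ZI :: "complex set" where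
  "ZI = {of_int a + of_int b * \<i> | a b. True}"

lemma gauss_intsI [simp, intro]: "of_int a + of_int b * \<i> \<in> ZI"
  by (auto simp: ZI_def)

lemma gauss_intsE: assumes "x \<in> ZI" obtains a b where "x = of_int a + of_int b * \<i>"
  using assms by (auto simp: ZI_def)

lemma gauss_fieldE: assumes "x \<in> QI" obtains r s :: real where "r \<in> \<rat>" "s \<in> \<rat>" "x = Complex r s"
proof -
  obtain a b where ab: "a \<in> \<rat>" "b \<in> \<rat>" "x = a + b * \<i>" using assms by (auto simp: gauss_field_def)
  obtain p q where p: "a = of_rat p" "b = of_rat q" using ab by (auto elim!: Rats_cases)
  have e: "complex_of_real (of_rat p) = of_rat p" for p
    by (cases p) (simp add: of_rat_rat)
  have "x = Complex (of_rat p) (of_rat q)" unfolding ab p by (simp add: complex_eq_iff flip: e)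
  then show thesis using that[of "of_rat p" "of_rat q"] by simp
qed

lemma gauss_fieldI: "r \<in> \<rat> \<Longrightarrow> s \<in> \<rat> \<Longrightarrow> Complex r s \<in> QI"
proof -
  assume "r \<in> \<rat>" "s \<in> \<rat>"
  then obtain p q where p: "r = of_rat p" "s = of_rat q" by (auto elim!: Rats_cases)
  have e: "complex_of_real (of_rat p) = of_rat p" for p
    by (cases p) (simp add: of_rat_rat)
  have "Complex r s = of_rat p + of_rat q * \<i>" unfolding p by (simp add: complex_eq_iff flip: e)
  then show ?thesis unfolding gauss_field_def by (intro CollectI exI[of _ "of_rat p"] exI[of _ "of_rat q"]) auto
qed

interpretation QI: euclid_field QI ZI
proof
  show "x + y \<in> QI" "x * y \<in> QI" if "x \<in> QI" "y \<in> QI" for x y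
    using that by (auto elim!: gauss_fieldE simp: complex_add complex_mult intro!: gauss_fieldI)
  show "inverse x \<in> QI" if "x \<in> QI" for x
    using that by (auto elim!: gauss_fieldE simp: complex_inverse intro!: gauss_fieldI)
  show "cnj x \<in> QI" if "x \<in> QI" for x
    using that by (auto elim!: gauss_fieldE simp: complex_cnj intro!: gauss_fieldI)
  show "ZI \<subseteq> QI"
  proof
    fix x assume "x \<in> ZI"
    then obtain a b where "x = of_int a + of_int b * \<i>" by (rule gauss_intsE)
    then show "x \<in> QI" unfolding gauss_field_def
      by (intro CollectI exI[of _ "of_int a"] exI[of _ "of_int b"]) auto
  qed
  show "of_int k \<in> ZI" for k using gauss_intsI[of k 0] by simp
  show "x + y \<in> ZI" "x * y \<in> ZI" if "x \<in> ZI" "y \<in> ZI" for x y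
  proof -
    obtain a b where a: "x = of_int a + of_int b * \<i>" using \<open>x \<in> ZI\<close> by (rule gauss_intsE)
    obtain c d where c: "y = of_int c + of_int d * \<i>" using \<open>y \<in> ZI\<close> by (rule gauss_intsE)
    have "x + y = of_int (a + c) + of_int (b + d) * \<i>" "x * y = of_int (a * c - b * d) + of_int (a * d + b * c) * \<i>"
      by (simp_all add: a c complex_eq_iff)
    then show "x + y \<in> ZI" "x * y \<in> ZI" using gauss_intsI by metis+
  qed
  show "cnj x \<in> ZI" if xm: "x \<in> ZI" for x
  proof -
    obtain a b where a: "x = of_int a + of_int b * \<i>" using xm by (rule gauss_intsE)
    have "cnj x = of_int a + of_int (- b) * \<i>" by (simp add: a complex_eq_iff)
    then show ?thesis using gauss_intsI by metis
  qed
  show "\<exists>n::nat. 0 < n \<and> of_nat n * x \<in> ZI" if xm: "x \<in> QI" for x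
  proof -
    obtain a b where ab: "a \<in> \<rat>" "b \<in> \<rat>" "x = a + b * \<i>" using xm by (auto simp: gauss_field_def)
    obtain n where n: "n > 0" "of_nat n * a \<in> \<int>" using rat.O_frac[OF ab(1)] by blast
    obtain m where m: "m > 0" "of_nat m * b \<in> \<int>" using rat.O_frac[OF ab(2)] by blast
    obtain k l where k: "of_nat n * a = of_int k" "of_nat m * b = of_int l" using n m by (metis Ints_cases)
    have "of_nat (n * m) * x = of_nat m * (of_nat n * a) + of_nat n * (of_nat m * b) * \<i>" by (simp add: ab algebra_simps)
    also have "\<dots> = of_int (int m * k) + of_int (int n * l) * \<i>" by (simp add: k)
    finally have "of_nat (n * m) * x \<in> ZI" using gauss_intsI by metis
    then show ?thesis using n m by (intro exI[of _ "n * m"]) auto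
  qed
  show "\<exists>q\<in>ZI. cmod (x - q) < 1" if xm: "x \<in> QI" for x
  proof -
    \<comment> \<open>Rounding both coordinates leaves a squared distance of at most 1/4 +
      1/4.\<close>
    define q where "q = of_int (round (Re x)) + of_int (round (Im x)) * \<i>"
    have "(Re x - of_int (round (Re x)))^2 \<le> (1/2)^2" "(Im x - of_int (round (Im x)))^2 \<le> (1/2)^2"
      using of_int_round_abs_le[of "Re x"] of_int_round_abs_le[of "Im x"]
      by (auto simp: abs_le_square_iff[symmetric] abs_minus_commute)
    moreover have "(cmod (x - q))^2 = (Re x - of_int (round (Re x)))^2 + (Im x - of_int (round (Im x)))^2"
      by (simp add: q_def cmod_power2)
    ultimately have "(cmod (x - q))^2 \<le> (1/2)^2 + (1/2)^2" by linarith
    then have "(cmod (x - q))^2 < 1^2" by (simp add: power2_eq_square)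
    then have "cmod (x - q) < 1" by (rule power_less_imp_less_base) simp
    then show ?thesis using q_def by blast
  qed
  show "\<exists>k::nat. (cmod x)\<^sup>2 = real k" if xm: "x \<in> ZI" for x
  proof -
    obtain a b where a: "x = of_int a + of_int b * \<i>" using xm by (rule gauss_intsE)
    show ?thesis by (rule exI[of _ "nat (a^2 + b^2)"]) (simp add: a cmod_power2)
  qed
  show "algebraic_int x" if xm: "x \<in> ZI" for x
  proof -
    obtain a b where a: "x = of_int a + of_int b * \<i>" using xm by (rule gauss_intsE)
    \<comment> \<open>The monic polynomial with roots \<open>x\<close> and
      \<open>cnj x\<close>.\<close>
    show ?thesis
    proof (rule algebraic_int.intros[of "[:of_int (a^2 + b^2), of_int (- 2 * a), 1:]"])
      show "\<forall>i. Polynomial.coeff [:of_int (a^2 + b^2), of_int (- 2 * a), 1:] i \<in> (\<int> :: complex set)"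
        by (auto simp: Polynomial.coeff_pCons split: nat.splits)
      show "poly [:of_int (a^2 + b^2), of_int (- 2 * a), 1:] x = 0"
        by (simp add: a complex_eq_iff power2_eq_square algebra_simps)
    qed simp
  qed
  show "finite {x \<in> ZI. cmod x < r}" for r
  proof (rule finite_subset)
    show "{x \<in> ZI. cmod x < r} \<subseteq> (\<lambda>(a, b). of_int a + of_int b * \<i>) ` ({-\<lceil>r\<rceil>..\<lceil>r\<rceil>} \<times> {-\<lceil>r\<rceil>..\<lceil>r\<rceil>})"
    proof
      fix x assume x: "x \<in> {x \<in> ZI. cmod x < r}"
      then have "x \<in> ZI" by simp
      then obtain a b where a: "x = of_int a + of_int b * \<i>" by (rule gauss_intsE)
      have "\<bar>real_of_int a\<bar> \<le> cmod x" "\<bar>real_of_int b\<bar> \<le> cmod x"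
        using abs_Re_le_cmod[of x] abs_Im_le_cmod[of x] by (simp_all add: a)
      then have "\<bar>a\<bar> \<le> \<lceil>r\<rceil>" "\<bar>b\<bar> \<le> \<lceil>r\<rceil>" using x by simp_all linarith+
      then show "x \<in> (\<lambda>(a, b). of_int a + of_int b * \<i>) ` ({-\<lceil>r\<rceil>..\<lceil>r\<rceil>} \<times> {-\<lceil>r\<rceil>..\<lceil>r\<rceil>})"
        by (intro image_eqI[of _ _ "(a, b)"]) (auto simp: a)
    qed
  qed simp
qed

abbreviation "VK \<equiv> places QI"
abbreviation "PK \<equiv> finite_places QI"
abbreviation "PQ \<equiv> finite_places (\<rat> :: complex set)"

lemma Q_sub_K: "x \<in> \<rat> \<Longrightarrow> x \<in> QI"
  unfolding gauss_field_def by (intro CollectI exI[of _ x] exI[of _ 0]) auto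

lemma Z_sub: "x \<in> \<int> \<Longrightarrow> x \<in> ZI"
  using QI.O_int by (auto elim!: Ints_cases)

lemma i_gauss [simp]: "\<i> \<in> ZI" using gauss_intsI[of 0 1] by simp

lemma gauss_Rats: assumes "x \<in> QI" "cnj x = x" shows "x \<in> \<rat>"
proof -
  obtain r s where rs: "r \<in> \<rat>" "s \<in> \<rat>" "x = Complex r s" using assms(1) by (rule gauss_fieldE)
  have "s = 0" using assms(2) rs(3) by (simp add: complex_eq_iff)
  then have "x = complex_of_real r" using rs by (simp add: complex_eq_iff)
  then show ?thesis using rs(1) by (auto elim!: Rats_cases')
qed

lemma nrm_gauss: "QI.nrm (of_int a + of_int b * \<i>) = nat (a^2 + b^2)"
proof -
  have "real (QI.nrm (of_int a + of_int b * \<i>)) = real_of_int (a^2 + b^2)"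
    using QI.nrm[OF gauss_intsI[of a b]] by (simp add: cmod_power2)
  then show ?thesis by linarith
qed

lemma nrm_sum_squares: "x = of_int a + of_int b * \<i> \<Longrightarrow> QI.nrm x = p \<Longrightarrow> a^2 + b^2 = int p"
  using nrm_gauss[of a b] by auto

lemma nrm_of_nat: "QI.nrm (of_nat n) = n^2"
  using nrm_gauss[of "int n" 0] by (simp add: nat_power_eq)

section \<open>Gaussian primes above a rational prime\<close>

lemma places_above_iff: "P \<in> places_above p \<longleftrightarrow> P \<in> PK \<and> of_nat p \<in> P"
  by (simp add: places_above_def)

lemma above_ex: "P \<in> PK \<Longrightarrow> \<exists>p. prime p \<and> P \<in> places_above p"
  using QI.prime_below[of P] by (auto simp: places_above_iff)

lemma above_int: assumes P: "P \<in> places_above p" and p: "prime p"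
  shows "of_int m \<in> P \<longleftrightarrow> int p dvd m"
proof
  have PK: "P \<in> PK" "of_nat p \<in> P" using P by (auto simp: places_above_iff)
  { assume m: "of_int m \<in> P"
    show "int p dvd m"
    proof (rule ccontr)
      assume "\<not> int p dvd m"
      then have "coprime (int p) m" using p by (simp add: prime_imp_coprime)
      then obtain x y where xy: "x * int p + y * m = 1" using bezout_int[of "int p" m] by auto
      then have "of_int x * of_nat p + of_int y * of_int m = (1::complex)" by (metis of_int_1 of_int_add of_int_mult of_int_of_nat_eq)
      moreover have "of_int x * of_nat p + of_int y * of_int m \<in> P"
        using PK m by (intro QI.place_add QI.place_mult QI.O_int)
      ultimately show False using QI.placeD(3)[OF PK(1)] by simp
    qed }
  { assume "int p dvd m"
    then obtain k where "m = k * int p" by (metis dvd_def mult.commute)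
    then have "of_int m = of_int k * (of_nat p :: complex)" by simp
    then show "of_int m \<in> P" using QI.place_mult[OF PK(1) QI.O_int PK(2)] by simp }
qed

lemma above_unique: assumes "P \<in> places_above p" "P \<in> places_above q" "prime p" "prime q" shows "p = q"
proof -
  have "of_int (int q) \<in> P" using assms by (simp add: places_above_iff)
  then have "int p dvd int q" using above_int[OF assms(1,3)] by blast
  then show ?thesis using assms by (simp add: primes_dvd_imp_eq)
qed

lemma cnj_place: assumes P: "P \<in> PK" shows "cnj ` P \<in> PK"
proof (rule QI.placeI)
  have I: "\<And>c x. c \<in> ZI \<Longrightarrow> x \<in> P \<Longrightarrow> c * x \<in> P" "\<And>x y. x \<in> P \<Longrightarrow> y \<in> P \<Longrightarrow> x + y \<in> P" "P \<subseteq> ZI" "0 \<in> P"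
    using QI.place_mult[OF P] QI.place_add[OF P] QI.placeD(2)[OF P] QI.idealD(2)[OF QI.placeD(1)[OF P]] by auto
  have ci: "x \<in> cnj ` P \<longleftrightarrow> cnj x \<in> P" for x by (metis complex_cnj_cnj image_iff)
  show "ideal (cnj ` P) (int_ring QI)" unfolding QI.ideal_iff
    using I QI.O_cnj by (auto simp: ci image_subset_iff) (metis complex_cnj_cnj complex_cnj_mult QI.O_cnj)?
  show "1 \<notin> cnj ` P" using QI.placeD(3)[OF P] by (simp add: ci)
  show "a \<in> cnj ` P \<or> b \<in> cnj ` P" if "a \<in> ZI" "b \<in> ZI" "a * b \<in> cnj ` P" for a b
    using QI.placeD(4)[OF P QI.O_cnj[OF that(1)] QI.O_cnj[OF that(2)]] that(3) by (simp add: ci)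
  show "cnj ` P \<noteq> {0}"
  proof
    assume "cnj ` P = {0}"
    then have "P \<subseteq> {0}" by (metis complex_cnj_zero_iff image_subset_iff singletonD singletonI subsetI subset_refl)
    then show False using QI.placeD(5)[OF P] I(4) by blast
  qed
qed

lemma cnj_image_iff: "x \<in> cnj ` P \<longleftrightarrow> cnj x \<in> P" by (metis complex_cnj_cnj image_iff)

lemma cnj_cnj_image [simp]: "cnj ` cnj ` P = P" by (auto simp: image_image)

lemma cnj_above: "P \<in> places_above p \<Longrightarrow> cnj ` P \<in> places_above p"
  using cnj_place by (auto simp: places_above_iff cnj_image_iff)

text \<open>The generator divides \<open>p\<close>, so its norm divides \<open>p ^ 2\<close> and is
  not 1. If it is \<open>p ^ 2\<close>, the cofactor is a unit and \<open>p\<close> itself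
  generates.\<close>

lemma nrm_ppi: assumes P: "P \<in> places_above p" and p: "prime p"
  shows "QI.nrm (euclid_field.ppi ZI P) = p \<or> QI.nrm (euclid_field.ppi ZI P) = p^2 \<and> P = QI.pid (of_nat p)"
proof -
  have PK: "P \<in> PK" "of_nat p \<in> P" using P by (auto simp: places_above_iff)
  let ?\<pi> = "QI.ppi P"
  note \<pi> = QI.ppi[OF PK(1)]
  obtain c where c: "c \<in> ZI" "of_nat p = c * ?\<pi>" using \<pi>(2) PK(2) by (metis QI.pidE)
  have n: "p^2 = QI.nrm c * QI.nrm ?\<pi>" using QI.nrm_mult[OF c(1) \<pi>(1)] c(2) nrm_of_nat by metis
  then have "QI.nrm ?\<pi> dvd p^2" by simp
  then obtain i where i: "i \<le> 2" "QI.nrm ?\<pi> = p^i" using p divides_primepow_nat by blast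
  have "i \<noteq> 0"
  proof
    assume "i = 0"
    then show False using \<pi>(5) i(2) by simp
  qed
  then have "i = 1 \<or> i = 2" using i by auto
  moreover have "P = QI.pid (of_nat p)" if "i = 2"
  proof -
    have "QI.nrm c = 1" using n i that p by (simp add: prime_gt_0_nat)
    then have ic: "inverse c \<in> ZI" "c \<noteq> 0" using QI.nrm_1[OF c(1)] by auto
    then have "?\<pi> = inverse c * of_nat p" using c(2) by simp
    then have "QI.pid ?\<pi> \<subseteq> QI.pid (of_nat p)" using QI.pid_subset[OF \<pi>(1), of "of_nat p"] ic by auto
    moreover have "QI.pid (of_nat p) \<subseteq> QI.pid ?\<pi>"
      by (rule iffD2[OF QI.pid_subset[OF QI.O_simps(4) \<pi>(1)]]) (use c in blast)
    ultimately show ?thesis using \<pi>(2) by simp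
  qed
  ultimately show ?thesis using i by auto
qed

text \<open>The norm of the generator of \<open>P\<close> is divisible by \<open>p\<close>, so a
  place above \<open>p\<close> contains this generator or its conjugate.\<close>

lemma places_above_eq: assumes P: "P \<in> places_above p" and p: "prime p"
  shows "places_above p = {P, cnj ` P}"
proof
  have PK: "P \<in> PK" "of_nat p \<in> P" using P by (auto simp: places_above_iff)
  note \<pi> = QI.ppi[OF PK(1)]
  show "{P, cnj ` P} \<subseteq> places_above p" using P cnj_above by simp
  show "places_above p \<subseteq> {P, cnj ` P}"
  proof
    fix Q assume Q: "Q \<in> places_above p"
    then have QK: "Q \<in> PK" "of_nat p \<in> Q" by (auto simp: places_above_iff)
    have "p dvd QI.nrm (QI.ppi P)" using nrm_ppi[OF P p] by auto
    then have "int p dvd int (QI.nrm (QI.ppi P))" by simp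
    then have "of_int (int (QI.nrm (QI.ppi P))) \<in> Q" using above_int[OF Q p] by blast
    then have "QI.ppi P * cnj (QI.ppi P) \<in> Q" using QI.nrm_cnj[OF \<pi>(1)] by simp
    then have "QI.ppi P \<in> Q \<or> cnj (QI.ppi P) \<in> Q" using QI.placeD(4)[OF QK(1) \<pi>(1) QI.O_cnj[OF \<pi>(1)]] by blast
    then have "P = Q \<or> P = cnj ` Q"
      using QI.places_unique[OF PK(1) QK(1)] QI.places_unique[OF PK(1) cnj_place[OF QK(1)]] cnj_image_iff by blast
    then show "Q \<in> {P, cnj ` P}" by auto
  qed
qed

text \<open>With the generator \<open>a + b i\<close> also \<open>2 a\<close> and
  \<open>2 b i\<close> lie in \<open>P\<close>. As 2 does not, \<open>p\<close> divides
  \<open>a\<close> and \<open>b\<close>, and the norm \<open>a^2 + b^2\<close> cannot be just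
  \<open>p\<close>.\<close>

lemma real_place: assumes P: "P \<in> places_above p" and p: "prime p" and c: "cnj ` P = P" and two: "2 \<notin> P"
  shows "P = QI.pid (of_nat p)" "inert_prime p" "odd p"
proof -
  have PK: "P \<in> PK" "of_nat p \<in> P" using P by (auto simp: places_above_iff)
  note \<pi> = QI.ppi[OF PK(1)]
  obtain a b where ab: "QI.ppi P = of_int a + of_int b * \<i>" using \<pi>(1) by (rule gauss_intsE)
  have cP: "cnj (QI.ppi P) \<in> P" using \<pi>(4) c by blast
  have "2 * of_int a = QI.ppi P + cnj (QI.ppi P)" "(2 * \<i>) * of_int b = QI.ppi P - cnj (QI.ppi P)" by (simp_all add: ab complex_eq_iff)
  then have "2 * of_int a \<in> P" "(2 * \<i>) * of_int b \<in> P" using QI.place_add[OF PK(1)] QI.place_diff[OF PK(1)] \<pi>(4) cP by simp_all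
  moreover have "2 * \<i> \<notin> P"
  proof
    assume "2 * \<i> \<in> P"
    then have "(- \<i>) * (2 * \<i>) \<in> P" by (rule QI.place_mult[OF PK(1) QI.O_uminus[OF i_gauss]])
    moreover have "(- \<i>) * (2 * \<i>) = 2" by (simp add: complex_eq_iff)
    ultimately show False using two by metis
  qed
  moreover have "2 * \<i> \<in> ZI" using QI.O_mult by simp
  ultimately have "of_int a \<in> P" "of_int b \<in> P" using QI.placeD(4)[OF PK(1)] two QI.O_int QI.O_simps(3) by blast+
  then have d: "int p dvd a" "int p dvd b" using above_int[OF P p] by auto
  have "QI.nrm (QI.ppi P) \<noteq> p"
  proof
    assume "QI.nrm (QI.ppi P) = p"
    then have e: "a^2 + b^2 = int p" by (rule nrm_sum_squares[OF ab])
    have "(int p)^2 dvd a^2" "(int p)^2 dvd b^2" using d by simp_all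
    then have "(int p)^2 dvd int p" using dvd_add e by metis
    then have "p^2 dvd p" by (metis of_nat_dvd_iff of_nat_power)
    then have "p^2 \<le> p" using p prime_gt_0_nat dvd_imp_le by blast
    then show False using prime_gt_1_nat[OF p] by (simp add: power2_eq_square)
  qed
  then show P': "P = QI.pid (of_nat p)" using nrm_ppi[OF P p] by blast
  then show "inert_prime p" using PK p unfolding inert_prime_def finite_places_def QI.PIdl by simp
  have "p \<noteq> 2" using PK two by auto
  then show "odd p" using p primes_dvd_imp_eq two_is_prime_nat by blast
qed

lemma inert_place: assumes "inert_prime p" "P \<in> places_above p" shows "cnj ` P = P" "P = QI.pid (of_nat p)"
proof -
  have p: "prime p" and I: "primeideal (QI.pid (of_nat p)) (int_ring QI)" using assms by (auto simp: inert_prime_def QI.PIdl)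
  have PK: "P \<in> PK" "of_nat p \<in> P" using assms(2) by (auto simp: places_above_iff)
  have "QI.pid (of_nat p) \<noteq> {0}" using QI.pid_self[of "of_nat p"] p prime_gt_0_nat[OF p] by force
  then have IK: "QI.pid (of_nat p) \<in> PK" using I by (simp add: finite_places_def)
  have "QI.pid (of_nat p) \<subseteq> P" using QI.place_mult[OF PK(1) _ PK(2)] by (auto elim!: QI.pidE)
  then have "QI.ppi (QI.pid (of_nat p)) \<in> P" using QI.ppi(4)[OF IK] by blast
  then show e: "P = QI.pid (of_nat p)" using QI.places_unique[OF IK PK(1)] by blast
  have "x \<in> cnj ` P \<longleftrightarrow> x \<in> P" for x
    unfolding cnj_image_iff e using QI.O_cnj unfolding QI.pid_def
    by (smt (verit) complex_cnj_cnj complex_cnj_mult complex_cnj_of_nat mem_Collect_eq)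
  then show "cnj ` P = P" by blast
qed

section \<open>The place above 2, split primes and ramified primes\<close>

definition P2 :: "complex set" where "P2 = QI.pid (1 + \<i>)"

lemma one_i: "1 + \<i> \<in> ZI" "QI.nrm (1 + \<i>) = 2"
  using gauss_intsI[of 1 1] nrm_gauss[of 1 1] by simp_all

lemma P2_place: "P2 \<in> PK"
  unfolding P2_def
proof (rule QI.irred_place[OF one_i(1)])
  fix x y assume xy: "x \<in> ZI" "y \<in> ZI" "1 + \<i> = x * y"
  then have "QI.nrm x * QI.nrm y = 2" using QI.nrm_mult one_i(2) by metis
  then have "QI.nrm x dvd 2" by (metis dvd_triv_left)
  then have "QI.nrm x = 1 \<or> QI.nrm x = 2" by (metis prime_nat_iff two_is_prime_nat)
  then show "QI.nrm x = 1 \<or> QI.nrm y = 1" using \<open>QI.nrm x * QI.nrm y = 2\<close> by auto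
qed (simp add: one_i)

lemma two_P2: "2 \<in> P2"
proof -
  have "2 = (1 - \<i>) * (1 + \<i>)" by (simp add: complex_eq_iff)
  then show ?thesis unfolding P2_def by (intro QI.pidI[of "1 - \<i>"]) (use QI.O_diff in auto)
qed

text \<open>Because \<open>(1 + i)^2 = 2 i\<close>, a prime ideal containing 2 contains
  \<open>1 + i\<close>.\<close>

lemma P2_unique: assumes P: "P \<in> PK" "2 \<in> P" shows "P = P2"
proof -
  have "(1 + \<i>) * (1 + \<i>) = \<i> * 2" by (simp add: complex_eq_iff)
  then have "(1 + \<i>) * (1 + \<i>) \<in> P" using QI.place_mult[OF P(1) i_gauss P(2)] by simp
  then have "1 + \<i> \<in> P" using QI.placeD(4)[OF P(1) one_i(1) one_i(1)] by blast
  then have "P2 \<subseteq> P" unfolding P2_def using QI.place_mult[OF P(1)] by (auto elim!: QI.pidE)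
  then have "QI.ppi P2 \<in> P" using QI.ppi(4)[OF P2_place] by blast
  then show ?thesis using QI.places_unique[OF P2_place P(1)] by simp
qed

lemma above_2: "places_above 2 = {P2}"
proof -
  have "P \<in> places_above 2 \<longleftrightarrow> P = P2" for P
    using P2_place two_P2 P2_unique[of P] unfolding places_above_iff by auto
  then show ?thesis by blast
qed

lemma cnj_P2: "cnj ` P2 = P2"
  by (rule P2_unique[OF cnj_place[OF P2_place]]) (simp add: cnj_image_iff two_P2)

lemma not_split_2: "\<not> split_prime 2" by (simp add: split_prime_def above_2)

lemma sum_squares_mod4: assumes "a^2 + b^2 = int p" shows "p mod 4 \<noteq> 3"
proof -
  have sq: "x^2 mod 4 = 0 \<or> x^2 mod 4 = 1" for x :: int
  proof (cases "even x")
    case True then obtain y where "x = 2 * y" by blast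
    then show ?thesis by (simp add: power_mult_distrib)
  next
    case False then obtain y where "x = 2 * y + 1" by (blast elim: oddE)
    then have "x^2 = 4 * (y^2 + y) + 1" by (simp add: power2_eq_square algebra_simps)
    then show ?thesis by presburger
  qed
  have "int p mod 4 = (a^2 mod 4 + b^2 mod 4) mod 4" by (simp add: mod_add_eq flip: assms)
  then have "int p mod 4 \<noteq> 3" using sq[of a] sq[of b] by auto
  then show ?thesis by presburger
qed

text \<open>The generator has norm \<open>p\<close>: otherwise \<open>p\<close> itself generates,
  and that ideal is stable under conjugation. The last claim says that the residue field is the
  prime field, so computations modulo \<open>P\<close> can be made with rational integers.\<close>

lemma nonreal_place: assumes P: "P \<in> places_above p" and p: "prime p" and c: "cnj ` P \<noteq> P"
  shows "split_prime p" "odd p" "2 \<notin> P" "p mod 4 = 1" "\<And>x. x \<in> ZI \<Longrightarrow> \<exists>m. x - of_int m \<in> P"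
proof -
  have PK: "P \<in> PK" "of_nat p \<in> P" using P by (auto simp: places_above_iff)
  note \<pi> = QI.ppi[OF PK(1)]
  show s: "split_prime p" using places_above_eq[OF P p] p c by (simp add: split_prime_def)
  show two: "2 \<notin> P" using P2_unique[OF PK(1)] cnj_P2 c by auto
  have "p \<noteq> 2" using PK two by auto
  then show op: "odd p" using p primes_dvd_imp_eq two_is_prime_nat by blast
  obtain a b where ab: "QI.ppi P = of_int a + of_int b * \<i>" using \<pi>(1) by (rule gauss_intsE)
  have "P \<noteq> QI.pid (of_nat p)"
  proof
    assume e: "P = QI.pid (of_nat p)"
    then have "inert_prime p" using PK p unfolding inert_prime_def finite_places_def QI.PIdl by simp
    then show False using inert_place[OF _ P] c by blast
  qed
  then have "QI.nrm (QI.ppi P) = p" using nrm_ppi[OF P p] by blast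
  then have e: "a^2 + b^2 = int p" by (rule nrm_sum_squares[OF ab])
  have "p mod 4 \<noteq> 3" by (rule sum_squares_mod4[OF e])
  then show "p mod 4 = 1" using op by presburger
  fix x assume "x \<in> ZI"
  then obtain m n where x: "x = of_int m + of_int n * \<i>" by (rule gauss_intsE)
  have "\<not> int p dvd b"
  proof
    assume b: "int p dvd b"
    then have "int p dvd b^2" by (simp add: power2_eq_square)
    then have "int p dvd a^2" using e by (metis dvd_add_left_iff dvd_refl)
    then have a: "int p dvd a" using p by (simp add: prime_dvd_power_iff)
    have "(int p)^2 dvd a^2" "(int p)^2 dvd b^2" using a b by simp_all
    then have "(int p)^2 dvd int p" using dvd_add e by metis
    then have "p^2 dvd p" by (metis of_nat_dvd_iff of_nat_power)
    then have "p^2 \<le> p" using p prime_gt_0_nat dvd_imp_le by blast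
    then show False using prime_gt_1_nat[OF p] by (simp add: power2_eq_square)
  qed
  then have "coprime (int p) b" using p by (simp add: prime_imp_coprime)
  then obtain s t where st: "t * int p + s * b = 1" using bezout_int[of "int p" b] by auto
  then have st': "of_int t * of_nat p + of_int s * of_int b = (1::complex)" by (metis of_int_1 of_int_add of_int_mult of_int_of_nat_eq)
  \<comment> \<open>\<open>s\<close> inverts \<open>b\<close> modulo \<open>p\<close>, so
    \<open>i\<close> is congruent to \<open>- (s * a)\<close> because \<open>a + b i\<close> lies in
    \<open>P\<close>.\<close>
  have "x - of_int (m - n * (s * a)) = of_int n * (of_int s * QI.ppi P + (of_int t * \<i>) * of_nat p)"
  proof -
    have "of_int n * (of_int s * QI.ppi P + (of_int t * \<i>) * of_nat p) = of_int n * (of_int s * of_int a) + of_int n * \<i> * (of_int t * of_nat p + of_int s * of_int b)"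
      by (simp add: ab algebra_simps)
    then show ?thesis unfolding st' by (simp add: x)
  qed
  also have "\<dots> \<in> P" using PK \<pi>(4) by (intro QI.place_mult QI.place_add QI.O_mult QI.O_int) auto
  finally show "\<exists>m. x - of_int m \<in> P" by blast
qed

lemma split_place: assumes "split_prime p" "P \<in> places_above p" shows "cnj ` P \<noteq> P"
  using assms places_above_eq[OF assms(2)] by (auto simp: split_prime_def)

text \<open>If the square of the generator divides \<open>p\<close>, its norm is \<open>p\<close>
  rather than \<open>p ^ 2\<close>, so \<open>p\<close> is a sum of two squares. Condition (B) thus
  has no cases.\<close>

lemma ramified_mod4: assumes "ramified_prime p" shows "p mod 4 \<noteq> 3"
proof -
  obtain P where p: "prime p" and P: "P \<in> places_above p" and o: "ord_ideal QI P (QI.pid (of_nat p)) > 1"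
    using assms by (auto simp: ramified_prime_def QI.PIdl)
  have PK: "P \<in> PK" "of_nat p \<in> P" using P by (auto simp: places_above_iff)
  have p0: "(of_nat p :: complex) \<noteq> 0" using prime_gt_0_nat[OF p] by simp
  note \<pi> = QI.ppi[OF PK(1)]
  have "QI.val P (of_nat p) \<ge> int 2" using o QI.ord_ideal_pid[OF PK(1) _ p0] by simp
  then have "of_nat p \<in> QI.pid (QI.ppi P ^ 2)" using QI.val_O_ge[OF PK(1) _ p0, of 2] by simp
  then obtain c where c: "c \<in> ZI" "of_nat p = c * QI.ppi P ^ 2" by (rule QI.pidE)
  have "p^2 = QI.nrm c * QI.nrm (QI.ppi P ^ 2)" using QI.nrm_mult[OF c(1) QI.O_power[OF \<pi>(1)]] c(2) nrm_of_nat by metis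
  also have "QI.nrm (QI.ppi P ^ 2) = QI.nrm (QI.ppi P) ^ 2" using QI.nrm_mult[OF \<pi>(1) \<pi>(1)] by (simp add: power2_eq_square)
  finally have n: "p^2 = QI.nrm c * QI.nrm (QI.ppi P) ^ 2" .
  have "QI.nrm (QI.ppi P) \<noteq> p^2"
  proof
    assume "QI.nrm (QI.ppi P) = p^2"
    then have "p^2 * 1 = p^2 * (QI.nrm c * p^2)" using n by (simp add: power2_eq_square mult_ac)
    then have "p^2 = 0 \<or> 1 = QI.nrm c * p^2" by (simp only: mult_cancel_left)
    then show False using prime_gt_1_nat[OF p] by simp
  qed
  then have "QI.nrm (QI.ppi P) = p" using nrm_ppi[OF P p] by blast
  moreover obtain a b where ab: "QI.ppi P = of_int a + of_int b * \<i>" using \<pi>(1) by (rule gauss_intsE)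
  ultimately have "a^2 + b^2 = int p" by (intro nrm_sum_squares[OF ab])
  then show ?thesis by (rule sum_squares_mod4)
qed

section \<open>Conjugation, inclusion and norm of ideles\<close>

lemma gauss_ints_Rats: assumes "x \<in> ZI" "x \<in> \<rat>" shows "x \<in> \<int>"
  using rational_algebraic_int_is_int[OF QI.O_alg[OF assms(1)] assms(2)] .

lemma below_place: assumes P: "P \<in> PK" shows "P \<inter> \<rat> \<in> PQ"
proof (rule rat.placeI)
  note I = QI.place_mult[OF P] QI.place_add[OF P] QI.placeD(2)[OF P] QI.idealD(2)[OF QI.placeD(1)[OF P]]
  show "ideal (P \<inter> \<rat>) (int_ring \<rat>)" unfolding rat.ideal_iff
    using I gauss_ints_Rats Z_sub by (auto intro: Rats_mult Ints_subset_Rats[THEN subsetD])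
  show "1 \<notin> P \<inter> \<rat>" using QI.placeD(3)[OF P] by simp
  show "a \<in> P \<inter> \<rat> \<or> b \<in> P \<inter> \<rat>" if "a \<in> \<int>" "b \<in> \<int>" "a * b \<in> P \<inter> \<rat>" for a b
    using QI.placeD(4)[OF P Z_sub[OF that(1)] Z_sub[OF that(2)]] that Ints_subset_Rats by blast
  obtain p where p: "prime p" "P \<in> places_above p" using above_ex[OF P] by blast
  then have "of_nat p \<in> P \<inter> \<rat>" "(of_nat p :: complex) \<noteq> 0" using prime_gt_0_nat by (auto simp: places_above_iff)
  then show "P \<inter> \<rat> \<noteq> {0}" by blast
qed

lemma below_places: "v \<in> VK \<Longrightarrow> place_below v \<in> places \<rat>"
  by (cases v) (auto simp: below_place)

text \<open>At a finite place the exponent is the ramification index, because both absolute values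
  use base 2 with normalised valuations; at infinity it is 1.\<close>

lemma abs_below: assumes v: "v \<in> VK"
  shows "\<exists>e>0. \<forall>x\<in>\<rat>. absv QI v x = absv \<rat> (place_below v) x ^ e"
proof (cases v)
  case Inf_place then show ?thesis by (intro exI[of _ 1]) (simp add: absv.simps)
next
  case (Fin_place P)
  then have P: "P \<in> PK" using v by simp
  define p where "p = P \<inter> \<rat>"
  have pQ: "p \<in> PQ" using below_place[OF P] by (simp add: p_def)
  note \<pi> = rat.ppi[OF pQ]
  have \<pi>P: "rat.ppi p \<in> P" "rat.ppi p \<in> ZI" using \<pi>(4,1) Z_sub by (auto simp: p_def)
  have \<pi>K: "rat.ppi p \<in> QI" using QI.O_F \<pi>P by blast
  have "QI.val P (rat.ppi p) \<ge> 1" using QI.val_O_nonneg(2)[OF P \<pi>P(2) \<pi>(3)] \<pi>P by blast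
  then obtain e where e: "QI.val P (rat.ppi p) = int e" "e > 0" by (metis int_one_le_iff_zero_less zero_less_imp_eq_int of_nat_0_less_iff)
  have "absv QI v x = absv \<rat> (place_below v) x ^ e" if x: "x \<in> \<rat>" for x
  proof (cases "x = 0")
    case True then show ?thesis using e(2) Fin_place by (simp add: absv.simps)
  next
    case False
    obtain b c where bc: "b \<in> \<int> - p" "c \<in> \<int> - p" "x = rat.ppi p powi (rat.val p x) * b / c" using rat.val_ex[OF pQ x False] by blast
    have u: "QI.val P b = 0 \<and> b \<in> QI \<and> b \<noteq> 0" if "b \<in> \<int> - p" for b
    proof -
      have b: "b \<in> ZI" "b \<notin> P" using that Z_sub Ints_subset_Rats by (auto simp: p_def)
      then have "b \<noteq> 0" using QI.idealD(2)[OF QI.placeD(1)[OF P]] by auto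
      then show ?thesis using QI.val_O_nonneg[OF P b(1)] b QI.O_F by force
    qed
    note ub = u[OF bc(1)] and uc = u[OF bc(2)]
    have \<pi>k: "rat.ppi p powi (rat.val p x) \<in> QI" "rat.ppi p powi (rat.val p x) \<noteq> 0" using QI.F_powi \<pi>K \<pi>(3) by auto
    have "QI.val P x = QI.val P ((rat.ppi p powi (rat.val p x) * b) * inverse c)" using bc(3) by (simp add: divide_inverse)
    also have "\<dots> = QI.val P (rat.ppi p powi (rat.val p x)) + QI.val P b + - QI.val P c"
      using ub uc \<pi>k QI.F_mult QI.F_inverse by (simp add: QI.val_mult[OF P] QI.val_inverse[OF P])
    also have "\<dots> = rat.val p x * int e" using ub uc QI.val_powi[OF P \<pi>K \<pi>(3)] e by simp
    finally have vx: "QI.val P x = rat.val p x * int e" .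
    have "absv QI v x = 2 powi (- (rat.val p x * int e))" using QI.AP_val[OF P Q_sub_K[OF x] False] vx Fin_place by simp
    also have "\<dots> = (2 powi (- rat.val p x)) ^ e" by (simp add: power_int_power' flip: mult_minus_left)
    also have "\<dots> = absv \<rat> (place_below v) x ^ e" using rat.AP_val[OF pQ x False] Fin_place by (simp add: p_def)
    finally show ?thesis .
  qed
  then show ?thesis using e(2) by blast
qed

section \<open>Inclusion of the rational ideles\<close>

abbreviation "CK v \<equiv> carrier (cauchy_ring QI v)"
abbreviation "CQ v \<equiv> carrier (cauchy_ring \<rat> v)"

text \<open>A positive power of an absolute value has the same Cauchy and null sequences; powers and
  roots translate the bounds.\<close>

lemma cauchy_below: assumes v: "v \<in> VK" and s: "\<And>n. s n \<in> \<rat>"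
  shows "s \<in> CK v \<longleftrightarrow> s \<in> CQ (place_below v)"
    "s \<in> null_seqs QI v \<longleftrightarrow> s \<in> null_seqs \<rat> (place_below v)"
proof -
  note vQ = below_places[OF v]
  from abs_below[OF v] obtain e :: nat where e0: "e > 0 \<and> (\<forall>x\<in>\<rat>. absv QI v x = absv \<rat> (place_below v) x ^ e)" ..
  have e: "e > 0" "\<And>x. x \<in> \<rat> \<Longrightarrow> absv QI v x = absv \<rat> (place_below v) x ^ e" using e0 by simp_all
  have d: "s m - s n \<in> \<rat>" for m n using s by auto
  show c: "s \<in> CK v \<longleftrightarrow> s \<in> CQ (place_below v)"
  proof
    assume a: "s \<in> CK v"
    show "s \<in> CQ (place_below v)"
    proof (rule rat.C_I[OF vQ s])
      fix r :: real assume r: "r > 0"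
      then obtain N where N: "\<And>m n. m \<ge> N \<Longrightarrow> n \<ge> N \<Longrightarrow> absv QI v (s m - s n) < r ^ e" using QI.C_D[OF v a, of "r ^ e"] by auto
      have "absv \<rat> (place_below v) (s m - s n) < r" if "m \<ge> N" "n \<ge> N" for m n
        by (rule power_less_imp_less_base[OF N[OF that, unfolded e(2)[OF d]] less_imp_le[OF r]])
      then show "\<exists>N. \<forall>m\<ge>N. \<forall>n\<ge>N. absv \<rat> (place_below v) (s m - s n) < r" by blast
    qed
  next
    assume a: "s \<in> CQ (place_below v)"
    show "s \<in> CK v"
    proof (rule QI.C_I[OF v Q_sub_K[OF s]])
      fix r :: real assume r: "r > 0"
      \<comment> \<open>For numbers below 1 a positive power is at most the base, hence the bound
        \<open>min r 1\<close>.\<close>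
      then obtain N where N: "\<And>m n. m \<ge> N \<Longrightarrow> n \<ge> N \<Longrightarrow> absv \<rat> (place_below v) (s m - s n) < min r 1" using rat.C_D[OF vQ a, of "min r 1"] by auto
      have "absv QI v (s m - s n) < r" if "m \<ge> N" "n \<ge> N" for m n
      proof -
        let ?a = "absv \<rat> (place_below v) (s m - s n)"
        have "?a ^ e \<le> ?a ^ 1" using N[OF that] e(1) rat.A_nonneg[OF vQ] by (intro power_decreasing) auto
        then show ?thesis unfolding e(2)[OF d] using N[OF that] by simp
      qed
      then show "\<exists>N. \<forall>m\<ge>N. \<forall>n\<ge>N. absv QI v (s m - s n) < r" by blast
    qed
  qed
  have "(\<lambda>n. absv QI v (s n)) \<longlonglongrightarrow> 0 \<longleftrightarrow> (\<lambda>n. absv \<rat> (place_below v) (s n)) \<longlonglongrightarrow> 0"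
  proof
    assume "(\<lambda>n. absv QI v (s n)) \<longlonglongrightarrow> 0"
    then have "(\<lambda>n. root e (absv QI v (s n))) \<longlonglongrightarrow> root e 0" by (intro tendsto_real_root)
    then show "(\<lambda>n. absv \<rat> (place_below v) (s n)) \<longlonglongrightarrow> 0"
      using e(1) rat.A_nonneg[OF vQ] by (simp add: e(2)[OF s] real_root_power_cancel)
  next
    assume "(\<lambda>n. absv \<rat> (place_below v) (s n)) \<longlonglongrightarrow> 0"
    then have "(\<lambda>n. absv \<rat> (place_below v) (s n) ^ e) \<longlonglongrightarrow> 0 ^ e" by (intro tendsto_power)
    then show "(\<lambda>n. absv QI v (s n)) \<longlonglongrightarrow> 0" unfolding e(2)[OF s] by (simp only: zero_power[OF e(1)])
  qed
  then show "s \<in> null_seqs QI v \<longleftrightarrow> s \<in> null_seqs \<rat> (place_below v)"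
    using c by (simp add: QI.N_iff[OF v] rat.N_iff[OF vQ])
qed

text \<open>On representing sequences the inclusion is the identity: Gaussian classes are disjoint,
  so a rational class lies inside exactly one of them.\<close>

lemma idele_incl_at:
  assumes v: "v \<in> VK" and s: "s \<in> CQ (place_below v)" and y: "y (place_below v) = rat.cl (place_below v) s"
  shows "idele_incl y v = QI.cl v s" "s \<in> CK v"
proof -
  note vQ = below_places[OF v]
  have sQ: "s n \<in> \<rat>" for n by (rule rat.C_F[OF vQ s])
  show sK: "s \<in> CK v" using cauchy_below(1)[where s=s, OF v sQ] s by blast
  have sub: "rat.cl (place_below v) s \<subseteq> QI.cl v s"
  proof
    fix t assume t: "t \<in> rat.cl (place_below v) s"
    then have t': "t \<in> CQ (place_below v)" "(\<lambda>n. t n - s n) \<in> null_seqs \<rat> (place_below v)" using rat.cl_set[OF vQ s] by auto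
    have tQ: "t n \<in> \<rat>" for n by (rule rat.C_F[OF vQ t'(1)])
    have "t \<in> CK v" using cauchy_below(1)[where s=t, OF v tQ] t' by blast
    moreover have "(\<lambda>n. t n - s n) \<in> null_seqs QI v" using cauchy_below(2)[OF v, of "\<lambda>n. t n - s n"] tQ sQ t' by auto
    ultimately show "t \<in> QI.cl v s" using QI.cl_set[OF v sK] by auto
  qed
  have "(THE Z. Z \<in> carrier (completion QI v) \<and> y (place_below v) \<subseteq> Z) = QI.cl v s"
  proof (rule the_equality)
    show "QI.cl v s \<in> carrier (completion QI v) \<and> y (place_below v) \<subseteq> QI.cl v s"
      using QI.cl_carrier[OF v sK] sub y by simp
    fix Z assume Z: "Z \<in> carrier (completion QI v) \<and> y (place_below v) \<subseteq> Z"
    then have "s \<in> Z" using y rat.cl_self[OF vQ s] by auto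
    then show "Z = QI.cl v s" using QI.mem_cl(2)[OF v] Z by blast
  qed
  then show "idele_incl y v = QI.cl v s" using v by (simp add: idele_incl_def)
qed

section \<open>Conjugation of ideles\<close>

lemma conj_places: "v \<in> VK \<Longrightarrow> conj_place v \<in> VK"
  by (cases v) (auto simp: cnj_place)
lemma conj_conj_place [simp]: "conj_place (conj_place v) = v"
  by (cases v) auto
lemma below_conj [simp]: "place_below (conj_place v) = place_below v"
proof (cases v)
  case (Fin_place P)
  have "cnj ` P \<inter> \<rat> = P \<inter> \<rat>"
  proof -
    have "x \<in> cnj ` P \<longleftrightarrow> x \<in> P" if "x \<in> \<rat>" for x :: complex
    proof -
      have "cnj x = x" using that by (auto elim!: Rats_fracE)
      then show ?thesis by (simp add: cnj_image_iff)
    qed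
    then show ?thesis by blast
  qed
  then show ?thesis by (simp add: Fin_place)
qed simp

text \<open>The conjugate of a uniformiser at the conjugate place is a uniformiser at
  \<open>P\<close>. Conjugating the normal form of \<open>x\<close> then gives the claim.\<close>

lemma val_cnj: assumes P: "P \<in> PK" and x: "x \<in> QI" "x \<noteq> 0"
  shows "QI.val P (cnj x) = QI.val (cnj ` P) x"
proof -
  define Q where "Q = cnj ` P"
  have Q: "Q \<in> PK" using cnj_place[OF P] by (simp add: Q_def)
  have PQ: "z \<in> Q \<longleftrightarrow> cnj z \<in> P" for z by (simp add: Q_def cnj_image_iff)
  note \<pi> = QI.ppi[OF Q] and \<rho> = QI.ppi[OF P]
  \<comment> \<open>The conjugate of the generator of \<open>Q\<close> lies in \<open>P\<close> and
    divides the generator of \<open>P\<close>, which bounds its valuation from both sides.\<close>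
  have 1: "QI.val P (cnj (QI.ppi Q)) = 1"
  proof -
    have c: "cnj (QI.ppi Q) \<in> ZI" "cnj (QI.ppi Q) \<noteq> 0" using QI.O_cnj \<pi> by auto
    have "cnj (QI.ppi P) \<in> Q" using PQ \<rho>(4) by simp
    then obtain d where d: "d \<in> ZI" "cnj (QI.ppi P) = d * QI.ppi Q" using \<pi>(2) by (metis QI.pidE)
    have cd: "cnj d \<in> ZI" using QI.O_cnj[OF d(1)] .
    have "cnj (cnj (QI.ppi P)) = cnj d * cnj (QI.ppi Q)" unfolding d(2) by simp
    then have e: "QI.ppi P = cnj d * cnj (QI.ppi Q)" by simp
    then have d0: "cnj d \<noteq> 0" using \<rho>(3) by auto
    have "QI.val P (QI.ppi P) = QI.val P (cnj d) + QI.val P (cnj (QI.ppi Q))"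
      by (subst e) (rule QI.val_mult[OF P QI.O_F[OF cd] d0 QI.O_F[OF c(1)] c(2)])
    moreover have "QI.val P (QI.ppi P) = 1" using QI.val_ppi[OF P P] by simp
    moreover have "QI.val P (cnj d) \<ge> 0" using QI.val_O_nonneg(1)[OF P cd d0] .
    moreover have "QI.val P (cnj (QI.ppi Q)) \<ge> 1" using QI.val_O_nonneg(2)[OF P c] PQ \<pi>(4) by simp
    ultimately show ?thesis by linarith
  qed
  obtain b c where bc: "b \<in> ZI - Q" "c \<in> ZI - Q" "x = QI.ppi Q powi (QI.val Q x) * b / c"
    using QI.val_ex[OF Q x] by blast
  have u: "QI.val P (cnj b) = 0 \<and> cnj b \<in> QI \<and> cnj b \<noteq> 0" if "b \<in> ZI - Q" for b
  proof -
    have b: "cnj b \<in> ZI" "cnj b \<notin> P" using that PQ QI.O_cnj by auto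
    then have "cnj b \<noteq> 0" using QI.idealD(2)[OF QI.placeD(1)[OF P]] by auto
    then show ?thesis using QI.val_O_nonneg[OF P b(1)] b QI.O_F by force
  qed
  note ub = u[OF bc(1)] and uc = u[OF bc(2)]
  have \<pi>K: "cnj (QI.ppi Q) \<in> QI" "cnj (QI.ppi Q) \<noteq> 0" using QI.F_cnj[OF \<pi>(6)] \<pi>(3) by auto
  have \<pi>k: "cnj (QI.ppi Q) powi (QI.val Q x) \<in> QI" "cnj (QI.ppi Q) powi (QI.val Q x) \<noteq> 0" using QI.F_powi \<pi>K by auto
  have "cnj x = cnj (QI.ppi Q powi (QI.val Q x) * b / c)" using bc(3) by simp
  also have "\<dots> = (cnj (QI.ppi Q) powi (QI.val Q x) * cnj b) * inverse (cnj c)" by (simp add: divide_inverse power_int_def)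
  finally have "QI.val P (cnj x) = QI.val P ((cnj (QI.ppi Q) powi (QI.val Q x) * cnj b) * inverse (cnj c))" by simp
  also have "\<dots> = QI.val P (cnj (QI.ppi Q) powi (QI.val Q x)) + QI.val P (cnj b) + - QI.val P (cnj c)"
    using ub uc \<pi>k QI.F_mult QI.F_inverse by (simp add: QI.val_mult[OF P] QI.val_inverse[OF P])
  also have "\<dots> = QI.val Q x" using ub uc QI.val_powi[OF P \<pi>K] 1 by simp
  finally show ?thesis by (simp add: Q_def)
qed

lemma abs_cnj: assumes v: "v \<in> VK" and x: "x \<in> QI"
  shows "absv QI v (cnj x) = absv QI (conj_place v) x"
proof (cases v)
  case (Fin_place P)
  then have P: "P \<in> PK" using v by simp
  show ?thesis using val_cnj[OF P x] QI.AP_val[OF P, of "cnj x"] QI.AP_val[OF cnj_place[OF P], of x] x QI.F_cnj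
    by (cases "x = 0") (auto simp: Fin_place absv.simps)
qed (simp add: absv.simps)

lemma cauchy_cnj: assumes v: "v \<in> VK" and s: "s \<in> CK (conj_place v)" shows "cnj \<circ> s \<in> CK v"
    "s \<in> null_seqs QI (conj_place v) \<Longrightarrow> cnj \<circ> s \<in> null_seqs QI v"
proof -
  note cv = conj_places[OF v]
  have sF: "s n \<in> QI" for n by (rule QI.C_F[OF cv s])
  have e: "absv QI v (cnj (s m) - cnj (s n)) = absv QI (conj_place v) (s m - s n)" for m n
    using abs_cnj[OF v QI.F_diff[OF sF sF]] by simp
  show *: "cnj \<circ> s \<in> CK v"
    by (rule QI.C_I[OF v]) (use QI.C_D[OF cv s] sF QI.F_cnj in \<open>auto simp: e\<close>)
  assume "s \<in> null_seqs QI (conj_place v)"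
  then show "cnj \<circ> s \<in> null_seqs QI v" using * by (simp add: QI.N_iff[OF v] QI.N_iff[OF cv] abs_cnj[OF v sF])
qed

text \<open>The reverse inclusion is the same statement at the conjugate place, since conjugating
  twice changes nothing.\<close>

lemma conj_cl: assumes v: "v \<in> VK" and s: "s \<in> CK (conj_place v)"
  shows "(\<lambda>s. cnj \<circ> s) ` QI.cl (conj_place v) s = QI.cl v (cnj \<circ> s)"
proof -
  note cv = conj_places[OF v]
  have sub: "(\<lambda>s. cnj \<circ> s) ` QI.cl (conj_place v) s \<subseteq> QI.cl v (cnj \<circ> s)"
    if v: "v \<in> VK" and s: "s \<in> CK (conj_place v)" for v s
  proof
    note cv = conj_places[OF v]
    fix u assume "u \<in> (\<lambda>s. cnj \<circ> s) ` QI.cl (conj_place v) s"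
    then obtain t where t: "t \<in> QI.cl (conj_place v) s" "u = cnj \<circ> t" by blast
    then have t': "t \<in> CK (conj_place v)" "(\<lambda>n. t n - s n) \<in> null_seqs QI (conj_place v)" using QI.cl_set[OF cv s] by auto
    have "(\<lambda>n. t n - s n) \<in> CK (conj_place v)" by (rule QI.C_diff[OF cv t'(1) s])
    then have "cnj \<circ> (\<lambda>n. t n - s n) \<in> null_seqs QI v" using cauchy_cnj(2)[OF v] t'(2) by blast
    moreover have "cnj \<circ> (\<lambda>n. t n - s n) = (\<lambda>n. (cnj \<circ> t) n - (cnj \<circ> s) n)" by (simp add: fun_eq_iff)
    ultimately show "u \<in> QI.cl v (cnj \<circ> s)" unfolding t(2) QI.cl_set[OF v cauchy_cnj(1)[OF v s]]
      using cauchy_cnj(1)[OF v t'(1)] by simp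
  qed
  have cc: "cnj \<circ> (cnj \<circ> t) = t" for t :: "nat \<Rightarrow> complex" by (simp add: fun_eq_iff)
  have "QI.cl v (cnj \<circ> s) \<subseteq> (\<lambda>s. cnj \<circ> s) ` QI.cl (conj_place v) s"
  proof
    fix u assume u: "u \<in> QI.cl v (cnj \<circ> s)"
    have "cnj \<circ> s \<in> CK (conj_place (conj_place v))" using cauchy_cnj(1)[OF v s] by simp
    from sub[OF cv this] have "(\<lambda>s. cnj \<circ> s) ` QI.cl v (cnj \<circ> s) \<subseteq> QI.cl (conj_place v) s" by (simp add: cc)
    then have "cnj \<circ> u \<in> QI.cl (conj_place v) s" using u by blast
    then show "u \<in> (\<lambda>s. cnj \<circ> s) ` QI.cl (conj_place v) s" by (intro image_eqI[of _ _ "cnj \<circ> u"]) (simp_all add: cc)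
  qed
  then show ?thesis using sub[OF v s] by blast
qed

abbreviation "IK \<equiv> idele_group QI"
abbreviation "IQ \<equiv> idele_group \<rat>"
abbreviation "KKv v \<equiv> completion QI v"
abbreviation "KQv v \<equiv> completion \<rat> v"

lemma idele_conj_at: assumes v: "v \<in> VK" and s: "s \<in> CK (conj_place v)" "x (conj_place v) = QI.cl (conj_place v) s"
  shows "idele_conj x v = QI.cl v (cnj \<circ> s)"
  using v s conj_cl[OF v s(1)] by (simp add: idele_conj_def)

lemma idele_rep: assumes x: "x \<in> carrier IK" and v: "v \<in> VK"
  obtains s where "s \<in> CK v" "x v = QI.cl v s" "s \<notin> null_seqs QI v"
  using QI.units_cases[OF v QI.IG_D(1)[OF x v]] by metis

lemma cabs_conj: assumes v: "v \<in> VK" and s: "s \<in> CK (conj_place v)"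
  shows "QI.cabs v (QI.cl v (cnj \<circ> s)) = QI.cabs (conj_place v) (QI.cl (conj_place v) s)"
proof -
  note cv = conj_places[OF v]
  have "(\<lambda>n. absv QI v ((cnj \<circ> s) n)) \<longlonglongrightarrow> QI.cabs (conj_place v) (QI.cl (conj_place v) s)"
    using QI.cabs_lim[OF cv s] abs_cnj[OF v QI.C_F[OF cv s]] by simp
  then show ?thesis by (rule QI.cabs_eqI[OF v cauchy_cnj(1)[OF v s]])
qed

lemma idele_conj_lu: assumes x: "x \<in> carrier IK" and P: "P \<in> PK"
  shows "idele_conj x (fp P) \<in> QI.LU P \<longleftrightarrow> x (fp (cnj ` P)) \<in> QI.LU (cnj ` P)"
proof -
  have v: "fp P \<in> VK" using P by simp
  obtain s where s: "s \<in> CK (conj_place (fp P))" "x (conj_place (fp P)) = QI.cl (conj_place (fp P)) s"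
    by (rule idele_rep[OF x conj_places[OF v]])
  have e: "idele_conj x (fp P) = QI.cl (fp P) (cnj \<circ> s)" by (rule idele_conj_at[where x=x, OF v s])
  show ?thesis unfolding e QI.local_units[OF P] QI.local_units[OF cnj_place[OF P]]
    using QI.cl_carrier[OF v cauchy_cnj(1)[OF v s(1)]] QI.cl_carrier[OF conj_places[OF v] s(1)] cabs_conj[OF v s(1)] s(2) by simp
qed

lemma idele_conj_closed: assumes x: "x \<in> carrier IK" shows "idele_conj x \<in> carrier IK"
proof (rule QI.IG_I[of _ "(`) cnj ` {P \<in> PK. x (fp P) \<notin> QI.LU P}"])
  fix v assume v: "v \<in> VK"
  note cv = conj_places[OF v]
  obtain s where s: "s \<in> CK (conj_place v)" "x (conj_place v) = QI.cl (conj_place v) s" "s \<notin> null_seqs QI (conj_place v)"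
    by (rule idele_rep[OF x cv])
  have "cnj \<circ> s \<notin> null_seqs QI v"
  proof
    assume n: "cnj \<circ> s \<in> null_seqs QI v"
    have "cnj \<circ> s \<in> CK (conj_place (conj_place v))" using cauchy_cnj(1)[OF v s(1)] by simp
    from cauchy_cnj(2)[OF cv this] n have "cnj \<circ> (cnj \<circ> s) \<in> null_seqs QI (conj_place v)" by simp
    moreover have "cnj \<circ> (cnj \<circ> s) = s" by (simp add: fun_eq_iff)
    ultimately show False using s(3) by simp
  qed
  then show "idele_conj x v \<in> QI.KU v"
    unfolding idele_conj_at[where x=x, OF v s(1,2)] by (rule QI.cl_units[OF v cauchy_cnj(1)[OF v s(1)]])
next
  show "finite ((`) cnj ` {P \<in> PK. x (fp P) \<notin> QI.LU P})" using QI.IG_D(3)[OF x] by simp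
  fix P assume P: "P \<in> PK" "P \<notin> (`) cnj ` {P \<in> PK. x (fp P) \<notin> QI.LU P}"
  have "x (fp (cnj ` P)) \<in> QI.LU (cnj ` P)"
  proof (rule ccontr)
    assume "\<not> ?thesis"
    then have "cnj ` (cnj ` P) \<in> (`) cnj ` {P \<in> PK. x (fp P) \<notin> QI.LU P}" using cnj_place[OF P(1)] by blast
    then show False using P(2) by simp
  qed
  then show "idele_conj x (fp P) \<in> QI.LU P" using idele_conj_lu[OF x P(1)] by simp
qed (simp add: idele_conj_def)

lemma idele_conj_mult: assumes x: "x \<in> carrier IK" and y: "y \<in> carrier IK"
  shows "idele_conj (x \<otimes>\<^bsub>IK\<^esub> y) = idele_conj x \<otimes>\<^bsub>IK\<^esub> idele_conj y"
proof (rule QI.IG_ext)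
  fix v assume v: "v \<in> VK"
  note cv = conj_places[OF v]
  obtain s where s: "s \<in> CK (conj_place v)" "x (conj_place v) = QI.cl (conj_place v) s" by (rule idele_rep[OF x cv])
  obtain t where t: "t \<in> CK (conj_place v)" "y (conj_place v) = QI.cl (conj_place v) t" by (rule idele_rep[OF y cv])
  have "(x \<otimes>\<^bsub>IK\<^esub> y) (conj_place v) = QI.cl (conj_place v) (\<lambda>n. s n * t n)"
    using QI.IG_mult[OF cv] QI.cl_mult[OF cv s(1) t(1)] s t by simp
  then have "idele_conj (x \<otimes>\<^bsub>IK\<^esub> y) v = QI.cl v (cnj \<circ> (\<lambda>n. s n * t n))"
    by (rule idele_conj_at[OF v QI.C_mult[OF cv s(1) t(1)]])
  also have "cnj \<circ> (\<lambda>n. s n * t n) = (\<lambda>n. (cnj \<circ> s) n * (cnj \<circ> t) n)" by (simp add: fun_eq_iff)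
  also have "QI.cl v \<dots> = idele_conj x v \<otimes>\<^bsub>KKv v\<^esub> idele_conj y v"
    unfolding idele_conj_at[where x=x, OF v s] idele_conj_at[where x=y, OF v t]
    using QI.cl_mult[OF v cauchy_cnj(1)[OF v s(1)] cauchy_cnj(1)[OF v t(1)]] by simp
  finally show "idele_conj (x \<otimes>\<^bsub>IK\<^esub> y) v = (idele_conj x \<otimes>\<^bsub>IK\<^esub> idele_conj y) v" using QI.IG_mult[OF v] by simp
qed (intro idele_conj_closed QI.IG_mult_closed x y)+

lemma idele_conj_conj: assumes x: "x \<in> carrier IK" shows "idele_conj (idele_conj x) = x"
proof (rule QI.IG_ext)
  fix v assume v: "v \<in> VK"
  note cv = conj_places[OF v]
  obtain s where s: "s \<in> CK v" "x v = QI.cl v s" by (rule idele_rep[OF x v])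
  have "idele_conj x (conj_place v) = QI.cl (conj_place v) (cnj \<circ> s)" by (rule idele_conj_at[OF cv]) (simp_all add: s)
  moreover have "cnj \<circ> s \<in> CK (conj_place v)" by (rule cauchy_cnj(1)[OF cv]) (simp add: s)
  ultimately have "idele_conj (idele_conj x) v = QI.cl v (cnj \<circ> (cnj \<circ> s))" by (intro idele_conj_at[OF v])
  moreover have "cnj \<circ> (cnj \<circ> s) = s" by (simp add: fun_eq_iff)
  ultimately show "idele_conj (idele_conj x) v = x v" using s by simp
qed (intro idele_conj_closed x)+

lemma conj_embed: assumes v: "v \<in> VK" and a: "a \<in> QI"
  shows "(\<lambda>s. cnj \<circ> s) ` embed QI (conj_place v) a = embed QI v (cnj a)"
proof -
  have "(\<lambda>s. cnj \<circ> s) ` embed QI (conj_place v) a = QI.cl v (cnj \<circ> (\<lambda>_. a))"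
    unfolding QI.embed_cl[OF conj_places[OF v]] by (rule conj_cl[OF v QI.C_const[OF conj_places[OF v] a]])
  also have "cnj \<circ> (\<lambda>_::nat. a) = (\<lambda>_. cnj a)" by (simp add: fun_eq_iff)
  finally show ?thesis unfolding QI.embed_cl[OF v] .
qed

lemma idele_conj_principal: "a \<in> QI \<Longrightarrow> idele_conj (principal_idele QI a) = principal_idele QI (cnj a)"
  using conj_embed conj_places by (auto simp: idele_conj_def principal_idele_def fun_eq_iff restrict_def)

lemma idele_conj_local: assumes v: "v \<in> VK" and a: "a \<in> QI"
  shows "idele_conj (local_idele QI v (embed QI v a)) = local_idele QI (conj_place v) (embed QI (conj_place v) (cnj a))"
proof
  fix w
  show "idele_conj (local_idele QI v (embed QI v a)) w = local_idele QI (conj_place v) (embed QI (conj_place v) (cnj a)) w"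
  proof (cases "w \<in> VK")
    case w: True
    note cw = conj_places[OF w]
    show ?thesis
    proof (cases "w = conj_place v")
      case True
      then have "conj_place w = v" by simp
      then show ?thesis using conj_embed[OF w a] w v True by (simp add: idele_conj_def local_idele_def)
    next
      case False
      then have n: "conj_place w \<noteq> v" by auto
      have "(\<lambda>s. cnj \<circ> s) ` embed QI (conj_place w) 1 = embed QI w (cnj 1)" by (rule conj_embed[OF w]) simp
      then show ?thesis using w cw n False QI.embed_one[OF w] QI.embed_one[OF cw] by (simp add: idele_conj_def local_idele_def)
    qed
  qed (simp add: idele_conj_def local_idele_def)
qed

section \<open>Existence and uniqueness of the idele norm\<close>

lemma place_surj: assumes p: "p \<in> PQ" obtains P where "P \<in> PK" "P \<inter> \<rat> = p"
proof -
  note \<pi> = rat.ppi[OF p]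
  have "QI.nrm (rat.ppi p) \<noteq> 1"
  proof
    assume "QI.nrm (rat.ppi p) = 1"
    then have "inverse (rat.ppi p) \<in> ZI" using QI.nrm_1[OF Z_sub[OF \<pi>(1)]] by blast
    moreover have "inverse (rat.ppi p) \<in> \<rat>" using \<pi>(6) by auto
    ultimately have "inverse (rat.ppi p) \<in> \<int>" by (rule gauss_ints_Rats)
    then have "inverse (rat.ppi p) * rat.ppi p \<in> p" using rat.place_mult[OF p _ \<pi>(4)] by blast
    then show False using \<pi>(3) rat.placeD(3)[OF p] by simp
  qed
  then obtain P where P: "P \<in> PK" "rat.ppi p \<in> P" using QI.nonunit_place[OF Z_sub[OF \<pi>(1)]] by blast
  have "rat.ppi p \<in> P \<inter> \<rat>" using P \<pi>(6) by blast
  then have "p = P \<inter> \<rat>" by (rule rat.places_unique[OF p below_place[OF P(1)]])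
  then show thesis using that P by blast
qed

lemma below_eq: assumes P: "P \<in> PK" "Q \<in> PK" "P \<inter> \<rat> = Q \<inter> \<rat>" shows "Q = P \<or> Q = cnj ` P"
proof -
  obtain p where p: "prime p" "P \<in> places_above p" using above_ex[OF P(1)] by blast
  then have "of_nat p \<in> P \<inter> \<rat>" by (simp add: places_above_iff)
  then have "Q \<in> places_above p" using P by (auto simp: places_above_iff)
  then show ?thesis using places_above_eq[OF p(2,1)] by blast
qed

text \<open>Replaces a representative by any sequence whose \<open>n\<close>-th term is within
  \<open>1 / 2 ^ n\<close> of it, such as one supplied by weak approximation.\<close>

lemma close_mem:
  assumes v: "v \<in> VK" and s: "s \<in> CK v" and r: "\<And>n. r n \<in> QI"
    and c: "\<And>n. absv QI v (r n - s n) \<le> 1 / 2 ^ n"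
  shows "r \<in> QI.cl v s"
proof -
  let ?d = "\<lambda>n. r n - s n"
  have dF: "?d n \<in> QI" for n using r QI.C_F[OF v s] QI.F_diff by blast
  have lim: "(\<lambda>n. absv QI v (?d n)) \<longlonglongrightarrow> 0"
  proof (rule tendsto_sandwich[of "\<lambda>_. 0"])
    have "(\<lambda>n. (1/2::real) ^ n) \<longlonglongrightarrow> 0" by (rule LIMSEQ_realpow_zero) auto
    then show "(\<lambda>n. 1 / (2::real) ^ n) \<longlonglongrightarrow> 0" by (simp add: power_divide)
  qed (use c QI.A_nonneg[OF v] in auto)
  have dC: "?d \<in> CK v"
  proof (rule QI.C_I[OF v dF])
    fix e :: real assume "e > 0"
    then have "\<forall>\<^sub>F n in sequentially. absv QI v (?d n) < e/2" by (intro order_tendstoD(2)[OF lim]) simp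
    then obtain N where N: "\<And>n. n \<ge> N \<Longrightarrow> absv QI v (?d n) < e/2" by (auto simp: eventually_sequentially)
    have "absv QI v (?d m - ?d n) < e" if "m \<ge> N" "n \<ge> N" for m n
    proof -
      have "absv QI v (?d m - ?d n) = absv QI v (?d m + - ?d n)" by (simp only: diff_conv_add_uminus[of "?d m" "?d n"])
      also have "\<dots> \<le> absv QI v (?d m) + absv QI v (- ?d n)"
        by (rule QI.A_triangle[OF v dF QI.F_uminus[OF dF]])
      also have "absv QI v (- ?d n) = absv QI v (?d n)" by (rule QI.A_minus[OF v dF])
      finally show ?thesis using N[OF that(1)] N[OF that(2)] by simp
    qed
    then show "\<exists>N. \<forall>m\<ge>N. \<forall>n\<ge>N. absv QI v (?d m - ?d n) < e" by blast
  qed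
  then have dN: "?d \<in> null_seqs QI v" using lim QI.N_iff[OF v] by blast
  have "(\<lambda>n. ?d n + s n) \<in> CK v" by (rule QI.C_add[OF v dC s])
  then have "r \<in> CK v" by simp
  then show ?thesis using QI.cl_set[OF v s] dN by simp
qed

text \<open>Powers of the two generators are coprime, so \<open>1 = e + f\<close> with
  \<open>f\<close> small at \<open>P\<close> and \<open>e\<close> small at \<open>Q\<close>. Then
  \<open>t + e * (s - t)\<close> is close to \<open>s\<close> at \<open>P\<close> and to
  \<open>t\<close> at \<open>Q\<close>.\<close>

lemma weak_approx:
  assumes P: "P \<in> PK" "Q \<in> PK" "P \<noteq> Q" and st: "s \<in> QI" "t \<in> QI"
  shows "\<exists>r\<in>QI. QI.av P (r - s) \<le> 1 / 2 ^ n \<and> QI.av Q (r - t) \<le> 1 / 2 ^ n"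
proof -
  note \<pi> = QI.ppi[OF P(1)] and \<rho> = QI.ppi[OF P(2)]
  obtain g x y a' b' where g: "g \<in> ZI" "x \<in> ZI" "y \<in> ZI" "a' \<in> ZI" "b' \<in> ZI"
    "g = x * QI.ppi P + y * QI.ppi Q" "QI.ppi P = a' * g" "QI.ppi Q = b' * g"
    using QI.bezout[OF \<pi>(1) \<rho>(1)] by blast
  have "QI.nrm g = 1"
  proof (rule ccontr)
    assume "QI.nrm g \<noteq> 1"
    then obtain R where R: "R \<in> PK" "g \<in> R" using QI.nonunit_place[OF g(1)] by blast
    have "QI.ppi P \<in> R" "QI.ppi Q \<in> R" unfolding g(7) g(8) using QI.place_mult[OF R(1) _ R(2)] g(4,5) by blast+
    then show False using QI.places_unique[OF P(1) R(1)] QI.places_unique[OF P(2) R(1)] P(3) by simp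
  qed
  then have ig: "inverse g \<in> ZI" "g \<noteq> 0" using QI.nrm_1[OF g(1)] by auto
  define X where "X = inverse g * x"
  define Y where "Y = inverse g * y"
  have XY: "X \<in> ZI" "Y \<in> ZI" using ig(1) g(2,3) QI.O_mult by (auto simp: X_def Y_def)
  have 1: "X * QI.ppi P + Y * QI.ppi Q = 1"
  proof -
    have "X * QI.ppi P + Y * QI.ppi Q = inverse g * (x * QI.ppi P + y * QI.ppi Q)" by (simp add: X_def Y_def algebra_simps)
    also have "\<dots> = inverse g * g" by (simp only: g(6)[symmetric])
    finally show ?thesis using ig(2) by simp
  qed
  \<comment> \<open>\<open>B\<close> bounds the difference \<open>s - t\<close> at both places;
    \<open>m\<close> is then taken so large that \<open>B / 2 ^ m\<close> is within the
    tolerance.\<close>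
  define B where "B = max (QI.av P (s - t)) (QI.av Q (s - t)) + 1"
  have vP: "fp P \<in> VK" "fp Q \<in> VK" using P by auto
  have B: "B > 0" "QI.av P (s - t) \<le> B" "QI.av Q (s - t) \<le> B"
    using QI.A_nonneg[OF vP(1), of "s - t"] by (auto simp: B_def)
  obtain m where "(1/2::real) ^ m < (1 / 2 ^ n) / B" using real_arch_pow_inv[of "(1 / 2 ^ n) / B" "1/2"] B(1) by auto
  then have "(1/2) ^ m * B < 1 / (2::real) ^ n" using B(1) by (simp only: pos_less_divide_eq)
  then have m: "(1 / 2 ^ m) * B \<le> 1 / (2::real) ^ n" unfolding power_one_over by simp
  obtain X' Y' where X': "X' \<in> ZI" "Y' \<in> ZI" "X' * QI.ppi P ^ m + Y' * QI.ppi Q = 1"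
    using QI.bezout_power[OF XY \<pi>(1) \<rho>(1) 1] by blast
  have "Y' * QI.ppi Q + X' * QI.ppi P ^ m = 1" using X'(3) by (simp add: add.commute)
  from QI.bezout_power[OF X'(2,1) \<rho>(1) QI.O_power[OF \<pi>(1)] this]
  obtain Y'' X'' where X'': "Y'' \<in> ZI" "X'' \<in> ZI" "Y'' * QI.ppi Q ^ m + X'' * QI.ppi P ^ m = 1" by blast
  define e where "e = Y'' * QI.ppi Q ^ m"
  define f where "f = X'' * QI.ppi P ^ m"
  have ef: "e \<in> ZI" "f \<in> ZI" using X'' \<pi>(1) \<rho>(1) QI.O_mult QI.O_power by (auto simp: e_def f_def)
  have ef1: "e + f = 1" using X''(3) by (simp add: e_def f_def)
  have Af: "QI.av P f \<le> 1 / 2 ^ m" using QI.AP_O[OF P(1) ef(2)] X''(2) by (auto simp: f_def intro: QI.pidI)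
  have Ae: "QI.av Q e \<le> 1 / 2 ^ m" using QI.AP_O[OF P(2) ef(1)] X''(1) by (auto simp: e_def intro: QI.pidI)
  have F: "e \<in> QI" "f \<in> QI" "s - t \<in> QI" using ef QI.O_F st QI.F_diff by auto
  define r where "r = t + e * (s - t)"
  have "r - s = - (f * (s - t))"
  proof -
    have "r - s = (e - 1) * (s - t)" by (simp add: r_def algebra_simps)
    also have "e = 1 - f" using ef1 by (simp add: eq_diff_eq)
    finally show ?thesis by simp
  qed
  then have "QI.av P (r - s) = QI.av P f * QI.av P (s - t)"
    using QI.A_minus[OF vP(1) QI.F_mult[OF F(2,3)]] QI.A_mult[OF vP(1) F(2,3)] by simp
  also have "\<dots> \<le> (1 / 2 ^ m) * B" using Af B QI.A_nonneg[OF vP(1)] by (intro mult_mono) auto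
  finally have 2: "QI.av P (r - s) \<le> 1 / 2 ^ n" using m by linarith
  have "QI.av Q (r - t) = QI.av Q e * QI.av Q (s - t)"
    using QI.A_mult[OF vP(2) F(1,3)] by (simp add: r_def)
  also have "\<dots> \<le> (1 / 2 ^ m) * B" using Ae B QI.A_nonneg[OF vP(2)] by (intro mult_mono) auto
  finally have 3: "QI.av Q (r - t) \<le> 1 / 2 ^ n" using m by linarith
  have "r \<in> QI" using F st QI.F_add QI.F_mult by (simp add: r_def)
  then show ?thesis using 2 3 by blast
qed

text \<open>A single sequence of Gaussian numbers represents an idele at both places above a rational one;
  the squares of its moduli then represent the norm.\<close>

lemma common_rep: assumes x: "x \<in> carrier IK" and v: "v \<in> VK"
  obtains r where "r \<in> x v" "r \<in> x (conj_place v)"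
proof (cases "conj_place v = v")
  case True
  obtain s where "s \<in> CK v" "x v = QI.cl v s" by (rule idele_rep[OF x v])
  then show thesis using that[of s] QI.cl_self[OF v] True by simp
next
  case False
  then obtain P where P: "v = fp P" "cnj ` P \<noteq> P" by (cases v) auto
  note cv = conj_places[OF v]
  obtain s where s: "s \<in> CK v" "x v = QI.cl v s" by (rule idele_rep[OF x v])
  obtain t where t: "t \<in> CK (conj_place v)" "x (conj_place v) = QI.cl (conj_place v) t" by (rule idele_rep[OF x cv])
  have PK: "P \<in> PK" "cnj ` P \<in> PK" using v cnj_place P(1) by auto
  have "\<forall>n. \<exists>r. r\<in>QI \<and> QI.av P (r - s n) \<le> 1 / 2 ^ n \<and> QI.av (cnj ` P) (r - t n) \<le> 1 / 2 ^ n"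
    using weak_approx[OF PK] P(2) QI.C_F[OF v s(1)] QI.C_F[OF cv t(1)] by metis
  then obtain r where r: "\<And>n. r n \<in> QI" "\<And>n. QI.av P (r n - s n) \<le> 1 / 2 ^ n"
     "\<And>n. QI.av (cnj ` P) (r n - t n) \<le> 1 / 2 ^ n" by metis
  have "r \<in> x v" unfolding s(2) by (rule close_mem[OF v s(1) r(1)]) (use r P in simp)
  moreover have "r \<in> x (conj_place v)" unfolding t(2) by (rule close_mem[OF cv t(1) r(1)]) (use r P in simp)
  ultimately show thesis by (rule that)
qed

text \<open>Every rational place has a Gaussian place above it, and a rational sequence that is null
  there is null below. This gives the uniqueness behind the definition of
  \<open>idele_norm\<close>.\<close>

lemma incl_inj: assumes y: "y \<in> carrier IQ" "y' \<in> carrier IQ" and e: "idele_incl y = idele_incl y'" shows "y = y'"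
proof (rule rat.IG_ext[OF y])
  fix w assume w: "w \<in> places \<rat>"
  obtain v where v: "v \<in> VK" "place_below v = w"
  proof (cases w)
    case (Fin_place p)
    then have "p \<in> PQ" using w by simp
    then obtain P where "P \<in> PK" "P \<inter> \<rat> = p" by (rule place_surj)
    then show ?thesis using that[of "fp P"] Fin_place by simp
  next
    case Inf_place then show ?thesis using that[of Inf_place] by simp
  qed
  obtain s where s: "s \<in> CQ w" "y w = rat.cl w s" using rat.units_cases[OF w rat.IG_D(1)[OF y(1) w]] by metis
  obtain t where t: "t \<in> CQ w" "y' w = rat.cl w t" using rat.units_cases[OF w rat.IG_D(1)[OF y(2) w]] by metis
  have "QI.cl v s = QI.cl v t" using idele_incl_at(1)[OF v(1), of s y] idele_incl_at(1)[OF v(1), of t y'] s t v(2) e by simp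
  moreover have "s \<in> CK v" "t \<in> CK v" using idele_incl_at(2)[OF v(1), of s y] idele_incl_at(2)[OF v(1), of t y'] s t v(2) by auto
  ultimately have "(\<lambda>n. s n - t n) \<in> null_seqs QI v" using QI.cl_eq[OF v(1)] by blast
  then have "(\<lambda>n. s n - t n) \<in> null_seqs \<rat> w"
    using cauchy_below(2)[OF v(1), of "\<lambda>n. s n - t n"] rat.C_F[OF w s(1)] rat.C_F[OF w t(1)] v(2) by auto
  then show "y w = y' w" using rat.cl_eq[OF w s(1) t(1)] s t by simp
qed

lemma cabs_below: assumes v: "v \<in> VK" and s: "s \<in> CQ (place_below v)"
  shows "\<exists>e>0. QI.cabs v (QI.cl v s) = rat.cabs (place_below v) (rat.cl (place_below v) s) ^ e"
proof -
  note vQ = below_places[OF v]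
  from abs_below[OF v] obtain e :: nat where e0: "e > 0 \<and> (\<forall>x\<in>\<rat>. absv QI v x = absv \<rat> (place_below v) x ^ e)" ..
  have e: "e > 0" "\<And>x. x \<in> \<rat> \<Longrightarrow> absv QI v x = absv \<rat> (place_below v) x ^ e" using e0 by simp_all
  have sQ: "s n \<in> \<rat>" for n by (rule rat.C_F[OF vQ s])
  have sK: "s \<in> CK v" using cauchy_below(1)[where v=v and s=s, OF v sQ] s by blast
  have "(\<lambda>n. absv QI v (s n)) \<longlonglongrightarrow> rat.cabs (place_below v) (rat.cl (place_below v) s) ^ e"
    using tendsto_power[OF rat.cabs_lim[OF vQ s], of e] e(2)[OF rat.C_F[OF vQ s]] by simp
  then have "QI.cabs v (QI.cl v s) = rat.cabs (place_below v) (rat.cl (place_below v) s) ^ e"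
    by (rule QI.cabs_eqI[OF v sK])
  then show ?thesis using e by blast
qed

text \<open>With a common representative \<open>r\<close> at the places above \<open>w\<close>, the
  rational sequence \<open>r n * cnj (r n)\<close> represents \<open>x\<close> times its conjugate
  at all of them. Almost all of these classes are local units below, because a positive power of
  their absolute value is 1.\<close>

lemma norm_exists: assumes x: "x \<in> carrier IK"
  shows "\<exists>y\<in>carrier IQ. idele_incl y = x \<otimes>\<^bsub>IK\<^esub> idele_conj x"
proof -
  have "\<exists>s. s \<in> CQ w \<and> s \<notin> null_seqs \<rat> w \<and> (\<forall>v\<in>VK. place_below v = w \<longrightarrow> (x \<otimes>\<^bsub>IK\<^esub> idele_conj x) v = QI.cl v s)"
    if w: "w \<in> places \<rat>" for w
  proof -
    \<comment> \<open>The places above \<open>w\<close> are one place and its conjugate, which may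
      coincide.\<close>
    obtain v where v: "v \<in> VK" "place_below v = w" "\<And>v'. v' \<in> VK \<Longrightarrow> place_below v' = w \<Longrightarrow> v' = v \<or> v' = conj_place v"
    proof (cases w)
      case (Fin_place p)
      then have "p \<in> PQ" using w by simp
      then obtain P where P: "P \<in> PK" "P \<inter> \<rat> = p" by (rule place_surj)
      show ?thesis
      proof (rule that[of "fp P"])
        fix v' assume "v' \<in> VK" "place_below v' = w"
        then obtain Q where "v' = fp Q" "Q \<in> PK" "Q \<inter> \<rat> = p" using Fin_place by (cases v') auto
        then show "v' = fp P \<or> v' = conj_place (fp P)" using below_eq[OF P(1), of Q] P(2) by auto
      qed (use P Fin_place in auto)
    next
      case Inf_place
      show ?thesis
      proof (rule that[of Inf_place])
        fix v' assume "place_below v' = w"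
        then show "v' = Inf_place \<or> v' = conj_place Inf_place" using Inf_place by (cases v') auto
      qed (use Inf_place in auto)
    qed
    obtain r where r: "r \<in> x v" "r \<in> x (conj_place v)" by (rule common_rep[OF x v(1)])
    define s where "s n = r n * cnj (r n)" for n
    have at: "(x \<otimes>\<^bsub>IK\<^esub> idele_conj x) v' = QI.cl v' s \<and> s \<in> CK v' \<and> s \<notin> null_seqs QI v'" if v': "v' = v \<or> v' = conj_place v" for v'
    proof -
      have v'p: "v' \<in> VK" using v' v conj_places by auto
      note cv = conj_places[OF v'p]
      have r': "r \<in> x v'" "r \<in> x (conj_place v')" using r v' by auto
      have u: "x v' \<in> QI.KU v'" "x (conj_place v') \<in> QI.KU (conj_place v')"
        using QI.IG_D(1)[OF x] v'p cv by auto
      note m = QI.mem_cl[OF v'p QI.units_carrier[OF v'p u(1)] r'(1)] QI.mem_cl[OF cv QI.units_carrier[OF cv u(2)] r'(2)]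
      have c: "idele_conj x v' = QI.cl v' (cnj \<circ> r)" by (rule idele_conj_at[where x=x, OF v'p m(3,4)])
      have cr: "cnj \<circ> r \<in> CK v'" by (rule cauchy_cnj(1)[OF v'p m(3)])
      have "QI.cl v' r \<otimes>\<^bsub>KKv v'\<^esub> QI.cl v' (cnj \<circ> r) = QI.cl v' s"
        using QI.cl_mult[OF v'p m(1) cr] by (simp add: s_def[abs_def])
      then have e: "(x \<otimes>\<^bsub>IK\<^esub> idele_conj x) v' = QI.cl v' s"
        unfolding QI.IG_mult[OF v'p] c using m(2) by simp
      have sC: "s \<in> CK v'" using QI.C_mult[OF v'p m(1) cr] by (simp add: s_def[abs_def])
      have "(x \<otimes>\<^bsub>IK\<^esub> idele_conj x) v' \<in> QI.KU v'"
        using QI.IG_D(1)[OF QI.IG_mult_closed[OF x idele_conj_closed[OF x]] v'p] .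
      then have "s \<notin> null_seqs QI v'" unfolding e QI.K_units[OF v'p] using QI.cl_N[OF v'p sC] by blast
      then show ?thesis using e sC by blast
    qed
    have rF: "r n \<in> QI" for n
      using QI.C_F[OF v(1) QI.mem_cl(1)[OF v(1) QI.units_carrier[OF v(1) QI.IG_D(1)[OF x v(1)]] r(1)]] .
    have sQ: "s n \<in> \<rat>" for n unfolding s_def by (rule gauss_Rats) (use rF QI.F_mult QI.F_cnj in auto)
    have "s \<in> CQ w" "s \<notin> null_seqs \<rat> w" using at[of v] cauchy_below[where s=s, OF v(1) sQ] v(2) by auto
    moreover have "\<forall>v'\<in>VK. place_below v' = w \<longrightarrow> (x \<otimes>\<^bsub>IK\<^esub> idele_conj x) v' = QI.cl v' s"
      using at v(3) by blast
    ultimately show ?thesis by blast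
  qed
  then obtain S where S: "\<And>w. w \<in> places \<rat> \<Longrightarrow> S w \<in> CQ w \<and> S w \<notin> null_seqs \<rat> w \<and> (\<forall>v\<in>VK. place_below v = w \<longrightarrow> (x \<otimes>\<^bsub>IK\<^esub> idele_conj x) v = QI.cl v (S w))"
    by metis
  define z where "z = x \<otimes>\<^bsub>IK\<^esub> idele_conj x"
  have zc: "z \<in> carrier IK" using QI.IG_mult_closed[OF x idele_conj_closed[OF x]] by (simp add: z_def)
  define y where "y = (\<lambda>w\<in>places \<rat>. rat.cl w (S w))"
  have yw: "y w = rat.cl w (S w)" if "w \<in> places \<rat>" for w using that by (simp add: y_def)
  have zv: "z v = QI.cl v (S (place_below v))" if v: "v \<in> VK" for v
    using S[OF below_places[OF v]] v by (simp add: z_def)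
  have "y \<in> carrier IQ"
  proof (rule rat.IG_I[of _ "(\<lambda>P. P \<inter> \<rat>) ` {P \<in> PK. z (fp P) \<notin> QI.LU P}"])
    show "y w \<in> rat.KU w" if w: "w \<in> places \<rat>" for w unfolding yw[OF w] using rat.cl_units[OF w] S[OF w] by blast
    show "finite ((\<lambda>P. P \<inter> \<rat>) ` {P \<in> PK. z (fp P) \<notin> QI.LU P})" using QI.IG_D(3)[OF zc] by simp
    fix p assume p: "p \<in> PQ" "p \<notin> (\<lambda>P. P \<inter> \<rat>) ` {P \<in> PK. z (fp P) \<notin> QI.LU P}"
    obtain P where P: "P \<in> PK" "P \<inter> \<rat> = p" by (rule place_surj[OF p(1)])
    have vP: "fp P \<in> VK" "fp p \<in> places \<rat>" using P p by auto
    have zl: "z (fp P) \<in> QI.LU P" using P p(2) by blast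
    have Sp: "S (fp p) \<in> CQ (place_below (fp P))" using S[OF vP(2)] P by simp
    obtain e :: nat where e: "e > 0" "QI.cabs (fp P) (QI.cl (fp P) (S (fp p))) = rat.cabs (fp p) (rat.cl (fp p) (S (fp p))) ^ e"
      using cabs_below[OF vP(1) Sp] P by auto
    have "rat.cabs (fp p) (y (fp p)) ^ e = 1"
      using zl zv[OF vP(1)] e(2) P yw[OF vP(2)] QI.local_units[OF P(1)] by simp
    moreover have yc: "y (fp p) \<in> carrier (rat.KP p)" using yw[OF vP(2)] rat.cl_carrier[OF vP(2)] S[OF vP(2)] by simp
    ultimately have "rat.cabs (fp p) (y (fp p)) = 1" using rat.cabs_nonneg[OF vP(2) yc] e(1) power_eq_1_iff by (metis abs_of_nonneg real_norm_def gr_implies_not0 power_eq_iff_eq_base power_one zero_le_one)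
    then show "y (fp p) \<in> rat.LU p" using rat.local_units[OF p(1)] yc by simp
  qed (simp add: y_def)
  moreover have "idele_incl y = z"
  proof
    fix v show "idele_incl y v = z v"
    proof (cases "v \<in> VK")
      case True
      have "idele_incl y v = QI.cl v (S (place_below v))"
        using idele_incl_at(1)[where y=y and s="S (place_below v)", OF True _ yw[OF below_places[OF True]]] S[OF below_places[OF True]] by blast
      then show ?thesis using zv[OF True] by simp
    next
      case False
      then show ?thesis using QI.IG_D(2)[OF zc] by (simp add: idele_incl_def)
    qed
  qed
  ultimately show ?thesis by (auto simp: z_def)
qed

lemma idele_norm: assumes x: "x \<in> carrier IK"
  shows "idele_norm x \<in> carrier IQ" "idele_incl (idele_norm x) = x \<otimes>\<^bsub>IK\<^esub> idele_conj x"
proof -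
  have "\<exists>!y. y \<in> carrier IQ \<and> idele_incl y = x \<otimes>\<^bsub>IK\<^esub> idele_conj x"
    using norm_exists[OF x] incl_inj by (metis (no_types, lifting))
  then have "idele_norm x \<in> carrier IQ \<and> idele_incl (idele_norm x) = x \<otimes>\<^bsub>IK\<^esub> idele_conj x"
    unfolding idele_norm_def by (rule theI')
  then show "idele_norm x \<in> carrier IQ" "idele_incl (idele_norm x) = x \<otimes>\<^bsub>IK\<^esub> idele_conj x" by auto
qed

lemma idele_norm_eq: assumes x: "x \<in> carrier IK" and y: "y \<in> carrier IQ" "idele_incl y = x \<otimes>\<^bsub>IK\<^esub> idele_conj x"
  shows "idele_norm x = y"
  using incl_inj[OF idele_norm(1)[OF x] y(1)] idele_norm(2)[OF x] y(2) by simp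

lemma idele_incl_mult: assumes y: "y \<in> carrier IQ" and y': "y' \<in> carrier IQ"
  shows "idele_incl (y \<otimes>\<^bsub>IQ\<^esub> y') = idele_incl y \<otimes>\<^bsub>IK\<^esub> idele_incl y'"
proof
  fix v
  show "idele_incl (y \<otimes>\<^bsub>IQ\<^esub> y') v = (idele_incl y \<otimes>\<^bsub>IK\<^esub> idele_incl y') v"
  proof (cases "v \<in> VK")
    case v: True
    note w = below_places[OF v]
    obtain s where s: "s \<in> CQ (place_below v)" "y (place_below v) = rat.cl (place_below v) s"
      using rat.units_cases[OF w rat.IG_D(1)[OF y w]] by metis
    obtain t where t: "t \<in> CQ (place_below v)" "y' (place_below v) = rat.cl (place_below v) t"
      using rat.units_cases[OF w rat.IG_D(1)[OF y' w]] by metis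
    have c: "(\<lambda>n. s n * t n) \<in> CQ (place_below v)" by (rule rat.C_mult[OF w s(1) t(1)])
    have "(y \<otimes>\<^bsub>IQ\<^esub> y') (place_below v) = rat.cl (place_below v) (\<lambda>n. s n * t n)"
      using rat.IG_mult[OF w] rat.cl_mult[OF w s(1) t(1)] s t by simp
    then have "idele_incl (y \<otimes>\<^bsub>IQ\<^esub> y') v = QI.cl v (\<lambda>n. s n * t n)" by (rule idele_incl_at(1)[OF v c])
    also have "\<dots> = QI.cl v s \<otimes>\<^bsub>KKv v\<^esub> QI.cl v t"
      using QI.cl_mult[OF v idele_incl_at(2)[where y=y, OF v s] idele_incl_at(2)[where y=y', OF v t]] by simp
    finally show ?thesis using QI.IG_mult[OF v] idele_incl_at(1)[where y=y, OF v s] idele_incl_at(1)[where y=y', OF v t] by simp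
  qed (simp add: idele_incl_def idele_group_def)
qed

lemma norm_mult: assumes x: "x \<in> carrier IK" and y: "y \<in> carrier IK"
  shows "idele_norm (x \<otimes>\<^bsub>IK\<^esub> y) = idele_norm x \<otimes>\<^bsub>IQ\<^esub> idele_norm y"
proof (rule idele_norm_eq)
  interpret comm_monoid IK by (rule QI.IG_comm_monoid)
  note c = idele_conj_closed[OF x] idele_conj_closed[OF y]
  show "x \<otimes>\<^bsub>IK\<^esub> y \<in> carrier IK" using x y by simp
  show "idele_norm x \<otimes>\<^bsub>IQ\<^esub> idele_norm y \<in> carrier IQ" by (intro rat.IG_mult_closed idele_norm(1) x y)
  show "idele_incl (idele_norm x \<otimes>\<^bsub>IQ\<^esub> idele_norm y) = x \<otimes>\<^bsub>IK\<^esub> y \<otimes>\<^bsub>IK\<^esub> idele_conj (x \<otimes>\<^bsub>IK\<^esub> y)"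
    unfolding idele_incl_mult[OF idele_norm(1)[OF x] idele_norm(1)[OF y]] idele_norm(2)[OF x] idele_norm(2)[OF y] idele_conj_mult[OF x y]
    using x y c by (simp add: m_ac)
qed

lemma norm_at: assumes x: "x \<in> carrier IK" and v: "v \<in> VK"
  obtains s where "s \<in> CQ (place_below v)" "idele_norm x (place_below v) = rat.cl (place_below v) s"
    "x v \<otimes>\<^bsub>KKv v\<^esub> idele_conj x v = QI.cl v s" "s \<in> CK v"
proof -
  note w = below_places[OF v]
  obtain s where s: "s \<in> CQ (place_below v)" "idele_norm x (place_below v) = rat.cl (place_below v) s"
    using rat.units_cases[OF w rat.IG_D(1)[OF idele_norm(1)[OF x] w]] by metis
  have "x v \<otimes>\<^bsub>KKv v\<^esub> idele_conj x v = QI.cl v s"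
    using idele_incl_at(1)[where y="idele_norm x", OF v s] idele_norm(2)[OF x] QI.IG_mult[OF v] by simp
  then show thesis using that s idele_incl_at(2)[where y="idele_norm x", OF v s] by blast
qed

text \<open>A component of the norm can be read off at a single place above, since the inclusion is
  injective place by place.\<close>

lemma norm_embed: assumes x: "x \<in> carrier IK" and v: "v \<in> VK" and b: "b \<in> \<rat>"
    and e: "x v \<otimes>\<^bsub>KKv v\<^esub> idele_conj x v = embed QI v b"
  shows "idele_norm x (place_below v) = embed \<rat> (place_below v) b"
proof -
  note w = below_places[OF v]
  obtain s where s: "s \<in> CQ (place_below v)" "idele_norm x (place_below v) = rat.cl (place_below v) s"
    "x v \<otimes>\<^bsub>KKv v\<^esub> idele_conj x v = QI.cl v s" "s \<in> CK v" by (rule norm_at[OF x v])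
  have "QI.cl v s = QI.cl v (\<lambda>_. b)" using e s(3) QI.embed_cl[OF v] by simp
  then have "(\<lambda>n. s n - b) \<in> null_seqs QI v" using QI.cl_eq[OF v s(4) QI.C_const[OF v Q_sub_K[OF b]]] by simp
  then have "(\<lambda>n. s n - b) \<in> null_seqs \<rat> (place_below v)"
    using cauchy_below(2)[OF v, of "\<lambda>n. s n - b"] rat.C_F[OF w s(1)] b by auto
  then show ?thesis unfolding s(2) rat.embed_cl[OF w] using rat.cl_eq[OF w s(1) rat.C_const[OF w b]] by simp
qed

lemma above_place_ex: assumes w: "w \<in> places \<rat>" obtains v where "v \<in> VK" "place_below v = w"
proof (cases w)
  case (Fin_place p)
  then have "p \<in> PQ" using w by simp
  then obtain P where "P \<in> PK" "P \<inter> \<rat> = p" by (rule place_surj)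
  then show ?thesis using that[of "fp P"] Fin_place by simp
next
  case Inf_place then show ?thesis using that[of Inf_place] by simp
qed

lemma gauss_norm_Rats: "a \<in> QI \<Longrightarrow> a * cnj a \<in> \<rat>"
  by (rule gauss_Rats) (auto intro: QI.F_mult QI.F_cnj)

text \<open>Compatibility with the norm of elements; it makes base changes trivial on principal
  ideles.\<close>

lemma norm_principal: assumes a: "a \<in> QI" "a \<noteq> 0"
  shows "idele_norm (principal_idele QI a) = principal_idele \<rat> (a * cnj a)"
proof (rule rat.IG_ext)
  note pc = QI.principal_closed[OF a]
  show "idele_norm (principal_idele QI a) \<in> carrier IQ" by (rule idele_norm(1)[OF pc])
  show "principal_idele \<rat> (a * cnj a) \<in> carrier IQ" using rat.principal_closed[OF gauss_norm_Rats[OF a(1)]] a by simp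
  fix w assume w: "w \<in> places \<rat>"
  obtain v where v: "v \<in> VK" "place_below v = w" by (rule above_place_ex[OF w])
  have "principal_idele QI a v \<otimes>\<^bsub>KKv v\<^esub> idele_conj (principal_idele QI a) v = embed QI v (a * cnj a)"
    unfolding idele_conj_principal[OF a(1)] using v QI.embed_mult[OF v(1) a(1) QI.F_cnj[OF a(1)]] by (simp add: principal_idele_def)
  from norm_embed[OF pc v(1) gauss_norm_Rats[OF a(1)] this]
  have "idele_norm (principal_idele QI a) w = embed \<rat> w (a * cnj a)" unfolding v(2) .
  moreover have "principal_idele \<rat> (a * cnj a) w = embed \<rat> w (a * cnj a)" using w by (simp add: principal_idele_def)
  ultimately show "idele_norm (principal_idele QI a) w = principal_idele \<rat> (a * cnj a) w" by simp
qed

lemma norm_lu: assumes x: "x \<in> carrier IK" and P: "P \<in> PK" and l: "x (fp P) \<in> QI.LU P" "x (fp (cnj ` P)) \<in> QI.LU (cnj ` P)"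
  shows "idele_norm x (fp (P \<inter> \<rat>)) \<in> rat.LU (P \<inter> \<rat>)"
proof -
  have v: "fp P \<in> VK" using P by simp
  note p = below_place[OF P]
  have w: "fp (P \<inter> \<rat>) \<in> places \<rat>" using p by simp
  obtain s where s: "s \<in> CQ (place_below (fp P))" "idele_norm x (place_below (fp P)) = rat.cl (place_below (fp P)) s"
    "x (fp P) \<otimes>\<^bsub>QI.KP P\<^esub> idele_conj x (fp P) = QI.cl (fp P) s" "s \<in> CK (fp P)" by (rule norm_at[OF x v])
  have "QI.cl (fp P) s \<in> QI.LU P"
    unfolding s(3)[symmetric] using QI.lu_mult[OF P l(1)] idele_conj_lu[OF x P] l(2) by blast
  then have 1: "QI.cabs (fp P) (QI.cl (fp P) s) = 1" using QI.local_units[OF P] by simp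
  from cabs_below[OF v s(1)] obtain e where e: "e > 0"
    "QI.cabs (fp P) (QI.cl (fp P) s) = rat.cabs (fp (P \<inter> \<rat>)) (rat.cl (fp (P \<inter> \<rat>)) s) ^ e" by auto
  have c: "rat.cl (fp (P \<inter> \<rat>)) s \<in> carrier (rat.KP (P \<inter> \<rat>))" using rat.cl_carrier[OF w] s(1) by simp
  have "rat.cabs (fp (P \<inter> \<rat>)) (rat.cl (fp (P \<inter> \<rat>)) s) ^ e = 1 ^ e" using 1 e(2) by simp
  then have "rat.cabs (fp (P \<inter> \<rat>)) (rat.cl (fp (P \<inter> \<rat>)) s) = 1"
    by (rule power_eq_imp_eq_base) (use rat.cabs_nonneg[OF w c] e(1) in auto)
  then show ?thesis using s(2) c rat.local_units[OF p] by simp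
qed

lemma conj_hu: assumes x: "x \<in> carrier IK" and P: "P \<in> PK" and l: "x (fp (cnj ` P)) \<in> QI.HU (cnj ` P) m"
  shows "idele_conj x (fp P) \<in> QI.HU P m"
proof -
  have v: "fp P \<in> VK" using P by simp
  have Q: "cnj ` P \<in> PK" by (rule cnj_place[OF P])
  have cv: "fp (cnj ` P) \<in> VK" using Q by simp
  obtain s where s: "s \<in> CK (fp (cnj ` P))" "x (fp (cnj ` P)) = QI.cl (fp (cnj ` P)) s" by (rule idele_rep[OF x cv])
  have e: "idele_conj x (fp P) = QI.cl (fp P) (cnj \<circ> s)" by (rule idele_conj_at[where x=x, OF v]) (use s in auto)
  have sF: "s n \<in> QI" for n by (rule QI.C_F[OF cv s(1)])
  have c: "cnj \<circ> s \<in> CK (fp P)" by (rule cauchy_cnj(1)[OF v]) (use s in simp)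
  have "QI.apx (cnj ` P) m (QI.cl (fp (cnj ` P)) s) 1" using l s(2) QI.higher_units[OF Q] by simp
  then have "\<forall>\<^sub>F n in sequentially. QI.av (cnj ` P) (s n - 1) \<le> 1 / 2 ^ m"
    using QI.apx_seq[OF Q QI.cl_carrier[OF cv s(1)] QI.cl_self[OF cv s(1)], of 1 m] by simp
  moreover have "QI.av (cnj ` P) (s n - 1) = QI.av P ((cnj \<circ> s) n - 1)" for n
    using abs_cnj[OF v QI.F_diff[OF sF[of n] QI.F_simps(2)]] by simp
  ultimately have "\<forall>\<^sub>F n in sequentially. QI.av P ((cnj \<circ> s) n - 1) \<le> 1 / 2 ^ m" by simp
  then have "QI.apx P m (QI.cl (fp P) (cnj \<circ> s)) 1"
    using QI.apx_seq[OF P QI.cl_carrier[OF v c] QI.cl_self[OF v c], of 1 m] by simp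
  then show ?thesis unfolding e using QI.higher_units[OF P] QI.cl_carrier[OF v c] by simp
qed

text \<open>\<open>e\<close> is the exponent from \<open>abs_below\<close>: depth \<open>n\<close>
  below corresponds to depth \<open>n * e\<close> above. The norm involves the components at
  \<open>P\<close> and at its conjugate, so both are asked to have this depth.\<close>

lemma norm_hu: assumes P: "P \<in> PK"
  shows "\<exists>e>0. \<forall>n. \<forall>x\<in>carrier IK. x (fp P) \<in> QI.HU P (n * e) \<longrightarrow> x (fp (cnj ` P)) \<in> QI.HU (cnj ` P) (n * e)
    \<longrightarrow> idele_norm x (fp (P \<inter> \<rat>)) \<in> rat.HU (P \<inter> \<rat>) n"
proof -
  have v: "fp P \<in> VK" using P by simp
  note p = below_place[OF P]
  have w: "fp (P \<inter> \<rat>) \<in> places \<rat>" using p by simp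
  from abs_below[OF v] obtain e :: nat where e0: "e > 0 \<and> (\<forall>x\<in>\<rat>. QI.av P x = absv \<rat> (place_below (fp P)) x ^ e)" ..
  then have e: "e > 0" "\<And>x. x \<in> \<rat> \<Longrightarrow> QI.av P x = rat.av (P \<inter> \<rat>) x ^ e" by simp_all
  have "idele_norm x (fp (P \<inter> \<rat>)) \<in> rat.HU (P \<inter> \<rat>) n" if x: "x \<in> carrier IK"
    and h: "x (fp P) \<in> QI.HU P (n * e)" "x (fp (cnj ` P)) \<in> QI.HU (cnj ` P) (n * e)" for x n
  proof -
    obtain s where s: "s \<in> CQ (place_below (fp P))" "idele_norm x (place_below (fp P)) = rat.cl (place_below (fp P)) s"
      "x (fp P) \<otimes>\<^bsub>QI.KP P\<^esub> idele_conj x (fp P) = QI.cl (fp P) s" "s \<in> CK (fp P)" by (rule norm_at[OF x v])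
    have s1: "s \<in> CQ (fp (P \<inter> \<rat>))" using s(1) by simp
    have a: "x (fp P) \<in> carrier (QI.KP P)" "QI.apx P (n * e) (x (fp P)) 1"
      "idele_conj x (fp P) \<in> carrier (QI.KP P)" "QI.apx P (n * e) (idele_conj x (fp P)) 1"
      using h(1) conj_hu[OF x P h(2)] QI.higher_units[OF P] by auto
    have "QI.apx P (n * e) (QI.cl (fp P) s) (1 * 1)" unfolding s(3)[symmetric]
      by (rule QI.apx_mult[OF P a(1,3) _ _ a(2,4)]) (simp_all add: QI.aA_1[OF P])
    then have "\<forall>\<^sub>F k in sequentially. QI.av P (s k - 1) \<le> 1 / 2 ^ (n * e)"
      using QI.apx_seq[OF P QI.cl_carrier[OF v s(4)] QI.cl_self[OF v s(4)], of 1 "n * e"] by simp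
    moreover have "rat.av (P \<inter> \<rat>) (s k - 1) \<le> 1 / 2 ^ n" if "QI.av P (s k - 1) \<le> 1 / 2 ^ (n * e)" for k
    proof -
      have "s k - 1 \<in> \<rat>" using rat.C_F[OF w s1, of k] by simp
      then have "rat.av (P \<inter> \<rat>) (s k - 1) ^ e \<le> (1 / 2 ^ n) ^ e" using that e(2) by (simp add: power_mult power_one_over)
      moreover have "x ^ e \<le> y ^ e \<longleftrightarrow> x \<le> y" if "0 \<le> x" "0 \<le> y" for x y :: real
        using power_mono_iff[OF that e(1)] .
      ultimately show ?thesis using rat.A_nonneg[OF w] by (metis zero_le_divide_1_iff zero_le_numeral zero_le_power)
    qed
    ultimately have "\<forall>\<^sub>F k in sequentially. rat.av (P \<inter> \<rat>) (s k - 1) \<le> 1 / 2 ^ n" by (rule eventually_mono)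
    then have "rat.apx (P \<inter> \<rat>) n (rat.cl (fp (P \<inter> \<rat>)) s) 1"
      using rat.apx_seq[OF p rat.cl_carrier[OF w s1] rat.cl_self[OF w s1], of 1 n] by simp
    then show ?thesis using s(2) rat.higher_units[OF p] rat.cl_carrier[OF w s1] by simp
  qed
  then show ?thesis using e(1) by blast
qed

section \<open>Base change of characters\<close>

lemma finite_above: assumes "finite T" "T \<subseteq> PQ" shows "finite {P \<in> PK. P \<inter> \<rat> \<in> T}"
proof -
  have "finite {P \<in> PK. P \<inter> \<rat> = p}" if p: "p \<in> PQ" for p
  proof -
    obtain P where P: "P \<in> PK" "P \<inter> \<rat> = p" by (rule place_surj[OF p])
    have "{P \<in> PK. P \<inter> \<rat> = p} \<subseteq> {P, cnj ` P}"
    proof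
      fix Q assume "Q \<in> {P \<in> PK. P \<inter> \<rat> = p}"
      then show "Q \<in> {P, cnj ` P}" using below_eq[OF P(1), of Q] P(2) by simp
    qed
    then show ?thesis by (rule finite_subset) simp
  qed
  then have "finite (\<Union>p\<in>T. {P \<in> PK. P \<inter> \<rat> = p})" using assms(2) by (intro finite_UN_I[OF assms(1)]) blast
  moreover have "{P \<in> PK. P \<inter> \<rat> \<in> T} = (\<Union>p\<in>T. {P \<in> PK. P \<inter> \<rat> = p})" by blast
  ultimately show ?thesis by simp
qed

lemma base_change_qchar:
  assumes q: "rat.qchar \<nu>" and f: "rat.full \<nu>"
  shows "QI.qchar (\<nu> \<circ> idele_norm)" "QI.full (\<nu> \<circ> idele_norm)" "from_base_change (\<nu> \<circ> idele_norm)"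
proof -
  obtain T n where T: "finite T" "T \<subseteq> PQ" "n > 0" "\<forall>x\<in>rat.box T n. \<nu> x = 1" using f unfolding rat.full_def by blast
  define T' where "T' = {P \<in> PK. P \<inter> \<rat> \<in> T}"
  have fT': "finite T'" using finite_above[OF T(1,2)] by (simp add: T'_def)
  have "\<forall>P. \<exists>e>0. P \<in> PK \<longrightarrow> (\<forall>n. \<forall>x\<in>carrier IK. x (fp P) \<in> QI.HU P (n * e) \<longrightarrow> x (fp (cnj ` P)) \<in> QI.HU (cnj ` P) (n * e)
    \<longrightarrow> idele_norm x (fp (P \<inter> \<rat>)) \<in> rat.HU (P \<inter> \<rat>) n)" using norm_hu by (metis zero_less_one)
  from choice[OF this] obtain e :: "complex set \<Rightarrow> nat" where e: "\<And>P. e P > 0" "\<And>P n x. P \<in> PK \<Longrightarrow> x \<in> carrier IK \<Longrightarrow> x (fp P) \<in> QI.HU P (n * e P) \<Longrightarrow> x (fp (cnj ` P)) \<in> QI.HU (cnj ` P) (n * e P)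
    \<Longrightarrow> idele_norm x (fp (P \<inter> \<rat>)) \<in> rat.HU (P \<inter> \<rat>) n" by auto
  \<comment> \<open>A box has one level for all its places, so \<open>n\<close> is multiplied by a
    bound for all the exponents \<open>e P\<close> with \<open>P\<close> in
    \<open>T'\<close>.\<close>
  define m where "m = n * (1 + (\<Sum>P\<in>T'. e P))"
  have m0: "m > 0" using T(3) by (simp add: m_def)
  have em: "n * e P \<le> m" if "P \<in> T'" for P
  proof -
    have "e P \<le> 1 + (\<Sum>P\<in>T'. e P)" using member_le_sum[OF that _ fT', of e] by simp
    then show ?thesis unfolding m_def by (rule mult_le_mono2)
  qed
  have b: "(\<nu> \<circ> idele_norm) x = 1" if x: "x \<in> QI.box T' m" for x
  proof -
    have xc: "x \<in> carrier IK" using x by (simp add: QI.box_def)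
    have xh: "x (fp P) \<in> (if P \<in> T' then QI.HU P m else QI.LU P)" if "P \<in> PK" for P
      using x that unfolding QI.box_def by blast
    have xl: "x (fp P) \<in> QI.LU P" if "P \<in> PK" for P
      using xh[OF that] QI.hu_lu[OF that m0] by (auto split: if_splits)
    have "idele_norm x (fp p) \<in> (if p \<in> T then rat.HU p n else rat.LU p)" if p: "p \<in> PQ" for p
    proof -
      obtain P where P: "P \<in> PK" "P \<inter> \<rat> = p" by (rule place_surj[OF p])
      note Q = cnj_place[OF P(1)]
      have Qp: "cnj ` P \<inter> \<rat> = p" using below_conj[of "fp P"] P(2) by simp
      show ?thesis
      proof (cases "p \<in> T")
        case True
        then have PT: "P \<in> T'" "cnj ` P \<in> T'" using P Q Qp by (auto simp: T'_def)
        have "x (fp P) \<in> QI.HU P (n * e P)" using xh[OF P(1)] PT QI.hu_mono[OF P(1) em[OF PT(1)]] by auto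
        moreover have "x (fp (cnj ` P)) \<in> QI.HU (cnj ` P) (n * e P)" using xh[OF Q] PT QI.hu_mono[OF Q em[OF PT(1)]] by auto
        ultimately show ?thesis using e(2)[OF P(1) xc] P(2) True by auto
      next
        case False
        then show ?thesis using norm_lu[OF xc P(1) xl[OF P(1)] xl[OF Q]] P(2) by simp
      qed
    qed
    then have "idele_norm x \<in> rat.box T n" using idele_norm(1)[OF xc] unfolding rat.box_def by blast
    then show ?thesis using T(4) by simp
  qed
  show full: "QI.full (\<nu> \<circ> idele_norm)" unfolding QI.full_def
    by (rule exI[of _ T'], rule exI[of _ m]) (use fT' m0 b in \<open>auto simp: T'_def\<close>)
  show qc: "QI.qchar (\<nu> \<circ> idele_norm)"
  proof (rule QI.qcharI[OF _ fT' m0 b])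
    show "QI.sign_hom (\<nu> \<circ> idele_norm)" unfolding QI.sign_hom_def
      using rat.qchar_sign[OF q idele_norm(1)] rat.qchar_mult[OF q idele_norm(1) idele_norm(1)] norm_mult by simp
    fix a assume a: "a \<in> QI" "a \<noteq> 0"
    show "(\<nu> \<circ> idele_norm) (principal_idele QI a) = 1"
      using norm_principal[OF a] rat.qchar_principal[OF q gauss_norm_Rats[OF a(1)]] a by simp
  qed
  show "from_base_change (\<nu> \<circ> idele_norm)" unfolding from_base_change_def
    using qc q by (auto simp: QI.qchar_def rat.qchar_def char_eq_def)
qed

lemma norm_conj: assumes x: "x \<in> carrier IK" shows "idele_norm (idele_conj x) = idele_norm x"
proof (rule idele_norm_eq[OF idele_conj_closed[OF x] idele_norm(1)[OF x]])
  interpret comm_monoid IK by (rule QI.IG_comm_monoid)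
  show "idele_incl (idele_norm x) = idele_conj x \<otimes>\<^bsub>IK\<^esub> idele_conj (idele_conj x)"
    using idele_norm(2)[OF x] idele_conj_conj[OF x] m_comm[OF x idele_conj_closed[OF x]] by simp
qed

text \<open>Invariance under conjugation is the property by which base changes are recognised in
  statements (II) and (III).\<close>

lemma base_change_conj: assumes "from_base_change \<mu>" "x \<in> carrier IK" shows "\<mu> (idele_conj x) = \<mu> x"
  using assms idele_conj_closed[OF assms(2)] norm_conj[OF assms(2)] unfolding from_base_change_def char_eq_def by auto

lemma conj_one_at: assumes w: "w \<in> VK" and x: "x (conj_place w) = \<one>\<^bsub>KKv (conj_place w)\<^esub>"
  shows "idele_conj x w = \<one>\<^bsub>KKv w\<^esub>"
proof -
  have "(\<lambda>s. cnj \<circ> s) ` embed QI (conj_place w) 1 = embed QI w (cnj 1)" by (rule conj_embed[OF w]) simp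
  then show ?thesis using w x QI.embed_one[OF w] QI.embed_one[OF conj_places[OF w]] by (simp add: idele_conj_def)
qed

section \<open>Local components of a base change\<close>

lemma norm_local_off: assumes P: "P \<in> PK" and X: "X \<in> QI.KU (fp P)" and w: "w \<in> places \<rat>" "w \<noteq> fp (P \<inter> \<rat>)"
  shows "idele_norm (QI.lid P X) w = \<one>\<^bsub>KQv w\<^esub>"
proof -
  have vP: "fp P \<in> VK" using P by simp
  obtain v where v: "v \<in> VK" "place_below v = w" by (rule above_place_ex[OF w(1)])
  let ?x = "QI.lid P X"
  have xc: "?x \<in> carrier IK" by (rule QI.local_idele_closed[OF vP X])
  have n1: "v \<noteq> fp P" using v(2) w(2) by auto
  have n2: "conj_place v \<noteq> fp P"
  proof
    assume "conj_place v = fp P"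
    then have "place_below (conj_place v) = fp (P \<inter> \<rat>)" by simp
    then show False using v(2) w(2) by simp
  qed
  note n = n1 n2
  interpret comm_monoid "KKv v" by (rule QI.K_comm_monoid[OF v(1)])
  have "?x v = \<one>\<^bsub>KKv v\<^esub>" "idele_conj ?x v = \<one>\<^bsub>KKv v\<^esub>"
    using n v conj_places[OF v(1)] by (auto intro!: conj_one_at simp: local_idele_def)
  then have "?x v \<otimes>\<^bsub>KKv v\<^esub> idele_conj ?x v = embed QI v 1" using QI.embed_one[OF v(1)] by simp
  from norm_embed[OF xc v(1) _ this] show ?thesis using v(2) rat.embed_one[OF w(1)] by simp
qed

lemma norm_local: assumes P: "P \<in> PK" and X: "X \<in> QI.KU (fp P)"
  shows "idele_norm (QI.lid P X) =
    rat.lid (P \<inter> \<rat>) (idele_norm (QI.lid P X) (fp (P \<inter> \<rat>)))"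
proof
  fix w
  have vP: "fp P \<in> VK" using P by simp
  note n = idele_norm(1)[OF QI.local_idele_closed[OF vP X]]
  show "idele_norm (QI.lid P X) w =
    rat.lid (P \<inter> \<rat>) (idele_norm (QI.lid P X) (fp (P \<inter> \<rat>))) w"
    using norm_local_off[OF P X, of w] rat.IG_D(2)[OF n, of w]
    by (cases "w \<in> places \<rat>"; cases "w = fp (P \<inter> \<rat>)") (auto simp: local_idele_def)
qed

lemma norm_local_real: assumes P: "P \<in> PK" "cnj ` P = P" and a: "a \<in> QI" "a \<noteq> 0"
  shows "idele_norm (QI.lid P (QI.emb P a)) =
    rat.lid (P \<inter> \<rat>) (rat.emb (P \<inter> \<rat>) (a * cnj a))"
proof -
  have v: "fp P \<in> VK" using P by simp
  have X: "QI.emb P a \<in> QI.KU (fp P)" by (rule QI.embed_units[OF v a])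
  let ?x = "QI.lid P (QI.emb P a)"
  have xc: "?x \<in> carrier IK" by (rule QI.local_idele_closed[OF v X])
  have "idele_conj ?x = QI.lid P (QI.emb P (cnj a))"
    using idele_conj_local[OF v a(1)] P(2) by simp
  then have "?x (fp P) \<otimes>\<^bsub>QI.KP P\<^esub> idele_conj ?x (fp P) = QI.emb P (a * cnj a)"
    using v QI.embed_mult[OF v a(1) QI.F_cnj[OF a(1)]] by (simp add: local_idele_def)
  from norm_embed[OF xc v gauss_norm_Rats[OF a(1)] this]
  show ?thesis by (subst norm_local[OF P(1) X]) simp
qed

text \<open>The conjugate idele is supported at the other place above, so at \<open>P\<close> the
  norm is \<open>a\<close> itself, whereas at a self-conjugate place it is
  \<open>a * cnj a\<close>.\<close>

lemma norm_local_nonreal: assumes P: "P \<in> PK" "cnj ` P \<noteq> P" and a: "a \<in> \<rat>" "a \<noteq> 0"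
  shows "idele_norm (QI.lid P (QI.emb P a)) =
    rat.lid (P \<inter> \<rat>) (rat.emb (P \<inter> \<rat>) a)"
proof -
  have v: "fp P \<in> VK" using P by simp
  have X: "QI.emb P a \<in> QI.KU (fp P)" by (rule QI.embed_units[OF v Q_sub_K[OF a(1)] a(2)])
  let ?x = "QI.lid P (QI.emb P a)"
  have xc: "?x \<in> carrier IK" by (rule QI.local_idele_closed[OF v X])
  have "idele_conj ?x (fp P) = \<one>\<^bsub>QI.KP P\<^esub>"
    by (rule conj_one_at[OF v]) (use P conj_places[OF v] in \<open>auto simp: local_idele_def\<close>)
  moreover interpret comm_monoid "QI.KP P" by (rule QI.K_comm_monoid[OF v])
  have "QI.emb P a \<otimes>\<^bsub>QI.KP P\<^esub> \<one>\<^bsub>QI.KP P\<^esub> = QI.emb P a"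
    using QI.embed_carrier[OF v Q_sub_K[OF a(1)]] by simp
  ultimately have "?x (fp P) \<otimes>\<^bsub>QI.KP P\<^esub> idele_conj ?x (fp P) = QI.emb P a"
    using v by (simp add: local_idele_def)
  from norm_embed[OF xc v a(1) this]
  show ?thesis by (subst norm_local[OF P(1) X]) simp
qed

lemma lam_base_change_real: "P \<in> PK \<Longrightarrow> cnj ` P = P \<Longrightarrow> a \<in> QI \<Longrightarrow> a \<noteq> 0 \<Longrightarrow>
   QI.lam (\<nu> \<circ> idele_norm) P a = rat.lam \<nu> (P \<inter> \<rat>) (a * cnj a)"
  using norm_local_real by (simp add: QI.lam_def rat.lam_def local_char_def)
lemma lam_base_change_nonreal: "P \<in> PK \<Longrightarrow> cnj ` P \<noteq> P \<Longrightarrow> a \<in> \<rat> \<Longrightarrow> a \<noteq> 0 \<Longrightarrow>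
   QI.lam (\<nu> \<circ> idele_norm) P a = rat.lam \<nu> (P \<inter> \<rat>) a"
  using norm_local_nonreal by (simp add: QI.lam_def rat.lam_def local_char_def)

text \<open>The norm of an idele supported at \<open>P\<close> with unit component is supported at
  the place below and has unit component there.\<close>

lemma base_change_unram: assumes P: "P \<in> PK" and n: "\<And>X. X \<in> rat.LU (P \<inter> \<rat>) \<Longrightarrow> rat.lc \<nu> (P \<inter> \<rat>) X = 1"
  shows "P \<notin> QI.Ram (\<nu> \<circ> idele_norm)"
proof -
  have v: "fp P \<in> VK" using P by simp
  have "QI.lc (\<nu> \<circ> idele_norm) P X = 1" if X: "X \<in> QI.LU P" for X
  proof -
    have Xu: "X \<in> QI.KU (fp P)" using X QI.local_units_sub[OF P] by blast
    let ?x = "QI.lid P X"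
    have xc: "?x \<in> carrier IK" by (rule QI.local_idele_closed[OF v Xu])
    have "?x (fp Q) \<in> QI.LU Q" if "Q \<in> PK" for Q
      using that X QI.lu_one by (auto simp: local_idele_def)
    then have "idele_norm ?x (fp (P \<inter> \<rat>)) \<in> rat.LU (P \<inter> \<rat>)" by (intro norm_lu[OF xc P]) (use P cnj_place in auto)
    then have 1: "\<nu> (rat.lid (P \<inter> \<rat>) (idele_norm ?x (fp (P \<inter> \<rat>)))) = 1"
      using n unfolding local_char_def by blast
    have "\<nu> (idele_norm ?x) = \<nu> (rat.lid (P \<inter> \<rat>) (idele_norm ?x (fp (P \<inter> \<rat>))))"
      by (rule arg_cong[OF norm_local[OF P Xu]])
    then show ?thesis using 1 by (simp add: local_char_def)
  qed
  then show ?thesis using QI.lu_embed[OF P] QI.vunit_F[OF P] by (auto simp: QI.Ram_def QI.lam_def)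
qed

text \<open>Sign characters are trivial at infinity because every element of that completion is a square.\<close>

lemma gauss_dense: assumes "e > 0" shows "\<exists>r\<in>QI. cmod (r - z) < e"
proof -
  obtain a where a: "a \<in> \<rat>" "Re z < a" "a < Re z + e/2" using Rats_dense_in_real[of "Re z" "Re z + e/2"] assms by auto
  obtain b where b: "b \<in> \<rat>" "Im z < b" "b < Im z + e/2" using Rats_dense_in_real[of "Im z" "Im z + e/2"] assms by auto
  have "cmod (Complex a b - z) \<le> \<bar>Re (Complex a b - z)\<bar> + \<bar>Im (Complex a b - z)\<bar>" by (rule cmod_le)
  also have "\<dots> < e" using a b by simp
  finally show ?thesis using gauss_fieldI[OF a(1) b(1)] by blast
qed

text \<open>A representative converges to a complex number \<open>z\<close>, and a sequence of
  Gaussian numbers converging to \<open>csqrt z\<close> represents a square root.\<close>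

lemma gauss_inf_square: assumes X: "X \<in> QI.KU Inf_place"
  shows "\<exists>Y\<in>QI.KU Inf_place. X = Y \<otimes>\<^bsub>KKv Inf_place\<^esub> Y"
proof -
  have v: "Inf_place \<in> VK" by simp
  have A: "absv QI Inf_place x = cmod x" for x by (simp add: absv.simps)
  obtain s where s: "s \<in> CK Inf_place" "X = QI.cl Inf_place s" "s \<notin> null_seqs QI Inf_place" using QI.units_cases[OF v X] by metis
  have "Cauchy s"
  proof (rule metric_CauchyI)
    fix e :: real assume "e > 0"
    then show "\<exists>M. \<forall>m\<ge>M. \<forall>n\<ge>M. dist (s m) (s n) < e" using QI.C_D[OF v s(1), of e] by (simp add: A dist_norm)
  qed
  then obtain z where z: "s \<longlonglongrightarrow> z" using Cauchy_convergent convergent_def by blast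
  define c where "c = csqrt z"
  have cz: "c * c = z" by (simp add: c_def flip: power2_eq_square)
  have "\<exists>r. \<forall>n. r n \<in> QI \<and> cmod (r n - c) < inverse (real (Suc n))"
    by (rule choice) (use gauss_dense[of "inverse (real (Suc n))" c for n] in auto)
  then obtain r where r: "\<And>n. r n \<in> QI" "\<And>n. cmod (r n - c) < inverse (real (Suc n))" by blast
  have "(\<lambda>n. cmod (r n - c)) \<longlonglongrightarrow> 0"
    by (rule tendsto_sandwich[OF _ _ tendsto_const LIMSEQ_inverse_real_of_nat])
      (simp, rule always_eventually, rule allI, rule less_imp_le, rule r(2))
  then have rc: "r \<longlonglongrightarrow> c" using tendsto_norm_zero_iff LIM_zero_iff by blast
  have rC: "r \<in> CK Inf_place"
  proof (rule QI.C_I[OF v r(1)])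
    fix e :: real assume "e > 0"
    then show "\<exists>N. \<forall>m\<ge>N. \<forall>n\<ge>N. absv QI Inf_place (r m - r n) < e"
      using metric_CauchyD[OF LIMSEQ_imp_Cauchy[OF rc]] by (simp add: A dist_norm)
  qed
  have rr: "(\<lambda>n. r n * r n) \<in> CK Inf_place" by (rule QI.C_mult[OF v rC rC])
  have "(\<lambda>n. s n - r n * r n) \<longlonglongrightarrow> z - c * c" by (intro tendsto_diff tendsto_mult z rc)
  then have "(\<lambda>n. cmod (s n - r n * r n)) \<longlonglongrightarrow> 0" using cz tendsto_norm_zero by fastforce
  then have "(\<lambda>n. s n - r n * r n) \<in> null_seqs QI Inf_place"
    using QI.C_diff[OF v s(1) rr] by (simp add: QI.N_iff[OF v] A)
  then have e: "X = QI.cl Inf_place (\<lambda>n. r n * r n)" using QI.cl_eq[OF v s(1) rr] s(2) by simp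
  have "r \<notin> null_seqs QI Inf_place"
  proof
    assume "r \<in> null_seqs QI Inf_place"
    then have "(\<lambda>n. r n * r n) \<in> null_seqs QI Inf_place" by (rule QI.N_mult[OF v rC])
    then have "X = \<zero>\<^bsub>KKv Inf_place\<^esub>" using e QI.cl_N[OF v rr] by simp
    then show False using X QI.K_units[OF v] by simp
  qed
  then have "QI.cl Inf_place r \<in> QI.KU Inf_place" by (rule QI.cl_units[OF v rC])
  then show ?thesis using e QI.cl_mult[OF v rC rC] by auto
qed

text \<open>Write \<open>x\<close> as the square of a local idele at infinity times an idele with
  component 1 there. The square has sign 1, and \<open>qchar_box\<close> covers the rest.\<close>

lemma gauss_full: assumes q: "QI.qchar \<psi>" shows "QI.full \<psi>"
proof -
  have v: "Inf_place \<in> VK" by simp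
  obtain T n where T: "finite T" "T \<subseteq> PK" "n > 0" "\<forall>x\<in>QI.box T n. x Inf_place = \<one>\<^bsub>KKv Inf_place\<^esub> \<longrightarrow> \<psi> x = 1"
    using QI.qchar_box[OF q] by blast
  have "\<psi> x = 1" if x: "x \<in> QI.box T n" for x
  proof -
    have xc: "x \<in> carrier IK" using x by (simp add: QI.box_def)
    obtain Y where Y: "Y \<in> QI.KU Inf_place" "x Inf_place = Y \<otimes>\<^bsub>KKv Inf_place\<^esub> Y"
      using gauss_inf_square[OF QI.IG_D(1)[OF xc v]] by blast
    define l where "l = local_idele QI Inf_place Y"
    have lc: "l \<in> carrier IK" using QI.local_idele_closed[OF v Y(1)] by (simp add: l_def)
    define x' where "x' = (\<lambda>w\<in>VK. if w = Inf_place then \<one>\<^bsub>KKv w\<^esub> else x w)"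
    have x'c: "x' \<in> carrier IK"
      by (rule QI.IG_I[of _ "{P \<in> PK. x (fp P) \<notin> QI.LU P}"])
        (use QI.IG_D[OF xc] QI.units_one in \<open>auto simp: x'_def\<close>)
    have "x' (fp P) = x (fp P)" if "P \<in> PK" for P using that by (simp add: x'_def)
    then have "x' \<in> QI.box T n" using x x'c unfolding QI.box_def by simp
    then have 1: "\<psi> x' = 1" using T(4) by (simp add: x'_def)
    have "x = (l \<otimes>\<^bsub>IK\<^esub> l) \<otimes>\<^bsub>IK\<^esub> x'"
    proof (rule QI.IG_ext[OF xc])
      show "(l \<otimes>\<^bsub>IK\<^esub> l) \<otimes>\<^bsub>IK\<^esub> x' \<in> carrier IK" by (intro QI.IG_mult_closed lc x'c)
      fix w assume w: "w \<in> VK"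
      interpret comm_monoid "KKv w" by (rule QI.K_comm_monoid[OF w])
      have xw: "x w \<in> carrier (KKv w)" using QI.units_carrier[OF w QI.IG_D(1)[OF xc w]] .
      then have "\<one>\<^bsub>KKv w\<^esub> \<otimes>\<^bsub>KKv w\<^esub> x w = x w" "x w \<otimes>\<^bsub>KKv w\<^esub> \<one>\<^bsub>KKv w\<^esub> = x w" "\<one>\<^bsub>KKv w\<^esub> \<otimes>\<^bsub>KKv w\<^esub> \<one>\<^bsub>KKv w\<^esub> = \<one>\<^bsub>KKv w\<^esub>" by simp_all
      then show "x w = ((l \<otimes>\<^bsub>IK\<^esub> l) \<otimes>\<^bsub>IK\<^esub> x') w" using w Y(2)
        by (cases "w = Inf_place") (simp_all add: QI.IG_mult l_def local_idele_def x'_def)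
    qed
    then have "\<psi> x = \<psi> (l \<otimes>\<^bsub>IK\<^esub> l) * \<psi> x'" using QI.qchar_mult[OF q QI.IG_mult_closed[OF lc lc] x'c] by simp
    then show ?thesis using 1 QI.qchar_mult[OF q lc lc] QI.qchar_sq[OF q lc] by simp
  qed
  then show ?thesis using T unfolding QI.full_def by blast
qed

section \<open>Characters with prescribed local signs, and the product formula\<close>

context euclid_field
begin

text \<open>The character of \<open>qchar_exists\<close> evaluated on local ideles: their only
  nontrivial component yields the prescribed sign at places in \<open>T\<close> and 1 at the other
  finite places.\<close>

lemma char_from_signs:
  assumes T: "finite T" "T \<subseteq> FP" and n: "n > 0"
    and sg: "\<And>P. P \<in> T \<Longrightarrow> local_sgn P n (L P)"
    and un: "\<And>e. e \<in> Oi \<Longrightarrow> nrm e = 1 \<Longrightarrow> (\<Prod>P\<in>T. L P (emb P e)) = 1"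
  shows "\<exists>\<psi>. qchar \<psi> \<and> full \<psi> \<and> (\<forall>P\<in>FP. \<forall>X\<in>LU P. lc \<psi> P X = (if P \<in> T then L P X else 1))"
proof -
  have one: "L P \<one>\<^bsub>KP P\<^esub> = 1" if "P \<in> T" for P
    using local_sgn_embed(1)[OF _ sg[OF that]] embed_one[OF vP, of P] that T by auto
  show ?thesis
  proof (rule qchar_exists[where L=L, OF T n local_sgnD[OF sg] un])
    fix \<psi> assume \<psi>: "qchar \<psi>" "\<And>x. x \<in> box T n \<Longrightarrow> \<psi> x = 1"
      "\<And>x. x \<in> carrier IG \<Longrightarrow> (\<And>P. P \<in> FP \<Longrightarrow> x (fp P) \<in> LU P) \<Longrightarrow> \<psi> x = (\<Prod>P\<in>T. L P (x (fp P)))"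
    have "lc \<psi> P X = (if P \<in> T then L P X else 1)" if P: "P \<in> FP" and X: "X \<in> LU P" for P X
    proof -
      let ?x = "lid P X"
      have xc: "?x \<in> carrier IG" using local_idele_closed[OF vP[OF P]] X local_units_sub[OF P] by blast
      have "?x (fp Q) \<in> LU Q" if "Q \<in> FP" for Q
        using that X lu_one by (auto simp: local_idele_def)
      then have "\<psi> ?x = (\<Prod>Q\<in>T. L Q (?x (fp Q)))" by (rule \<psi>(3)[OF xc])
      also have "\<dots> = (\<Prod>Q\<in>T. if Q = P then L P X else 1)"
        by (rule prod.cong) (use T(2) one in \<open>auto simp: local_idele_def\<close>)
      also have "\<dots> = (if P \<in> T then L P X else 1)" using T(1) by (simp add: prod.delta)
      finally show ?thesis by (simp add: local_char_def)
    qed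
    moreover have "full \<psi>" unfolding full_def using T n \<psi>(2) by blast
    ultimately show ?thesis using \<psi>(1) by blast
  qed
qed

text \<open>The sign -1 on a generator modulo \<open>P\<close>, obtained from
  \<open>local_sign\<close> with 1 in place of the other two generators. Only a relation with odd
  exponent could contradict it, and \<open>odd_generator\<close> excludes these.\<close>

lemma odd_sign:
  assumes P: "P \<in> FP" and odd: "2 \<notin> P"
  shows "\<exists>L. local_sgn P 1 L \<and> (\<exists>g. vunit P g \<and> L (emb P g) = -1)"
proof -
  obtain g where g: "g \<in> Oi" "g \<notin> P" "\<And>a. vunit P a \<Longrightarrow> \<exists>k. cng P 1 a (g ^ k)" "\<And>m. cng P 1 (g ^ m) 1 \<Longrightarrow> even m"
    using odd_generator[OF P odd] by metis
  have vg: "vunit P g" using vunit_O[OF P g(1)] g(2) by blast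
  have gen: "\<exists>i j k. cng P 1 (a * (g ^ i * 1 ^ j * 1 ^ k)) 1" if a: "vunit P a" for a
  proof -
    obtain k where k: "cng P 1 (inverse a) (g ^ k)" using g(3)[OF vunit_inverse[OF P a]] by blast
    have "cng P 1 (a * g ^ k) (a * inverse a)"
      by (rule cng_vmult[OF P a a vunit_power[OF P vg] vunit_inverse[OF P a] cng_refl[OF P] cng_sym[OF P vunit_F[OF P vunit_inverse[OF P a]] F_power[OF O_F[OF g(1)]] k]])
    then show ?thesis using vunit_nz[OF P a] by (intro exI[of _ k]) simp
  qed
  have rel: "(-1) ^ i * 1 ^ j * 1 ^ k = (1::complex)" if "cng P 1 (g ^ i * 1 ^ j * 1 ^ k) 1" for i j k :: nat
    using g(4)[of i] that by simp
  from local_sign[OF P zero_less_one vg vunit_1[OF P] vunit_1[OF P] disjI2[OF refl] disjI1[OF refl] disjI1[OF refl] gen rel]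
  show ?thesis using vg by blast
qed

text \<open>The principal idele of a global unit has unit components at all finite places and
  character value 1. Places outside \<open>Ram \<psi>\<close> contribute 1, and infinity contributes
  nothing because \<open>\<psi>\<close> is \<open>full\<close>.\<close>

lemma product_formula:
  assumes q: "qchar \<psi>" "full \<psi>" and e: "e \<in> Oi" "nrm e = 1"
  shows "(\<Prod>P\<in>Ram \<psi>. lam \<psi> P e) = 1"
proof -
  obtain T n where T: "finite T" "T \<subseteq> FP" "n > 0" "\<And>x. x\<in>box T n \<Longrightarrow> \<psi> x = 1" using q(2) unfolding full_def by blast
  define S where "S = T \<union> Ram \<psi>"
  have S: "finite S" "S \<subseteq> FP" using T finite_Ram[OF q(1)] Ram_places[OF q(1)] by (auto simp: S_def)
  have e0: "e \<in> F" "e \<noteq> 0" using O_F e nrm_1 by auto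
  have ve: "vunit P e" if P: "P \<in> FP" for P
  proof -
    have "e \<notin> P"
    proof
      assume "e \<in> P"
      then have "inverse e * e \<in> P" using place_mult[OF P] nrm_1[OF e] by blast
      then show False using e0 placeD(3)[OF P] by simp
    qed
    then show ?thesis using vunit_O[OF P e(1)] by simp
  qed
  let ?x = "principal_idele F e"
  have xc: "?x \<in> carrier IG" by (rule principal_closed[OF e0])
  have xl: "?x (fp P) \<in> LU P" if P: "P \<in> FP" for P
    using lu_embed[OF P e0(1)] ve[OF P] P by (simp add: principal_idele_def)
  have one: "\<one>\<^bsub>KP P\<^esub> \<in> HU P n" if P: "P \<in> FP" for P
    using hu_embed[OF P, of 1 n] cng_refl[OF P] embed_one[OF vP[OF P]] by simp
  have "repl S ?x \<in> box T n" using repl_closed[OF xc] xl one lu_one by (auto simp: box_def repl_def S_def)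
  then have "\<psi> (repl S ?x) = 1" by (rule T(4))
  then have "(\<Prod>P\<in>S. lc \<psi> P (?x (fp P))) = 1"
    using qchar_split[OF q(1) xc S] qchar_principal[OF q(1) e0] by simp
  also have "(\<Prod>P\<in>S. lc \<psi> P (?x (fp P))) = (\<Prod>P\<in>S. lam \<psi> P e)"
    by (rule prod.cong) (use S(2) in \<open>auto simp: lam_def principal_idele_def\<close>)
  also have "\<dots> = (\<Prod>P\<in>Ram \<psi>. lam \<psi> P e)"
  proof (rule prod.mono_neutral_right)
    show "\<forall>P\<in>S - Ram \<psi>. lam \<psi> P e = 1" using S(2) ve by (auto simp: Ram_def)
  qed (use S in \<open>auto simp: S_def\<close>)
  finally show ?thesis .
qed

end

section \<open>Local sign characters at two\<close>

context euclid_field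
begin

text \<open>Lets a concrete generator, such as 2 or \<open>1 + i\<close>, take the role of the
  chosen \<open>ppi P\<close>.\<close>

lemma av_generator:
  assumes P: "P \<in> FP" and d: "d \<in> Oi" "d \<noteq> 0" "d \<in> P" and g: "ppi P \<in> pid d"
  shows "av P d = 1/2"
proof -
  obtain c where c: "c \<in> Oi" "ppi P = c * d" using g by (rule pidE)
  have c0: "c \<noteq> 0" using c ppi(3)[OF P] by auto
  have "val P c + val P d = val P (c * d)" by (rule val_mult[OF P O_F[OF c(1)] c0 O_F[OF d(1)] d(2), symmetric])
  also have "\<dots> = 1" using val_ppi[OF P P] c(2) by simp
  finally have "val P d = 1" using val_O_nonneg(1)[OF P c(1) c0] val_O_nonneg(2)[OF P d(1,2)] d(3) by linarith
  then show ?thesis using AP_val[OF P O_F[OF d(1)] d(2)] by simp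
qed

lemma residue_two:
  assumes P: "P \<in> FP" and r: "\<And>b. b \<in> Oi \<Longrightarrow> b \<notin> P \<Longrightarrow> b - 1 \<in> P" and x: "vunit P x"
  shows "cng P 1 x 1"
proof -
  have xF: "x \<in> F" "x \<noteq> 0" using vunit_F[OF P x] vunit_nz[OF P x] by auto
  have "val P x = 0" using x vunit_val[OF P xF] by blast
  then obtain b c where bc: "b \<in> Oi - P" "c \<in> Oi - P" "x = b / c" using val_ex[OF P xF] by auto
  have F: "b \<in> F" "c \<in> F" using bc O_F by auto
  have "cng P 1 b 1" "cng P 1 c 1" using cng_O1[OF P] r bc by auto
  then have "cng P 1 b c" using cng_trans[OF P F(1) _ F(2)] cng_sym[OF P F(2), of 1] F_simps(2) by blast
  moreover have "vunit P c" using vunit_O[OF P] bc by auto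
  ultimately show ?thesis using cng_div[OF P _ F(1)] bc(3) by (simp add: divide_inverse)
qed

text \<open>Turns the alternatives of \<open>level_step\<close> into an exponent 0 or 1, so that
  steps at successive levels can be chained.\<close>

lemma step_ex:
  assumes P: "P \<in> FP" and res: "\<And>x. vunit P x \<Longrightarrow> cng P 1 x 1" and two: "2 \<in> P"
    and a: "vunit P a" "cng P k a 1" and g: "vunit P g" "av P (g - 1) = 1 / 2 ^ k" and k: "k > 0"
  shows "\<exists>j::nat. cng P (Suc k) (a * g ^ j) 1"
  using level_step[OF P res two a g k]
proof
  assume "cng P (Suc k) a 1" then show ?thesis by (intro exI[of _ 0]) simp
next
  assume "cng P (Suc k) (a * g) 1" then show ?thesis by (intro exI[of _ 1]) simp
qed

lemma cng_1_power: "P \<in> FP \<Longrightarrow> vunit P x \<Longrightarrow> cng P n x 1 \<Longrightarrow> cng P n (x ^ k) 1"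
  using cng_power[of P x 1 n k] vunit_1[of P] by simp
lemma cng_1_mult: "P \<in> FP \<Longrightarrow> vunit P x \<Longrightarrow> vunit P y \<Longrightarrow> cng P n x 1 \<Longrightarrow> cng P n y 1 \<Longrightarrow> cng P n (x * y) 1"
  using cng_vmult[of P x 1 y 1 n] vunit_1[of P] by simp

end

section \<open>The place 2 of the rationals\<close>

definition p2 :: "complex set" where "p2 = P2 \<inter> \<rat>"

lemma p2_place: "p2 \<in> PQ" and two_p2: "2 \<in> p2"
  using below_place[OF P2_place] two_P2 by (auto simp: p2_def)

lemma P2_above: "P2 \<in> places_above 2" using above_2 by simp

lemma int_P2: "of_int m \<in> P2 \<longleftrightarrow> even m"
  using above_int[OF P2_above two_is_prime_nat, of m] by simp

lemma int_p2: "of_int m \<in> p2 \<longleftrightarrow> even m"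
  using int_P2[of m] by (simp add: p2_def)

lemma num_p2: "numeral n \<in> p2 \<longleftrightarrow> even (numeral n :: int)"
  using int_p2[of "numeral n"] by simp

abbreviation "AQ2 \<equiv> rat.av p2"
abbreviation "AK2 \<equiv> QI.av P2"

lemma AQ2_2: "AQ2 2 = 1/2"
proof (rule rat.av_generator[OF p2_place])
  obtain m where m: "rat.ppi p2 = of_int m" using rat.ppi(1)[OF p2_place] by (auto elim: Ints_cases)
  then have "even m" using rat.ppi(4)[OF p2_place] int_p2 by simp
  then obtain c where "m = 2 * c" by blast
  then show "rat.ppi p2 \<in> rat.pid 2" using m by (intro rat.pidI[of "of_int c"]) simp_all
qed (use two_p2 in simp_all)

lemma AQ2_odd: "odd m \<Longrightarrow> AQ2 (of_int m) = 1"
  using rat.AP_O_1[OF p2_place, of "of_int m"] int_p2[of m] by simp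

lemma AQ2_mult: "AQ2 (of_int a * of_int b) = AQ2 (of_int a) * AQ2 (of_int b)"
  by (rule rat.aA_mult[OF p2_place]) auto

text \<open>The constants are \<open>13 - 1\<close> and \<open>13^2 - 1\<close>; their values give
  the levels of 13 and of its square.\<close>

lemma AQ2_12: "AQ2 12 = 1/4" and AQ2_168: "AQ2 168 = 1/8"
proof -
  have 4: "AQ2 4 = 1/4" using AQ2_mult[of 2 2] AQ2_2 by simp
  then have 8: "AQ2 8 = 1/8" using AQ2_mult[of 2 4] AQ2_2 by simp
  show "AQ2 12 = 1/4" using AQ2_mult[of 4 3] AQ2_odd[of 3] 4 by simp
  show "AQ2 168 = 1/8" using AQ2_mult[of 8 21] AQ2_odd[of 21] 8 by simp
qed

lemma rat_res2: "rat.vunit p2 x \<Longrightarrow> rat.cng p2 1 x 1"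
proof (rule rat.residue_two[OF p2_place])
  fix b :: complex assume b: "b \<in> \<int>" "b \<notin> p2"
  then obtain m where m: "b = of_int m" by (auto elim: Ints_cases)
  then have "odd m" using b int_p2 by simp
  then have "of_int (m - 1) \<in> p2" using int_p2[of "m - 1"] by simp
  then show "b - 1 \<in> p2" using m by simp
qed

text \<open>Level 3 is congruence modulo 8. There -1 has exact level 1, 13 has exact level 2, and
  both have square 1, so they generate independently and both signs are free.\<close>

lemma two_adic_rat:
  assumes s: "s = 1 \<or> s = (-1::complex)" "t = 1 \<or> t = (-1::complex)"
  shows "\<exists>L. rat.local_sgn p2 3 L \<and> L (rat.emb p2 13) = s \<and> L (rat.emb p2 (-1)) = t"
proof -
  note P = p2_place
  have v: "rat.vunit p2 13" "rat.vunit p2 (-1)" "rat.vunit p2 1"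
    using rat.vunit_O[OF P, of 13] num_p2 rat.vunit_minus1[OF P] rat.vunit_1[OF P] by auto
  have A: "AQ2 (-1 - 1) = 1 / 2 ^ 1" "AQ2 (13 - 1) = 1 / 2 ^ 2"
    using AQ2_2 rat.A_minus[OF rat.vP[OF P], of 2] AQ2_12 by simp_all
  have c: "rat.cng p2 2 13 1" "rat.cng p2 3 169 1" using AQ2_12 AQ2_168 by (simp_all add: rat.cng_def)
  have gen: "\<exists>i j k. rat.cng p2 3 (a * (13 ^ i * (-1) ^ j * 1 ^ k)) 1" if a: "rat.vunit p2 a" for a
  proof -
    obtain j where j: "rat.cng p2 (Suc 1) (a * (-1) ^ j) 1"
      using rat.step_ex[OF P rat_res2 two_p2 a rat_res2[OF a] v(2) A(1)] by auto
    have va: "rat.vunit p2 (a * (-1) ^ j)" by (intro rat.vunit_mult[OF P] a rat.vunit_power[OF P] v)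
    obtain i where i: "rat.cng p2 (Suc 2) (a * (-1) ^ j * 13 ^ i) 1"
      using rat.step_ex[OF P rat_res2 two_p2 va _ v(1) A(2)] j by (auto simp: numeral_2_eq_2)
    then show ?thesis by (intro exI[of _ i] exI[of _ j] exI[of _ 0]) (simp add: mult_ac numeral_3_eq_3 numeral_2_eq_2)
  qed
  have rel: "s ^ i * t ^ j * 1 ^ k = 1" if h: "rat.cng p2 3 (13 ^ i * (-1) ^ j * 1 ^ k) 1" for i j k :: nat
  proof -
    have ej: "even j"
    proof (rule ccontr)
      assume "odd j"
      then have "rat.cng p2 3 ((-1) * 13 ^ i) 1" using h by simp
      moreover have "\<not> rat.cng p2 3 ((-1) * 13 ^ i) 1"
        by (rule rat.level_exact[OF P v(2) A(1) rat.vunit_power[OF P v(1)]])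
          (use rat.cng_1_power[OF P v(1) c(1)] in \<open>auto simp: numeral_2_eq_2\<close>)
      ultimately show False by blast
    qed
    have ei: "even i"
    proof (rule ccontr)
      assume "odd i"
      then obtain m where m: "i = 2 * m + 1" by (blast elim: oddE)
      have "(13::complex) ^ i = 13 * 169 ^ m" unfolding m by (simp add: power_mult)
      then have "rat.cng p2 3 (13 * 169 ^ m) 1" using h ej by simp
      moreover have v169: "rat.vunit p2 169" using rat.vunit_O[OF P, of 169] num_p2 by simp
      have "\<not> rat.cng p2 3 (13 * 169 ^ m) 1"
        by (rule rat.level_exact[OF P v(1) A(2) rat.vunit_power[OF P v169]])
          (use rat.cng_1_power[OF P v169 c(2)] in \<open>auto simp: numeral_3_eq_3 numeral_2_eq_2\<close>)
      ultimately show False by blast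
    qed
    have "s ^ i = 1" "t ^ j = 1" using s ei ej by auto
    then show ?thesis by simp
  qed
  show ?thesis using rat.local_sign[OF P _ v s disjI1[OF refl] gen rel] by auto
qed

text \<open>The places in \<open>A\<close> receive their nontrivial sign. The sign at -1 of the
  component at 2 serves to satisfy the product formula for the global unit -1, and the sign at 13
  can still be prescribed.\<close>

lemma nu_exists:
  assumes A: "finite A" "A \<subseteq> PQ" "\<And>p. p \<in> A \<Longrightarrow> 2 \<notin> p" and s: "s = 1 \<or> s = (-1::complex)"
  shows "\<exists>\<nu>. rat.qchar \<nu> \<and> rat.full \<nu> \<and> (\<forall>p\<in>A. p \<in> rat.Ram \<nu>) \<and>
    (\<forall>p\<in>PQ - insert p2 A. \<forall>X\<in>rat.LU p. rat.lc \<nu> p X = 1) \<and> rat.lam \<nu> p2 13 = s"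
proof -
  have "\<forall>p\<in>A. \<exists>L. rat.local_sgn p 1 L \<and> (\<exists>g. rat.vunit p g \<and> L (rat.emb p g) = -1)"
    using rat.odd_sign A by blast
  from bchoice[OF this] obtain LA
    where LA: "\<forall>p\<in>A. rat.local_sgn p 1 (LA p) \<and> (\<exists>g. rat.vunit p g \<and> LA p (rat.emb p g) = -1)" ..
  \<comment> \<open>The product of the signs of -1 over \<open>A\<close>. Taking it once more at the
    place 2 makes the total product \<open>t * t = 1\<close>.\<close>
  define t where "t = (\<Prod>p\<in>A. LA p (rat.emb p (-1)))"
  have tt: "t * t = 1" unfolding t_def prod.distrib[symmetric]
  proof (rule prod.neutral, rule ballI)
    fix p assume p: "p \<in> A"
    then show "LA p (rat.emb p (-1)) * LA p (rat.emb p (-1)) = 1"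
      using rat.local_sgn_embed(2)[of p 1 "LA p" "-1"] rat.vunit_minus1[of p] A(2) LA by (metis mult_1 minus_mult_minus subsetD)
  qed
  then have ts: "t = 1 \<or> t = -1" by (simp add: square_eq_1_iff)
  from two_adic_rat[OF s ts] obtain L2
    where L2: "rat.local_sgn p2 3 L2" "L2 (rat.emb p2 13) = s" "L2 (rat.emb p2 (-1)) = t" by blast
  define L where "L p = (if p = p2 then L2 else LA p)" for p
  have nA: "p2 \<notin> A" using A(3) two_p2 by blast
  have sL: "rat.local_sgn p 3 (L p)" if p: "p \<in> insert p2 A" for p
  proof (cases "p = p2")
    case False
    then show ?thesis using rat.local_sgn_mono[of p 1 "LA p" 3] LA p A(2) by (auto simp: L_def)
  qed (use L2(1) in \<open>simp add: L_def\<close>)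
  have ex: "\<exists>\<nu>. rat.qchar \<nu> \<and> rat.full \<nu> \<and> (\<forall>p\<in>PQ. \<forall>X\<in>rat.LU p. rat.lc \<nu> p X = (if p \<in> insert p2 A then L p X else 1))"
  proof (rule rat.char_from_signs[OF _ _ _ sL])
    show "finite (insert p2 A)" "insert p2 A \<subseteq> PQ" "(3::nat) > 0" using A p2_place by auto
    fix e :: complex assume e: "e \<in> \<int>" "rat.nrm e = 1"
    then obtain m where m: "e = of_int m" by (auto elim: Ints_cases)
    have "(cmod e)^2 = 1" using rat.nrm[OF e(1)] e(2) by simp
    then have "real_of_int (m^2) = 1" using m by simp
    then have "m^2 = 1" by linarith
    then have "m = 1 \<or> m = -1" by (simp add: power2_eq_1_iff)
    then show "(\<Prod>p\<in>insert p2 A. L p (rat.emb p e)) = 1"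
    proof
      assume "m = 1"
      have "L p (rat.emb p 1) = 1" if p: "p \<in> insert p2 A" for p
        by (rule rat.local_sgn_embed(1)[OF _ sL[OF p]]) (use p A(2) p2_place in auto)
      then show ?thesis using m \<open>m = 1\<close> by simp
    next
      assume "m = -1"
      then have e1: "e = -1" using m by simp
      have "(\<Prod>p\<in>insert p2 A. L p (rat.emb p (-1))) = t * (\<Prod>p\<in>A. L p (rat.emb p (-1)))"
        using A(1) nA L2(3) by (simp add: L_def)
      also have "(\<Prod>p\<in>A. L p (rat.emb p (-1))) = t"
        unfolding t_def by (rule prod.cong) (use nA in \<open>auto simp: L_def\<close>)
      finally show ?thesis using tt e1 by simp
    qed
  qed
  then obtain \<nu> where \<nu>: "rat.qchar \<nu>" "rat.full \<nu>" "\<And>p X. p\<in>PQ \<Longrightarrow> X\<in>rat.LU p \<Longrightarrow> rat.lc \<nu> p X = (if p \<in> insert p2 A then L p X else 1)" by blast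
  have "p \<in> rat.Ram \<nu>" if p: "p \<in> A" for p
  proof -
    have pQ: "p \<in> PQ" "p \<noteq> p2" using p A(2) nA by auto
    obtain g where g: "rat.vunit p g" "LA p (rat.emb p g) = -1" using LA p by blast
    have "rat.lam \<nu> p g = -1" unfolding rat.lam_def
      using \<nu>(3)[OF pQ(1), of "rat.emb p g"] rat.lu_embed[OF pQ(1) rat.vunit_F[OF pQ(1) g(1)]] g p pQ(2) by (simp add: L_def)
    then show ?thesis using g(1) pQ unfolding rat.Ram_def by (auto intro!: exI[of _ g])
  qed
  moreover have "rat.lam \<nu> p2 13 = s" unfolding rat.lam_def
    using \<nu>(3)[OF p2_place, of "rat.emb p2 13"] rat.lu_embed[OF p2_place, of 13] rat.vunit_O[OF p2_place, of 13] num_p2 L2(2) by (simp add: L_def)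
  ultimately show ?thesis using \<nu> by (intro exI[of _ \<nu>]) auto
qed

section \<open>The place \<open>1 + i\<close> of the Gaussian numbers\<close>

lemma AK2_one_i: "AK2 (1 + \<i>) = 1/2"
proof (rule QI.av_generator[OF P2_place one_i(1)])
  show "1 + \<i> \<noteq> 0" by (simp add: complex_eq_iff)
  show "1 + \<i> \<in> P2" unfolding P2_def by (rule QI.pid_self)
  show "QI.ppi P2 \<in> QI.pid (1 + \<i>)" using QI.ppi(4)[OF P2_place] by (simp add: P2_def)
qed

lemma AK2_mult: "a \<in> ZI \<Longrightarrow> b \<in> ZI \<Longrightarrow> AK2 (a * b) = AK2 a * AK2 b"
  by (rule QI.aA_mult[OF P2_place]) (auto intro: QI.O_F)

lemma AK2_odd: "odd m \<Longrightarrow> AK2 (of_int m) = 1"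
  using QI.AP_O_1[OF P2_place QI.O_int, of m] int_P2[of m] by simp

lemma AK2_i: "AK2 \<i> = 1"
proof -
  have "AK2 (\<i> * \<i>) = AK2 1" using QI.A_minus[OF QI.vP[OF P2_place], of 1] by simp
  then have "AK2 \<i> * AK2 \<i> = 1" using AK2_mult[of \<i> \<i>] QI.aA_1[OF P2_place] by simp
  then show ?thesis using QI.aA_nonneg[OF P2_place, of \<i>] by (simp add: square_eq_1_iff)
qed

lemma AK2_2: "AK2 2 = 1/4"
proof -
  have "(1 + \<i>) * (1 + \<i>) = \<i> * 2" by (simp add: complex_eq_iff)
  then have "AK2 (1 + \<i>) * AK2 (1 + \<i>) = AK2 \<i> * AK2 2" using AK2_mult[OF one_i(1) one_i(1)] AK2_mult[of \<i> 2] by simp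
  then show ?thesis using AK2_one_i AK2_i by simp
qed

lemma AK2_12: "AK2 12 = 1/16" and AK2_168: "AK2 168 = 1/64"
proof -
  have 4: "AK2 4 = 1/16" using AK2_mult[of 2 2] AK2_2 by simp
  then have 8: "AK2 8 = 1/64" using AK2_mult[of 2 4] AK2_2 by simp
  show "AK2 12 = 1/16" using AK2_mult[of 4 3] AK2_odd[of 3] 4 by simp
  show "AK2 168 = 1/64" using AK2_mult[of 8 21] AK2_odd[of 21] 8 by simp
qed

text \<open>\<open>m + n i = (m - n) + n (1 + i)\<close>, so the class modulo \<open>1 + i\<close>
  is the parity of \<open>m - n\<close>.\<close>

lemma gauss_res2: "QI.vunit P2 x \<Longrightarrow> QI.cng P2 1 x 1"
proof (rule QI.residue_two[OF P2_place])
  fix b assume b: "b \<in> ZI" "b \<notin> P2"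
  obtain m n where mn: "b = of_int m + of_int n * \<i>" using b(1) by (rule gauss_intsE)
  have e: "b = of_int (m - n) + of_int n * (1 + \<i>)" by (simp add: mn algebra_simps)
  have i: "of_int n * (1 + \<i>) \<in> P2" unfolding P2_def by (rule QI.pidI[OF QI.O_int refl])
  have "odd (m - n)"
  proof
    assume "even (m - n)"
    then have "of_int (m - n) \<in> P2" using int_P2 by blast
    then show False using b(2) e QI.place_add[OF P2_place _ i] QI.place_add[OF P2_place i] by (metis add.commute)
  qed
  then have "of_int (m - n - 1) \<in> P2" using int_P2[of "m - n - 1"] by simp
  then have "of_int (m - n - 1) + of_int n * (1 + \<i>) \<in> P2" using QI.place_add[OF P2_place i] by blast
  moreover have "of_int (m - n - 1) + of_int n * (1 + \<i>) = b - 1" by (simp add: e)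
  ultimately show "b - 1 \<in> P2" by metis
qed

locale fourth_root =
  fixes u :: complex
  assumes u2: "u ^ 2 = -1"
begin

text \<open>\<open>3 + 2 i\<close> for \<open>u = i\<close> and its conjugate for
  \<open>u = -i\<close>: a Gaussian integer of norm 13 that is 1 to exact level 3. Its sign is the
  one that condition (D') prescribes for exponent 5.\<close>

definition w :: complex where "w = 1 + (u - 1) ^ 3"

lemma u_cases: "u = \<i> \<or> u = - \<i>"
proof -
  have "(u - \<i>) * (u + \<i>) = 0" using u2 by (simp add: algebra_simps power2_eq_square)
  then show ?thesis by (simp add: eq_neg_iff_add_eq_0)
qed

lemma u_int: "u \<in> ZI" using u_cases QI.O_uminus by auto
lemma w_int: "w \<in> ZI" unfolding w_def by (intro QI.O_closed u_int) simp_all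
lemma u_K: "u \<in> QI" "w \<in> QI" using u_int w_int QI.O_F by auto
lemma w_cnj: "w * cnj w = 13"
  using u_cases by (auto simp: w_def complex_eq_iff power3_eq_cube)

lemma u_pow: "u ^ (2 * n) = (-1) ^ n" "u ^ (2 * n + 1) = u * (-1) ^ n"
proof -
  show "u ^ (2 * n) = (-1) ^ n" by (simp only: power_mult u2)
  then show "u ^ (2 * n + 1) = u * (-1) ^ n" by (simp only: power_add power_one_right mult.commute)
qed

lemma AK2_u: "AK2 (u - 1) = 1/2"
  using u_cases
proof
  assume "u = \<i>"
  then have "u - 1 = \<i> * (1 + \<i>)" by (simp add: complex_eq_iff)
  then show ?thesis using AK2_mult[OF i_gauss one_i(1)] AK2_i AK2_one_i by simp
next
  assume "u = - \<i>"
  then have e: "u - 1 = - (1 + \<i>)" by simp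
  show ?thesis unfolding e QI.A_minus[OF QI.vP[OF P2_place] QI.O_F[OF one_i(1)]] by (rule AK2_one_i)
qed

lemma AK2_w: "AK2 (w - 1) = 1/8"
proof -
  have "u - 1 \<in> QI" using u_K QI.F_diff by simp
  then have "AK2 ((u - 1) ^ 3) = AK2 (u - 1) ^ 3" by (rule QI.AP_power[OF P2_place])
  then show ?thesis by (simp add: w_def AK2_u power3_eq_cube)
qed

lemma vunit_near: "x \<in> QI \<Longrightarrow> QI.cng P2 1 x 1 \<Longrightarrow> QI.vunit P2 x"
  using QI.vunit_cng[OF P2_place QI.vunit_1[OF P2_place], of x 1] QI.cng_sym[OF P2_place, of x 1 1] by simp

lemma vu: "QI.vunit P2 u" "QI.vunit P2 w" "QI.vunit P2 13" "QI.vunit P2 (-1)" "QI.vunit P2 169"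
  using vunit_near[of u] vunit_near[of w] vunit_near[of 13] vunit_near[of 169] u_K AK2_u AK2_w AK2_12 AK2_168 QI.vunit_minus1[OF P2_place]
  by (simp_all add: QI.cng_def)

lemma AKs: "AK2 (u - 1) = 1 / 2 ^ 1" "AK2 (-1 - 1) = 1 / 2 ^ 2" "AK2 (w - 1) = 1 / 2 ^ 3" "AK2 (13 - 1) = 1 / 2 ^ 4"
  using AK2_u AK2_w AK2_12 AK2_2 QI.A_minus[OF QI.vP[OF P2_place], of 2] by simp_all

lemma cngs: "QI.cng P2 3 w 1" "QI.cng P2 4 13 1" "QI.cng P2 5 169 1" "QI.cng P2 2 (-1) 1" "QI.cng P2 5 (w^2) 1"
proof -
  show "QI.cng P2 3 w 1" "QI.cng P2 4 13 1" "QI.cng P2 5 169 1" "QI.cng P2 2 (-1) 1"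
    using AKs AK2_168 by (simp_all add: QI.cng_def)
  \<comment> \<open>\<open>w - 1\<close> has level 3, and \<open>w + 1 = (w - 1) + 2\<close> has
    level at least 2, so the product has level at least 5.\<close>
  have "w^2 - 1 = (w - 1) * (w + 1)" by (simp add: power2_eq_square algebra_simps)
  moreover have F: "w - 1 \<in> QI" "w + 1 \<in> QI" using u_K QI.F_diff QI.F_add by simp_all
  have "AK2 (w + 1) \<le> 1/4"
  proof -
    have e: "w + 1 = (w - 1) + 2" by simp
    show ?thesis unfolding e by (rule order_trans[OF QI.aA_ultra[OF P2_place F(1)] max.boundedI]) (simp_all add: AK2_w AK2_2)
  qed
  ultimately show "QI.cng P2 5 (w^2) 1" using QI.aA_mult[OF P2_place F] AK2_w by (simp add: QI.cng_def)
qed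

text \<open>The units \<open>u\<close>, \<open>-1 = u^2\<close>, \<open>w\<close>, \<open>13\<close> have exact levels 1, 2, 3, 4, so they generate the units
  modulo level 5.\<close>

lemma gens: assumes a: "QI.vunit P2 a"
  shows "\<exists>i j k. QI.cng P2 5 (a * (u ^ i * w ^ j * 13 ^ k)) 1"
proof -
  note P = P2_place and m = QI.vunit_mult[OF P2_place] and p = QI.vunit_power[OF P2_place]
  obtain i1 :: nat where i1: "QI.cng P2 2 (a * u ^ i1) 1"
    using QI.step_ex[OF P gauss_res2 two_P2 a gauss_res2[OF a] vu(1) AKs(1)] by (auto simp: numeral_2_eq_2)
  obtain i2 :: nat where i2: "QI.cng P2 3 (a * u ^ i1 * (-1) ^ i2) 1"
    using QI.step_ex[OF P gauss_res2 two_P2 m[OF a p[OF vu(1)]] i1 vu(4) AKs(2)] by (auto simp: numeral_3_eq_3 numeral_2_eq_2)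
  obtain j :: nat where j: "QI.cng P2 (Suc 3) (a * u ^ i1 * (-1) ^ i2 * w ^ j) 1"
    using QI.step_ex[OF P gauss_res2 two_P2 m[OF m[OF a p[OF vu(1)]] p[OF vu(4)]] i2 vu(2) AKs(3)] by auto
  then have j: "QI.cng P2 4 (a * u ^ i1 * (-1) ^ i2 * w ^ j) 1" by simp
  obtain k :: nat where k: "QI.cng P2 (Suc 4) (a * u ^ i1 * (-1) ^ i2 * w ^ j * 13 ^ k) 1"
    using QI.step_ex[OF P gauss_res2 two_P2 m[OF m[OF m[OF a p[OF vu(1)]] p[OF vu(4)]] p[OF vu(2)]] j vu(3) AKs(4)] by auto
  have e: "a * u ^ i1 * (-1) ^ i2 * w ^ j * 13 ^ k = a * (u ^ (i1 + 2 * i2) * w ^ j * 13 ^ k)" by (simp only: power_add u_pow(1)) (simp only: mult_ac)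
  have "Suc 4 = (5::nat)" by simp
  then have "QI.cng P2 5 (a * (u ^ (i1 + 2 * i2) * w ^ j * 13 ^ k)) 1" using k e by metis
  then show ?thesis by blast
qed

text \<open>At level 2 the generators \<open>w\<close> and 13 are invisible and
  \<open>u^2 = -1\<close> is 1, so only the parity of the exponent of \<open>u\<close> is
  seen.\<close>

lemma u_even: assumes h: "QI.cng P2 2 (u ^ i * w ^ j * 13 ^ k) 1" shows "even i"
proof (rule ccontr)
  note P = P2_place and m = QI.vunit_mult[OF P2_place] and p = QI.vunit_power[OF P2_place]
  assume "odd i"
  then obtain l where l: "i = 2 * l + 1" by (blast elim: oddE)
  let ?h = "(-1) ^ l * w ^ j * 13 ^ k"
  have e: "u ^ i * w ^ j * 13 ^ k = u * ?h" unfolding l u_pow(2) by (simp only: mult_ac)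
  have v: "QI.vunit P2 ?h" by (intro m p vu)
  have "QI.cng P2 2 ?h 1" using cngs
    by (intro QI.cng_1_mult[OF P] QI.cng_1_power[OF P] m p vu) (auto intro: QI.cng_mono[OF P])
  then have "\<not> QI.cng P2 2 (u * ?h) 1" by (intro QI.level_exact[OF P vu(1) AKs(1) v]) (auto simp: numeral_2_eq_2)
  then show False using h e by simp
qed

text \<open>Relations are taken apart from the lowest level upwards: an odd power of the generator
  of level 1, 2, 3 or 4 would survive, since the remaining factors are deeper. The squares of
  \<open>w\<close> and of 13 are 1 at level 5 and drop out.\<close>

lemma rels: assumes h: "QI.cng P2 5 (u ^ i * w ^ j * 13 ^ k) 1" shows "even i" "even j" "even k"
proof -
  note P = P2_place and m = QI.vunit_mult[OF P2_place] and p = QI.vunit_power[OF P2_place]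
  show ei: "even i" by (rule u_even) (rule QI.cng_mono[OF P h], simp)
  then obtain l where l: "i = 2 * l" by blast
  have ul: "u ^ i = (-1) ^ l" unfolding l by (rule u_pow(1))
  have "even l"
  proof (rule ccontr)
    assume "odd l"
    then have e: "u ^ i * w ^ j * 13 ^ k = (-1) * (w ^ j * 13 ^ k)" using ul by simp
    have v: "QI.vunit P2 (w ^ j * 13 ^ k)" by (intro m p vu)
    have "QI.cng P2 3 (w ^ j * 13 ^ k) 1" using cngs
      by (intro QI.cng_1_mult[OF P] QI.cng_1_power[OF P] m p vu) (auto intro: QI.cng_mono[OF P])
    then have "\<not> QI.cng P2 5 ((-1) * (w ^ j * 13 ^ k)) 1" by (intro QI.level_exact[OF P vu(4) AKs(2) v]) (auto simp: numeral_3_eq_3 numeral_2_eq_2)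
    then show False using h e by simp
  qed
  then have h2: "QI.cng P2 5 (w ^ j * 13 ^ k) 1" using h ul by simp
  show ej: "even j"
  proof (rule ccontr)
    assume "odd j"
    then obtain l where l: "j = 2 * l + 1" by (blast elim: oddE)
    have e: "w ^ j * 13 ^ k = w * ((w^2) ^ l * 13 ^ k)" unfolding l by (simp only: power_add power_mult power_one_right) (simp only: mult_ac)
    have v: "QI.vunit P2 ((w^2) ^ l * 13 ^ k)" by (intro m p vu)
    have "QI.cng P2 4 ((w^2) ^ l * 13 ^ k) 1"
      by (rule QI.cng_1_mult[OF P p[OF p[OF vu(2)]] p[OF vu(3)] QI.cng_1_power[OF P p[OF vu(2)]] QI.cng_1_power[OF P vu(3) cngs(2)]])
        (rule QI.cng_mono[OF P cngs(5)], simp)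
    then have "\<not> QI.cng P2 5 (w * ((w^2) ^ l * 13 ^ k)) 1" by (intro QI.level_exact[OF P vu(2) AKs(3) v]) simp_all
    then show False using h2 e by simp
  qed
  show "even k"
  proof (rule ccontr)
    assume "odd k"
    then obtain l where l: "k = 2 * l + 1" by (blast elim: oddE)
    obtain n where n: "j = 2 * n" using ej by blast
    have e: "w ^ j * 13 ^ k = 13 * ((w^2) ^ n * 169 ^ l)" 
    proof -
      have "(13::complex) ^ 2 = 169" by simp
      then show ?thesis unfolding l n by (simp only: power_add power_mult power_one_right) (simp only: mult_ac)
    qed
    have v: "QI.vunit P2 ((w^2) ^ n * 169 ^ l)" by (intro m p vu)
    have "QI.cng P2 5 ((w^2) ^ n * 169 ^ l) 1"
      by (rule QI.cng_1_mult[OF P p[OF p[OF vu(2)]] p[OF vu(5)] QI.cng_1_power[OF P p[OF vu(2)] cngs(5)] QI.cng_1_power[OF P vu(5) cngs(3)]])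
    then have "\<not> QI.cng P2 5 (13 * ((w^2) ^ n * 169 ^ l)) 1" by (intro QI.level_exact[OF P vu(3) AKs(4) v]) simp_all
    then show False using h2 e by simp
  qed
qed

text \<open>The sign of \<open>w\<close> is set to 1 as the normal form demands, while those of
  \<open>u\<close> and 13 stay free. All relations at level 5 have even exponents, so any choice of
  signs respects them.\<close>

lemma two_adic_gauss:
  assumes s: "s = 1 \<or> s = (-1::complex)" "t = 1 \<or> t = (-1::complex)"
  shows "\<exists>L. QI.local_sgn P2 5 L \<and> L (QI.emb P2 u) = s \<and>
    L (QI.emb P2 w) = 1 \<and> L (QI.emb P2 13) = t"
proof -
  have rel: "s ^ i * 1 ^ j * t ^ k = 1" if h: "QI.cng P2 5 (u ^ i * w ^ j * 13 ^ k) 1" for i j k :: nat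
    using rels[OF h] s by auto
  show ?thesis by (rule QI.local_sign[OF P2_place _ vu(1-3) s(1) disjI1[OF refl] s(2) gens rel]) simp_all
qed

text \<open>Since \<open>(1 + x/2)^2 = 1 + x + x^2/4\<close>, units close to 1 are squares up to closer units.\<close>

lemma ltriv_two: assumes q: "QI.qchar \<psi>" shows "QI.ltriv \<psi> P2 5"
proof -
  note P = P2_place
  have step: "QI.ltriv \<psi> P2 n" if n: "n \<ge> 5" and l: "QI.ltriv \<psi> P2 (Suc n)" for n
    unfolding QI.ltriv_def
  proof (intro allI impI)
    fix a assume a: "QI.vunit P2 a" "QI.cng P2 n a 1"
    have aF: "a \<in> QI" by (rule QI.vunit_F[OF P a(1)])
    \<comment> \<open>As 2 has level 2, \<open>y\<close> has level at least \<open>n - 2\<close>,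
      and \<open>a\<close> differs from \<open>(1 + y)^2\<close> by \<open>y^2\<close>, of level at
      least \<open>2 * n - 4\<close>. This bound exceeds \<open>n\<close> exactly from
      \<open>n = 5\<close> on.\<close>
    define y where "y = (a - 1) / 2"
    have yF: "y \<in> QI" using aF QI.F_diff QI.F_divide by (simp add: y_def)
    have "a - 1 = y * 2" by (simp add: y_def)
    then have "AK2 (a - 1) = AK2 y * AK2 2" using QI.aA_mult[OF P yF, of 2] by simp
    then have y: "AK2 y \<le> 4 / 2 ^ n" using a(2) AK2_2 by (simp add: QI.cng_def)
    have p5: "(2::real) ^ 5 \<le> 2 ^ n" using n by (intro power_increasing) auto
    then have "(4::real) / 2 ^ n \<le> 4 / 2 ^ 5" by (intro divide_left_mono) auto
    also have "\<dots> \<le> 1 / 2" by simp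
    finally have y8: "AK2 y \<le> 1/2" using y by (rule order_trans[rotated])
    have bF: "1 + y \<in> QI" using yF QI.F_add by simp
    have vb: "QI.vunit P2 (1 + y)" by (rule vunit_near[OF bF]) (use y8 in \<open>simp add: QI.cng_def\<close>)
    have e: "a - (1 + y)^2 = - (y * y)" by (simp add: y_def power2_eq_square field_simps)
    have "AK2 (a - (1 + y)^2) = AK2 y * AK2 y" unfolding e using QI.A_minus[OF QI.vP[OF P] QI.F_mult[OF yF yF]] QI.aA_mult[OF P yF yF] by simp
    also have "\<dots> \<le> (4 / 2 ^ n) * (4 / 2 ^ n)" using y QI.aA_nonneg[OF P] by (intro mult_mono) auto
    also have "\<dots> \<le> (4 / 2 ^ n) * (4 / 2 ^ 5)" using p5 by (intro mult_left_mono divide_left_mono) auto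
    also have "\<dots> = 1 / 2 ^ Suc n" by simp
    finally have "QI.cng P2 (Suc n) a ((1 + y)^2)" by (simp add: QI.cng_def)
    then have "QI.lam \<psi> P2 a = QI.lam \<psi> P2 ((1 + y)^2)"
      by (rule QI.lam_cng[OF q P l a(1) QI.vunit_power[OF P vb]])
    also have "\<dots> = 1" using QI.lam_power[OF q P vb, of 2] QI.lam_sign[OF q P vb] by auto
    finally show "QI.lam \<psi> P2 a = 1" .
  qed
  obtain n where n: "n > 0" "QI.ltriv \<psi> P2 n" using QI.ltriv_ex[OF q P] by blast
  have "QI.ltriv \<psi> P2 (5 + k) \<Longrightarrow> QI.ltriv \<psi> P2 5" for k
  proof (induction k)
    case (Suc k) then show ?case using step[of "5 + k"] by simp
  qed simp
  moreover have "QI.ltriv \<psi> P2 (5 + n)" by (rule QI.ltriv_mono[OF n(2) P]) simp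
  ultimately show ?thesis by blast
qed

lemma lam_two: assumes q: "QI.qchar \<psi>" and w1: "QI.lam \<psi> P2 w = 1" and a: "QI.vunit P2 a"
  and h: "QI.cng P2 5 (a * (u ^ i * w ^ j * 13 ^ k)) 1"
  shows "QI.lam \<psi> P2 a = QI.lam \<psi> P2 u ^ i * QI.lam \<psi> P2 13 ^ k"
proof -
  note P = P2_place and m = QI.vunit_mult[OF P2_place] and p = QI.vunit_power[OF P2_place]
  have v: "QI.vunit P2 (u ^ i * w ^ j * 13 ^ k)" by (intro m p vu)
  have "QI.lam \<psi> P2 (a * (u ^ i * w ^ j * 13 ^ k)) = 1" using ltriv_two[OF q] m[OF a v] h unfolding QI.ltriv_def by blast
  then have "QI.lam \<psi> P2 a * QI.lam \<psi> P2 (u ^ i * w ^ j * 13 ^ k) = 1" using QI.lam_mult[OF q P a v] by simp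
  then have "QI.lam \<psi> P2 a = QI.lam \<psi> P2 (u ^ i * w ^ j * 13 ^ k)" using QI.lam_sign[OF q P a] QI.lam_sign[OF q P v] by auto
  also have "\<dots> = QI.lam \<psi> P2 u ^ i * QI.lam \<psi> P2 w ^ j * QI.lam \<psi> P2 13 ^ k"
    using QI.lam_mult[OF q P m[OF p[OF vu(1)] p[OF vu(2)]] p[OF vu(3)]] QI.lam_mult[OF q P p[OF vu(1)] p[OF vu(2)]]
      QI.lam_power[OF q P vu(1)] QI.lam_power[OF q P vu(2)] QI.lam_power[OF q P vu(3)] by simp
  finally show ?thesis using w1 by simp
qed

text \<open>The exponent is one more than the deepest level of a generator with sign -1. Level 2
  belongs to \<open>-1 = u^2\<close> and level 3 to \<open>w\<close>, both of sign 1; what remains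
  is level 1 for \<open>u\<close> and level 4 for 13. This is the origin of the values 2 and
  5.\<close>

lemma two_cases: assumes q: "QI.qchar \<psi>" and w1: "QI.lam \<psi> P2 w = 1"
  shows "QI.lam \<psi> P2 u = 1 \<Longrightarrow> QI.lam \<psi> P2 13 = 1 \<Longrightarrow> P2 \<notin> QI.Ram \<psi>"
    "QI.lam \<psi> P2 u = -1 \<Longrightarrow> QI.lam \<psi> P2 13 = 1 \<Longrightarrow> QI.cexpo \<psi> P2 = 2"
    "QI.lam \<psi> P2 13 = -1 \<Longrightarrow> QI.cexpo \<psi> P2 = 5"
proof -
  note P = P2_place and m = QI.vunit_mult[OF P2_place] and p = QI.vunit_power[OF P2_place]
  { assume "QI.lam \<psi> P2 u = 1" "QI.lam \<psi> P2 13 = 1"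
    then have "QI.lam \<psi> P2 a = 1" if a: "QI.vunit P2 a" for a
      using gens[OF a] lam_two[OF q w1 a] by auto
    then show "P2 \<notin> QI.Ram \<psi>" by (auto simp: QI.Ram_def) }
  { assume l: "QI.lam \<psi> P2 u = -1" "QI.lam \<psi> P2 13 = 1"
    show "QI.cexpo \<psi> P2 = 2"
    proof (rule QI.cexpI[OF q P])
      show "QI.ltriv \<psi> P2 2" unfolding QI.ltriv_def
      proof (intro allI impI)
        fix a assume a: "QI.vunit P2 a" "QI.cng P2 2 a 1"
        obtain i j k where h: "QI.cng P2 5 (a * (u ^ i * w ^ j * 13 ^ k)) 1" using gens[OF a(1)] by blast
        let ?m = "u ^ i * w ^ j * 13 ^ k"
        have v: "QI.vunit P2 ?m" by (intro m p vu)
        \<comment> \<open>\<open>a\<close> is 1 at level 2 and \<open>a * ?m\<close> is 1 at level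
          5, so \<open>?m\<close> is 1 at level 2, where \<open>u_even\<close> applies.\<close>
        have "QI.cng P2 2 (a * ?m) (1 * ?m)"
          by (rule QI.cng_vmult[OF P a(1) QI.vunit_1[OF P] v v a(2) QI.cng_refl[OF P]])
        then have "QI.cng P2 2 ?m (a * ?m)" using QI.cng_sym[OF P] QI.vunit_F[OF P v] QI.vunit_F[OF P m[OF a(1) v]] by simp
        moreover have "QI.cng P2 2 (a * ?m) 1" by (rule QI.cng_mono[OF P h]) simp
        ultimately have "QI.cng P2 2 ?m 1"
          using QI.cng_trans[OF P QI.vunit_F[OF P v] QI.vunit_F[OF P m[OF a(1) v]] QI.F_simps(2)] by blast
        then have "even i" by (rule u_even)
        then show "QI.lam \<psi> P2 a = 1" using lam_two[OF q w1 a(1) h] l by simp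
      qed
      have "QI.cng P2 1 u 1" using AK2_u by (simp add: QI.cng_def)
      then have "\<not> QI.ltriv \<psi> P2 1" using vu(1) l(1) unfolding QI.ltriv_def by force
      then show "2 = 1 \<or> \<not> QI.ltriv \<psi> P2 (2 - 1)" by simp
    qed simp }
  { assume l: "QI.lam \<psi> P2 13 = -1"
    show "QI.cexpo \<psi> P2 = 5"
    proof (rule QI.cexpI[OF q P _ ltriv_two[OF q]])
      have "\<not> QI.ltriv \<psi> P2 4" using vu(3) cngs(2) l unfolding QI.ltriv_def by force
      then show "5 = 1 \<or> \<not> QI.ltriv \<psi> P2 (5 - 1)" by simp
    qed simp }
qed

lemma gauss_units: assumes "e \<in> ZI" "QI.nrm e = 1" shows "\<exists>k. e = u ^ k"
proof -
  obtain a b where ab: "e = of_int a + of_int b * \<i>" using assms(1) by (rule gauss_intsE)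
  have s: "a^2 + b^2 = 1" using nrm_sum_squares[OF ab assms(2)] by simp
  have "\<bar>a\<bar> \<le> 1"
  proof (rule ccontr)
    assume "\<not> \<bar>a\<bar> \<le> 1"
    then have "2^2 \<le> \<bar>a\<bar>^2" by (intro power_mono) auto
    then show False using s zero_le_power2[of b] by (simp del: zero_le_power2)
  qed
  moreover have "\<bar>b\<bar> \<le> 1"
  proof (rule ccontr)
    assume "\<not> \<bar>b\<bar> \<le> 1"
    then have "2^2 \<le> \<bar>b\<bar>^2" by (intro power_mono) auto
    then show False using s zero_le_power2[of a] by (simp del: zero_le_power2)
  qed
  ultimately have "a \<in> {-1,0,1}" "b \<in> {-1,0,1}" by auto
  then have "e = 1 \<or> e = -1 \<or> e = \<i> \<or> e = -\<i>" using s ab by auto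
  then have "e = 1 \<or> e = -1 \<or> e = u \<or> e = - u" using u_cases by auto
  moreover have "u ^ 0 = 1" "u ^ 2 = -1" "u ^ 1 = u" "u ^ 3 = - u" using u2 by (simp_all add: power3_eq_cube power2_eq_square)
  ultimately show ?thesis by (elim disjE) (metis+)
qed

end

text \<open>If \<open>n ^ 4\<close> were -1 modulo \<open>p = 8 t + 5\<close>, then
  \<open>n ^ (p - 1) = (n ^ 4) ^ (2 t + 1)\<close> would be -1, against Fermat: there are no
  primitive eighth roots of unity modulo \<open>p\<close>.\<close>

lemma quartic_nonroot: assumes p: "prime p" "p mod 8 = 5" shows "\<not> int p dvd n ^ 4 + 1"
proof
  assume d: "int p dvd n ^ 4 + 1"
  define m where "m = nat \<bar>n\<bar>"
  have n4: "n ^ 4 = int (m ^ 4)" by (simp add: m_def)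
  have c: "[n ^ 4 = -1] (mod int p)" using d by (simp add: cong_iff_dvd_diff)
  have "\<not> p dvd m"
  proof
    assume "p dvd m"
    then have "p dvd m ^ 4" by (simp add: dvd_power_iff dvd_trans numeral_eq_Suc)
    then have "int p dvd n ^ 4" unfolding n4 by (rule of_nat_dvd_iff[THEN iffD2])
    then have "int p dvd (n ^ 4 + 1) - n ^ 4" using d by (rule dvd_diff[rotated])
    then show False using p(1) by (simp add: prime_nat_iff)
  qed
  then have "[m ^ (p - 1) = 1] (mod p)" by (rule fermat_theorem[OF p(1)])
  then have f: "[int (m ^ (p - 1)) = int 1] (mod int p)" by (simp only: cong_int_iff)
  define t where "t = p div 8"
  have pt: "p = 8 * t + 5" using p(2) by (simp add: t_def) presburger
  have "p - 1 = 4 * (2 * t + 1)" using pt by simp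
  then have "int (m ^ (p - 1)) = (n ^ 4) ^ (2 * t + 1)" by (simp only: power_mult n4 of_nat_power)
  also have "[\<dots> = (-1) ^ (2 * t + 1)] (mod int p)" by (rule cong_pow[OF c])
  finally have "[int (m ^ (p - 1)) = -1] (mod int p)" by simp
  then have "[int 1 = -1] (mod int p)" using f by (meson cong_sym cong_trans)
  then have "int p dvd 2" by (simp add: cong_iff_dvd_diff)
  then have "int p \<le> 2" by (rule zdvd_imp_le) simp
  then show False using pt by simp
qed

text \<open>Euler's criterion: for \<open>p = 8 t + 1\<close> the power
  \<open>n ^ ((p - 1) div 2) = (n ^ 2) ^ (2 t)\<close> is 1 modulo \<open>p\<close>, so a square
  root of -1 is itself a square.\<close>

lemma root_of_minus_one_square: assumes p: "prime p" "p mod 8 = 1" and d: "int p dvd n ^ 2 + 1"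
  shows "\<exists>y. int p dvd n - y ^ 2"
proof -
  define t where "t = p div 8"
  have pt: "p = 8 * t + 1" using p(2) by (simp add: t_def) presburger
  have p2: "2 < p" using pt p(1) by (cases t) auto
  have c: "[n ^ 2 = -1] (mod int p)" using d by (simp add: cong_iff_dvd_diff)
  have "(p - 1) div 2 = 2 * (2 * t)" using pt by simp
  then have "n ^ ((p - 1) div 2) = (n ^ 2) ^ (2 * t)" by (simp only: power_mult)
  also have "[\<dots> = (-1) ^ (2 * t)] (mod int p)" by (rule cong_pow[OF c])
  finally have "[n ^ ((p - 1) div 2) = 1] (mod int p)" by simp
  then have l: "[Legendre n (int p) = 1] (mod int p)" using euler_criterion[OF p(1) p2, of n] by (rule cong_trans[rotated])
  have "QuadRes (int p) n"
  proof (rule ccontr)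
    assume "\<not> QuadRes (int p) n"
    then have "Legendre n (int p) \<in> {0, -1}" by (auto simp: Legendre_def)
    then have "int p dvd 1 \<or> int p dvd 2" using l by (auto simp: cong_iff_dvd_diff)
    then have "int p \<le> 2" by (auto dest: zdvd_imp_le)
    then show False using p2 by simp
  qed
  then obtain y where "[y ^ 2 = n] (mod int p)" by (auto simp: QuadRes_def)
  then have "int p dvd n - y ^ 2" by (simp add: cong_iff_dvd_diff dvd_diff_commute)
  then show ?thesis ..
qed

context fourth_root
begin

lemma u_place: "P \<in> PK \<Longrightarrow> QI.vunit P u" "P \<in> PK \<Longrightarrow> u \<notin> P"
proof -
  assume P: "P \<in> PK"
  show n: "u \<notin> P"
  proof
    assume "u \<in> P"
    then have "(- u) * u \<in> P" using QI.place_mult[OF P, of "- u" u] u_int QI.O_uminus by blast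
    then show False using u2 QI.placeD(3)[OF P] by (simp add: power2_eq_square)
  qed
  then show "QI.vunit P u" using QI.vunit_O[OF P u_int] by blast
qed

text \<open>\<open>u\<close> is a square modulo a split prime \<open>p\<close> iff there are eighth roots of unity modulo \<open>p\<close>.\<close>

lemma split_sign:
  assumes p: "prime p" "P \<in> places_above p" and c: "cnj ` P \<noteq> P"
    and sg: "\<And>a. QI.vunit P a \<Longrightarrow> s a = 1 \<or> s a = (-1::complex)"
    and mu: "\<And>a b. QI.vunit P a \<Longrightarrow> QI.vunit P b \<Longrightarrow> s (a * b) = s a * s b"
    and cg: "\<And>a b. QI.vunit P a \<Longrightarrow> QI.vunit P b \<Longrightarrow> QI.cng P 1 a b \<Longrightarrow> s a = s b"
    and nt: "\<exists>a. QI.vunit P a \<and> s a \<noteq> 1"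
  shows "s u = (if p mod 8 = 5 then -1 else 1)"
proof -
  have P: "P \<in> PK" using p(2) by (simp add: places_above_iff)
  note np = nonreal_place[OF p(2,1) c]
  have s1: "s 1 = 1" using mu[of 1 1] sg[of 1] QI.vunit_1[OF P] by auto
  have pw: "s (a ^ k) = s a ^ k" if a: "QI.vunit P a" for a k
    by (induction k) (use s1 mu[OF a QI.vunit_power[OF P a]] in auto)
  obtain g where g: "g \<in> ZI" "g \<notin> P" "\<And>a. QI.vunit P a \<Longrightarrow> \<exists>k. QI.cng P 1 a (g ^ k)"
    "\<And>m. QI.cng P 1 (g ^ m) 1 \<Longrightarrow> even m" using QI.odd_generator[OF P np(3)] by metis
  have vg: "QI.vunit P g" using QI.vunit_O[OF P g(1)] g(2) by simp
  have sgk: "s a = s g ^ k" if "QI.vunit P a" "QI.cng P 1 a (g ^ k)" for a k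
    using cg[OF that(1) QI.vunit_power[OF P vg] that(2)] pw[OF vg] by simp
  have s_g: "s g = -1"
  proof (rule ccontr)
    assume "s g \<noteq> -1"
    then have "s g = 1" using sg[OF vg] by blast
    then have "s a = 1" if "QI.vunit P a" for a using g(3)[OF that] sgk[OF that] by auto
    then show False using nt by blast
  qed
  note vu = u_place(1)[OF P]
  obtain k where k: "QI.cng P 1 u (g ^ k)" using g(3)[OF vu] by blast
  show ?thesis
  proof (cases "p mod 8 = 5")
    case True
    have "s u \<noteq> 1"
    proof
      assume "s u = 1"
      then have "even k" using sgk[OF vu k] s_g by (cases "even k") auto
      then obtain l where l: "k = 2 * l" by blast
      \<comment> \<open>If \<open>u\<close> is congruent to the square of \<open>g ^ l\<close>,
        replace \<open>g ^ l\<close> by a rational integer \<open>n\<close>; then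
        \<open>n ^ 4\<close> is congruent to \<open>u ^ 2 = -1\<close>.\<close>
      obtain n where n: "g ^ l - of_int n \<in> P" using np(5)[OF QI.O_power[OF g(1)]] by blast
      have gl: "g ^ l \<in> ZI" by (rule QI.O_power[OF g(1)])
      have "u - g ^ k \<in> P" using k QI.cng_O1[OF P u_int QI.O_power[OF g(1)]] by simp
      then have "(u + g ^ k) * (u - g ^ k) \<in> P" by (intro QI.place_mult[OF P] QI.O_add u_int QI.O_power g)
      moreover have "(u + g ^ k) * (u - g ^ k) = -1 - (g ^ l) ^ 4"
      proof -
        have "g ^ k = (g ^ l) ^ 2" unfolding l by (simp only: power_mult[symmetric] mult.commute)
        moreover have "(x + h^2) * (x - h^2) = x^2 - h^4" for x h :: complex
          by (simp add: power2_eq_square power4_eq_xxxx algebra_simps)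
        ultimately show ?thesis using u2 by simp
      qed
      ultimately have 1: "-1 - (g ^ l) ^ 4 \<in> P" by simp
      have "((g ^ l) ^ 3 + (g ^ l) ^ 2 * of_int n + g ^ l * of_int n ^ 2 + of_int n ^ 3) * (g ^ l - of_int n) \<in> P"
        by (intro QI.place_mult[OF P] n QI.O_add QI.O_mult QI.O_power gl QI.O_int)
      moreover have "((g ^ l) ^ 3 + (g ^ l) ^ 2 * of_int n + g ^ l * of_int n ^ 2 + of_int n ^ 3) * (g ^ l - of_int n) = (g ^ l) ^ 4 - of_int n ^ 4"
        by (simp add: power4_eq_xxxx power3_eq_cube power2_eq_square algebra_simps)
      ultimately have "(g ^ l) ^ 4 - of_int n ^ 4 \<in> P" by simp
      then have "- ((-1 - (g ^ l) ^ 4) + ((g ^ l) ^ 4 - of_int n ^ 4)) \<in> P"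
        using 1 by (intro QI.place_minus[OF P] QI.place_add[OF P])
      then have "of_int (n ^ 4 + 1) \<in> P" by (simp add: add.commute)
      then have "int p dvd n ^ 4 + 1" using above_int[OF p(2,1)] by blast
      then show False using quartic_nonroot[OF p(1) True] by blast
    qed
    then show ?thesis using sg[OF vu] True by auto
  next
    case False
    then have p8: "p mod 8 = 1" using np(4) by presburger
    \<comment> \<open>A rational integer congruent to \<open>u\<close> is a square root of -1 modulo
      \<open>p\<close>, hence itself a square, so the sign of \<open>u\<close> is the square of a
      sign.\<close>
    obtain n where n: "u - of_int n \<in> P" using np(5)[OF u_int] by blast
    have "(- (u + of_int n)) * (u - of_int n) \<in> P" by (intro QI.place_mult[OF P] n QI.O_uminus QI.O_add u_int QI.O_int)
    moreover have "(- (u + of_int n)) * (u - of_int n) = of_int (n ^ 2 + 1)" using u2 by (simp add: power2_eq_square algebra_simps)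
    ultimately have "int p dvd n ^ 2 + 1" using above_int[OF p(2,1)] by metis
    then obtain y where y: "int p dvd n - y ^ 2" using root_of_minus_one_square[OF p(1) p8] by blast
    then have "of_int (n - y ^ 2) \<in> P" using above_int[OF p(2,1)] by blast
    then have "(u - of_int n) + of_int (n - y ^ 2) \<in> P" using n by (intro QI.place_add[OF P])
    then have uy: "u - (of_int y) ^ 2 \<in> P" by simp
    have "of_int y \<notin> P"
    proof
      assume "of_int y \<in> P"
      then have "of_int y * of_int y \<in> P" by (intro QI.place_mult[OF P QI.O_int])
      then have "(u - (of_int y) ^ 2) + of_int y * of_int y \<in> P" using uy by (intro QI.place_add[OF P])
      then show False using u_place(2)[OF P] by (simp add: power2_eq_square)
    qed
    then have vy: "QI.vunit P (of_int y)" using QI.vunit_O[OF P QI.O_int] by blast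
    have "QI.cng P 1 u (of_int y ^ 2)" using uy QI.cng_O1[OF P u_int QI.O_power[OF QI.O_int]] by blast
    then have "s u = s (of_int y) ^ 2" using cg[OF vu QI.vunit_power[OF P vy]] pw[OF vy] by simp
    then show ?thesis using sg[OF vy] False by auto
  qed
qed

end

section \<open>Ramification of base changes\<close>

lemma below_int: "P \<in> places_above p \<Longrightarrow> prime p \<Longrightarrow> of_int m \<in> P \<inter> \<rat> \<longleftrightarrow> int p dvd m"
  using above_int[of P p m] by simp

text \<open>If \<open>n\<close> is the least positive nonresidue then \<open>n - 1 = y^2\<close> modulo \<open>p\<close>, so that \<open>n\<close> is
  congruent to the norm of \<open>y + i\<close>.\<close>

lemma ram_real:
  assumes P: "P \<in> PK" "cnj ` P = P" "2 \<notin> P" and q: "rat.qchar \<nu>" and r: "P \<inter> \<rat> \<in> rat.Ram \<nu>"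
  shows "P \<in> QI.Ram (\<nu> \<circ> idele_norm)"
proof -
  define p0 where "p0 = P \<inter> \<rat>"
  have p0: "p0 \<in> PQ" "2 \<notin> p0" using below_place[OF P(1)] P(3) by (auto simp: p0_def)
  obtain p where p: "prime p" "P \<in> places_above p" using above_ex[OF P(1)] by blast
  have bi: "of_int m \<in> p0 \<longleftrightarrow> int p dvd m" for m unfolding p0_def by (rule below_int[OF p(2,1)])
  have vi: "rat.vunit p0 (of_int m) \<longleftrightarrow> \<not> int p dvd m" for m using rat.vunit_O[OF p0(1), of "of_int m"] bi by simp
  have lt: "rat.ltriv \<nu> p0 1" by (rule rat.ltriv_odd[OF q p0])
  define l where "l m = rat.lam \<nu> p0 (of_int m)" for m :: int
  have lc: "l a = l b" if "\<not> int p dvd a" "int p dvd a - b" for a b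
  proof -
    have "\<not> int p dvd b" using that by (metis dvd_diffD1 diff_add_cancel dvd_add)
    moreover have "rat.cng p0 1 (of_int a) (of_int b)" using rat.cng_O1[OF p0(1), of "of_int a" "of_int b"] bi[of "a - b"] that(2) by simp
    ultimately show ?thesis unfolding l_def using rat.lam_cng[OF q p0(1) lt] vi that(1) by blast
  qed
  obtain g0 where g0: "g0 \<in> \<int>" "g0 \<notin> p0" "\<And>a. rat.vunit p0 a \<Longrightarrow> \<exists>k. rat.cng p0 1 a (g0 ^ k)" using rat.odd_generator[OF p0] by metis
  obtain g where g: "g0 = of_int g" using g0(1) by (auto elim: Ints_cases)
  have vg: "rat.vunit p0 g0" using rat.vunit_O[OF p0(1) g0(1)] g0(2) by simp
  have gk: "rat.lam \<nu> p0 a = l g ^ k" if "rat.vunit p0 a" "rat.cng p0 1 a (g0 ^ k)" for a k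
    using rat.lam_cng[OF q p0(1) lt that(1) rat.vunit_power[OF p0(1) vg] that(2)] rat.lam_power[OF q p0(1) vg] g by (simp add: l_def)
  have lg: "l g = -1"
  proof (rule ccontr)
    assume "l g \<noteq> -1"
    then have "l g = 1" using rat.lam_sign[OF q p0(1) vg] g by (simp add: l_def)
    then have "rat.lam \<nu> p0 a = 1" if "rat.vunit p0 a" for a using g0(3)[OF that] gk[OF that] by auto
    then show False using r by (auto simp: rat.Ram_def p0_def)
  qed
  \<comment> \<open>The quadratic nonresidues: \<open>l\<close> is the Legendre symbol modulo
    \<open>p\<close> on integers prime to \<open>p\<close>, since \<open>\<nu>\<close> has level 1
    at the odd place \<open>p0\<close> and is ramified there.\<close>
  define bad where "bad n \<longleftrightarrow> \<not> int p dvd int n \<and> l (int n) = -1" for n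
  have "bad (nat (g mod int p))"
  proof -
    have pp: "int p > 0" using p(1) prime_gt_0_nat by simp
    have e: "int (nat (g mod int p)) = g mod int p" using pp by simp
    have ng: "\<not> int p dvd g" using vg vi g by simp
    have "int p dvd g - g mod int p" by (simp add: minus_mod_eq_mult_div)
    then have "l (g mod int p) = -1" using lc[OF ng, of "g mod int p"] lg by metis
    moreover have "\<not> int p dvd g mod int p" using ng by (simp add: dvd_mod_iff)
    ultimately show ?thesis unfolding bad_def e by simp
  qed
  then have nb: "bad (LEAST n. bad n)" by (rule LeastI)
  define n where "n = (LEAST n. bad n)"
  have n: "\<not> int p dvd int n" "l (int n) = -1" using nb by (auto simp: n_def bad_def)
  have l1: "l 1 = 1" using rat.lam_1[OF q p0(1)] by (simp add: l_def)
  have n0: "n > 0" using n(1) by (cases n) auto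
  have nm: "int (n - 1) = int n - 1" using n0 by simp
  \<comment> \<open>If \<open>n\<close> were 1 modulo \<open>p\<close>, its sign would be
    \<open>l 1 = 1\<close>. So \<open>n - 1\<close> is prime to \<open>p\<close> and, by minimality
    of \<open>n\<close>, a residue.\<close>
  have m1: "\<not> int p dvd int n - 1" using lc[OF n(1), of 1] n(2) l1 by auto
  have "\<not> bad (n - 1)" unfolding n_def by (rule not_less_Least) (use n0 n_def in simp)
  then have "l (int n - 1) \<noteq> -1" using m1 unfolding bad_def nm by simp
  moreover have vm: "rat.vunit p0 (of_int (int n - 1))" using vi m1 by blast
  ultimately have lm: "l (int n - 1) = 1" using rat.lam_sign[OF q p0(1) vm] by (auto simp: l_def)
  obtain k where k: "rat.cng p0 1 (of_int (int n - 1)) (g0 ^ k)" using g0(3)[OF vm] by blast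
  have "(-1) ^ k = (1::complex)" using gk[OF vm k] lm lg by (simp add: l_def)
  then have "even k" by (cases "even k") auto
  then obtain j where j: "k = 2 * j" by blast
  define y where "y = g ^ j"
  have "g0 ^ k = of_int (y ^ 2)" by (simp add: g j y_def power_mult[symmetric] mult.commute)
  then have "of_int (int n - 1) - of_int (y ^ 2) \<in> p0" using k rat.cng_O1[OF p0(1), of "of_int (int n - 1)" "of_int (y ^ 2)"] by simp
  then have "of_int (int n - 1 - y ^ 2) \<in> p0" by simp
  then have "int p dvd int n - 1 - y ^ 2" using bi by blast
  then have d: "int p dvd int n - (y ^ 2 + 1)" by (simp add: algebra_simps)
  have ly: "l (y ^ 2 + 1) = -1" using lc[OF n(1) d] n(2) by simp
  define x where "x = of_int y + of_int 1 * \<i>"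
  have xO: "x \<in> ZI" "cnj x \<in> ZI" unfolding x_def using QI.O_cnj by blast+
  have xx: "x * cnj x = of_int (y ^ 2 + 1)" by (simp add: x_def algebra_simps power2_eq_square)
  have "x \<notin> P"
  proof
    assume "x \<in> P"
    then have "cnj x * x \<in> P" by (rule QI.place_mult[OF P(1) xO(2)])
    then have "of_int (y ^ 2 + 1) \<in> P" using xx by (simp add: mult.commute)
    then have "int p dvd y ^ 2 + 1" using above_int[OF p(2,1)] by blast
    then have "int p dvd int n" using d by (metis dvd_diffD1 diff_add_cancel dvd_add)
    then show False using n(1) by blast
  qed
  then have vx: "QI.vunit P x" using QI.vunit_O[OF P(1) xO(1)] by blast
  have "QI.lam (\<nu> \<circ> idele_norm) P x = rat.lam \<nu> (P \<inter> \<rat>) (x * cnj x)"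
    by (rule lam_base_change_real[OF P(1,2) QI.vunit_F[OF P(1) vx] QI.vunit_nz[OF P(1) vx]])
  also have "\<dots> = -1" using ly unfolding xx by (simp add: l_def p0_def)
  finally show ?thesis using vx P(1) unfolding QI.Ram_def by (auto intro!: exI[of _ x])
qed

text \<open>On rational units the base change at such a place coincides with the character below, so
  a rational witness of ramification survives.\<close>

lemma ram_nonreal:
  assumes P: "P \<in> PK" "cnj ` P \<noteq> P" and r: "P \<inter> \<rat> \<in> rat.Ram \<nu>"
  shows "P \<in> QI.Ram (\<nu> \<circ> idele_norm)"
proof -
  obtain a where a: "rat.vunit (P \<inter> \<rat>) a" "rat.lam \<nu> (P \<inter> \<rat>) a \<noteq> 1" using r by (auto simp: rat.Ram_def)
  have aQ: "a \<in> \<rat>" "a \<noteq> 0" using rat.vunit_F[OF below_place[OF P(1)] a(1)] rat.vunit_nz[OF below_place[OF P(1)] a(1)] by auto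
  have "fp P \<in> VK" using P(1) by simp
  from abs_below[OF this] obtain e where "\<forall>x\<in>\<rat>. QI.av P x = absv \<rat> (place_below (fp P)) x ^ e" by blast
  then have "QI.vunit P a" using a(1) aQ(1) Q_sub_K by (simp add: QI.vunit_def rat.vunit_def)
  then show ?thesis using lam_base_change_nonreal[OF P aQ, of \<nu>] a(2) P(1) unfolding QI.Ram_def by auto
qed

lemma split_choice_iff: assumes S: "split_choice S" and P: "P \<in> PK" "cnj ` P \<noteq> P"
  shows "P \<in> S \<longleftrightarrow> cnj ` P \<notin> S"
proof -
  obtain p where p: "prime p" "P \<in> places_above p" using above_ex[OF P(1)] by blast
  have "split_prime p" by (rule nonreal_place(1)[OF p(2,1) P(2)])
  then have "\<exists>!Q. Q \<in> S \<and> Q \<in> places_above p" using S unfolding split_choice_def by blast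
  moreover have "places_above p = {P, cnj ` P}" by (rule places_above_eq[OF p(2,1)])
  ultimately have ex: "\<exists>!Q. Q \<in> S \<and> Q \<in> {P, cnj ` P}" by simp
  have "A \<in> S \<longleftrightarrow> B \<notin> S" if "\<exists>!Q. Q \<in> S \<and> Q \<in> {A, B}" "B \<noteq> A" for A B :: "complex set" using that by blast
  from this[OF ex P(2)] show ?thesis .
qed

section \<open>Normal form of the conditions\<close>

context fourth_root
begin

text \<open>At odd places the exponent is always 1, so (A) and (C) only restrict which places
  ramify. In (D'), exponent 2 gives \<open>w\<close> the sign 1 because \<open>w\<close> has level
  3, and exponent 5 demands it. Conversely, once \<open>w\<close> has sign 1, a ramified
  \<open>P2\<close> has exponent 2 or 5 by \<open>two_cases\<close>, and exponent 2 forces the sign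
  -1 at \<open>u\<close>.\<close>

lemma conds_iff:
  assumes S: "split_choice S" and q: "QI.qchar \<phi>"
  shows "char_conditions S u \<phi> \<longleftrightarrow> (\<forall>P\<in>QI.Ram \<phi>. 2 \<notin> P \<longrightarrow> cnj ` P \<noteq> P \<and> P \<in> S) \<and> QI.lam \<phi> P2 w = 1"
    (is "?L \<longleftrightarrow> ?H1 \<and> ?H2")
proof -
  let ?f = "conductor QI \<phi>"
  have dv: "divides_cond P ?f \<longleftrightarrow> P \<in> QI.Ram \<phi>" if "P \<in> places_above p" for P p
    using QI.cond_dvd[OF q, of P] that by (simp add: places_above_iff)
  have ord: "cond_mult P ?f = QI.cexpo \<phi> P" if "P \<in> QI.Ram \<phi>" for P
    using QI.cond_ord[OF q that] .
  have RP: "P \<in> PK" if "P \<in> QI.Ram \<phi>" for P using that by (simp add: QI.Ram_def)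
  have D: "condD_char u \<phi> \<longleftrightarrow> (P2 \<in> QI.Ram \<phi> \<longrightarrow> (QI.cexpo \<phi> P2 = 2 \<longrightarrow> QI.lam \<phi> P2 u = -1) \<and>
      (QI.cexpo \<phi> P2 = 5 \<longrightarrow> QI.lam \<phi> P2 w = 1))"
    using dv[OF P2_above] ord[of P2] unfolding condD_char_def above_2 by (auto simp: QI.lam_def w_def)
  have DI: "condD_ideal ?f \<longleftrightarrow> (P2 \<in> QI.Ram \<phi> \<longrightarrow> QI.cexpo \<phi> P2 \<in> {2, 5})"
    using dv[OF P2_above] ord[of P2] unfolding condD_ideal_def above_2 by auto
  show ?thesis
  proof
    assume L: ?L
    have ?H1
    proof (intro ballI impI)
      fix P assume P: "P \<in> QI.Ram \<phi>" "2 \<notin> P"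
      obtain p where p: "prime p" "P \<in> places_above p" using above_ex[OF RP[OF P(1)]] by blast
      have d: "divides_cond P ?f" using dv[OF p(2)] P(1) by simp
      have "cnj ` P \<noteq> P"
      proof
        assume c: "cnj ` P = P"
        have "condA ?f" using L unfolding char_conditions_def ideal_conditions_def by blast
        then show False using real_place(2,3)[OF p(2,1) c P(2)] p(2) d unfolding condA_def by blast
      qed
      moreover from this have "P \<in> S" using L d p(2) nonreal_place(1)[OF p(2,1)]
        unfolding char_conditions_def ideal_conditions_def condC_def by blast
      ultimately show "cnj ` P \<noteq> P \<and> P \<in> S" ..
    qed
    moreover have ?H2
    proof (cases "P2 \<in> QI.Ram \<phi>")
      case False then show ?thesis using vu(2) P2_place by (auto simp: QI.Ram_def)
    next
      case True
      have "condD_ideal ?f" "condD_char u \<phi>" using L unfolding char_conditions_def ideal_conditions_def by auto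
      then have "QI.cexpo \<phi> P2 = 2 \<or> QI.cexpo \<phi> P2 = 5 \<and> QI.lam \<phi> P2 w = 1"
        using D DI True by blast
      then show ?thesis
      proof
        assume "QI.cexpo \<phi> P2 = 2"
        then have "QI.ltriv \<phi> P2 2" using QI.cexp_pos(2)[OF q P2_place] by simp
        moreover have "QI.cng P2 2 w 1" by (rule QI.cng_mono[OF P2_place cngs(1)]) simp
        ultimately show ?thesis using vu(2) unfolding QI.ltriv_def by blast
      qed simp
    qed
    ultimately show "?H1 \<and> ?H2" ..
  next
    assume H: "?H1 \<and> ?H2"
    have u1: "QI.lam \<phi> P2 u = 1 \<or> QI.lam \<phi> P2 u = -1" by (rule QI.lam_sign[OF q P2_place vu(1)])
    have t1: "QI.lam \<phi> P2 13 = 1 \<or> QI.lam \<phi> P2 13 = -1" by (rule QI.lam_sign[OF q P2_place vu(3)])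
    note tc = two_cases[OF q conjunct2[OF H]]
    have nr: "cnj ` P \<noteq> P" "P \<in> S" if "P \<in> QI.Ram \<phi>" "2 \<notin> P" for P using H that by auto
    have "condA ?f" unfolding condA_def
    proof (intro allI impI ballI notI)
      fix p P assume p: "odd p \<and> inert_prime p" and P: "P \<in> places_above p" and d: "divides_cond P ?f"
      have pp: "prime p" using p by (simp add: inert_prime_def)
      have "of_int 2 \<notin> P" using above_int[OF P pp, of 2] p pp by (metis even_of_nat dvd_antisym dvd_refl of_nat_numeral of_nat_dvd_iff primes_dvd_imp_eq two_is_prime_nat)
      then show False using nr(1)[of P] inert_place(1)[OF _ P] p dv[OF P] d by simp
    qed
    moreover have "condB ?f"
    proof -
      have e: "{P. divides_cond P ?f \<and> (\<exists>p. ramified_prime p \<and> p mod 4 = 3 \<and> P \<in> places_above p)} = {}" using ramified_mod4 by blast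
      show ?thesis unfolding condB_def Let_def e by simp
    qed
    moreover have "condC S ?f" unfolding condC_def
    proof (intro allI impI ballI)
      fix p P assume p: "split_prime p" and P: "P \<in> places_above p" and d: "divides_cond P ?f"
      have pp: "prime p" using p by (simp add: split_prime_def)
      have R: "P \<in> QI.Ram \<phi>" using dv[OF P] d by simp
      have n2: "2 \<notin> P" by (rule nonreal_place(3)[OF P pp split_place[OF p P]])
      have "QI.cexpo \<phi> P = 1" by (rule QI.cexpI[OF q RP[OF R] _ QI.ltriv_odd[OF q RP[OF R] n2]]) simp_all
      then show "P \<in> S \<and> (odd p \<longrightarrow> cond_mult P ?f = 1) \<and> (p = 2 \<longrightarrow> cond_mult P ?f \<in> {2, 3})"
        using nr(2)[OF R n2] ord[OF R] p not_split_2 by auto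
    qed
    moreover have K: "P2 \<notin> QI.Ram \<phi> \<or> QI.lam \<phi> P2 u = -1 \<and> QI.cexpo \<phi> P2 = 2 \<or> QI.cexpo \<phi> P2 = 5"
      using u1
    proof
      assume a: "QI.lam \<phi> P2 u = 1"
      from t1 show ?thesis
      proof
        assume "QI.lam \<phi> P2 13 = 1" from tc(1)[OF a this] show ?thesis ..
      next
        assume "QI.lam \<phi> P2 13 = -1" from tc(3)[OF this] show ?thesis by simp
      qed
    next
      assume a: "QI.lam \<phi> P2 u = -1"
      from t1 show ?thesis
      proof
        assume "QI.lam \<phi> P2 13 = 1" from tc(2)[OF a this] show ?thesis using a by simp
      next
        assume "QI.lam \<phi> P2 13 = -1" from tc(3)[OF this] show ?thesis by simp
      qed
    qed
    moreover have "condD_ideal ?f" unfolding DI using K by auto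
    moreover have "condD_char u \<phi>" unfolding D
    proof (intro impI conjI)
      assume "QI.cexpo \<phi> P2 = 2" "P2 \<in> QI.Ram \<phi>"
      then show "QI.lam \<phi> P2 u = -1" using K by simp
    qed (rule conjunct2[OF H])
    ultimately show ?L unfolding char_conditions_def ideal_conditions_def by (intro conjI)
  qed
qed

end

context euclid_field
begin

lemma lam_idele: "P \<in> FP \<Longrightarrow> vunit P a \<Longrightarrow> lid P (emb P a) \<in> carrier IG"
  using lu_embed[of P a] vunit_F[of P a] local_units_sub[of P] by (intro local_idele_closed) auto

lemma trivial_unram: "char_eq F \<psi> trivial_char \<Longrightarrow> Ram \<psi> = {}"
  using lam_idele by (auto simp: Ram_def lam_def local_char_def char_eq_def trivial_char_def)

lemma unram_conductor: "qchar \<psi> \<Longrightarrow> Ram \<psi> = {} \<Longrightarrow> conductor F \<psi> = carrier RR"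
  using conductor_cgen(1)[of \<psi>] by (simp add: cgen_def)

end

section \<open>Conjugate characters and counts of places\<close>

lemma char_conj_qchar: assumes q: "QI.qchar \<psi>" shows "QI.qchar (char_conj \<psi>)"
proof -
  obtain T n where T: "finite T" "T \<subseteq> PK" "n > 0" "\<forall>x\<in>QI.box T n. \<psi> x = 1"
    using gauss_full[OF q] unfolding QI.full_def by blast
  \<comment> \<open>The component of the conjugate idele at \<open>P\<close> comes from the
    conjugate place, so the congruences are imposed at both.\<close>
  let ?T = "T \<union> (\<lambda>P. cnj ` P) ` T"
  show ?thesis
  proof (rule QI.qcharI[of _ ?T n])
    show "QI.sign_hom (char_conj \<psi>)" unfolding QI.sign_hom_def char_conj_def comp_def
    proof (intro conjI ballI)
      fix x assume x: "x \<in> carrier IK"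
      show "\<psi> (idele_conj x) = 1 \<or> \<psi> (idele_conj x) = -1" by (rule QI.qchar_sign[OF q idele_conj_closed[OF x]])
      fix y assume y: "y \<in> carrier IK"
      show "\<psi> (idele_conj (x \<otimes>\<^bsub>IK\<^esub> y)) = \<psi> (idele_conj x) * \<psi> (idele_conj y)"
        unfolding idele_conj_mult[OF x y] by (rule QI.qchar_mult[OF q idele_conj_closed[OF x] idele_conj_closed[OF y]])
    qed
    show "finite ?T" "n > 0" using T by auto
    fix x assume x: "x \<in> QI.box ?T n"
    then have xI: "x \<in> carrier IK" by (simp add: QI.box_def)
    have "idele_conj x \<in> QI.box T n" unfolding QI.box_def
    proof (intro CollectI conjI ballI)
      show "idele_conj x \<in> carrier IK" by (rule idele_conj_closed[OF xI])
      fix P assume P: "P \<in> PK"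
      have cP: "cnj ` P \<in> PK" by (rule cnj_place[OF P])
      have m: "x (fp (cnj ` P)) \<in> (if cnj ` P \<in> ?T then QI.HU (cnj ` P) n else QI.LU (cnj ` P))"
        using x cP unfolding QI.box_def by blast
      show "idele_conj x (fp P) \<in> (if P \<in> T then QI.HU P n else QI.LU P)"
      proof (cases "P \<in> T")
        case True
        then have "x (fp (cnj ` P)) \<in> QI.HU (cnj ` P) n" using m by simp
        then show ?thesis using conj_hu[OF xI P] True by simp
      next
        case False
        have "x (fp (cnj ` P)) \<in> QI.LU (cnj ` P)"
          using m QI.hu_lu[OF cP T(3)] by (auto split: if_splits)
        then show ?thesis using idele_conj_lu[OF xI P] False by simp
      qed
    qed
    then show "char_conj \<psi> x = 1" using T(4) by (simp add: char_conj_def)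
  next
    fix a assume a: "a \<in> QI" "a \<noteq> 0"
    then have "cnj a \<in> QI" "cnj a \<noteq> 0" using QI.F_cnj by auto
    then show "char_conj \<psi> (principal_idele QI a) = 1"
      unfolding char_conj_def comp_def idele_conj_principal[OF a(1)] by (rule QI.qchar_principal[OF q])
  qed
qed

lemma lam_conj:
  assumes inv: "\<forall>x\<in>carrier IK. \<psi> (idele_conj x) = \<psi> x" and P: "P \<in> PK" and a: "QI.vunit P a"
  shows "QI.vunit (cnj ` P) (cnj a)" "QI.lam \<psi> (cnj ` P) (cnj a) = QI.lam \<psi> P a"
proof -
  have aF: "a \<in> QI" by (rule QI.vunit_F[OF P a])
  have v: "fp P \<in> VK" "fp (cnj ` P) \<in> VK" using P cnj_place by auto
  have "QI.av (cnj ` P) (cnj a) = QI.av P a"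
    using abs_cnj[OF v(2) aF] by simp
  then show "QI.vunit (cnj ` P) (cnj a)" using a QI.F_cnj[OF aF] by (simp add: QI.vunit_def)
  show "QI.lam \<psi> (cnj ` P) (cnj a) = QI.lam \<psi> P a"
    using bspec[OF inv QI.lam_idele[OF P a]] idele_conj_local[OF v(1) aF] by (simp add: QI.lam_def local_char_def)
qed

lemma count_sign: "finite R \<Longrightarrow> (\<Prod>P\<in>R. if Q P then -1 else (1::complex)) = (-1) ^ card {P\<in>R. Q P}"
  by (simp add: prod.If_cases Int_def)

definition five :: "complex set \<Rightarrow> bool" where
  "five P \<longleftrightarrow> (\<exists>p. prime p \<and> p mod 8 = 5 \<and> P \<in> places_above p)"

lemma five_iff: "prime p \<Longrightarrow> P \<in> places_above p \<Longrightarrow> five P \<longleftrightarrow> p mod 8 = 5"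
  using above_unique by (auto simp: five_def)

lemma not_five_2: "\<not> five P2" using five_iff[OF two_is_prime_nat P2_above] by simp

lemma r_count_eq: assumes "\<And>P. P \<in> PK \<Longrightarrow> divides_cond P f \<longleftrightarrow> P \<in> R" "R \<subseteq> PK"
  shows "r_count f = card {P \<in> R. five P}"
proof -
  have "{P. divides_cond P f \<and> (\<exists>p. prime p \<and> p mod 8 = 5 \<and> P \<in> places_above p)} = {P \<in> R. five P}"
    using assms by (auto simp: five_def places_above_iff)
  then show ?thesis by (simp add: r_count_def)
qed

section \<open>Statements on base change, and necessity of the parity condition\<close>

context fourth_root
begin

lemma lam_split_u:
  assumes q: "QI.qchar \<phi>" and R: "P \<in> QI.Ram \<phi>" "2 \<notin> P" "cnj ` P \<noteq> P"
  shows "QI.lam \<phi> P u = (if five P then -1 else 1)"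
proof -
  have P: "P \<in> PK" using R(1) by (simp add: QI.Ram_def)
  obtain p where p: "prime p" "P \<in> places_above p" using above_ex[OF P] by blast
  have "QI.lam \<phi> P u = (if p mod 8 = 5 then -1 else 1)"
  proof (rule split_sign[OF p R(3) QI.lam_sign[OF q P] QI.lam_mult[OF q P] QI.lam_cng[OF q P QI.ltriv_odd[OF q P R(2)]]])
    show "\<exists>a. QI.vunit P a \<and> QI.lam \<phi> P a \<noteq> 1" using R(1) by (simp add: QI.Ram_def)
  qed
  then show ?thesis using five_iff[OF p] by simp
qed

text \<open>Each odd ramified place contributes the sign of \<open>u\<close> computed in
  \<open>split_sign\<close>, which is -1 exactly at the places singled out by
  \<open>five\<close>.\<close>

lemma product_u:
  assumes q: "QI.qchar \<phi>" and H: "\<forall>P\<in>QI.Ram \<phi>. 2 \<notin> P \<longrightarrow> cnj ` P \<noteq> P"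
  shows "(if P2 \<in> QI.Ram \<phi> then QI.lam \<phi> P2 u else 1) * (-1) ^ card {P \<in> QI.Ram \<phi>. five P} = 1"
proof -
  let ?R = "QI.Ram \<phi>"
  note fin = QI.finite_Ram[OF q]
  have "QI.nrm u = 1"
  proof -
    have "(cmod u)^2 = 1" using u_cases by auto
    then show ?thesis using QI.nrm[OF u_int] by simp
  qed
  then have 1: "(\<Prod>P\<in>?R. QI.lam \<phi> P u) = 1" by (rule QI.product_formula[OF q gauss_full[OF q] u_int])
  have odd: "2 \<notin> P" if "P \<in> ?R - {P2}" for P using that P2_unique[of P] by (auto simp: QI.Ram_def)
  have "(\<Prod>P\<in>?R - {P2}. QI.lam \<phi> P u) = (\<Prod>P\<in>?R - {P2}. if five P then -1 else 1)"
    by (rule prod.cong[OF refl lam_split_u[OF q _ odd]]) (use odd H in auto)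
  also have "\<dots> = (-1) ^ card {P \<in> ?R - {P2}. five P}" by (rule count_sign) (use fin in simp)
  also have "{P \<in> ?R - {P2}. five P} = {P \<in> ?R. five P}" using not_five_2 by auto
  finally have 2: "(\<Prod>P\<in>?R - {P2}. QI.lam \<phi> P u) = (-1) ^ card {P \<in> ?R. five P}" .
  show ?thesis
  proof (cases "P2 \<in> ?R")
    case True then show ?thesis using 1 2 prod.remove[OF fin True, of "\<lambda>P. QI.lam \<phi> P u"] by simp
  next
    case False then show ?thesis using 1 2 by simp
  qed
qed

text \<open>Invariance makes ramification symmetric under conjugation, while \<open>S\<close> holds
  only one of two conjugate places. With at most \<open>P2\<close> left, the product formula gives
  \<open>u\<close> the sign 1 there. Invariance gives \<open>cnj w\<close> the sign of
  \<open>w\<close>, so \<open>13 = w * cnj w\<close> has sign 1 as well.\<close>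

lemma conj_invariant_unram:
  assumes S: "split_choice S" and q: "QI.qchar \<phi>"
    and H: "\<forall>P\<in>QI.Ram \<phi>. 2 \<notin> P \<longrightarrow> cnj ` P \<noteq> P \<and> P \<in> S" "QI.lam \<phi> P2 w = 1"
    and inv: "\<forall>x\<in>carrier IK. \<phi> (idele_conj x) = \<phi> x"
  shows "QI.Ram \<phi> = {}"
proof -
  have odd: "2 \<in> P" if R: "P \<in> QI.Ram \<phi>" for P
  proof (rule ccontr)
    assume n: "2 \<notin> P"
    have P: "P \<in> PK" using R by (simp add: QI.Ram_def)
    have PS: "cnj ` P \<noteq> P" "P \<in> S" using H(1) R n by auto
    obtain a where a: "QI.vunit P a" "QI.lam \<phi> P a \<noteq> 1" using R by (auto simp: QI.Ram_def)
    have "cnj ` P \<in> QI.Ram \<phi>" using lam_conj[OF inv P a(1)] a(2) cnj_place[OF P] unfolding QI.Ram_def by auto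
    moreover have "2 \<notin> cnj ` P" using n by (simp add: cnj_image_iff)
    ultimately have "cnj ` P \<in> S" using H(1) by blast
    then show False using split_choice_iff[OF S P PS(1)] PS(2) by blast
  qed
  have sub: "QI.Ram \<phi> \<subseteq> {P2}" using odd P2_unique by (auto simp: QI.Ram_def)
  have nf: "{P \<in> QI.Ram \<phi>. five P} = {}" using sub not_five_2 by auto
  have u1: "P2 \<in> QI.Ram \<phi> \<Longrightarrow> QI.lam \<phi> P2 u = 1" using product_u[OF q] odd unfolding nf by auto
  have "QI.vunit P2 (cnj w)" "QI.lam \<phi> P2 (cnj w) = 1"
    using lam_conj[OF inv P2_place vu(2)] H(2) by (simp_all add: cnj_P2)
  then have "QI.lam \<phi> P2 13 = 1" using QI.lam_mult[OF q P2_place vu(2), of "cnj w"] H(2) w_cnj by simp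
  then have "P2 \<notin> QI.Ram \<phi>" using two_cases(1)[OF q H(2)] u1 by blast
  then show ?thesis using sub by blast
qed

lemma base_change_representative:
  assumes S: "split_choice S" and q: "QI.qchar \<psi>"
  shows "\<exists>\<mu>. from_base_change \<mu> \<and> QI.qchar (char_mult \<psi> \<mu>) \<and> char_conditions S u (char_mult \<psi> \<mu>)"
proof -
  \<comment> \<open>The odd ramified places at which the normal form fails; they are to be removed
    by base change.\<close>
  define B where "B = {P \<in> QI.Ram \<psi>. 2 \<notin> P \<and> (cnj ` P = P \<or> P \<notin> S)}"
  define A where "A = (\<lambda>P. P \<inter> \<rat>) ` B"
  define s where "s = QI.lam \<psi> P2 w"
  have BP: "P \<in> PK" "2 \<notin> P" if "P \<in> B" for P using that by (auto simp: B_def QI.Ram_def)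
  have "finite B" unfolding B_def using QI.finite_Ram[OF q] by (rule rev_finite_subset) blast
  then have A1: "finite A" by (simp add: A_def)
  have A2: "A \<subseteq> PQ" unfolding A_def
  proof (rule image_subsetI)
    fix P assume "P \<in> B" then show "P \<inter> \<rat> \<in> PQ" by (rule below_place[OF BP(1)])
  qed
  have A3: "2 \<notin> p" if p: "p \<in> A" for p
  proof -
    obtain P where P: "P \<in> B" "p = P \<inter> \<rat>" using p unfolding A_def by (rule imageE) 
    show ?thesis using BP(2)[OF P(1)] unfolding P(2) by simp
  qed
  note A = A1 A2 A3
  have s: "s = 1 \<or> s = -1" unfolding s_def by (rule QI.lam_sign[OF q P2_place vu(2)])
  from nu_exists[OF A s] obtain \<nu> where \<nu>: "rat.qchar \<nu>" "rat.full \<nu>" "\<forall>p\<in>A. p \<in> rat.Ram \<nu>"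
    "\<forall>p\<in>PQ - insert p2 A. \<forall>X\<in>rat.LU p. rat.lc \<nu> p X = 1" "rat.lam \<nu> p2 13 = s" by blast
  define \<mu> where "\<mu> = \<nu> \<circ> idele_norm"
  have \<mu>: "QI.qchar \<mu>" "QI.full \<mu>" "from_base_change \<mu>" unfolding \<mu>_def by (rule base_change_qchar[OF \<nu>(1,2)])+
  let ?\<phi> = "char_mult \<psi> \<mu>"
  have q\<phi>: "QI.qchar ?\<phi>" by (rule QI.qchar_char_mult(1)[OF q \<mu>(1) gauss_full[OF q] \<mu>(2)])
  \<comment> \<open>The norm of \<open>w\<close> is 13, where \<open>\<nu>\<close> was given the
    sign of \<open>\<psi>\<close> at \<open>w\<close>; so the product has sign 1 at
    \<open>w\<close>.\<close>
  have "QI.lam \<mu> P2 w = rat.lam \<nu> (P2 \<inter> \<rat>) (w * cnj w)" unfolding \<mu>_def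
    by (rule lam_base_change_real[OF P2_place cnj_P2 u_K(2) QI.vunit_nz[OF P2_place vu(2)]])
  also have "\<dots> = s" using \<nu>(5) by (simp add: w_cnj p2_def)
  finally have H2: "QI.lam ?\<phi> P2 w = 1" using s by (auto simp: QI.lam_char_mult s_def[symmetric])
  have H1: "cnj ` P \<noteq> P \<and> P \<in> S" if R: "P \<in> QI.Ram ?\<phi>" "2 \<notin> P" for P
  proof (rule ccontr)
    assume n: "\<not> (cnj ` P \<noteq> P \<and> P \<in> S)"
    have P: "P \<in> PK" using R(1) by (simp add: QI.Ram_def)
    obtain a where a: "QI.vunit P a" "QI.lam \<psi> P a * QI.lam \<mu> P a \<noteq> 1"
      using R(1) by (auto simp: QI.Ram_def QI.lam_char_mult)
    show False
    proof (cases "P \<in> QI.Ram \<psi>")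
      case True
      \<comment> \<open>At a place of \<open>B\<close> the base change ramifies too, and both
        characters carry the only nontrivial sign character there, so the product is
        unramified.\<close>
      then have "P \<in> B" using R(2) n by (auto simp: B_def)
      then have "P \<inter> \<rat> \<in> rat.Ram \<nu>" using \<nu>(3) by (auto simp: A_def)
      then have "P \<in> QI.Ram \<mu>" unfolding \<mu>_def
        using ram_real[OF P _ R(2) \<nu>(1)] ram_nonreal[OF P] by blast
      then have "QI.lam \<psi> P a = QI.lam \<mu> P a" by (rule QI.odd_unique[OF q \<mu>(1) P R(2) True _ a(1)])
      then show False using a(2) QI.lam_sq[OF \<mu>(1) P a(1)] by simp
    next
      case False
      then have l\<psi>: "QI.lam \<psi> P a = 1" using a(1) P by (auto simp: QI.Ram_def)
      \<comment> \<open>Ramification brought in by the base change sits at the conjugate of a place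
        \<open>Q\<close> of \<open>B\<close> that is not self-conjugate, hence outside
        \<open>S\<close>; that conjugate then belongs to \<open>S\<close>.\<close>
      have "P \<inter> \<rat> \<in> A"
      proof (rule ccontr)
        assume nA: "P \<inter> \<rat> \<notin> A"
        have "P \<inter> \<rat> \<noteq> p2" using R(2) two_p2 by blast
        then have "rat.lc \<nu> (P \<inter> \<rat>) X = 1" if "X \<in> rat.LU (P \<inter> \<rat>)" for X
          using \<nu>(4) nA below_place[OF P] that by blast
        then have "P \<notin> QI.Ram \<mu>" unfolding \<mu>_def by (rule base_change_unram[OF P])
        then show False using a l\<psi> P by (auto simp: QI.Ram_def)
      qed
      then obtain Q where Q: "Q \<in> B" "P \<inter> \<rat> = Q \<inter> \<rat>" by (auto simp: A_def)
      have QR: "Q \<in> QI.Ram \<psi>" using Q(1) by (simp add: B_def)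
      have "P = Q \<or> P = cnj ` Q" using below_eq[OF BP(1)[OF Q(1)] P Q(2)[symmetric]] by blast
      then have PQ: "P = cnj ` Q" "cnj ` Q \<noteq> Q" using False QR by auto
      then have "Q \<notin> S" using Q(1) by (auto simp: B_def)
      then have "P \<in> S" using split_choice_iff[OF S BP(1)[OF Q(1)] PQ(2)] PQ(1) by blast
      moreover have "cnj ` P \<noteq> P" using PQ by auto
      ultimately show False using n by blast
    qed
  qed
  have "char_conditions S u ?\<phi>" using conds_iff[OF S q\<phi>] H1 H2 by blast
  then show ?thesis using \<mu>(3) q\<phi> by blast
qed

text \<open>As \<open>\<psi>\<close> is its own inverse, \<open>\<delta>\<close> is the conjugate
  character times \<open>\<psi>\<close>. It is nontrivial because an invariant character in normal
  form is unramified, so that its conductor would be the whole ring.\<close>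

lemma not_base_change:
  assumes S: "split_choice S" and q: "QI.qchar \<psi>" and c: "conductor QI \<psi> \<noteq> carrier ZK" and cc: "char_conditions S u \<psi>"
  shows "\<not> from_base_change \<psi>" "\<exists>\<delta>. quadratic_char QI \<delta> \<and> char_eq QI (char_conj \<psi>) (char_mult \<psi> \<delta>)"
proof -
  have H: "\<forall>P\<in>QI.Ram \<psi>. 2 \<notin> P \<longrightarrow> cnj ` P \<noteq> P \<and> P \<in> S" "QI.lam \<psi> P2 w = 1" using conds_iff[OF S q] cc by auto
  have ninv: "\<not> (\<forall>x\<in>carrier IK. \<psi> (idele_conj x) = \<psi> x)"
  proof
    assume "\<forall>x\<in>carrier IK. \<psi> (idele_conj x) = \<psi> x"
    from conj_invariant_unram[OF S q H this] show False using QI.unram_conductor[OF q] c by simp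
  qed
  show "\<not> from_base_change \<psi>"
  proof
    assume "from_base_change \<psi>"
    from base_change_conj[OF this] show False using ninv by simp
  qed
  let ?d = "char_mult (char_conj \<psi>) \<psi>"
  have qd: "QI.qchar ?d"
    by (rule QI.qchar_char_mult(1)[OF char_conj_qchar[OF q] q gauss_full[OF char_conj_qchar[OF q]] gauss_full[OF q]])
  have sq: "\<psi> x * \<psi> x = 1" if "x \<in> carrier IK" for x by (rule QI.qchar_sq[OF q that])
  have "\<not> char_eq QI ?d trivial_char"
  proof
    assume d: "char_eq QI ?d trivial_char"
    have "\<psi> (idele_conj x) = \<psi> x" if x: "x \<in> carrier IK" for x
    proof -
      have "\<psi> (idele_conj x) * \<psi> x = 1" using d x by (simp add: char_eq_def char_mult_def char_conj_def trivial_char_def)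
      then have "\<psi> (idele_conj x) * (\<psi> x * \<psi> x) = \<psi> x" by (simp only: mult.assoc[symmetric] mult_1)
      then show ?thesis using sq[OF x] by simp
    qed
    then show False using ninv by simp
  qed
  moreover have "char_eq QI (char_conj \<psi>) (char_mult \<psi> ?d)" unfolding char_eq_def
  proof
    fix x assume x: "x \<in> carrier IK"
    have "char_mult \<psi> ?d x = char_conj \<psi> x * (\<psi> x * \<psi> x)" by (simp add: char_mult_def mult_ac)
    then show "char_conj \<psi> x = char_mult \<psi> ?d x" using sq[OF x] by simp
  qed
  ultimately show "\<exists>\<delta>. quadratic_char QI \<delta> \<and> char_eq QI (char_conj \<psi>) (char_mult \<psi> \<delta>)"
    using qd QI.quadratic_qchar by blast
qed

text \<open>The product of the two characters equals \<open>\<mu>\<close> and is therefore invariant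
  under conjugation. It inherits the normal form, so it is unramified and trivial.\<close>

lemma representative_unique:
  assumes S: "split_choice S" and q: "QI.qchar \<psi>1" "QI.qchar \<psi>2"
    and c: "char_conditions S u \<psi>1" "char_conditions S u \<psi>2" and \<mu>: "from_base_change \<mu>" "char_eq QI \<psi>1 (char_mult \<psi>2 \<mu>)"
  shows "char_eq QI \<psi>1 \<psi>2"
proof -
  let ?\<phi> = "char_mult \<psi>1 \<psi>2"
  have q\<phi>: "QI.qchar ?\<phi>" by (rule QI.qchar_char_mult(1)[OF q gauss_full[OF q(1)] gauss_full[OF q(2)]])
  note H = conds_iff[OF S q(1), THEN iffD1, OF c(1)] conds_iff[OF S q(2), THEN iffD1, OF c(2)]
  have e: "?\<phi> x = \<mu> x" if x: "x \<in> carrier IK" for x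
  proof -
    have "\<psi>1 x * \<psi>2 x = \<mu> x * (\<psi>2 x * \<psi>2 x)" using \<mu>(2) x by (simp add: char_eq_def char_mult_def mult_ac)
    then show ?thesis using QI.qchar_sq[OF q(2) x] by (simp add: char_mult_def)
  qed
  have "QI.Ram ?\<phi> = {}"
  proof (rule conj_invariant_unram[OF S q\<phi>])
    have "P \<in> QI.Ram \<psi>1 \<or> P \<in> QI.Ram \<psi>2" if "P \<in> QI.Ram ?\<phi>" for P
      using that by (fastforce simp: QI.Ram_def QI.lam_char_mult)
    then have R: "QI.Ram ?\<phi> \<subseteq> QI.Ram \<psi>1 \<union> QI.Ram \<psi>2" by (intro subsetI) simp
    have B: "\<forall>P\<in>QI.Ram \<psi>1 \<union> QI.Ram \<psi>2. 2 \<notin> P \<longrightarrow> cnj ` P \<noteq> P \<and> P \<in> S" unfolding ball_Un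
      by (rule conjI[OF conjunct1[OF H(1)] conjunct1[OF H(2)]])
    show "\<forall>P\<in>QI.Ram ?\<phi>. 2 \<notin> P \<longrightarrow> cnj ` P \<noteq> P \<and> P \<in> S"
      by (rule ballI, rule bspec[OF B], erule subsetD[OF R])
    show "QI.lam ?\<phi> P2 w = 1" using H by (simp add: QI.lam_char_mult)
    show "\<forall>x\<in>carrier IK. ?\<phi> (idele_conj x) = ?\<phi> x"
    proof
      fix x assume x: "x \<in> carrier IK"
      show "?\<phi> (idele_conj x) = ?\<phi> x" unfolding e[OF x] e[OF idele_conj_closed[OF x]] by (rule base_change_conj[OF \<mu>(1) x])
    qed
  qed
  then have 1: "?\<phi> x = 1" if "x \<in> carrier IK" for x by (rule QI.qchar_unram_trivial[OF q\<phi> gauss_full[OF q\<phi>] _ that])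
  show ?thesis unfolding char_eq_def
  proof
    fix x assume x: "x \<in> carrier IK"
    have "\<psi>1 x = (\<psi>1 x * \<psi>2 x) * \<psi>2 x" using QI.qchar_sq[OF q(2) x] by (simp add: mult.assoc)
    also have "\<psi>1 x * \<psi>2 x = 1" using 1[OF x] by (simp add: char_mult_def)
    finally show "\<psi>1 x = \<psi>2 x" by simp
  qed
qed

text \<open>If \<open>P2\<close> is unramified, or has exponent 2 and thus sign -1 at
  \<open>u\<close>, the product formula at \<open>u\<close> fixes the parity. Exponent 5 leaves the
  sign at \<open>u\<close> open and gives no condition.\<close>

lemma parity_necessary:
  assumes S: "split_choice S" and q: "QI.qchar \<psi>" and c: "char_conditions S u \<psi>" and f: "conductor QI \<psi> = f"
  shows "\<forall>P\<in>places_above 2. \<not> divides_cond P f \<Longrightarrow> even (r_count f)"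
    "\<exists>P\<in>places_above 2. divides_cond P f \<and> cond_mult P f = 2 \<Longrightarrow> odd (r_count f)"
proof -
  have H: "\<forall>P\<in>QI.Ram \<psi>. 2 \<notin> P \<longrightarrow> cnj ` P \<noteq> P" using conds_iff[OF S q] c by auto
  have dv: "divides_cond P f \<longleftrightarrow> P \<in> QI.Ram \<psi>" if "P \<in> PK" for P using QI.cond_dvd[OF q that] f by simp
  have r: "r_count f = card {P \<in> QI.Ram \<psi>. five P}" by (rule r_count_eq[OF dv]) (auto simp: QI.Ram_def)
  note pu = product_u[OF q H, folded r]
  { assume "\<forall>P\<in>places_above 2. \<not> divides_cond P f"
    then have "P2 \<notin> QI.Ram \<psi>" using dv[OF P2_place] P2_above by blast
    then show "even (r_count f)" using pu by (cases "even (r_count f)") auto }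
  { assume "\<exists>P\<in>places_above 2. divides_cond P f \<and> cond_mult P f = 2"
    then have d: "divides_cond P2 f" "cond_mult P2 f = 2" by (auto simp: above_2)
    moreover have "condD_char u \<psi>" using c by (simp add: char_conditions_def)
    ultimately have "QI.lam \<psi> P2 u = -1" using P2_above f by (simp add: condD_char_def QI.lam_def)
    then show "odd (r_count f)" using pu d(1) dv[OF P2_place] by (cases "even (r_count f)") auto }
qed

end

section \<open>Sufficiency of the parity condition\<close>

lemma odd_local_sign:
  assumes P: "P \<in> PK" "2 \<notin> P" "cnj ` P \<noteq> P" and u: "u ^ 2 = -1"
  shows "\<exists>L. QI.local_sgn P 1 L \<and> (\<exists>g. QI.vunit P g \<and> L (QI.emb P g) = -1) \<and>
    L (QI.emb P u) = (if five P then -1 else 1)"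
proof -
  interpret fourth_root u by unfold_locales (rule u)
  from QI.odd_sign[OF P(1,2)] obtain L where L: "QI.local_sgn P 1 L" "\<exists>g. QI.vunit P g \<and> L (QI.emb P g) = -1" by blast
  obtain p where p: "prime p" "P \<in> places_above p" using above_ex[OF P(1)] by blast
  have "L (QI.emb P u) = (if p mod 8 = 5 then -1 else 1)"
  proof (rule split_sign[OF p P(3) QI.local_sgn_embed(2,3,5)[OF P(1) L(1)]])
    show "\<exists>a. QI.vunit P a \<and> L (QI.emb P a) \<noteq> 1" using L(2) by force
  qed
  then have "L (QI.emb P u) = (if five P then -1 else 1)" using five_iff[OF p] by simp
  then show ?thesis using L by (intro exI[of _ L] conjI)
qed

lemma ideal_conditions_odd:
  assumes c: "ideal_conditions S f" and P: "P \<in> PK" "2 \<notin> P" and d: "divides_cond P f"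
  shows "cnj ` P \<noteq> P" "P \<in> S" "cond_mult P f = 1"
proof -
  obtain p where p: "prime p" "P \<in> places_above p" using above_ex[OF P(1)] by blast
  have "condA f" "condC S f" using c by (simp_all add: ideal_conditions_def)
  show n: "cnj ` P \<noteq> P"
  proof
    assume "cnj ` P = P"
    then show False using real_place(2,3)[OF p(2,1) _ P(2)] \<open>condA f\<close> p(2) d unfolding condA_def by blast
  qed
  show "P \<in> S" "cond_mult P f = 1"
    using \<open>condC S f\<close> nonreal_place(1,2)[OF p(2,1) n] p(2) d unfolding condC_def by blast+
qed

context fourth_root
begin

text \<open>The odd places dividing \<open>f\<close> receive the nontrivial sign, and
  \<open>P2\<close>, if it divides \<open>f\<close>, the signs of \<open>u\<close> and 13 that yield
  the required exponent. Global units are powers of \<open>u\<close>, so the only obstruction is the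
  product of the signs at \<open>u\<close>.\<close>

lemma parity_sufficient:
  assumes S: "split_choice S" and f: "ideal f ZK" "f \<noteq> {0}" "f \<noteq> carrier ZK" "ideal_conditions S f"
    and par: "\<forall>P\<in>places_above 2. \<not> divides_cond P f \<Longrightarrow> even (r_count f)"
    "\<exists>P\<in>places_above 2. divides_cond P f \<and> cond_mult P f = 2 \<Longrightarrow> odd (r_count f)"
  shows "\<exists>\<psi>. QI.qchar \<psi> \<and> conductor QI \<psi> = f \<and> char_conditions S u \<psi>"
proof -
  obtain a where a: "a \<in> ZI" "f = QI.pid a" using QI.ideal_principal[OF f(1)] by blast
  have a0: "a \<noteq> 0" using f(2) a(2) by auto
  define T where "T = {P \<in> PK. a \<in> P}"
  have T: "finite T" "T \<subseteq> PK" unfolding T_def by (rule QI.finite_val_O[OF a(1) a0]) blast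
  have TP: "P \<in> PK" if "P \<in> T" for P using that by (simp add: T_def)
  have dv: "divides_cond P f \<longleftrightarrow> P \<in> T" if "P \<in> PK" for P using QI.ideal_dvd_place[OF that a(1)] that a(2) by (simp add: T_def)
  have mlt: "cond_mult P f = nat (QI.val P a)" if "P \<in> PK" for P unfolding a(2) by (rule QI.ord_ideal_pid[OF that a(1) a0])
  define r where "r = card {P \<in> T. five P}"
  have r: "r_count f = r" unfolding r_def by (rule r_count_eq[OF dv T(2)])
  have odd: "2 \<notin> P" "P \<in> PK" if "P \<in> T - {P2}" for P using that P2_unique[of P] T(2) by auto
  note oc = ideal_conditions_odd[OF f(4)]
  have T1: "cnj ` P \<noteq> P" "P \<in> S" "QI.val P a = 1" if P: "P \<in> T - {P2}" for P
  proof -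
    have d: "divides_cond P f" using dv[OF odd(2)[OF P]] P by blast
    show "cnj ` P \<noteq> P" "P \<in> S" by (rule oc(1,2)[OF odd(2,1)[OF P] d])+
    show "QI.val P a = 1" using oc(3)[OF odd(2,1)[OF P] d] mlt[OF odd(2)[OF P]] by simp
  qed
  have T2: "QI.val P2 a = 2 \<or> QI.val P2 a = 5" if "P2 \<in> T"
  proof -
    have "cond_mult P2 f \<in> {2, 5}" using f(4) dv[OF P2_place] that P2_above by (simp add: ideal_conditions_def condD_ideal_def)
    then show ?thesis using mlt[OF P2_place] by auto
  qed
  have "\<forall>P\<in>T - {P2}. \<exists>L. QI.local_sgn P 1 L \<and> (\<exists>g. QI.vunit P g \<and> L (QI.emb P g) = -1) \<and>
    L (QI.emb P u) = (if five P then -1 else 1)"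
    by (intro ballI) (rule odd_local_sign[OF odd(2) odd(1) T1(1) u2])
  from bchoice[OF this] obtain LA where LA0: "\<forall>P\<in>T - {P2}. QI.local_sgn P 1 (LA P) \<and> (\<exists>g. QI.vunit P g \<and> LA P (QI.emb P g) = -1) \<and>
    LA P (QI.emb P u) = (if five P then -1 else 1)" ..
  note LA = bspec[OF LA0, THEN conjunct1] bspec[OF LA0, THEN conjunct2, THEN conjunct1] bspec[OF LA0, THEN conjunct2, THEN conjunct2]
  \<comment> \<open>For exponent 2 the sign at \<open>u\<close> has to be -1, and oddness of
    \<open>r\<close> balances it. For exponent 5 it is free and is chosen so as to balance the
    product.\<close>
  define s where "s = (if QI.val P2 a = 2 then -1 else (-1::complex) ^ r)"
  define t where "t = (if QI.val P2 a = 2 then 1 else (-1::complex))"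
  have st: "s = 1 \<or> s = -1" "t = 1 \<or> t = -1" by (cases "even r"; simp add: s_def t_def)+
  from two_adic_gauss[OF st] obtain L2
    where L2: "QI.local_sgn P2 5 L2" "L2 (QI.emb P2 u) = s" "L2 (QI.emb P2 w) = 1" "L2 (QI.emb P2 13) = t" by blast
  define L where "L P = (if P = P2 then L2 else LA P)" for P
  have sL: "QI.local_sgn P 5 (L P)" if P: "P \<in> T" for P
  proof (cases "P = P2")
    case False
    then have "QI.local_sgn P 1 (LA P)" using LA(1) P by simp
    then show ?thesis using QI.local_sgn_mono[OF _ TP[OF P], of 1 _ 5] False by (simp add: L_def)
  qed (use L2(1) in \<open>simp add: L_def\<close>)
  have Lu: "(\<Prod>P\<in>T. L P (QI.emb P u)) = 1"
  proof -
    have "(\<Prod>P\<in>T - {P2}. L P (QI.emb P u)) = (\<Prod>P\<in>T - {P2}. if five P then -1 else 1)"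
      by (rule prod.cong[OF refl]) (use LA(3) in \<open>simp add: L_def\<close>)
    also have "\<dots> = (-1) ^ card {P \<in> T - {P2}. five P}" by (rule count_sign) (use T in simp)
    also have "{P \<in> T - {P2}. five P} = {P \<in> T. five P}" using not_five_2 by auto
    finally have 1: "(\<Prod>P\<in>T - {P2}. L P (QI.emb P u)) = (-1) ^ r" by (simp add: r_def)
    show ?thesis
    proof (cases "P2 \<in> T")
      case True
      have "(\<Prod>P\<in>T. L P (QI.emb P u)) = s * (-1) ^ r" using prod.remove[OF T(1) True, of "\<lambda>P. L P (QI.emb P u)"] 1 L2(2) by (simp add: L_def)
      moreover have "odd r" if "QI.val P2 a = 2"
        using par(2) mlt[OF P2_place] dv[OF P2_place] True that P2_above unfolding r by auto
      ultimately show ?thesis by (cases "even r") (auto simp: s_def)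
    next
      case False
      then have "even r" using par(1) dv[OF P2_place] unfolding r above_2 by simp
      then show ?thesis using 1 False by simp
    qed
  qed
  have ex: "\<exists>\<psi>. QI.qchar \<psi> \<and> QI.full \<psi> \<and> (\<forall>P\<in>PK. \<forall>X\<in>QI.LU P. QI.lc \<psi> P X = (if P \<in> T then L P X else 1))"
  proof (rule QI.char_from_signs[OF T _ sL])
    show "(5::nat) > 0" by simp
    fix e assume "e \<in> ZI" "QI.nrm e = 1"
    then obtain k where e: "e = u ^ k" using gauss_units by blast
    have "L P (QI.emb P (u ^ k)) = L P (QI.emb P u) ^ k" if P: "P \<in> T" for P
      by (rule QI.local_sgn_embed(4)[OF TP[OF P] sL[OF P] u_place(1)[OF TP[OF P]]])
    then have "(\<Prod>P\<in>T. L P (QI.emb P e)) = (\<Prod>P\<in>T. L P (QI.emb P u) ^ k)" unfolding e by (rule prod.cong[OF refl])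
    also have "\<dots> = 1" using Lu by (simp add: prod_power_distrib[symmetric])
    finally show "(\<Prod>P\<in>T. L P (QI.emb P e)) = 1" .
  qed
  then obtain \<psi> where \<psi>: "QI.qchar \<psi>" "\<forall>P\<in>PK. \<forall>X\<in>QI.LU P. QI.lc \<psi> P X = (if P \<in> T then L P X else 1)" by blast
  have lam: "QI.lam \<psi> P x = (if P \<in> T then L P (QI.emb P x) else 1)" if P: "P \<in> PK" and x: "QI.vunit P x" for P x
    unfolding QI.lam_def using bspec[OF bspec[OF \<psi>(2) P], of "QI.emb P x"] QI.lu_embed[OF P QI.vunit_F[OF P x]] x by blast
  have RT: "QI.Ram \<psi> \<subseteq> T"
  proof
    fix P assume P: "P \<in> QI.Ram \<psi>"
    then have PK: "P \<in> PK" by (simp add: QI.Ram_def)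
    obtain x where x: "QI.vunit P x" "QI.lam \<psi> P x \<noteq> 1" using P by (auto simp: QI.Ram_def)
    show "P \<in> T" using lam[OF PK x(1)] x(2) by presburger
  qed
  have H2: "QI.lam \<psi> P2 w = 1" using lam[OF P2_place vu(2)] L2(3) by (simp add: L_def)
  have cx: "P \<in> QI.Ram \<psi> \<and> int (QI.cexpo \<psi> P) = QI.val P a" if P: "P \<in> T" for P
  proof (cases "P = P2")
    case True
    have 2: "P2 \<in> T" using P True by simp
    have us: "QI.lam \<psi> P2 u = s" "QI.lam \<psi> P2 13 = t"
      using lam[OF P2_place vu(1)] lam[OF P2_place vu(3)] 2 L2(2,4) by (simp_all add: L_def)
    from T2[OF 2] show ?thesis unfolding True
    proof
      assume v: "QI.val P2 a = 2"
      have l: "QI.lam \<psi> P2 u = -1" "QI.lam \<psi> P2 13 = 1" using us v by (simp_all add: s_def t_def)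
      have "P2 \<in> QI.Ram \<psi>" unfolding QI.Ram_def using P2_place vu(1) l(1) by force
      then show "P2 \<in> QI.Ram \<psi> \<and> int (QI.cexpo \<psi> P2) = QI.val P2 a"
        using two_cases(2)[OF \<psi>(1) H2 l] v by simp
    next
      assume v: "QI.val P2 a = 5"
      have l: "QI.lam \<psi> P2 13 = -1" using us v by (simp add: t_def)
      have "P2 \<in> QI.Ram \<psi>" unfolding QI.Ram_def using P2_place vu(3) l by force
      then show "P2 \<in> QI.Ram \<psi> \<and> int (QI.cexpo \<psi> P2) = QI.val P2 a"
        using two_cases(3)[OF \<psi>(1) H2 l] v by simp
    qed
  next
    case False
    then have PT: "P \<in> T - {P2}" using P by simp
    obtain g where g: "QI.vunit P g" "LA P (QI.emb P g) = -1" using LA(2)[OF PT] by blast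
    have "QI.lam \<psi> P g = -1" using lam[OF TP[OF P] g(1)] g(2) P False by (simp add: L_def)
    then have "P \<in> QI.Ram \<psi>" unfolding QI.Ram_def using TP[OF P] g(1) by force
    moreover have "QI.cexpo \<psi> P = 1"
      by (rule QI.cexpI[OF \<psi>(1) TP[OF P] _ QI.ltriv_odd[OF \<psi>(1) TP[OF P] odd(1)[OF PT]]]) simp_all
    ultimately show ?thesis using T1(3)[OF PT] by simp
  qed
  have "conductor QI \<psi> = QI.pid (QI.cgen \<psi>)" by (rule QI.conductor_cgen(1)[OF \<psi>(1)])
  also have "\<dots> = QI.pid a"
  proof (rule QI.pid_eq[OF QI.conductor_cgen(2,3)[OF \<psi>(1)] a(1) a0])
    fix P assume P: "P \<in> PK"
    show "QI.val P (QI.cgen \<psi>) = QI.val P a"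
    proof (cases "P \<in> T")
      case True then show ?thesis using QI.val_cgen[OF \<psi>(1) P] cx by simp
    next
      case False
      then have "QI.val P a = 0" using QI.val_O_nonneg[OF P a(1) a0] P by (simp add: T_def)
      then show ?thesis using QI.val_cgen[OF \<psi>(1) P] False RT by auto
    qed
  qed
  finally have c: "conductor QI \<psi> = f" using a(2) by simp
  have "cnj ` P \<noteq> P \<and> P \<in> S" if P: "P \<in> QI.Ram \<psi>" "2 \<notin> P" for P
  proof -
    have "P \<noteq> P2" using P(2) two_P2 by blast
    then have "P \<in> T - {P2}" using RT P(1) by blast
    then show ?thesis using T1(1,2) by blast
  qed
  then have "char_conditions S u \<psi>" using conds_iff[OF S \<psi>(1)] H2 by blast
  then show ?thesis using \<psi>(1) c by blast
qed

end

theorem theorem4p4: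
  fixes S :: "complex set set" and u :: complex
  assumes "split_choice S"
    and "u ^ 2 = -1"
  shows
    "(\<forall>\<psi>. quadratic_char gauss_field \<psi> \<longrightarrow>
        (\<exists>\<mu>. from_base_change \<mu> \<and>
           (quadratic_char gauss_field (char_mult \<psi> \<mu>) \<or>
            char_eq gauss_field (char_mult \<psi> \<mu>) trivial_char) \<and>
           char_conditions S u (char_mult \<psi> \<mu>)))
     \<and>
     (\<forall>\<psi>. quadratic_char gauss_field \<psi> \<and> conductor gauss_field \<psi> \<noteq> carrier ZK \<and>
           char_conditions S u \<psi> \<longrightarrow>
        \<not> from_base_change \<psi> \<and>
        (\<exists>\<delta>. quadratic_char gauss_field \<delta> \<and>
           char_eq gauss_field (char_conj \<psi>) (char_mult \<psi> \<delta>)))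
     \<and>
     (\<forall>\<psi>1 \<psi>2. quadratic_char gauss_field \<psi>1 \<and> char_conditions S u \<psi>1 \<and>
           quadratic_char gauss_field \<psi>2 \<and> char_conditions S u \<psi>2 \<and>
           \<not> char_eq gauss_field \<psi>1 \<psi>2 \<longrightarrow>
        \<not> (\<exists>\<mu>. from_base_change \<mu> \<and> char_eq gauss_field \<psi>1 (char_mult \<psi>2 \<mu>)))
     \<and>
     (\<forall>f. ideal f ZK \<and> f \<noteq> {0} \<and> f \<noteq> carrier ZK \<and> ideal_conditions S f \<longrightarrow>
        ((\<exists>\<psi>. quadratic_char gauss_field \<psi> \<and> conductor gauss_field \<psi> = f \<and>
             char_conditions S u \<psi>) \<longleftrightarrow>
         ((\<forall>P\<in>places_above 2. \<not> divides_cond P f) \<longrightarrow> even (r_count f)) \<and>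
         ((\<exists>P\<in>places_above 2. divides_cond P f \<and> cond_mult P f = 2) \<longrightarrow> odd (r_count f))))"
    (is "?I \<and> ?II \<and> ?III \<and> ?IV")
proof -
  interpret fourth_root u by unfold_locales (rule assms(2))
  note S = assms(1)
  have ?I
  proof (intro allI impI)
    \<comment> \<open>The product may be the trivial character, as happens when
      \<open>\<psi>\<close> is itself a base change.\<close>
    fix \<psi> assume "quadratic_char QI \<psi>"
    then have "QI.qchar \<psi>" unfolding QI.quadratic_qchar ..
    from base_change_representative[OF S this] show "\<exists>\<mu>. from_base_change \<mu> \<and>
       (quadratic_char QI (char_mult \<psi> \<mu>) \<or> char_eq QI (char_mult \<psi> \<mu>) trivial_char) \<and>
       char_conditions S u (char_mult \<psi> \<mu>)" unfolding QI.quadratic_qchar by blast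
  qed
  moreover have ?II
  proof (intro allI impI, elim conjE)
    fix \<psi> assume "quadratic_char QI \<psi>" and c: "conductor QI \<psi> \<noteq> carrier ZK" "char_conditions S u \<psi>"
    then have "QI.qchar \<psi>" unfolding QI.quadratic_qchar by blast
    from not_base_change[OF S this c] show "\<not> from_base_change \<psi> \<and>
      (\<exists>\<delta>. quadratic_char QI \<delta> \<and> char_eq QI (char_conj \<psi>) (char_mult \<psi> \<delta>))" ..
  qed
  moreover have ?III
  proof (intro allI impI notI, elim conjE exE)
    fix \<psi>1 \<psi>2 \<mu>
    assume "quadratic_char QI \<psi>1" "quadratic_char QI \<psi>2"
      and c: "char_conditions S u \<psi>1" "char_conditions S u \<psi>2" and n: "\<not> char_eq QI \<psi>1 \<psi>2"
      and \<mu>: "from_base_change \<mu>" "char_eq QI \<psi>1 (char_mult \<psi>2 \<mu>)"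
    then have "QI.qchar \<psi>1" "QI.qchar \<psi>2" unfolding QI.quadratic_qchar by blast+
    from representative_unique[OF S this c \<mu>] show False using n by contradiction
  qed
  moreover have ?IV
  proof (intro allI impI, elim conjE)
    fix f assume f: "ideal f ZK" "f \<noteq> {0}" "f \<noteq> carrier ZK" "ideal_conditions S f"
    show "(\<exists>\<psi>. quadratic_char QI \<psi> \<and> conductor QI \<psi> = f \<and> char_conditions S u \<psi>) \<longleftrightarrow>
         ((\<forall>P\<in>places_above 2. \<not> divides_cond P f) \<longrightarrow> even (r_count f)) \<and>
         ((\<exists>P\<in>places_above 2. divides_cond P f \<and> cond_mult P f = 2) \<longrightarrow> odd (r_count f))" (is "?ex \<longleftrightarrow> ?par")
    proof
      assume ?ex
      then obtain \<psi> where "QI.qchar \<psi>" and c: "char_conditions S u \<psi>" "conductor QI \<psi> = f"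
        unfolding QI.quadratic_qchar by blast
      from parity_necessary[OF S this] show ?par by blast
    next
      assume ?par
      then have "\<exists>\<psi>. QI.qchar \<psi> \<and> conductor QI \<psi> = f \<and> char_conditions S u \<psi>"
        by (intro parity_sufficient[OF S f]) blast+
      then obtain \<psi> where \<psi>: "QI.qchar \<psi>" "conductor QI \<psi> = f" "char_conditions S u \<psi>" by blast
      \<comment> \<open>The trivial character has the whole ring as conductor, which differs from
        \<open>f\<close>.\<close>
      have "\<not> char_eq QI \<psi> trivial_char"
        using QI.unram_conductor[OF \<psi>(1) QI.trivial_unram] \<psi>(2) f(3) by blast
      then show ?ex unfolding QI.quadratic_qchar using \<psi> by blast
    qed
  qed
  ultimately show ?thesis by blast
qed

end
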